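(* Let $A$ and $B$ be algebras over $k$, let $R:B\otimes A\to A\otimes B$ be an invertible twisting map, let $E$ be a right $A$-module with a right connection $\nabla^E:E\to E\otimes_A\Omega^1A$, and let $F$ be a right $B$-module with a right connection $\nabla^F:F\to F\otimes_B\Omega^1B$. Let $\tau_{F,A}:F\otimes A\to A\otimes F$ be an invertible right module twisting map satisfying $$(A\otimes\nabla^F)\circ\tau_{F,A}=(\tau_{F,A}\otimes\Omega^1B)\circ(F\otimes\widetilde R)\circ(\nabla^F\otimes A).$$ If $\nabla^E$ and $\nabla^F$ are flat connections, then the (twisted) product connection of $\nabla^E$ and $\nabla^F$ on $E\otimes B\oplus A\otimes F$ is a flat connection.
   Context: All algebras are associative unital over a field $k$; $\otimes=\otimes_k$; an object's name also denotes its identity map; $\mu_D$ is the multiplication of an algebra $D$. $\Omega A=\bigoplus_p\Omega^pA$, with differential $d_A$, is the universal differential graded algebra of $A$ (similarly for $B$). Given a differential calculus $(\Omega D,d)$ over an algebra $D$ (a differential graded algebra generated, as such, by $\Omega^0D=D$), a right connection on a right $D$-module $M$ is a linear map $\nabla:M\to M\otimes_D\Omega^1D$ with $\nabla(m\cdot x)=(\nabla m)\cdot x+m\otimes dx$. It extends uniquely to a degree 1 operator on $M\otimes_D\Omega D$ by $\nabla(m\otimes\omega)=\nabla(m)\,\omega+m\otimes d\omega$; let $\nabla^{[n]}:M\otimes_D\Omega^nD\to M\otimes_D\Omega^{n+1}D$ be its degree $n$ component. The curvature of $\nabla$ is $\theta:=\nabla^{[1]}\circ\nabla^{[0]}:M\to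 M\otimes_D\Omega^2D$, and $\nabla$ is flat if $\theta=0$. A twisting map is a linear map $R:B\otimes A\to A\otimes B$ with $R(b\otimes1)=1\otimes b$, $R(1\otimes a)=a\otimes1$, $R\circ(B\otimes\mu_A)=(\mu_A\otimes B)\circ(A\otimes R)\circ(R\otimes A)$ and $R\circ(\mu_B\otimes A)=(A\otimes\mu_B)\circ(R\otimes B)\circ(B\otimes R)$. Write $R(b\otimes a)=a_R\otimes b_R$ (summation omitted). The twisted tensor product $A\otimes_RB$ is $A\otimes B$ with product $(a\otimes b)(a'\otimes b')=aa'_R\otimes b_Rb'$. Any twisting map $R$ extends uniquely to a twisting map $\widetilde R:\Omega B\otimes\Omega A\to\Omega A\otimes\Omega B$ with $\widetilde R\circ(d_B\otimes\Omega A)=(\varepsilon_A\otimes d_B)\circ\widetilde R$ and $\widetilde R\circ(\Omega B\otimes d_A)=(d_A\otimes\varepsilon_B)\circ\widetilde R$, where $\varepsilon(\omega)=(-1)^{|\omega|}\omega$. Then $\Omega A\otimes_{\widetilde R}\Omega B$, with differential $d(\varphi\otimes\omega)=d_A\varphi\otimes\omega+(-1)^{|\varphi|}\varphi\otimes d_B\omega$, is a differential calculus over $A\otimes_RB$ whose module of 1-forms is $\Omega^1A\otimes B\oplus A\otimes\Omega^1B$. A right module twisting map for a right $B$-module $F$ with action $\rho:F\otimes B\to F$ is a linear map $\tau_{F,A}:F\otimes A\to A\otimes F$, written $\tau_{F,A}(f\otimes a)=a_\tau\otimes f_\tau$, with $\tau_{F,A}\circ(F\otimes\mu_A)=(\mu_A\otimes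 F)\circ(A\otimes\tau_{F,A})\circ(\tau_{F,A}\otimes A)$ and $\tau_{F,A}\circ(\rho\otimes A)=(A\otimes\rho)\circ(\tau_{F,A}\otimes B)\circ(F\otimes R)$. The right $(A\otimes_RB)$-module structure on $E\otimes B\oplus A\otimes F$ is $(e\otimes b)\cdot(\alpha\otimes\beta)=e\alpha_R\otimes b_R\beta$ and $(a\otimes f)\cdot(\alpha\otimes\beta)=a\alpha_\tau\otimes f_\tau\beta$. The elements $e\otimes b$ and $a\otimes f$ are identified with $(e\otimes b,0)$ and $(0,a\otimes f)$. In the compatibility condition on $\nabla^F$, the composite $(\tau_{F,A}\otimes\Omega^1B)\circ(F\otimes\widetilde R)$ is computed on representatives, sending $f\otimes_B\eta\otimes a$ to $(a_{\widetilde R})_\tau\otimes f_\tau\otimes_B\eta_{\widetilde R}$, where $\widetilde R(\eta\otimes a)=a_{\widetilde R}\otimes\eta_{\widetilde R}$. Product connection. Let $\sigma_{A,F}=\tau_{F,A}^{-1}$, written $\sigma_{A,F}(a\otimes f)=\sum f_\sigma\otimes a_\sigma$. The (twisted) product connection is the right connection $\nabla:E\otimes B\oplus A\otimes F\to(E\otimes B\oplus A\otimes F)\otimes_{A\otimes_RB}(\Omega^1A\otimes B\oplus A\otimes\Omega^1B)$ (with respect to the calculus $\Omega A\otimes_{\widetilde R}\Omega B$), $\nabla(e\otimes b,a\otimes f)=\nabla_1(e\otimes b)+\nabla_2(a\otimes f)$, with $$\nabla_1(e\otimes b)=\sum_i(e_i\otimes1)\otimes(d_Aa_i\otimes b)+(e\otimes1)\otimes(1\otimes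 d_Bb),\qquad \nabla^E(e)=\sum_ie_i\otimes_Ad_Aa_i,$$ $$\nabla_2(a\otimes f)=\sum_k(a\otimes f_k)\otimes(1\otimes d_Bb_k)+\sum(1\otimes f_\sigma)\otimes(d_A(a_\sigma)\otimes1),\qquad \nabla^F(f)=\sum_kf_k\otimes_Bd_Bb_k,$$ middle tensor products being over $A\otimes_RB$. *)

theory Defs
  imports "HOL-Algebra.Module" "HOL-Algebra.Free_Abelian_Groups"
begin

text \<open>
  Conventions.  The ground field \<open>K\<close> and all spaces are \<open>HOL-Algebra\<close> structures.
  The record type \<open>module\<close> serves both for vector spaces over \<open>K\<close> (its ring multiplication and
  unit are then irrelevant) and for associative unital \<open>K\<close>-algebras.  Maps are total functions of
  which only the values on carriers matter.
\<close>

section \<open>Abelian groups given by generators and relators\<close>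

definition presented :: "'x set \<Rightarrow> ('x \<Rightarrow>\<^sub>0 int) set \<Rightarrow> ('x \<Rightarrow>\<^sub>0 int) set monoid" where
  "presented X S = free_Abelian_group X Mod generate (free_Abelian_group X) S"

text \<open>Class of the generator \<open>x\<close> in a presented group; the elements of the carrier are cosets.\<close>

definition gen_class :: "(('x \<Rightarrow>\<^sub>0 int) set, 'r) partial_object_scheme \<Rightarrow> 'x \<Rightarrow> ('x \<Rightarrow>\<^sub>0 int) set" where
  "gen_class T x = (THE t. t \<in> carrier T \<and> frag_of x \<in> t)"

text \<open>
  Additive extension to a presented group of a map \<open>\<phi>\<close> given on generators, computed on a
  representative.  It is independent of the representative whenever \<open>\<phi>\<close> respects the relators.
\<close>

definition gen_extend :: "('p, 'r) ring_scheme \<Rightarrow> ('x \<Rightarrow> 'p) \<Rightarrow> ('x \<Rightarrow>\<^sub>0 int) set \<Rightarrow> 'p" where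
  "gen_extend P \<phi> t =
     (let p = (SOME p. p \<in> t)
      in \<Oplus>\<^bsub>P\<^esub>x \<in> Poly_Mapping.keys p. [Poly_Mapping.lookup p x] \<cdot>\<^bsub>P\<^esub> \<phi> x)"

definition presented_space :: "'x set \<Rightarrow> ('x \<Rightarrow>\<^sub>0 int) set \<Rightarrow> ('k, ('x \<Rightarrow>\<^sub>0 int) set) module" where
  "presented_space X S = \<lparr>carrier = carrier (presented X S), monoid.mult = undefined, one = undefined,
     ring.zero = \<one>\<^bsub>presented X S\<^esub>, add = monoid.mult (presented X S), smult = undefined\<rparr>"


section \<open>Algebras, modules and linear maps\<close>

text \<open>The library's locale \<open>algebra\<close> is for commutative algebras only.\<close>

definition assoc_algebra :: "('k, 'r) ring_scheme \<Rightarrow> ('k, 'a, 's) module_scheme \<Rightarrow> bool" where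
  "assoc_algebra K A \<longleftrightarrow> ring A \<and> module K A \<and>
     (\<forall>c \<in> carrier K. \<forall>x \<in> carrier A. \<forall>y \<in> carrier A.
        (c \<odot>\<^bsub>A\<^esub> x) \<otimes>\<^bsub>A\<^esub> y = c \<odot>\<^bsub>A\<^esub> (x \<otimes>\<^bsub>A\<^esub> y) \<and>
        x \<otimes>\<^bsub>A\<^esub> (c \<odot>\<^bsub>A\<^esub> y) = c \<odot>\<^bsub>A\<^esub> (x \<otimes>\<^bsub>A\<^esub> y))"

definition linear_map ::
  "('k, 'r) ring_scheme \<Rightarrow> ('k, 'v, 's) module_scheme \<Rightarrow> ('k, 'w, 't) module_scheme \<Rightarrow> ('v \<Rightarrow> 'w) \<Rightarrow> bool" where
  "linear_map K V W h \<longleftrightarrow> h \<in> hom (add_monoid V) (add_monoid W) \<and>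
     (\<forall>c \<in> carrier K. \<forall>x \<in> carrier V. h (c \<odot>\<^bsub>V\<^esub> x) = c \<odot>\<^bsub>W\<^esub> h x)"

record ('k, 'm, 'd) rmodule = "('k, 'm) module" +
  ract :: "'m \<Rightarrow> 'd \<Rightarrow> 'm"

definition right_module ::
  "('k, 'r) ring_scheme \<Rightarrow> ('k, 'd, 's) module_scheme \<Rightarrow> ('k, 'm, 'd, 't) rmodule_scheme \<Rightarrow> bool" where
  "right_module K D M \<longleftrightarrow> module K M \<and>
     (\<forall>m \<in> carrier M. \<forall>x \<in> carrier D. ract M m x \<in> carrier M) \<and>
     (\<forall>m \<in> carrier M. \<forall>m' \<in> carrier M. \<forall>x \<in> carrier D.
        ract M (m \<oplus>\<^bsub>M\<^esub> m') x = ract M m x \<oplus>\<^bsub>M\<^esub> ract M m' x) \<and>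
     (\<forall>m \<in> carrier M. \<forall>x \<in> carrier D. \<forall>y \<in> carrier D.
        ract M m (x \<oplus>\<^bsub>D\<^esub> y) = ract M m x \<oplus>\<^bsub>M\<^esub> ract M m y \<and>
        ract M m (x \<otimes>\<^bsub>D\<^esub> y) = ract M (ract M m x) y) \<and>
     (\<forall>m \<in> carrier M. ract M m \<one>\<^bsub>D\<^esub> = m) \<and>
     (\<forall>c \<in> carrier K. \<forall>m \<in> carrier M. \<forall>x \<in> carrier D.
        ract M (c \<odot>\<^bsub>M\<^esub> m) x = c \<odot>\<^bsub>M\<^esub> ract M m x \<and>
        ract M m (c \<odot>\<^bsub>D\<^esub> x) = c \<odot>\<^bsub>M\<^esub> ract M m x)"

definition direct_sum ::
  "('k, 'v, 's) module_scheme \<Rightarrow> ('k, 'w, 't) module_scheme \<Rightarrow> ('k, 'v \<times> 'w) module" where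
  "direct_sum V W = \<lparr>carrier = carrier V \<times> carrier W, monoid.mult = undefined, one = undefined,
     ring.zero = (\<zero>\<^bsub>V\<^esub>, \<zero>\<^bsub>W\<^esub>),
     add = (\<lambda>(v, w) (v', w'). (v \<oplus>\<^bsub>V\<^esub> v', w \<oplus>\<^bsub>W\<^esub> w')),
     smult = (\<lambda>c (v, w). (c \<odot>\<^bsub>V\<^esub> v, c \<odot>\<^bsub>W\<^esub> w))\<rparr>"


section \<open>Tensor products\<close>

type_synonym ('m, 'n) tensor = "('m \<times> 'n \<Rightarrow>\<^sub>0 int) set"

text \<open>
  \<open>tensor D M N\<close> is the tensor product over the ring \<open>D\<close> of a right module \<open>M\<close> and a left
  module \<open>N\<close>; the left action of \<open>D\<close> on \<open>N\<close> is the field \<open>smult\<close> of \<open>N\<close>.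
  The \<open>K\<close>-structure is that of \<open>M\<close>.
\<close>

definition tensor_relators ::
  "('d, 'r) partial_object_scheme \<Rightarrow> ('k, 'm, 'd, 's) rmodule_scheme \<Rightarrow> ('d, 'n, 't) module_scheme
   \<Rightarrow> ('m \<times> 'n \<Rightarrow>\<^sub>0 int) set" where
  "tensor_relators D M N =
     {frag_of (m \<oplus>\<^bsub>M\<^esub> m', n) - frag_of (m, n) - frag_of (m', n) | m m' n.
        m \<in> carrier M \<and> m' \<in> carrier M \<and> n \<in> carrier N} \<union>
     {frag_of (m, n \<oplus>\<^bsub>N\<^esub> n') - frag_of (m, n) - frag_of (m, n') | m n n'.
        m \<in> carrier M \<and> n \<in> carrier N \<and> n' \<in> carrier N} \<union>
     {frag_of (ract M m x, n) - frag_of (m, x \<odot>\<^bsub>N\<^esub> n) | m x n.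
        m \<in> carrier M \<and> x \<in> carrier D \<and> n \<in> carrier N}"

definition tensor ::
  "('d, 'r) partial_object_scheme \<Rightarrow> ('k, 'm, 'd, 's) rmodule_scheme \<Rightarrow> ('d, 'n, 't) module_scheme
   \<Rightarrow> ('k, ('m, 'n) tensor) module" where
  "tensor D M N =
     (let T = presented_space (carrier M \<times> carrier N) (tensor_relators D M N)
      in T\<lparr>smult := \<lambda>c. gen_extend T (\<lambda>(m, n). gen_class T (c \<odot>\<^bsub>M\<^esub> m, n))\<rparr>)"

abbreviation pure ::
  "(('m, 'n) tensor, 'r) partial_object_scheme \<Rightarrow> 'm \<Rightarrow> 'n \<Rightarrow> ('m, 'n) tensor" where
  "pure T m n \<equiv> gen_class T (m, n)"

text \<open>\<open>tlift P \<beta>\<close> is the map into \<open>P\<close> with \<open>m \<otimes> n \<mapsto> \<beta> m n\<close>, for a balanced biadditive \<open>\<beta>\<close>.\<close>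

abbreviation tlift :: "('p, 'r) ring_scheme \<Rightarrow> ('m \<Rightarrow> 'n \<Rightarrow> 'p) \<Rightarrow> ('m, 'n) tensor \<Rightarrow> 'p" where
  "tlift P \<beta> \<equiv> gen_extend P (\<lambda>(m, n). \<beta> m n)"

definition ktensor ::
  "('k, 'r) ring_scheme \<Rightarrow> ('k, 'm, 's) module_scheme \<Rightarrow> ('k, 'n, 't) module_scheme
   \<Rightarrow> ('k, ('m, 'n) tensor) module" where
  "ktensor K M N =
     tensor K (module.extend (module.truncate M) (rmodule.fields (\<lambda>m c. c \<odot>\<^bsub>M\<^esub> m))) N"


section \<open>Differential calculi, connections and curvature\<close>

text \<open>
  A differential graded algebra with the map \<open>emb\<close> identifying the base algebra with the
  degree 0 part, its homogeneous components \<open>deg n\<close> and its differential \<open>diff\<close>.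
\<close>

record ('k, 'w, 'd) calculus = "('k, 'w) module" +
  emb :: "'d \<Rightarrow> 'w"
  deg :: "nat \<Rightarrow> 'w set"
  diff :: "'w \<Rightarrow> 'w"

definition forms :: "('k, 'w, 'd, 's) calculus_scheme \<Rightarrow> nat \<Rightarrow> ('d, 'w) module" where
  "forms \<Gamma> n = \<lparr>carrier = deg \<Gamma> n, monoid.mult = monoid.mult \<Gamma>, one = \<one>\<^bsub>\<Gamma>\<^esub>, ring.zero = \<zero>\<^bsub>\<Gamma>\<^esub>,
     add = add \<Gamma>, smult = (\<lambda>x \<omega>. emb \<Gamma> x \<otimes>\<^bsub>\<Gamma>\<^esub> \<omega>)\<rparr>"

definition mforms ::
  "('d, 'r) partial_object_scheme \<Rightarrow> ('k, 'm, 'd, 's) rmodule_scheme \<Rightarrow> ('k, 'w, 'd, 't) calculus_scheme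
   \<Rightarrow> nat \<Rightarrow> ('k, ('m, 'w) tensor) module" where
  "mforms D M \<Gamma> n = tensor D M (forms \<Gamma> n)"

text \<open>The product \<open>(M \<otimes>\<^sub>D \<Omega>\<^sup>n) \<times> \<Omega>\<^sup>p \<rightarrow> M \<otimes>\<^sub>D \<Omega>\<^sup>n\<^sup>+\<^sup>p\<close>.\<close>

definition mforms_mult ::
  "('d, 'r) partial_object_scheme \<Rightarrow> ('k, 'm, 'd, 's) rmodule_scheme \<Rightarrow> ('k, 'w, 'd, 't) calculus_scheme
   \<Rightarrow> nat \<Rightarrow> nat \<Rightarrow> ('m, 'w) tensor \<Rightarrow> 'w \<Rightarrow> ('m, 'w) tensor" where
  "mforms_mult D M \<Gamma> n p t \<omega> =
     tlift (mforms D M \<Gamma> (n + p)) (\<lambda>m \<eta>. pure (mforms D M \<Gamma> (n + p)) m (\<eta> \<otimes>\<^bsub>\<Gamma>\<^esub> \<omega>)) t"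

definition right_connection ::
  "('k, 'r) ring_scheme \<Rightarrow> ('k, 'd, 'q) module_scheme \<Rightarrow> ('k, 'm, 'd, 's) rmodule_scheme
   \<Rightarrow> ('k, 'w, 'd, 't) calculus_scheme \<Rightarrow> ('m \<Rightarrow> ('m, 'w) tensor) \<Rightarrow> bool" where
  "right_connection K D M \<Gamma> nab \<longleftrightarrow> linear_map K M (mforms D M \<Gamma> 1) nab \<and>
     (\<forall>m \<in> carrier M. \<forall>x \<in> carrier D.
        nab (ract M m x) = mforms_mult D M \<Gamma> 1 0 (nab m) (emb \<Gamma> x)
          \<oplus>\<^bsub>mforms D M \<Gamma> 1\<^esub> pure (mforms D M \<Gamma> 1) m (diff \<Gamma> (emb \<Gamma> x)))"

definition conn_ext ::
  "('d, 'r) partial_object_scheme \<Rightarrow> ('k, 'm, 'd, 's) rmodule_scheme \<Rightarrow> ('k, 'w, 'd, 't) calculus_scheme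
   \<Rightarrow> ('m \<Rightarrow> ('m, 'w) tensor) \<Rightarrow> nat \<Rightarrow> ('m, 'w) tensor \<Rightarrow> ('m, 'w) tensor" where
  "conn_ext D M \<Gamma> nab n =
     tlift (mforms D M \<Gamma> (1 + n))
       (\<lambda>m \<omega>. mforms_mult D M \<Gamma> 1 n (nab m) \<omega>
          \<oplus>\<^bsub>mforms D M \<Gamma> (1 + n)\<^esub> pure (mforms D M \<Gamma> (1 + n)) m (diff \<Gamma> \<omega>))"

text \<open>\<open>M\<close> is identified with \<open>M \<otimes>\<^sub>D \<Omega>\<^sup>0\<close> by \<open>m \<mapsto> m \<otimes> 1\<close>.\<close>

definition curvature ::
  "('d, 'r) partial_object_scheme \<Rightarrow> ('k, 'm, 'd, 's) rmodule_scheme \<Rightarrow> ('k, 'w, 'd, 't) calculus_scheme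
   \<Rightarrow> ('m \<Rightarrow> ('m, 'w) tensor) \<Rightarrow> 'm \<Rightarrow> ('m, 'w) tensor" where
  "curvature D M \<Gamma> nab m =
     conn_ext D M \<Gamma> nab 1 (conn_ext D M \<Gamma> nab 0 (pure (mforms D M \<Gamma> 0) m \<one>\<^bsub>\<Gamma>\<^esub>))"

definition flat_connection ::
  "('k, 'r) ring_scheme \<Rightarrow> ('k, 'd, 'q) module_scheme \<Rightarrow> ('k, 'm, 'd, 's) rmodule_scheme
   \<Rightarrow> ('k, 'w, 'd, 't) calculus_scheme \<Rightarrow> ('m \<Rightarrow> ('m, 'w) tensor) \<Rightarrow> bool" where
  "flat_connection K D M \<Gamma> nab \<longleftrightarrow> right_connection K D M \<Gamma> nab \<and>
     (\<forall>m \<in> carrier M. curvature D M \<Gamma> nab m = \<zero>\<^bsub>mforms D M \<Gamma> 2\<^esub>)"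


section \<open>The universal differential graded algebra\<close>

text \<open>
  It is generated by letters \<open>El a\<close> (the element \<open>a\<close>) and \<open>Di a\<close> (its differential), subject to the
  relations that \<open>El\<close> is a unital ring homomorphism and \<open>Di\<close> is a \<open>K\<close>-linear derivation, where
  \<open>K\<close> acts through \<open>El (c \<odot> \<one>)\<close>.  These imply that \<open>El (c \<odot> \<one>)\<close> is central, so no
  separate relations for scalars are needed.
\<close>

datatype 'a letter = El 'a | Di 'a

type_synonym 'a form = "('a letter list \<Rightarrow>\<^sub>0 int) set"

definition words :: "('a, 'r) partial_object_scheme \<Rightarrow> 'a letter list set" where
  "words A = lists (El ` carrier A \<union> Di ` carrier A)"

definition dga_relators ::
  "('k, 'r) ring_scheme \<Rightarrow> ('k, 'a, 's) module_scheme \<Rightarrow> ('a letter list \<Rightarrow>\<^sub>0 int) set" where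
  "dga_relators K A =
     {frag_of [El (x \<oplus>\<^bsub>A\<^esub> y)] - frag_of [El x] - frag_of [El y] | x y. x \<in> carrier A \<and> y \<in> carrier A} \<union>
     {frag_of [El (x \<otimes>\<^bsub>A\<^esub> y)] - frag_of [El x, El y] | x y. x \<in> carrier A \<and> y \<in> carrier A} \<union>
     {frag_of [El \<one>\<^bsub>A\<^esub>] - frag_of []} \<union>
     {frag_of [Di (x \<oplus>\<^bsub>A\<^esub> y)] - frag_of [Di x] - frag_of [Di y] | x y. x \<in> carrier A \<and> y \<in> carrier A} \<union>
     {frag_of [Di (c \<odot>\<^bsub>A\<^esub> x)] - frag_of [El (c \<odot>\<^bsub>A\<^esub> \<one>\<^bsub>A\<^esub>), Di x] | c x. c \<in> carrier K \<and> x \<in> carrier A} \<union>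
     {frag_of [Di (x \<otimes>\<^bsub>A\<^esub> y)] - frag_of [Di x, El y] - frag_of [El x, Di y] | x y.
        x \<in> carrier A \<and> y \<in> carrier A}"

text \<open>The relators times arbitrary words generate the two-sided ideal as an additive group.\<close>

definition dga_ideal_gens ::
  "('k, 'r) ring_scheme \<Rightarrow> ('k, 'a, 's) module_scheme \<Rightarrow> ('a letter list \<Rightarrow>\<^sub>0 int) set" where
  "dga_ideal_gens K A =
     {frag_extend (\<lambda>w. frag_of (u @ w @ v)) r | u r v.
        u \<in> words A \<and> r \<in> dga_relators K A \<and> v \<in> words A}"

definition univ_alg :: "('k, 'r) ring_scheme \<Rightarrow> ('k, 'a, 's) module_scheme \<Rightarrow> ('k, 'a form) module" where
  "univ_alg K A =
     (let W = presented_space (words A) (dga_ideal_gens K A);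
          W' = W\<lparr>monoid.mult := \<lambda>s t. gen_extend W (\<lambda>u. gen_extend W (\<lambda>v. gen_class W (u @ v)) t) s,
                 one := gen_class W []\<rparr>
      in W'\<lparr>smult := \<lambda>c t. gen_class W [El (c \<odot>\<^bsub>A\<^esub> \<one>\<^bsub>A\<^esub>)] \<otimes>\<^bsub>W'\<^esub> t\<rparr>)"

fun word_deg :: "'a letter list \<Rightarrow> nat" where
  "word_deg [] = 0"
| "word_deg (El a # w) = word_deg w"
| "word_deg (Di a # w) = Suc (word_deg w)"

text \<open>The differential of a word, by the graded Leibniz rule.\<close>

fun word_diff :: "('k, 'a form, 's) module_scheme \<Rightarrow> 'a letter list \<Rightarrow> 'a form" where
  "word_diff W [] = \<zero>\<^bsub>W\<^esub>"
| "word_diff W (El a # w) = gen_class W (Di a # w) \<oplus>\<^bsub>W\<^esub> gen_class W [El a] \<otimes>\<^bsub>W\<^esub> word_diff W w"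
| "word_diff W (Di a # w) = \<ominus>\<^bsub>W\<^esub> (gen_class W [Di a] \<otimes>\<^bsub>W\<^esub> word_diff W w)"

definition univ_dga ::
  "('k, 'r) ring_scheme \<Rightarrow> ('k, 'a, 's) module_scheme \<Rightarrow> ('k, 'a form, 'a) calculus" where
  "univ_dga K A =
     (let W = univ_alg K A
      in module.extend W (calculus.fields
           (\<lambda>a. gen_class W [El a])
           (\<lambda>n. {t \<in> carrier W. \<exists>p \<in> t. \<forall>w \<in> Poly_Mapping.keys p. word_deg w = n})
           (gen_extend W (word_diff W))))"

text \<open>The grading involution \<open>\<omega> \<mapsto> (-1)\<^sup>n \<omega>\<close> for \<open>\<omega>\<close> of degree \<open>n\<close>.\<close>

definition parity :: "('k, 'r) ring_scheme \<Rightarrow> ('k, 'a, 's) module_scheme \<Rightarrow> 'a form \<Rightarrow> 'a form" where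
  "parity K A = gen_extend (univ_alg K A)
     (\<lambda>w. if even (word_deg w) then gen_class (univ_alg K A) w
          else \<ominus>\<^bsub>univ_alg K A\<^esub> gen_class (univ_alg K A) w)"


section \<open>Twisting maps and twisted tensor products\<close>

text \<open>
  Equalities of linear maps on threefold tensor products are stated on elementary tensors, a
  composite such as \<open>(\<mu>\<^sub>A \<otimes> B) \<circ> (A \<otimes> R) \<circ> (R \<otimes> A)\<close> being evaluated there.
\<close>

definition twisting_map ::
  "('k, 'r) ring_scheme \<Rightarrow> ('k, 'a, 's) module_scheme \<Rightarrow> ('k, 'b, 't) module_scheme
   \<Rightarrow> (('b, 'a) tensor \<Rightarrow> ('a, 'b) tensor) \<Rightarrow> bool" where
  "twisting_map K A B R \<longleftrightarrow>
     linear_map K (ktensor K B A) (ktensor K A B) R \<and>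
     (\<forall>b \<in> carrier B. R (pure (ktensor K B A) b \<one>\<^bsub>A\<^esub>) = pure (ktensor K A B) \<one>\<^bsub>A\<^esub> b) \<and>
     (\<forall>a \<in> carrier A. R (pure (ktensor K B A) \<one>\<^bsub>B\<^esub> a) = pure (ktensor K A B) a \<one>\<^bsub>B\<^esub>) \<and>
     (\<forall>b \<in> carrier B. \<forall>a \<in> carrier A. \<forall>a' \<in> carrier A.
        R (pure (ktensor K B A) b (a \<otimes>\<^bsub>A\<^esub> a')) =
          tlift (ktensor K A B) (\<lambda>x y.
            tlift (ktensor K A B) (\<lambda>x' y'. pure (ktensor K A B) (x \<otimes>\<^bsub>A\<^esub> x') y')
              (R (pure (ktensor K B A) y a')))
            (R (pure (ktensor K B A) b a))) \<and>
     (\<forall>b \<in> carrier B. \<forall>b' \<in> carrier B. \<forall>a \<in> carrier A.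
        R (pure (ktensor K B A) (b \<otimes>\<^bsub>B\<^esub> b') a) =
          tlift (ktensor K A B) (\<lambda>x y.
            tlift (ktensor K A B) (\<lambda>x' y'. pure (ktensor K A B) x' (y' \<otimes>\<^bsub>B\<^esub> y))
              (R (pure (ktensor K B A) b x)))
            (R (pure (ktensor K B A) b' a)))"

definition twisted_product ::
  "('k, 'r) ring_scheme \<Rightarrow> ('k, 'a, 's) module_scheme \<Rightarrow> ('k, 'b, 't) module_scheme
   \<Rightarrow> (('b, 'a) tensor \<Rightarrow> ('a, 'b) tensor) \<Rightarrow> ('k, ('a, 'b) tensor) module" where
  "twisted_product K A B R =
     (let T = ktensor K A B
      in T\<lparr>monoid.mult := \<lambda>s t.
             tlift T (\<lambda>a b. tlift T (\<lambda>a' b'.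
               tlift T (\<lambda>x y. pure T (a \<otimes>\<^bsub>A\<^esub> x) (y \<otimes>\<^bsub>B\<^esub> b')) (R (pure (ktensor K B A) b a'))) t) s,
           one := pure T \<one>\<^bsub>A\<^esub> \<one>\<^bsub>B\<^esub>\<rparr>)"

text \<open>
  The extension \<open>Rt\<close> of \<open>R\<close> to the universal differential graded algebras exists and is unique;
  it is described here by its characterizing properties.
\<close>

definition twisting_extension ::
  "('k, 'r) ring_scheme \<Rightarrow> ('k, 'a, 's) module_scheme \<Rightarrow> ('k, 'b, 't) module_scheme
   \<Rightarrow> (('b, 'a) tensor \<Rightarrow> ('a, 'b) tensor) \<Rightarrow> (('b form, 'a form) tensor \<Rightarrow> ('a form, 'b form) tensor)
   \<Rightarrow> bool" where
  "twisting_extension K A B R Rt \<longleftrightarrow>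
     (let \<Omega>A = univ_dga K A; \<Omega>B = univ_dga K B; T = ktensor K \<Omega>A \<Omega>B; S = ktensor K \<Omega>B \<Omega>A
      in twisting_map K \<Omega>A \<Omega>B Rt \<and>
         (\<forall>b \<in> carrier B. \<forall>a \<in> carrier A.
            Rt (pure S (emb \<Omega>B b) (emb \<Omega>A a)) =
              tlift T (\<lambda>x y. pure T (emb \<Omega>A x) (emb \<Omega>B y)) (R (pure (ktensor K B A) b a))) \<and>
         (\<forall>\<omega> \<in> carrier \<Omega>B. \<forall>\<phi> \<in> carrier \<Omega>A.
            Rt (pure S (diff \<Omega>B \<omega>) \<phi>) =
              tlift T (\<lambda>\<phi>' \<omega>'. pure T (parity K A \<phi>') (diff \<Omega>B \<omega>')) (Rt (pure S \<omega> \<phi>)) \<and>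
            Rt (pure S \<omega> (diff \<Omega>A \<phi>)) =
              tlift T (\<lambda>\<phi>' \<omega>'. pure T (diff \<Omega>A \<phi>') (parity K B \<omega>')) (Rt (pure S \<omega> \<phi>))))"

definition twisted_calculus ::
  "('k, 'r) ring_scheme \<Rightarrow> ('k, 'a, 's) module_scheme \<Rightarrow> ('k, 'b, 't) module_scheme
   \<Rightarrow> (('b form, 'a form) tensor \<Rightarrow> ('a form, 'b form) tensor)
   \<Rightarrow> ('k, ('a form, 'b form) tensor, ('a, 'b) tensor) calculus" where
  "twisted_calculus K A B Rt =
     (let \<Omega>A = univ_dga K A; \<Omega>B = univ_dga K B; T = twisted_product K \<Omega>A \<Omega>B Rt
      in module.extend T (calculus.fields
           (tlift T (\<lambda>a b. pure T (emb \<Omega>A a) (emb \<Omega>B b)))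
           (\<lambda>n. generate (add_monoid T)
              {pure T \<phi> \<omega> | \<phi> \<omega>. \<exists>p q. p + q = n \<and> \<phi> \<in> deg \<Omega>A p \<and> \<omega> \<in> deg \<Omega>B q})
           (tlift T (\<lambda>\<phi> \<omega>. pure T (diff \<Omega>A \<phi>) \<omega> \<oplus>\<^bsub>T\<^esub> pure T (parity K A \<phi>) (diff \<Omega>B \<omega>)))))"


section \<open>Module twisting maps and the product connection\<close>

definition module_twisting_map ::
  "('k, 'r) ring_scheme \<Rightarrow> ('k, 'a, 's) module_scheme \<Rightarrow> ('k, 'b, 't) module_scheme
   \<Rightarrow> (('b, 'a) tensor \<Rightarrow> ('a, 'b) tensor) \<Rightarrow> ('k, 'f, 'b, 'u) rmodule_scheme
   \<Rightarrow> (('f, 'a) tensor \<Rightarrow> ('a, 'f) tensor) \<Rightarrow> bool" where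
  "module_twisting_map K A B R F \<tau> \<longleftrightarrow>
     linear_map K (ktensor K F A) (ktensor K A F) \<tau> \<and>
     (\<forall>f \<in> carrier F. \<forall>a \<in> carrier A. \<forall>a' \<in> carrier A.
        \<tau> (pure (ktensor K F A) f (a \<otimes>\<^bsub>A\<^esub> a')) =
          tlift (ktensor K A F) (\<lambda>x g.
            tlift (ktensor K A F) (\<lambda>x' g'. pure (ktensor K A F) (x \<otimes>\<^bsub>A\<^esub> x') g')
              (\<tau> (pure (ktensor K F A) g a')))
            (\<tau> (pure (ktensor K F A) f a))) \<and>
     (\<forall>f \<in> carrier F. \<forall>b \<in> carrier B. \<forall>a \<in> carrier A.
        \<tau> (pure (ktensor K F A) (ract F f b) a) =
          tlift (ktensor K A F) (\<lambda>x y.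
            tlift (ktensor K A F) (\<lambda>x' g. pure (ktensor K A F) x' (ract F g y))
              (\<tau> (pure (ktensor K F A) f x)))
            (R (pure (ktensor K B A) b a)))"

text \<open>
  The condition
  \<open>(A \<otimes> \<nabla>\<^sup>F) \<circ> \<tau> = (\<tau> \<otimes> \<Omega>\<^sup>1B) \<circ> (F \<otimes> Rt) \<circ> (\<nabla>\<^sup>F \<otimes> A)\<close>, evaluated at \<open>f \<otimes> a\<close>.
  For a 1-form \<open>\<eta>\<close> the element \<open>Rt (\<eta> \<otimes> a)\<close> lies in the image of the injective map
  \<open>A \<otimes> \<Omega>\<^sup>1B \<rightarrow> \<Omega>A \<otimes> \<Omega>B\<close>; the function \<open>pull\<close> takes its preimage there.
\<close>

definition connection_compatible ::
  "('k, 'r) ring_scheme \<Rightarrow> ('k, 'a, 's) module_scheme \<Rightarrow> ('k, 'b, 't) module_scheme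
   \<Rightarrow> (('b form, 'a form) tensor \<Rightarrow> ('a form, 'b form) tensor) \<Rightarrow> ('k, 'f, 'b, 'u) rmodule_scheme
   \<Rightarrow> (('f, 'a) tensor \<Rightarrow> ('a, 'f) tensor) \<Rightarrow> ('f \<Rightarrow> ('f, 'b form) tensor) \<Rightarrow> bool" where
  "connection_compatible K A B Rt F \<tau> nabF \<longleftrightarrow>
     (let \<Omega>A = univ_dga K A; \<Omega>B = univ_dga K B; T = ktensor K \<Omega>A \<Omega>B; S = ktensor K \<Omega>B \<Omega>A;
          F1 = mforms B F \<Omega>B 1; AF1 = ktensor K A F1;
          A\<Omega> = ktensor K A (\<Omega>B\<lparr>carrier := deg \<Omega>B 1\<rparr>);
          pull = inv_into (carrier A\<Omega>) (tlift T (\<lambda>x \<eta>. pure T (emb \<Omega>A x) \<eta>))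
      in \<forall>f \<in> carrier F. \<forall>a \<in> carrier A.
           tlift AF1 (\<lambda>x g. pure AF1 x (nabF g)) (\<tau> (pure (ktensor K F A) f a)) =
           tlift AF1 (\<lambda>g \<eta>.
             tlift AF1 (\<lambda>x \<eta>'.
               tlift AF1 (\<lambda>x' g'. pure AF1 x' (pure F1 g' \<eta>')) (\<tau> (pure (ktensor K F A) g x)))
               (pull (Rt (pure S \<eta> (emb \<Omega>A a)))))
             (nabF f))"

definition product_module ::
  "('k, 'r) ring_scheme \<Rightarrow> ('k, 'a, 's) module_scheme \<Rightarrow> ('k, 'b, 't) module_scheme
   \<Rightarrow> (('b, 'a) tensor \<Rightarrow> ('a, 'b) tensor) \<Rightarrow> ('k, 'e, 'a, 'v) rmodule_scheme
   \<Rightarrow> ('k, 'f, 'b, 'u) rmodule_scheme \<Rightarrow> (('f, 'a) tensor \<Rightarrow> ('a, 'f) tensor)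
   \<Rightarrow> ('k, ('e, 'b) tensor \<times> ('a, 'f) tensor, ('a, 'b) tensor) rmodule" where
  "product_module K A B R E F \<tau> =
     (let EB = ktensor K E B; AF = ktensor K A F
      in module.extend (direct_sum EB AF) (rmodule.fields (\<lambda>(s, t) z.
        (tlift EB (\<lambda>e b. tlift EB (\<lambda>\<alpha> \<beta>.
           tlift EB (\<lambda>x y. pure EB (ract E e x) (y \<otimes>\<^bsub>B\<^esub> \<beta>)) (R (pure (ktensor K B A) b \<alpha>))) z) s,
         tlift AF (\<lambda>a f. tlift AF (\<lambda>\<alpha> \<beta>.
           tlift AF (\<lambda>x g. pure AF (a \<otimes>\<^bsub>A\<^esub> x) (ract F g \<beta>)) (\<tau> (pure (ktensor K F A) f \<alpha>))) z) t))))"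

text \<open>
  The sums over \<open>\<nabla>\<^sup>E e = \<Sum> e\<^sub>i \<otimes> d a\<^sub>i\<close> and \<open>\<nabla>\<^sup>F f = \<Sum> f\<^sub>k \<otimes> d b\<^sub>k\<close> are written for
  representatives with arbitrary 1-forms \<open>\<eta>\<close> in place of the exact ones; the expressions
  are balanced, so this is the same map.
\<close>

definition product_connection ::
  "('k, 'r) ring_scheme \<Rightarrow> ('k, 'a, 's) module_scheme \<Rightarrow> ('k, 'b, 't) module_scheme
   \<Rightarrow> (('b, 'a) tensor \<Rightarrow> ('a, 'b) tensor) \<Rightarrow> (('b form, 'a form) tensor \<Rightarrow> ('a form, 'b form) tensor)
   \<Rightarrow> ('k, 'e, 'a, 'v) rmodule_scheme \<Rightarrow> ('k, 'f, 'b, 'u) rmodule_scheme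
   \<Rightarrow> (('f, 'a) tensor \<Rightarrow> ('a, 'f) tensor)
   \<Rightarrow> ('e \<Rightarrow> ('e, 'a form) tensor) \<Rightarrow> ('f \<Rightarrow> ('f, 'b form) tensor)
   \<Rightarrow> ('e, 'b) tensor \<times> ('a, 'f) tensor
   \<Rightarrow> (('e, 'b) tensor \<times> ('a, 'f) tensor, ('a form, 'b form) tensor) tensor" where
  "product_connection K A B R Rt E F \<tau> nabE nabF =
     (let \<Omega>A = univ_dga K A; \<Omega>B = univ_dga K B; \<Gamma> = twisted_calculus K A B Rt;
          EB = ktensor K E B; AF = ktensor K A F;
          P = mforms (twisted_product K A B R) (product_module K A B R E F \<tau>) \<Gamma> 1;
          \<sigma> = inv_into (carrier (ktensor K F A)) \<tau>;
          inE = (\<lambda>e b. (pure EB e b, \<zero>\<^bsub>AF\<^esub>));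
          inF = (\<lambda>a f. (\<zero>\<^bsub>EB\<^esub>, pure AF a f));
          nab1 = tlift P (\<lambda>e b.
             tlift P (\<lambda>e' \<eta>. pure P (inE e' \<one>\<^bsub>B\<^esub>) (pure \<Gamma> \<eta> (emb \<Omega>B b))) (nabE e)
             \<oplus>\<^bsub>P\<^esub> pure P (inE e \<one>\<^bsub>B\<^esub>) (pure \<Gamma> \<one>\<^bsub>\<Omega>A\<^esub> (diff \<Omega>B (emb \<Omega>B b))));
          nab2 = tlift P (\<lambda>a f.
             tlift P (\<lambda>f' \<eta>. pure P (inF a f') (pure \<Gamma> \<one>\<^bsub>\<Omega>A\<^esub> \<eta>)) (nabF f)
             \<oplus>\<^bsub>P\<^esub> tlift P (\<lambda>g x. pure P (inF \<one>\<^bsub>A\<^esub> g) (pure \<Gamma> (diff \<Omega>A (emb \<Omega>A x)) \<one>\<^bsub>\<Omega>B\<^esub>))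
                   (\<sigma> (pure AF a f)))
      in (\<lambda>(s, t). nab1 s \<oplus>\<^bsub>P\<^esub> nab2 t))"

end

theory Submission
  imports Defs
begin

text \<open>
  Write \<open>D = A \<otimes>\<^sub>R B\<close> with calculus \<open>\<Gamma> = \<Omega>A \<otimes> \<Omega>B\<close> and \<open>M = E \<otimes> B \<oplus> A \<otimes> F\<close>.  As a \<open>D\<close>-module, \<open>M\<close> is
  generated by the elements \<open>\<psi> e = (e \<otimes> 1, 0)\<close> and \<open>\<psi> f = (0, 1 \<otimes> f)\<close>, and \<open>\<psi>\<close> is linear over \<open>A\<close> on \<open>E\<close>
  and over \<open>B\<close> on \<open>F\<close>.  The algebra maps \<open>a \<mapsto> a \<otimes> 1\<close> and \<open>b \<mapsto> 1 \<otimes> b\<close> into \<open>D\<close> extend to homomorphisms \<open>J\<close>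
  of differential graded algebras from \<open>\<Omega>A\<close> and \<open>\<Omega>B\<close> to \<open>\<Gamma>\<close>.  The whole proof consists in recognizing
  the product connection as the one induced from \<open>\<nabla>\<^sup>E\<close> and \<open>\<nabla>\<^sup>F\<close> along these maps: for \<open>s\<close> in \<open>E\<close> or \<open>F\<close>
  and \<open>y\<close> in \<open>D\<close>,
    \<open>\<nabla> (\<psi> s \<cdot> y) = (\<psi> \<otimes> J) (\<nabla> s) \<cdot> y + \<psi> s \<otimes> d y\<close>.

  On \<open>E\<close> (lemma \<open>leibniz_E\<close>) this is the definition of \<open>\<nabla>\<close> if \<open>y = 1 \<otimes> b\<close>.  It propagates from \<open>y\<close> to
  \<open>(a \<otimes> 1) y\<close> by the Leibniz rule of \<open>\<nabla>\<^sup>E\<close> (lemma \<open>leibniz_extend\<close>), and the \<open>(a \<otimes> 1) (1 \<otimes> b)\<close> span \<open>D\<close>.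
  On \<open>F\<close> (lemma \<open>leibniz_F\<close>) the roles of \<open>A\<close> and \<open>B\<close> are exchanged.  Since \<open>R\<close> is surjective, \<open>D\<close> is also
  spanned by the products \<open>(1 \<otimes> b) (a \<otimes> 1) = R (b \<otimes> a)\<close>, so \<open>y = a \<otimes> 1\<close> suffices.  There
  \<open>\<psi> f \<cdot> y = (0, \<tau> (f \<otimes> a))\<close>; the part of \<open>\<nabla>\<close> that involves \<open>\<sigma> = \<tau>\<inverse>\<close> yields \<open>\<psi> f \<otimes> d y\<close>, and the
  compatibility of \<open>\<nabla>\<^sup>F\<close> with \<open>\<tau>\<close> identifies the other part with \<open>(\<psi> \<otimes> J) (\<nabla>\<^sup>F f) \<cdot> y\<close>
  (theorem \<open>compatible_push\<close>).

  By the displayed formula \<open>\<nabla>\<close> is a connection (lemma \<open>connection_on_generators\<close>).  The curvature of a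
  connection is \<open>D\<close>-linear (theorem \<open>curvature_act\<close>), so it is determined by its values at the
  generators; and at \<open>\<psi> s\<close> it is the image of the curvature of \<open>\<nabla>\<^sup>E\<close> or \<open>\<nabla>\<^sup>F\<close> at \<open>s\<close>
  (theorem \<open>curvature_push\<close>), which is zero.

  These arguments presuppose that \<open>\<Gamma>\<close> satisfies the laws of a differential calculus and \<open>M\<close> those of a
  module.  The universal calculus is given by generators and relators, and its operations have to be
  shown to respect the relators (theorem \<open>univ_dga_calculus\<close>).  Associativity of \<open>D\<close> and \<open>\<Gamma>\<close> and of the
  actions on \<open>E \<otimes> B\<close> and \<open>A \<otimes> F\<close> are instances of a single statement (theorem \<open>tact_assoc\<close>).  The Leibniz
  rule in \<open>\<Gamma>\<close> (theorem \<open>G_calculus\<close>) rests on the fact that the extension of \<open>R\<close> to forms preserves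
  degrees (lemma \<open>Rt_gr\<close>), and the unit law for \<open>A \<otimes> F\<close> on \<open>\<tau> (f \<otimes> 1) = 1 \<otimes> f\<close>
  (lemma \<open>module_twisting_unit\<close>).
\<close>

section \<open>Additive maps and presented abelian groups\<close>

text \<open>
  The group axioms of both sides are part of the predicate, so that composites and pointwise sums of
  additive maps, and equalities between them, are obtained by composing rules.  The predicates \<open>lin\<close>
  and \<open>bilin\<close> follow the same pattern.
\<close>

definition addmap ::
  "('v, 'r) ring_scheme \<Rightarrow> ('w, 's) ring_scheme \<Rightarrow> ('v \<Rightarrow> 'w) \<Rightarrow> bool" where
  "addmap V W h \<longleftrightarrow> abelian_group V \<and> abelian_group W \<and> h \<in> carrier V \<rightarrow> carrier W \<and>
     (\<forall>x \<in> carrier V. \<forall>y \<in> carrier V. h (x \<oplus>\<^bsub>V\<^esub> y) = h x \<oplus>\<^bsub>W\<^esub> h y)"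

lemma addmapI:
  assumes "abelian_group V" "abelian_group W"
    and "\<And>x. x \<in> carrier V \<Longrightarrow> h x \<in> carrier W"
    and "\<And>x y. x \<in> carrier V \<Longrightarrow> y \<in> carrier V \<Longrightarrow> h (x \<oplus>\<^bsub>V\<^esub> y) = h x \<oplus>\<^bsub>W\<^esub> h y"
  shows "addmap V W h"
  using assms by (auto simp: addmap_def)

lemma
  assumes "addmap V W h"
  shows addmap_dom: "abelian_group V" and addmap_cod: "abelian_group W"
    and addmap_closed: "x \<in> carrier V \<Longrightarrow> h x \<in> carrier W"
    and addmap_add: "x \<in> carrier V \<Longrightarrow> y \<in> carrier V \<Longrightarrow> h (x \<oplus>\<^bsub>V\<^esub> y) = h x \<oplus>\<^bsub>W\<^esub> h y"
  using assms by (auto simp: addmap_def)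

lemma addmap_zero:
  assumes "addmap V W h"
  shows "h \<zero>\<^bsub>V\<^esub> = \<zero>\<^bsub>W\<^esub>"
proof -
  interpret V: abelian_group V using addmap_dom[OF assms] .
  interpret W: abelian_group W using addmap_cod[OF assms] .
  have "h \<zero>\<^bsub>V\<^esub> \<oplus>\<^bsub>W\<^esub> h \<zero>\<^bsub>V\<^esub> = h \<zero>\<^bsub>V\<^esub>"
    using addmap_add[OF assms, of "\<zero>\<^bsub>V\<^esub>" "\<zero>\<^bsub>V\<^esub>"] by simp
  then show ?thesis
    using addmap_closed[OF assms, of "\<zero>\<^bsub>V\<^esub>"] by (metis V.zero_closed W.add.l_cancel_one)
qed

lemma addmap_minus:
  assumes "addmap V W h" "x \<in> carrier V"
  shows "h (\<ominus>\<^bsub>V\<^esub> x) = \<ominus>\<^bsub>W\<^esub> h x"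
proof -
  interpret V: abelian_group V using addmap_dom[OF assms(1)] .
  interpret W: abelian_group W using addmap_cod[OF assms(1)] .
  have "h (\<ominus>\<^bsub>V\<^esub> x) \<oplus>\<^bsub>W\<^esub> h x = \<zero>\<^bsub>W\<^esub>"
    using addmap_add[OF assms(1), of "\<ominus>\<^bsub>V\<^esub> x" x] assms(2)
    by (simp add: V.l_neg addmap_zero[OF assms(1)])
  then show ?thesis
    using assms by (simp add: W.minus_equality addmap_closed)
qed

lemma addmap_id: "abelian_group V \<Longrightarrow> addmap V V (\<lambda>x. x)"
  by (auto intro: addmapI)

lemma addmap_comp:
  assumes f: "addmap U V f" and g: "addmap V W g" shows "addmap U W (\<lambda>x. g (f x))"
  using addmap_closed[OF f] addmap_closed[OF g] addmap_add[OF f] addmap_add[OF g]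
  by (intro addmapI[OF addmap_dom[OF f] addmap_cod[OF g]]) auto

lemma addmap_uminus:
  assumes f: "addmap U V f" shows "addmap U V (\<lambda>x. \<ominus>\<^bsub>V\<^esub> f x)"
proof -
  interpret V: abelian_group V using addmap_cod[OF f] .
  show ?thesis using addmap_closed[OF f] addmap_add[OF f]
    by (intro addmapI[OF addmap_dom[OF f] addmap_cod[OF f]]) (auto simp: V.minus_add)
qed

lemma addmap_plus:
  assumes f: "addmap U V f" and g: "addmap U V g" shows "addmap U V (\<lambda>x. f x \<oplus>\<^bsub>V\<^esub> g x)"
proof -
  interpret V: abelian_group V using addmap_cod[OF f] .
  show ?thesis using addmap_closed[OF f] addmap_closed[OF g] addmap_add[OF f] addmap_add[OF g]
    by (intro addmapI[OF addmap_dom[OF f] addmap_cod[OF f]]) (auto simp: V.a_ac)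
qed

lemma addmap_cong:
  assumes f: "addmap U V f" and g: "\<And>x. x \<in> carrier U \<Longrightarrow> g x = f x"
  shows "addmap U V g"
proof -
  interpret U: abelian_group U using addmap_dom[OF f] .
  show ?thesis using addmap_closed[OF f] addmap_add[OF f] g
    by (intro addmapI[OF addmap_dom[OF f] addmap_cod[OF f]]) auto
qed

lemma (in abelian_group) eq_if_diff_zero:
  assumes "x \<ominus> y = \<zero>" "x \<in> carrier G" "y \<in> carrier G" shows "x = y"
  using assms by (metis a_minus_def minus_equality minus_minus a_inv_closed)
lemma keys_three: "Poly_Mapping.keys (frag_of x - frag_of y - frag_of z) \<subseteq> {x, y, z}"
  using keys_diff[of "frag_of x - frag_of y" "frag_of z"] keys_diff[of "frag_of x" "frag_of y"]
  by (auto simp: keys_frag_of)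

lemma keys_two: "Poly_Mapping.keys (frag_of x - frag_of y) \<subseteq> {x, y}"
  using keys_diff[of "frag_of x" "frag_of y"] by (auto simp: keys_frag_of)

text \<open>
  The extension of \<open>\<phi>\<close> to the free abelian group; \<open>gen_extend\<close> is its value at a chosen representative.
\<close>

definition frag_eval :: "('p, 'r) ring_scheme \<Rightarrow> ('x \<Rightarrow> 'p) \<Rightarrow> ('x \<Rightarrow>\<^sub>0 int) \<Rightarrow> 'p" where
  "frag_eval P \<phi> p = (\<Oplus>\<^bsub>P\<^esub>x \<in> Poly_Mapping.keys p. [Poly_Mapping.lookup p x] \<cdot>\<^bsub>P\<^esub> \<phi> x)"

context abelian_group
begin

lemma frag_eval_superset:
  assumes "finite S" "Poly_Mapping.keys p \<subseteq> S" "\<And>x. x \<in> S \<Longrightarrow> \<phi> x \<in> carrier G"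
  shows "frag_eval G \<phi> p = (\<Oplus>x \<in> S. [Poly_Mapping.lookup p x] \<cdot> \<phi> x)"
proof -
  have "\<And>x. x \<in> S - Poly_Mapping.keys p \<Longrightarrow> [Poly_Mapping.lookup p x] \<cdot> \<phi> x = \<zero>"
    by (simp add: in_keys_iff add_pow_def int_pow_def)
  then show ?thesis
    unfolding frag_eval_def
    using assms by (intro add.finprod_mono_neutral_cong_left) auto
qed

lemma frag_eval_closed:
  assumes "\<And>x. x \<in> Poly_Mapping.keys p \<Longrightarrow> \<phi> x \<in> carrier G"
  shows "frag_eval G \<phi> p \<in> carrier G"
  unfolding frag_eval_def using assms by (intro finsum_closed) auto

lemma frag_eval_0 [simp]: "frag_eval G \<phi> 0 = \<zero>"
  by (simp add: frag_eval_def)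

lemma frag_eval_of [simp]:
  assumes "\<phi> x \<in> carrier G"
  shows "frag_eval G \<phi> (frag_of x) = \<phi> x"
  using assms by (simp add: frag_eval_def keys_frag_of add_pow_def add.int_pow_1[unfolded add_pow_def])

lemma frag_eval_add:
  assumes "\<And>x. x \<in> X \<Longrightarrow> \<phi> x \<in> carrier G"
    and "Poly_Mapping.keys p \<subseteq> X" "Poly_Mapping.keys q \<subseteq> X"
  shows "frag_eval G \<phi> (p + q) = frag_eval G \<phi> p \<oplus> frag_eval G \<phi> q"
proof -
  define S where "S = Poly_Mapping.keys p \<union> Poly_Mapping.keys q"
  have S: "finite S" "Poly_Mapping.keys p \<subseteq> S" "Poly_Mapping.keys q \<subseteq> S"
    "Poly_Mapping.keys (p + q) \<subseteq> S"
    using keys_add[of p q] by (auto simp: S_def)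
  have c: "\<And>x. x \<in> S \<Longrightarrow> \<phi> x \<in> carrier G" using assms by (auto simp: S_def)
  have "frag_eval G \<phi> (p + q)
      = (\<Oplus>x \<in> S. [Poly_Mapping.lookup p x] \<cdot> \<phi> x \<oplus> [Poly_Mapping.lookup q x] \<cdot> \<phi> x)"
    using c by (subst frag_eval_superset[OF S(1,4)], simp, intro finsum_cong') (auto simp: lookup_add add.int_pow_mult)
  also have "\<dots> = frag_eval G \<phi> p \<oplus> frag_eval G \<phi> q"
    using c frag_eval_superset[OF S(1,2), of \<phi>] frag_eval_superset[OF S(1,3), of \<phi>]
      finsum_addf[of "\<lambda>x. [Poly_Mapping.lookup p x] \<cdot> \<phi> x" S] by auto
  finally show ?thesis .
qed

lemma frag_eval_diff:
  assumes "\<And>x. x \<in> X \<Longrightarrow> \<phi> x \<in> carrier G"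
    and "Poly_Mapping.keys p \<subseteq> X" "Poly_Mapping.keys q \<subseteq> X"
  shows "frag_eval G \<phi> (p - q) = frag_eval G \<phi> p \<ominus> frag_eval G \<phi> q"
proof -
  have k: "Poly_Mapping.keys (p - q) \<subseteq> X" using keys_diff[of p q] assms by auto
  have "frag_eval G \<phi> p = frag_eval G \<phi> (p - q) \<oplus> frag_eval G \<phi> q"
    using frag_eval_add[OF assms(1) k assms(3)] by simp
  moreover have "frag_eval G \<phi> q \<in> carrier G" "frag_eval G \<phi> (p - q) \<in> carrier G"
    using assms k by (auto intro!: frag_eval_closed)
  ultimately show ?thesis by (simp add: minus_eq a_assoc r_neg)
qed

end

lemma frag_eval_cong:
  assumes "abelian_group P" "\<And>x. x \<in> Poly_Mapping.keys p \<Longrightarrow> \<phi> x \<in> carrier P"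
    "\<And>x. x \<in> Poly_Mapping.keys p \<Longrightarrow> \<psi> x = \<phi> x"
  shows "frag_eval P \<psi> p = frag_eval P \<phi> p"
proof -
  interpret abelian_group P by fact
  show ?thesis unfolding frag_eval_def using assms by (intro finsum_cong') auto
qed

lemma addmap_frag_eval:
  assumes h: "addmap P Q h" and c: "\<And>x. x \<in> X \<Longrightarrow> \<phi> x \<in> carrier P"
    and k: "Poly_Mapping.keys p \<subseteq> X"
  shows "h (frag_eval P \<phi> p) = frag_eval Q (\<lambda>x. h (\<phi> x)) p"
proof -
  interpret P: abelian_group P using addmap_dom[OF h] .
  interpret Q: abelian_group Q using addmap_cod[OF h] .
  have c': "\<And>x. x \<in> X \<Longrightarrow> h (\<phi> x) \<in> carrier Q" using c addmap_closed[OF h] by blast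
  show ?thesis
  proof (rule free_Abelian_group_induct[OF k])
    show "h (frag_eval P \<phi> 0) = frag_eval Q (\<lambda>x. h (\<phi> x)) 0"
      by (simp add: addmap_zero[OF h])
  next
    fix x assume "x \<in> X"
    then show "h (frag_eval P \<phi> (frag_of x)) = frag_eval Q (\<lambda>x. h (\<phi> x)) (frag_of x)"
      using c c' by simp
  next
    fix p q assume "Poly_Mapping.keys p \<subseteq> X" "Poly_Mapping.keys q \<subseteq> X"
      and "h (frag_eval P \<phi> p) = frag_eval Q (\<lambda>x. h (\<phi> x)) p"
      and "h (frag_eval P \<phi> q) = frag_eval Q (\<lambda>x. h (\<phi> x)) q"
    moreover have "frag_eval P \<phi> p \<in> carrier P" "frag_eval P \<phi> q \<in> carrier P"
      using calculation c by (auto intro!: P.frag_eval_closed)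
    ultimately show "h (frag_eval P \<phi> (p - q)) = frag_eval Q (\<lambda>x. h (\<phi> x)) (p - q)"
      using P.frag_eval_diff[of X \<phi> p q] Q.frag_eval_diff[of X "\<lambda>x. h (\<phi> x)" p q] c c'
      by (simp add: a_minus_def addmap_add[OF h] addmap_minus[OF h])
  qed
qed

text \<open>
  An additive group \<open>T\<close> presented by generators \<open>X\<close> and relators \<open>S\<close>.  The tensor products and
  the universal differential graded algebras are instances that carry further operations, so the
  locale speaks only of the additive part of \<open>T\<close>.
\<close>

locale presented_group =
  fixes X :: "'x set" and S :: "('x \<Rightarrow>\<^sub>0 int) set" and T :: "(('x \<Rightarrow>\<^sub>0 int) set, 'r) ring_scheme"
  assumes relators: "\<And>r. r \<in> S \<Longrightarrow> Poly_Mapping.keys r \<subseteq> X"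
    and carrier_T: "carrier T = carrier (presented X S)"
    and add_T: "add T = monoid.mult (presented X S)"
    and zero_T: "\<zero>\<^bsub>T\<^esub> = \<one>\<^bsub>presented X S\<^esub>"
begin

abbreviation "FG \<equiv> free_Abelian_group X"

definition cls :: "('x \<Rightarrow>\<^sub>0 int) \<Rightarrow> ('x \<Rightarrow>\<^sub>0 int) set" where
  "cls p = generate FG S #>\<^bsub>FG\<^esub> p"

lemma S_sub: "S \<subseteq> carrier FG"
  using relators by auto

sublocale FG: comm_group FG
  by (rule abelian_free_Abelian_group)

lemma subgroup_S: "subgroup (generate FG S) FG"
  by (rule FG.generate_is_subgroup[OF S_sub])

lemma normal_S: "generate FG S \<lhd> FG"
  by (rule FG.subgroup_imp_normal[OF subgroup_S])

lemma abelian_T: "abelian_group T"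
proof -
  interpret Q: comm_group "presented X S"
    unfolding presented_def by (rule FG.abelian_FactGroup[OF subgroup_S])
  show ?thesis
  proof (rule abelian_groupI)
    show "x \<oplus>\<^bsub>T\<^esub> y = y \<oplus>\<^bsub>T\<^esub> x" if "x \<in> carrier T" "y \<in> carrier T" for x y
      using that Q.m_comm by (simp add: carrier_T add_T)
    show "\<exists>y \<in> carrier T. y \<oplus>\<^bsub>T\<^esub> x = \<zero>\<^bsub>T\<^esub>" if "x \<in> carrier T" for x
      using that Q.l_inv Q.inv_closed by (auto simp: carrier_T add_T zero_T)
  qed (simp_all add: carrier_T add_T zero_T Q.m_assoc)
qed

sublocale T: abelian_group T by (rule abelian_T)

lemma cls_closed: "Poly_Mapping.keys p \<subseteq> X \<Longrightarrow> cls p \<in> carrier T"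
  by (auto simp: carrier_T presented_def FactGroup_def cls_def RCOSETS_def)

lemma cls_self: "Poly_Mapping.keys p \<subseteq> X \<Longrightarrow> p \<in> cls p"
  unfolding cls_def using FG.rcos_self[OF _ subgroup_S, of p] by simp

lemma mem_cls:
  assumes "t \<in> carrier T" "p \<in> t"
  shows "Poly_Mapping.keys p \<subseteq> X" "t = cls p"
proof -
  obtain q where q: "Poly_Mapping.keys q \<subseteq> X" "t = generate FG S #>\<^bsub>FG\<^esub> q"
    using assms(1) by (auto simp: carrier_T presented_def FactGroup_def RCOSETS_def)
  show "Poly_Mapping.keys p \<subseteq> X"
    using assms q FG.r_coset_subset_G[OF subgroup.subset[OF subgroup_S], of q]
    by (metis carrier_free_Abelian_group_iff subsetD)
  show "t = cls p"
    unfolding cls_def q(2)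
    using FG.repr_independence[OF _ _ subgroup_S, of p q] assms q by simp
qed

lemma ex_cls:
  assumes "t \<in> carrier T"
  obtains p where "p \<in> t" "Poly_Mapping.keys p \<subseteq> X" "t = cls p"
proof -
  obtain q where q: "Poly_Mapping.keys q \<subseteq> X" "t = cls q"
    using assms by (auto simp: carrier_T presented_def FactGroup_def RCOSETS_def cls_def)
  then show ?thesis using that cls_self by blast
qed

lemma cls_add:
  assumes "Poly_Mapping.keys p \<subseteq> X" "Poly_Mapping.keys q \<subseteq> X"
  shows "cls (p + q) = cls p \<oplus>\<^bsub>T\<^esub> cls q"
  using normal.rcos_sum[OF normal_S, of p q] assms
  by (simp add: add_T presented_def cls_def FactGroup_def)

lemma cls_0: "cls 0 = \<zero>\<^bsub>T\<^esub>"
  using FG.coset_mult_one[OF subgroup.subset[OF subgroup_S]]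
  by (simp add: zero_T presented_def cls_def FactGroup_def)

lemma cls_diff:
  assumes "Poly_Mapping.keys p \<subseteq> X" "Poly_Mapping.keys q \<subseteq> X"
  shows "cls (p - q) = cls p \<ominus>\<^bsub>T\<^esub> cls q"
proof -
  have k: "Poly_Mapping.keys (p - q) \<subseteq> X" using keys_diff[of p q] assms by auto
  have "cls p = cls (p - q) \<oplus>\<^bsub>T\<^esub> cls q"
    using cls_add[OF k assms(2)] by simp
  then show ?thesis
    using cls_closed[OF k] cls_closed[OF assms(2)] by (simp add: T.minus_eq T.a_assoc T.r_neg)
qed

lemma cls_relator:
  assumes "r \<in> S" shows "cls r = \<zero>\<^bsub>T\<^esub>"
proof -
  have "r \<in> generate FG S" using assms by (rule generate.incl)
  then have "cls r = generate FG S"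
    unfolding cls_def using FG.coset_join2[OF _ subgroup_S] subgroup.subset[OF subgroup_S] by auto
  then show ?thesis by (simp add: zero_T presented_def FactGroup_def)
qed

lemma gen_class_eq:
  assumes "x \<in> X" shows "gen_class T x = cls (frag_of x)"
  unfolding gen_class_def
proof (rule the_equality)
  have k: "Poly_Mapping.keys (frag_of x) \<subseteq> X" using assms by (simp add: keys_frag_of)
  show "cls (frag_of x) \<in> carrier T \<and> frag_of x \<in> cls (frag_of x)"
    using cls_closed[OF k] cls_self[OF k] by simp
  show "t = cls (frag_of x)" if "t \<in> carrier T \<and> frag_of x \<in> t" for t
    using mem_cls(2) that by blast
qed

lemma gen_class_closed: "x \<in> X \<Longrightarrow> gen_class T x \<in> carrier T"
  by (simp add: gen_class_eq cls_closed keys_frag_of)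

lemma relator_three:
  assumes "frag_of x - frag_of y - frag_of z \<in> S"
    "x \<in> X" "y \<in> X" "z \<in> X"
  shows "gen_class T x = gen_class T y \<oplus>\<^bsub>T\<^esub> gen_class T z"
proof -
  have "cls (frag_of x - (frag_of y + frag_of z)) = \<zero>\<^bsub>T\<^esub>"
    using cls_relator[OF assms(1)] by (simp add: diff_diff_eq)
  moreover have "Poly_Mapping.keys (frag_of y + frag_of z) \<subseteq> X"
    using keys_add[of "frag_of y" "frag_of z"] assms by (auto simp: keys_frag_of)
  ultimately have "gen_class T x \<ominus>\<^bsub>T\<^esub> (gen_class T y \<oplus>\<^bsub>T\<^esub> gen_class T z) = \<zero>\<^bsub>T\<^esub>"
    using assms by (simp add: cls_diff cls_add keys_frag_of gen_class_eq)
  then show ?thesis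
    by (rule T.eq_if_diff_zero) (use assms in \<open>simp_all add: gen_class_closed\<close>)
qed

lemma relator_two:
  assumes "frag_of x - frag_of y \<in> S"
    "x \<in> X" "y \<in> X"
  shows "gen_class T x = gen_class T y"
proof -
  have "gen_class T x \<ominus>\<^bsub>T\<^esub> gen_class T y = \<zero>\<^bsub>T\<^esub>"
    using cls_relator[OF assms(1)] assms by (simp add: cls_diff keys_frag_of gen_class_eq)
  then show ?thesis
    by (rule T.eq_if_diff_zero) (use assms in \<open>simp_all add: gen_class_closed\<close>)
qed

lemma cls_eq_eval:
  assumes "Poly_Mapping.keys p \<subseteq> X"
  shows "cls p = frag_eval T (gen_class T) p"
proof (rule free_Abelian_group_induct[OF assms])
  show "cls 0 = frag_eval T (gen_class T) 0" by (simp add: cls_0)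
  show "cls (frag_of x) = frag_eval T (gen_class T) (frag_of x)" if "x \<in> X" for x
    using that gen_class_closed[OF that] by (simp add: gen_class_eq)
  show "cls (p - q) = frag_eval T (gen_class T) (p - q)"
    if "Poly_Mapping.keys p \<subseteq> X" "Poly_Mapping.keys q \<subseteq> X"
      "cls p = frag_eval T (gen_class T) p" "cls q = frag_eval T (gen_class T) q" for p q
    using that cls_diff T.frag_eval_diff[of X "gen_class T" p q] gen_class_closed by simp
qed

lemma gen_extend_eval: "gen_extend P \<phi> t = frag_eval P \<phi> (SOME p. p \<in> t)"
  by (simp add: gen_extend_def frag_eval_def Let_def)

lemma representative:
  assumes "t \<in> carrier T"
  shows "Poly_Mapping.keys (SOME p. p \<in> t) \<subseteq> X" "t = cls (SOME p. p \<in> t)"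
proof -
  have "(SOME p. p \<in> t) \<in> t" using ex_cls[OF assms] by (metis someI_ex)
  then show "Poly_Mapping.keys (SOME p. p \<in> t) \<subseteq> X" "t = cls (SOME p. p \<in> t)"
    using mem_cls[OF assms] by auto
qed

lemma induct_T [consumes 1, case_names zero gen diff]:
  assumes "t \<in> carrier T" "Q \<zero>\<^bsub>T\<^esub>" "\<And>x. x \<in> X \<Longrightarrow> Q (gen_class T x)"
    and "\<And>s t. s \<in> carrier T \<Longrightarrow> t \<in> carrier T \<Longrightarrow> Q s \<Longrightarrow> Q t \<Longrightarrow> Q (s \<ominus>\<^bsub>T\<^esub> t)"
  shows "Q t"
proof -
  obtain p where p: "Poly_Mapping.keys p \<subseteq> X" "t = cls p" using ex_cls[OF assms(1)] .
  have "Q (cls p)"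
    using p(1)
  proof (rule free_Abelian_group_induct)
    show "Q (cls 0)" using assms by (simp add: cls_0)
    show "Q (cls (frag_of x))" if "x \<in> X" for x using assms(3)[OF that] that by (simp add: gen_class_eq)
    show "Q (cls (p - q))" if "Poly_Mapping.keys p \<subseteq> X" "Poly_Mapping.keys q \<subseteq> X"
      "Q (cls p)" "Q (cls q)" for p q
      using that by (simp add: cls_diff assms(4) cls_closed)
  qed
  with p show ?thesis by simp
qed

lemma addmap_eqI:
  assumes "addmap T P h" "addmap T P h'" "\<And>x. x \<in> X \<Longrightarrow> h (gen_class T x) = h' (gen_class T x)"
    and "t \<in> carrier T"
  shows "h t = h' t"
  using assms(4)
proof (induction t rule: induct_T)
  case (diff s t)
  interpret P: abelian_group P using addmap_cod[OF assms(1)] .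
  show ?case using diff
    by (simp add: a_minus_def addmap_add[OF assms(1)] addmap_add[OF assms(2)]
        addmap_minus[OF assms(1)] addmap_minus[OF assms(2)])
qed (use assms in \<open>auto simp: addmap_zero[OF assms(1)] addmap_zero[OF assms(2)]\<close>)

lemma gen_extend_closed:
  assumes "abelian_group P" "\<And>x. x \<in> X \<Longrightarrow> \<phi> x \<in> carrier P" "t \<in> carrier T"
  shows "gen_extend P \<phi> t \<in> carrier P"
  unfolding gen_extend_eval using representative(1)[OF assms(3)] assms(2)
  by (intro abelian_group.frag_eval_closed[OF assms(1)]) blast

lemma gen_extend_cong:
  assumes "abelian_group P" "\<And>x. x \<in> X \<Longrightarrow> \<phi> x \<in> carrier P" "t \<in> carrier T"
    "\<And>x. x \<in> X \<Longrightarrow> \<psi> x = \<phi> x"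
  shows "gen_extend P \<psi> t = gen_extend P \<phi> t"
  unfolding gen_extend_eval
  by (rule frag_eval_cong[OF assms(1)]) (use representative(1)[OF assms(3)] assms(2,4) in blast)+

text \<open>
  Both sides are computed on the same representative of \<open>t\<close>, so \<open>\<phi>\<close> may be arbitrary.  In this way additive
  maps are pulled into nested extensions without any information on the inner ones.
\<close>

lemma addmap_gen_extend:
  assumes "addmap P Q h" "\<And>x. x \<in> X \<Longrightarrow> \<phi> x \<in> carrier P" "t \<in> carrier T"
  shows "h (gen_extend P \<phi> t) = gen_extend Q (\<lambda>x. h (\<phi> x)) t"
  unfolding gen_extend_eval
  by (rule addmap_frag_eval[OF assms(1,2) representative(1)[OF assms(3)]])

lemma gen_extend_gen_class:
  assumes "t \<in> carrier T" shows "gen_extend T (gen_class T) t = t"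
  using representative[OF assms] cls_eq_eval by (simp add: gen_extend_eval)

context
  fixes P :: "('p, 's) ring_scheme" and \<phi>
  assumes P: "abelian_group P" and \<phi>: "\<And>x. x \<in> X \<Longrightarrow> \<phi> x \<in> carrier P"
    and compat: "\<And>r. r \<in> S \<Longrightarrow> frag_eval P \<phi> r = \<zero>\<^bsub>P\<^esub>"
begin

interpretation P: abelian_group P by (rule P)

lemma frag_eval_ideal: "r \<in> generate FG S \<Longrightarrow> Poly_Mapping.keys r \<subseteq> X \<and> frag_eval P \<phi> r = \<zero>\<^bsub>P\<^esub>"
proof (induction r rule: generate.induct)
  case one then show ?case by simp
next
  case (incl r) then show ?case using relators compat by simp
next
  case (inv r)
  then have k: "Poly_Mapping.keys r \<subseteq> X" using relators by simp
  have "frag_eval P \<phi> (0 - r) = \<zero>\<^bsub>P\<^esub>"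
    using P.frag_eval_diff[of X \<phi> 0 r] \<phi> k compat[OF inv] by (simp add: a_minus_def)
  then show ?case using k by simp
next
  case (eng r s)
  then show ?case using P.frag_eval_add[of X \<phi> r s] \<phi> keys_add[of r s] by auto
qed

lemma gen_extend_cls:
  assumes "Poly_Mapping.keys p \<subseteq> X"
  shows "gen_extend P \<phi> (cls p) = frag_eval P \<phi> p"
proof -
  define q where "q = (SOME q. q \<in> cls p)"
  have q: "Poly_Mapping.keys q \<subseteq> X" "q \<in> cls p"
    using representative(1)[OF cls_closed[OF assms]] cls_self[OF assms] someI_ex[of "\<lambda>q. q \<in> cls p"]
    by (auto simp: q_def)
  then obtain r where r: "r \<in> generate FG S" "q = r + p"
    by (auto simp: cls_def r_coset_def)
  then have "frag_eval P \<phi> q = frag_eval P \<phi> p"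
    using frag_eval_ideal[OF r(1)] P.frag_eval_add[of X \<phi> r p] assms \<phi> P.frag_eval_closed[of p \<phi>]
    by (metis P.l_zero subsetD)
  then show ?thesis by (simp add: gen_extend_eval q_def)
qed

lemma gen_extend_class: "x \<in> X \<Longrightarrow> gen_extend P \<phi> (gen_class T x) = \<phi> x"
  by (simp add: gen_class_eq gen_extend_cls keys_frag_of \<phi>)

lemma addmap_extend: "addmap T P (gen_extend P \<phi>)"
proof (rule addmapI[OF abelian_T P])
  show "gen_extend P \<phi> t \<in> carrier P" if "t \<in> carrier T" for t
    using gen_extend_closed[OF P \<phi> that] .
  show "gen_extend P \<phi> (s \<oplus>\<^bsub>T\<^esub> t) = gen_extend P \<phi> s \<oplus>\<^bsub>P\<^esub> gen_extend P \<phi> t"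
    if st: "s \<in> carrier T" "t \<in> carrier T" for s t
  proof -
    obtain p q where p: "Poly_Mapping.keys p \<subseteq> X" "s = cls p" "Poly_Mapping.keys q \<subseteq> X" "t = cls q"
      using ex_cls[OF st(1)] ex_cls[OF st(2)] by metis
    have k: "Poly_Mapping.keys (p + q) \<subseteq> X" using p keys_add[of p q] by auto
    have "gen_extend P \<phi> (s \<oplus>\<^bsub>T\<^esub> t) = frag_eval P \<phi> (p + q)"
      by (simp add: p(2,4) gen_extend_cls[OF k] flip: cls_add[OF p(1,3)])
    also have "\<dots> = frag_eval P \<phi> p \<oplus>\<^bsub>P\<^esub> frag_eval P \<phi> q"
      using P.frag_eval_add[of X \<phi> p q] \<phi> p(1,3) by blast
    finally show ?thesis by (simp add: p(2,4) gen_extend_cls[OF p(1)] gen_extend_cls[OF p(3)])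
  qed
qed

end

end

section \<open>Linear and bilinear maps\<close>

definition lin ::
  "('k, 'r) ring_scheme \<Rightarrow> ('k, 'v, 's) module_scheme \<Rightarrow> ('k, 'w, 't) module_scheme \<Rightarrow> ('v \<Rightarrow> 'w) \<Rightarrow> bool" where
  "lin K V W h \<longleftrightarrow> module K V \<and> module K W \<and> linear_map K V W h"

lemma module_abelian: "module K V \<Longrightarrow> abelian_group V"
  by (simp add: module_def)

lemma linI:
  assumes "module K V" "module K W" "\<And>x. x \<in> carrier V \<Longrightarrow> h x \<in> carrier W"
    and "\<And>x y. x \<in> carrier V \<Longrightarrow> y \<in> carrier V \<Longrightarrow> h (x \<oplus>\<^bsub>V\<^esub> y) = h x \<oplus>\<^bsub>W\<^esub> h y"
    and "\<And>c x. c \<in> carrier K \<Longrightarrow> x \<in> carrier V \<Longrightarrow> h (c \<odot>\<^bsub>V\<^esub> x) = c \<odot>\<^bsub>W\<^esub> h x"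
  shows "lin K V W h"
  using assms by (auto simp: lin_def linear_map_def hom_def)

lemma linI_addmap:
  assumes "module K V" "module K W" "addmap V W h"
    and "\<And>c x. c \<in> carrier K \<Longrightarrow> x \<in> carrier V \<Longrightarrow> h (c \<odot>\<^bsub>V\<^esub> x) = c \<odot>\<^bsub>W\<^esub> h x"
  shows "lin K V W h"
  using addmap_closed[OF assms(3)] addmap_add[OF assms(3)] assms(4)
  by (intro linI[OF assms(1,2)])

lemma
  assumes "lin K V W h"
  shows lin_dom: "module K V" and lin_cod: "module K W"
    and lin_closed: "x \<in> carrier V \<Longrightarrow> h x \<in> carrier W"
    and lin_add: "x \<in> carrier V \<Longrightarrow> y \<in> carrier V \<Longrightarrow> h (x \<oplus>\<^bsub>V\<^esub> y) = h x \<oplus>\<^bsub>W\<^esub> h y"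
    and lin_smult: "c \<in> carrier K \<Longrightarrow> x \<in> carrier V \<Longrightarrow> h (c \<odot>\<^bsub>V\<^esub> x) = c \<odot>\<^bsub>W\<^esub> h x"
  using assms by (auto simp: lin_def linear_map_def hom_def)

lemma lin_addmap:
  assumes "lin K V W h" shows "addmap V W h"
  by (rule addmapI)
    (simp_all add: module_abelian[OF lin_dom[OF assms]] module_abelian[OF lin_cod[OF assms]]
      lin_closed[OF assms] lin_add[OF assms])

lemmas lin_zero = addmap_zero[OF lin_addmap]
lemmas lin_minus = addmap_minus[OF lin_addmap]

lemma lin_id: "module K V \<Longrightarrow> lin K V V (\<lambda>x. x)"
  by (rule linI) simp_all

lemma lin_comp:
  assumes g: "lin K V W g" and f: "lin K U V f" shows "lin K U W (\<lambda>x. g (f x))"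
  using lin_closed[OF f] lin_closed[OF g] lin_add[OF f] lin_add[OF g] lin_smult[OF f] lin_smult[OF g]
  by (intro linI[OF lin_dom[OF f] lin_cod[OF g]]) auto

lemma lin_plus:
  assumes f: "lin K U V f" and g: "lin K U V g" shows "lin K U V (\<lambda>x. f x \<oplus>\<^bsub>V\<^esub> g x)"
proof -
  interpret V: module K V using lin_cod[OF f] .
  show ?thesis using addmap_plus[OF lin_addmap[OF f] lin_addmap[OF g]] lin_smult[OF f] lin_smult[OF g]
      lin_closed[OF f] lin_closed[OF g]
    by (intro linI_addmap[OF lin_dom[OF f] lin_cod[OF f]]) (auto simp: V.smult_r_distr)
qed

lemma lin_zero_map:
  assumes "module K U" "module K V" shows "lin K U V (\<lambda>x. \<zero>\<^bsub>V\<^esub>)"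
proof -
  interpret V: module K V by fact
  show ?thesis using assms by (intro linI) auto
qed

lemma lin_cong:
  assumes f: "lin K U V f" and g: "\<And>x. x \<in> carrier U \<Longrightarrow> g x = f x"
  shows "lin K U V g"
proof -
  interpret U: module K U using lin_dom[OF f] .
  show ?thesis using lin_closed[OF f] lin_add[OF f] lin_smult[OF f] g
    by (intro linI[OF lin_dom[OF f] lin_cod[OF f]]) auto
qed

definition biadd ::
  "('m, 'r) ring_scheme \<Rightarrow> ('n, 's) ring_scheme \<Rightarrow> ('p, 't) ring_scheme \<Rightarrow> ('m \<Rightarrow> 'n \<Rightarrow> 'p) \<Rightarrow> bool" where
  "biadd M N P \<beta> \<longleftrightarrow> (\<forall>m \<in> carrier M. addmap N P (\<beta> m)) \<and> (\<forall>n \<in> carrier N. addmap M P (\<lambda>m. \<beta> m n))"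

definition bilin ::
  "('k, 'r) ring_scheme \<Rightarrow> ('k, 'm, 's) module_scheme \<Rightarrow> ('k, 'n, 't) module_scheme
   \<Rightarrow> ('k, 'p, 'u) module_scheme \<Rightarrow> ('m \<Rightarrow> 'n \<Rightarrow> 'p) \<Rightarrow> bool" where
  "bilin K M N P \<beta> \<longleftrightarrow> module K M \<and> module K N \<and> module K P \<and>
     (\<forall>m \<in> carrier M. lin K N P (\<beta> m)) \<and> (\<forall>n \<in> carrier N. lin K M P (\<lambda>m. \<beta> m n))"

lemma biaddI:
  "(\<And>m. m \<in> carrier M \<Longrightarrow> addmap N P (\<beta> m)) \<Longrightarrow> (\<And>n. n \<in> carrier N \<Longrightarrow> addmap M P (\<lambda>m. \<beta> m n))
   \<Longrightarrow> biadd M N P \<beta>"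
  by (simp add: biadd_def)

lemma biadd_left: "biadd M N P \<beta> \<Longrightarrow> n \<in> carrier N \<Longrightarrow> addmap M P (\<lambda>m. \<beta> m n)"
  and biadd_right: "biadd M N P \<beta> \<Longrightarrow> m \<in> carrier M \<Longrightarrow> addmap N P (\<beta> m)"
  by (simp_all add: biadd_def)

lemma bilinI:
  "module K M \<Longrightarrow> module K N \<Longrightarrow> module K P \<Longrightarrow> (\<And>n. n \<in> carrier N \<Longrightarrow> lin K M P (\<lambda>m. \<beta> m n)) \<Longrightarrow>
   (\<And>m. m \<in> carrier M \<Longrightarrow> lin K N P (\<beta> m)) \<Longrightarrow> bilin K M N P \<beta>"
  by (simp add: bilin_def)

lemma
  assumes "bilin K M N P \<beta>"
  shows bilin_modules: "module K M" "module K N" "module K P"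
    and bilin_left: "n \<in> carrier N \<Longrightarrow> lin K M P (\<lambda>m. \<beta> m n)"
    and bilin_right: "m \<in> carrier M \<Longrightarrow> lin K N P (\<beta> m)"
    and bilin_closed: "m \<in> carrier M \<Longrightarrow> n \<in> carrier N \<Longrightarrow> \<beta> m n \<in> carrier P"
proof -
  show "module K M" "module K N" "module K P" "n \<in> carrier N \<Longrightarrow> lin K M P (\<lambda>m. \<beta> m n)"
    "m \<in> carrier M \<Longrightarrow> lin K N P (\<beta> m)"
    using assms by (simp_all add: bilin_def)
  show "m \<in> carrier M \<Longrightarrow> n \<in> carrier N \<Longrightarrow> \<beta> m n \<in> carrier P"
    using assms lin_closed[of K N P "\<beta> m"] by (simp add: bilin_def)
qed

lemma bilin_biadd: "bilin K M N P \<beta> \<Longrightarrow> biadd M N P \<beta>"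
  by (intro biaddI lin_addmap[of K] bilin_left[of K M N P] bilin_right[of K M N P])

lemma bilin_L:
  assumes "bilin K M N P \<beta>" "n \<in> carrier N" "lin K U M f"
  shows "lin K U P (\<lambda>x. \<beta> (f x) n)"
  using lin_comp[OF bilin_left[OF assms(1,2)] assms(3)] .

lemma bilin_R:
  assumes "bilin K M N P \<beta>" "m \<in> carrier M" "lin K U N f"
  shows "lin K U P (\<lambda>x. \<beta> m (f x))"
  using lin_comp[OF bilin_right[OF assms(1,2)] assms(3)] .

lemma bilin_comp:
  assumes "bilin K M N P \<beta>" "lin K U M f" "lin K V N g" "lin K P Q h"
  shows "bilin K U V Q (\<lambda>x y. h (\<beta> (f x) (g y)))"
proof (rule bilinI)
  show "module K U" "module K V" "module K Q"
    using lin_dom[OF assms(2)] lin_dom[OF assms(3)] lin_cod[OF assms(4)] .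
  show "lin K U Q (\<lambda>x. h (\<beta> (f x) (g y)))" if "y \<in> carrier V" for y
    by (rule lin_comp[OF assms(4) bilin_L[OF assms(1) lin_closed[OF assms(3) that] assms(2)]])
  show "lin K V Q (\<lambda>y. h (\<beta> (f x) (g y)))" if "x \<in> carrier U" for x
    by (rule lin_comp[OF assms(4) bilin_R[OF assms(1) lin_closed[OF assms(2) that] assms(3)]])
qed

lemma addmap_frag_eval_param:
  assumes X: "\<And>x. x \<in> X \<Longrightarrow> addmap V P (\<lambda>v. \<phi> v x)" and V: "abelian_group V" and P: "abelian_group P"
    and k: "Poly_Mapping.keys p \<subseteq> X"
  shows "addmap V P (\<lambda>v. frag_eval P (\<phi> v) p)"
proof -
  interpret P: abelian_group P by fact
  interpret V: abelian_group V by fact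
  have c: "\<phi> v x \<in> carrier P" if "v \<in> carrier V" "x \<in> X" for v x
    using addmap_closed[OF X] that by blast
  show ?thesis
  proof (rule free_Abelian_group_induct[OF k])
    show "addmap V P (\<lambda>v. frag_eval P (\<phi> v) 0)"
      by (auto intro: addmapI V P)
    show "addmap V P (\<lambda>v. frag_eval P (\<phi> v) (frag_of x))" if "x \<in> X" for x
      by (rule addmap_cong[OF X[OF that]]) (simp add: c that)
    show "addmap V P (\<lambda>v. frag_eval P (\<phi> v) (p - q))"
      if "Poly_Mapping.keys p \<subseteq> X" "Poly_Mapping.keys q \<subseteq> X"
        "addmap V P (\<lambda>v. frag_eval P (\<phi> v) p)" "addmap V P (\<lambda>v. frag_eval P (\<phi> v) q)" for p q
      by (rule addmap_cong[OF addmap_plus[OF that(3) addmap_uminus[OF that(4)]]])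
        (use P.frag_eval_diff[OF c that(1,2)] in \<open>simp add: a_minus_def\<close>)
  qed
qed

section \<open>Tensor products\<close>

locale tensor_pair =
  fixes D :: "('d, 'r) partial_object_scheme" and M :: "('k, 'm, 'd, 's) rmodule_scheme"
    and N :: "('d, 'n, 't) module_scheme"
  assumes M_ab: "abelian_group M" and N_ab: "abelian_group N"
    and ract_closed: "m \<in> carrier M \<Longrightarrow> x \<in> carrier D \<Longrightarrow> ract M m x \<in> carrier M"
    and lact_closed: "n \<in> carrier N \<Longrightarrow> x \<in> carrier D \<Longrightarrow> x \<odot>\<^bsub>N\<^esub> n \<in> carrier N"
begin

interpretation M: abelian_group M by (rule M_ab)
interpretation N: abelian_group N by (rule N_ab)

abbreviation "T \<equiv> tensor D M N"

sublocale presented_group "carrier M \<times> carrier N" "tensor_relators D M N" "tensor D M N"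
proof
  show "Poly_Mapping.keys r \<subseteq> carrier M \<times> carrier N" if "r \<in> tensor_relators D M N" for r
    using that unfolding tensor_relators_def
    by (elim UnE CollectE exE conjE; hypsubst)
      (rule order_trans[OF keys_three] order_trans[OF keys_two], simp add: ract_closed lact_closed)+
qed (simp_all add: tensor_def presented_space_def Let_def)

lemma pure_closed: "m \<in> carrier M \<Longrightarrow> n \<in> carrier N \<Longrightarrow> pure T m n \<in> carrier T"
  by (simp add: gen_class_closed)

lemma pure_add_left:
  "m \<in> carrier M \<Longrightarrow> m' \<in> carrier M \<Longrightarrow> n \<in> carrier N \<Longrightarrow>
   pure T (m \<oplus>\<^bsub>M\<^esub> m') n = pure T m n \<oplus>\<^bsub>T\<^esub> pure T m' n"
  by (rule relator_three) (auto simp: tensor_relators_def)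

lemma pure_add_right:
  "m \<in> carrier M \<Longrightarrow> n \<in> carrier N \<Longrightarrow> n' \<in> carrier N \<Longrightarrow>
   pure T m (n \<oplus>\<^bsub>N\<^esub> n') = pure T m n \<oplus>\<^bsub>T\<^esub> pure T m n'"
  by (rule relator_three) (auto simp: tensor_relators_def)

lemma pure_balanced:
  "m \<in> carrier M \<Longrightarrow> x \<in> carrier D \<Longrightarrow> n \<in> carrier N \<Longrightarrow>
   pure T (ract M m x) n = pure T m (x \<odot>\<^bsub>N\<^esub> n)"
  by (rule relator_two) (auto simp: tensor_relators_def ract_closed lact_closed)

lemma biadd_pure: "biadd M N T (pure T)"
  by (intro biaddI addmapI M_ab N_ab abelian_T pure_closed pure_add_left pure_add_right) assumption+

lemma pure_zero_left: "n \<in> carrier N \<Longrightarrow> pure T \<zero>\<^bsub>M\<^esub> n = \<zero>\<^bsub>T\<^esub>"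
  using addmap_zero[OF biadd_left[OF biadd_pure]] .

lemma pure_minus_left: "m \<in> carrier M \<Longrightarrow> n \<in> carrier N \<Longrightarrow> pure T (\<ominus>\<^bsub>M\<^esub> m) n = \<ominus>\<^bsub>T\<^esub> pure T m n"
  using addmap_minus[OF biadd_left[OF biadd_pure]] .

lemma tensor_induct [consumes 1, case_names pure plus]:
  assumes "t \<in> carrier T" "\<And>m n. m \<in> carrier M \<Longrightarrow> n \<in> carrier N \<Longrightarrow> Q (pure T m n)"
    and plus: "\<And>s t. s \<in> carrier T \<Longrightarrow> t \<in> carrier T \<Longrightarrow> Q s \<Longrightarrow> Q t \<Longrightarrow> Q (s \<oplus>\<^bsub>T\<^esub> t)"
  shows "Q t"
proof -
  \<comment> \<open>\<open>- (m \<otimes> n) = (- m) \<otimes> n\<close>, so sums of elementary tensors are closed under differences.\<close>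
  have "Q t \<and> Q (\<ominus>\<^bsub>T\<^esub> t)"
    using assms(1)
  proof (induction t rule: induct_T)
    case zero
    have "Q (pure T \<zero>\<^bsub>M\<^esub> \<zero>\<^bsub>N\<^esub>)" using assms(2) by simp
    moreover have "\<ominus>\<^bsub>T\<^esub> \<zero>\<^bsub>T\<^esub> = \<zero>\<^bsub>T\<^esub>" by (rule T.minus_equality) simp_all
    ultimately show ?case by (metis M.zero_closed N.zero_closed pure_zero_left)
  next
    case (gen x)
    then obtain m n where x: "x = (m, n)" "m \<in> carrier M" "n \<in> carrier N" by auto
    have "Q (pure T (\<ominus>\<^bsub>M\<^esub> m) n)" using assms(2) x by simp
    then show ?case using x assms(2) by (simp add: pure_minus_left)
  next
    case (diff s t)
    then have "Q (s \<oplus>\<^bsub>T\<^esub> \<ominus>\<^bsub>T\<^esub> t)" "Q (t \<oplus>\<^bsub>T\<^esub> \<ominus>\<^bsub>T\<^esub> s)" using plus by simp_all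
    moreover have "\<ominus>\<^bsub>T\<^esub> (s \<oplus>\<^bsub>T\<^esub> \<ominus>\<^bsub>T\<^esub> t) = t \<oplus>\<^bsub>T\<^esub> \<ominus>\<^bsub>T\<^esub> s"
      using diff T.minus_add[of s "\<ominus>\<^bsub>T\<^esub> t"] T.a_comm[of "\<ominus>\<^bsub>T\<^esub> s" t] by simp
    ultimately show ?case by (simp add: a_minus_def)
  qed
  then show ?thesis ..
qed

lemma tensor_eqI:
  assumes "addmap T P h" "addmap T P h'"
    "\<And>m n. m \<in> carrier M \<Longrightarrow> n \<in> carrier N \<Longrightarrow> h (pure T m n) = h' (pure T m n)" "t \<in> carrier T"
  shows "h t = h' t"
  by (rule addmap_eqI[OF assms(1,2) _ assms(4)]) (use assms(3) in auto)

lemma tlift_closed: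
  assumes "abelian_group P" "\<And>m n. m \<in> carrier M \<Longrightarrow> n \<in> carrier N \<Longrightarrow> \<beta> m n \<in> carrier P"
    "t \<in> carrier T"
  shows "tlift P \<beta> t \<in> carrier P"
  by (rule gen_extend_closed[OF assms(1) _ assms(3)]) (use assms(2) in auto)

lemma tlift_cong:
  assumes "abelian_group P" "\<And>m n. m \<in> carrier M \<Longrightarrow> n \<in> carrier N \<Longrightarrow> \<beta> m n \<in> carrier P"
    "t \<in> carrier T" "\<And>m n. m \<in> carrier M \<Longrightarrow> n \<in> carrier N \<Longrightarrow> \<gamma> m n = \<beta> m n"
  shows "tlift P \<gamma> t = tlift P \<beta> t"
  by (rule gen_extend_cong[OF assms(1) _ assms(3)]) (use assms(2,4) in auto)

lemma addmap_tlift: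
  assumes "addmap P Q h" "\<And>m n. m \<in> carrier M \<Longrightarrow> n \<in> carrier N \<Longrightarrow> \<beta> m n \<in> carrier P"
    "t \<in> carrier T"
  shows "h (tlift P \<beta> t) = tlift Q (\<lambda>m n. h (\<beta> m n)) t"
proof -
  have "h (tlift P \<beta> t) = gen_extend Q (\<lambda>x. h (case x of (m, n) \<Rightarrow> \<beta> m n)) t"
    by (rule addmap_gen_extend[OF assms(1) _ assms(3)]) (use assms(2) in auto)
  also have "(\<lambda>x. h (case x of (m, n) \<Rightarrow> \<beta> m n)) = (\<lambda>(m, n). h (\<beta> m n))"
    by auto
  finally show ?thesis .
qed

lemma tlift_pure: "t \<in> carrier T \<Longrightarrow> tlift T (pure T) t = t"
  using gen_extend_gen_class by (simp add: case_prod_eta)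

lemma tlift_param_addmap:
  assumes "\<And>m n. m \<in> carrier M \<Longrightarrow> n \<in> carrier N \<Longrightarrow> addmap V P (\<lambda>v. \<beta> v m n)"
    and "abelian_group V" "abelian_group P" "t \<in> carrier T"
  shows "addmap V P (\<lambda>v. tlift P (\<beta> v) t)"
  unfolding gen_extend_eval
  by (rule addmap_frag_eval_param[OF _ assms(2,3) representative(1)[OF assms(4)]]) (use assms(1) in auto)

context
  fixes P :: "('p, 'u) ring_scheme" and \<beta>
  assumes \<beta>: "biadd M N P \<beta>"
    and bal: "\<And>m x n. m \<in> carrier M \<Longrightarrow> x \<in> carrier D \<Longrightarrow> n \<in> carrier N \<Longrightarrow> \<beta> (ract M m x) n = \<beta> m (x \<odot>\<^bsub>N\<^esub> n)"
begin

lemma tlift_respects: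
  assumes "r \<in> tensor_relators D M N" shows "frag_eval P (\<lambda>(m, n). \<beta> m n) r = \<zero>\<^bsub>P\<^esub>"
proof -
  interpret P: abelian_group P using addmap_cod[OF biadd_right[OF \<beta> M.zero_closed]] .
  let ?\<phi> = "\<lambda>(m, n). \<beta> m n"
  have c: "?\<phi> x \<in> carrier P" if "x \<in> carrier M \<times> carrier N" for x
    using that addmap_closed[OF biadd_right[OF \<beta>]] by auto
  have two: "frag_eval P ?\<phi> (frag_of x - frag_of y) = ?\<phi> x \<ominus>\<^bsub>P\<^esub> ?\<phi> y"
    if "x \<in> carrier M \<times> carrier N" "y \<in> carrier M \<times> carrier N" for x y
    using P.frag_eval_diff[of "carrier M \<times> carrier N" ?\<phi>] c that by (simp add: keys_frag_of)
  have three: "frag_eval P ?\<phi> (frag_of x - frag_of y - frag_of z) = ?\<phi> x \<ominus>\<^bsub>P\<^esub> ?\<phi> y \<ominus>\<^bsub>P\<^esub> ?\<phi> z"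
    if "x \<in> carrier M \<times> carrier N" "y \<in> carrier M \<times> carrier N" "z \<in> carrier M \<times> carrier N" for x y z
  proof -
    have "Poly_Mapping.keys (frag_of x - frag_of y) \<subseteq> carrier M \<times> carrier N"
      using keys_two[of x y] that by blast
    then show ?thesis
      using P.frag_eval_diff[of "carrier M \<times> carrier N" ?\<phi> "frag_of x - frag_of y" "frag_of z"]
        two[OF that(1,2)] c that(3) by (simp add: keys_frag_of)
  qed
  have add3: "(a \<oplus>\<^bsub>P\<^esub> b) \<ominus>\<^bsub>P\<^esub> a \<ominus>\<^bsub>P\<^esub> b = \<zero>\<^bsub>P\<^esub>" if "a \<in> carrier P" "b \<in> carrier P" for a b
  proof -
    have "a \<oplus>\<^bsub>P\<^esub> b \<oplus>\<^bsub>P\<^esub> \<ominus>\<^bsub>P\<^esub> a = b"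
      using that P.a_comm[of "a \<oplus>\<^bsub>P\<^esub> b" "\<ominus>\<^bsub>P\<^esub> a"] by (simp add: P.r_neg1)
    then show ?thesis using that by (simp add: a_minus_def P.r_neg)
  qed
  show ?thesis
    using assms unfolding tensor_relators_def
  proof (elim UnE CollectE exE conjE)
    fix m m' n
    assume r: "r = frag_of (m \<oplus>\<^bsub>M\<^esub> m', n) - frag_of (m, n) - frag_of (m', n)"
      and mn: "m \<in> carrier M" "m' \<in> carrier M" "n \<in> carrier N"
    have "\<beta> m n \<in> carrier P" "\<beta> m' n \<in> carrier P" "\<beta> (m \<oplus>\<^bsub>M\<^esub> m') n = \<beta> m n \<oplus>\<^bsub>P\<^esub> \<beta> m' n"
      using mn addmap_add[OF biadd_left[OF \<beta>]] addmap_closed[OF biadd_left[OF \<beta>]] by auto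
    then show ?thesis using three[of "(m \<oplus>\<^bsub>M\<^esub> m', n)" "(m, n)" "(m', n)"] add3 mn by (simp add: r)
  next
    fix m n n'
    assume r: "r = frag_of (m, n \<oplus>\<^bsub>N\<^esub> n') - frag_of (m, n) - frag_of (m, n')"
      and mn: "m \<in> carrier M" "n \<in> carrier N" "n' \<in> carrier N"
    have "\<beta> m n \<in> carrier P" "\<beta> m n' \<in> carrier P" "\<beta> m (n \<oplus>\<^bsub>N\<^esub> n') = \<beta> m n \<oplus>\<^bsub>P\<^esub> \<beta> m n'"
      using mn addmap_add[OF biadd_right[OF \<beta>]] addmap_closed[OF biadd_right[OF \<beta>]] by auto
    then show ?thesis using three[of "(m, n \<oplus>\<^bsub>N\<^esub> n')" "(m, n)" "(m, n')"] add3 mn by (simp add: r)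
  next
    fix m x n
    assume r: "r = frag_of (ract M m x, n) - frag_of (m, x \<odot>\<^bsub>N\<^esub> n)"
      and mn: "m \<in> carrier M" "x \<in> carrier D" "n \<in> carrier N"
    have "\<beta> m (x \<odot>\<^bsub>N\<^esub> n) \<in> carrier P"
      using mn lact_closed addmap_closed[OF biadd_right[OF \<beta>]] by blast
    then show ?thesis
      using two[of "(ract M m x, n)" "(m, x \<odot>\<^bsub>N\<^esub> n)"] mn lact_closed ract_closed bal[of m x n]
      by (simp add: r a_minus_def P.r_neg)
  qed
qed

lemma tlift_addmap: "addmap T P (tlift P \<beta>)"
  by (rule addmap_extend[OF addmap_cod[OF biadd_right[OF \<beta> M.zero_closed]] _ tlift_respects])
    (use addmap_closed[OF biadd_right[OF \<beta>]] in auto)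

lemma tlift_elem: "m \<in> carrier M \<Longrightarrow> n \<in> carrier N \<Longrightarrow> tlift P \<beta> (pure T m n) = \<beta> m n"
  using gen_extend_class[OF addmap_cod[OF biadd_right[OF \<beta> M.zero_closed]] _ tlift_respects, of "(m, n)"]
    addmap_closed[OF biadd_right[OF \<beta>]] by auto

end

end

text \<open>The vector space structure that a tensor product over \<open>D\<close> inherits from its left factor.\<close>

locale tensor_space = tensor_pair D M N
  for K :: "('k, 'q) ring_scheme" and D :: "('d, 'r) partial_object_scheme"
    and M :: "('k, 'm, 'd, 's) rmodule_scheme" and N :: "('d, 'n, 't) module_scheme" +
  assumes M_module: "module K M"
    and smult_ract: "c \<in> carrier K \<Longrightarrow> m \<in> carrier M \<Longrightarrow> x \<in> carrier D \<Longrightarrow>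
      ract M (c \<odot>\<^bsub>M\<^esub> m) x = c \<odot>\<^bsub>M\<^esub> ract M m x"
begin

interpretation M: module K M by (rule M_module)

lemma smult_T: "smult T c = tlift T (\<lambda>m n. pure T (c \<odot>\<^bsub>M\<^esub> m) n)"
proof -
  define U where "U = (presented_space (carrier M \<times> carrier N) (tensor_relators D M N) :: ('k, ('m, 'n) tensor) module)"
  have T: "T = U\<lparr>smult := \<lambda>c. gen_extend U (\<lambda>(m, n). gen_class U (c \<odot>\<^bsub>M\<^esub> m, n))\<rparr>"
    by (simp add: tensor_def U_def Let_def)
  have gc: "gen_class T = gen_class U"
    by (simp add: T gen_class_def fun_eq_iff)
  have ge: "gen_extend T \<phi> t = gen_extend U \<phi> t" for \<phi> t
    by (simp add: T gen_extend_def finsum_def add_pow_def)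
  have "smult T c = gen_extend U (\<lambda>(m, n). gen_class U (c \<odot>\<^bsub>M\<^esub> m, n))"
    by (simp add: T)
  then show ?thesis
    by (simp add: gc ge fun_eq_iff)
qed

lemma smult_biadd:
  assumes "c \<in> carrier K" shows "biadd M N T (\<lambda>m n. pure T (c \<odot>\<^bsub>M\<^esub> m) n)"
proof (intro biaddI addmapI M_ab N_ab abelian_T)
qed (use assms in \<open>simp_all add: pure_closed pure_add_left pure_add_right M.smult_r_distr\<close>)

lemma smult_addmap: "c \<in> carrier K \<Longrightarrow> addmap T T (smult T c)"
  unfolding smult_T
  by (rule tlift_addmap[OF smult_biadd]) (simp_all add: smult_ract[symmetric] pure_balanced[symmetric])

lemma smult_pure:
  "c \<in> carrier K \<Longrightarrow> m \<in> carrier M \<Longrightarrow> n \<in> carrier N \<Longrightarrow> c \<odot>\<^bsub>T\<^esub> pure T m n = pure T (c \<odot>\<^bsub>M\<^esub> m) n"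
  unfolding smult_T
  by (rule tlift_elem[OF smult_biadd]) (simp_all add: smult_ract[symmetric] pure_balanced[symmetric])

lemma module_T: "module K T"
proof (rule moduleI[OF M.is_cring abelian_T])
  show "a \<odot>\<^bsub>T\<^esub> x \<in> carrier T" if "a \<in> carrier K" "x \<in> carrier T" for a x
    using addmap_closed[OF smult_addmap] that by blast
  show "a \<odot>\<^bsub>T\<^esub> (x \<oplus>\<^bsub>T\<^esub> y) = a \<odot>\<^bsub>T\<^esub> x \<oplus>\<^bsub>T\<^esub> a \<odot>\<^bsub>T\<^esub> y"
    if "a \<in> carrier K" "x \<in> carrier T" "y \<in> carrier T" for a x y
    using addmap_add[OF smult_addmap] that by blast
  show "(a \<oplus>\<^bsub>K\<^esub> b) \<odot>\<^bsub>T\<^esub> x = a \<odot>\<^bsub>T\<^esub> x \<oplus>\<^bsub>T\<^esub> b \<odot>\<^bsub>T\<^esub> x"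
    if "a \<in> carrier K" "b \<in> carrier K" "x \<in> carrier T" for a b x
    by (rule tensor_eqI[OF smult_addmap addmap_plus[OF smult_addmap[OF that(1)] smult_addmap[OF that(2)]]])
      (use that in \<open>simp_all add: smult_pure M.smult_l_distr pure_add_left\<close>)
  show "(a \<otimes>\<^bsub>K\<^esub> b) \<odot>\<^bsub>T\<^esub> x = a \<odot>\<^bsub>T\<^esub> (b \<odot>\<^bsub>T\<^esub> x)"
    if "a \<in> carrier K" "b \<in> carrier K" "x \<in> carrier T" for a b x
    by (rule tensor_eqI[OF smult_addmap addmap_comp[OF smult_addmap[OF that(2)] smult_addmap[OF that(1)]]])
      (use that in \<open>simp_all add: smult_pure M.smult_assoc1\<close>)
  show "\<one>\<^bsub>K\<^esub> \<odot>\<^bsub>T\<^esub> x = x" if "x \<in> carrier T" for x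
    by (rule tensor_eqI[OF smult_addmap addmap_id[OF abelian_T] _ that]) (simp_all add: smult_pure)
qed

lemma tlift_lin:
  assumes \<beta>: "biadd M N P \<beta>" and P: "module K P"
    and bal: "\<And>m x n. m \<in> carrier M \<Longrightarrow> x \<in> carrier D \<Longrightarrow> n \<in> carrier N \<Longrightarrow> \<beta> (ract M m x) n = \<beta> m (x \<odot>\<^bsub>N\<^esub> n)"
    and sm: "\<And>c m n. c \<in> carrier K \<Longrightarrow> m \<in> carrier M \<Longrightarrow> n \<in> carrier N \<Longrightarrow> \<beta> (c \<odot>\<^bsub>M\<^esub> m) n = c \<odot>\<^bsub>P\<^esub> \<beta> m n"
  shows "lin K T P (tlift P \<beta>)"
proof (rule linI_addmap[OF module_T P tlift_addmap[OF \<beta> bal]])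
  interpret P: module K P by fact
  note lift = tlift_addmap[OF \<beta> bal]
  show "tlift P \<beta> (c \<odot>\<^bsub>T\<^esub> x) = c \<odot>\<^bsub>P\<^esub> tlift P \<beta> x" if c: "c \<in> carrier K" and x: "x \<in> carrier T" for c x
  proof (rule tensor_eqI[OF addmap_comp[OF smult_addmap[OF c] lift] _ _ x])
    show "addmap T P (\<lambda>x. c \<odot>\<^bsub>P\<^esub> tlift P \<beta> x)"
      using addmap_closed[OF lift] addmap_add[OF lift] c
      by (intro addmapI abelian_T P.abelian_group_axioms) (simp_all add: P.smult_r_distr)
  qed (use c in \<open>simp_all add: smult_pure tlift_elem[OF \<beta> bal] sm\<close>)
qed

lemma pure_lin_left: "n \<in> carrier N \<Longrightarrow> lin K M T (\<lambda>m. pure T m n)"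
  by (rule linI_addmap[OF M_module module_T biadd_left[OF biadd_pure]]) (simp_all add: smult_pure)

end

section \<open>Tensor products over the ground field\<close>

lemma abelian_group_cong:
  assumes "abelian_group M" "carrier M' = carrier M" "add M' = add M" "\<zero>\<^bsub>M'\<^esub> = \<zero>\<^bsub>M\<^esub>"
  shows "abelian_group M'"
proof -
  interpret abelian_group M by fact
  show ?thesis
  proof (rule abelian_groupI)
    show "\<exists>y \<in> carrier M'. y \<oplus>\<^bsub>M'\<^esub> x = \<zero>\<^bsub>M'\<^esub>" if "x \<in> carrier M'" for x
      using that assms l_neg by auto
    show "x \<oplus>\<^bsub>M'\<^esub> y = y \<oplus>\<^bsub>M'\<^esub> x" if "x \<in> carrier M'" "y \<in> carrier M'" for x y
      using that assms a_comm by simp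
  qed (use assms a_assoc in simp_all)
qed

lemma module_cong:
  assumes "module K M" "carrier M' = carrier M" "add M' = add M" "\<zero>\<^bsub>M'\<^esub> = \<zero>\<^bsub>M\<^esub>" "smult M' = smult M"
  shows "module K M'"
proof -
  interpret module K M by fact
  show ?thesis
    by (rule moduleI[OF R.is_cring abelian_group_cong[OF M.abelian_group_axioms assms(2-4)]])
      (simp_all add: assms smult_l_distr smult_r_distr smult_assoc1)
qed

lemma addmap_cong_dom:
  assumes "addmap M P h" "carrier M' = carrier M" "add M' = add M" "\<zero>\<^bsub>M'\<^esub> = \<zero>\<^bsub>M\<^esub>"
  shows "addmap M' P h"
  using assms abelian_group_cong[OF addmap_dom[OF assms(1)] assms(2-4)] by (simp add: addmap_def)

lemma lin_cong_dom:
  assumes "lin K M P h" "carrier M' = carrier M" "add M' = add M" "\<zero>\<^bsub>M'\<^esub> = \<zero>\<^bsub>M\<^esub>" "smult M' = smult M"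
  shows "lin K M' P h"
  using assms module_cong[OF lin_dom[OF assms(1)] assms(2-5)] by (simp add: lin_def linear_map_def hom_def)

lemma lin_cong_cod:
  assumes "lin K M P h" "carrier P' = carrier P" "add P' = add P" "\<zero>\<^bsub>P'\<^esub> = \<zero>\<^bsub>P\<^esub>" "smult P' = smult P"
  shows "lin K M P' h"
  using assms module_cong[OF lin_cod[OF assms(1)] assms(2-5)] by (simp add: lin_def linear_map_def hom_def)

text \<open>
  The right module on which \<open>ktensor\<close> is built; making it explicit turns a tensor product over \<open>K\<close> into
  an instance of the general construction.
\<close>

definition right_scalars :: "('k, 'm, 's) module_scheme \<Rightarrow> ('k, 'm, 'k) rmodule" where
  "right_scalars M = module.extend (module.truncate M) (rmodule.fields (\<lambda>m c. c \<odot>\<^bsub>M\<^esub> m))"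

lemma right_scalars_simps [simp]:
  "carrier (right_scalars M) = carrier M" "add (right_scalars M) = add M"
  "\<zero>\<^bsub>right_scalars M\<^esub> = \<zero>\<^bsub>M\<^esub>" "smult (right_scalars M) = smult M"
  "ract (right_scalars M) m c = c \<odot>\<^bsub>M\<^esub> m"
  by (simp_all add: right_scalars_def module.defs rmodule.defs)

lemma ktensor_eq: "ktensor K M N = tensor K (right_scalars M) N"
  by (simp add: ktensor_def right_scalars_def)

context
  fixes K :: "('k, 'q) ring_scheme" and M :: "('k, 'm, 's) module_scheme" and N :: "('k, 'n, 't) module_scheme"
  assumes M: "module K M" and N: "module K N"
begin

interpretation M: module K M by (rule M)
interpretation N: module K N by (rule N)

lemma ktensor_space: "tensor_space K K (right_scalars M) N"
proof (intro tensor_space.intro tensor_pair.intro tensor_space_axioms.intro)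
  show "abelian_group (right_scalars M)" by (rule abelian_group_cong[OF M.abelian_group_axioms]) simp_all
  show "module K (right_scalars M)" by (rule module_cong[OF M]) simp_all
  show "abelian_group N" by (rule N.abelian_group_axioms)
  show "ract (right_scalars M) (c \<odot>\<^bsub>right_scalars M\<^esub> m) x = c \<odot>\<^bsub>right_scalars M\<^esub> ract (right_scalars M) m x"
    if "c \<in> carrier K" "m \<in> carrier (right_scalars M)" "x \<in> carrier K" for c m x
    using that by (simp add: M.smult_assoc1[symmetric] M.m_comm)
qed simp_all

interpretation kt: tensor_space K K "right_scalars M" N by (rule ktensor_space)

lemma kt_module: "module K (ktensor K M N)"
  using kt.module_T by (simp add: ktensor_eq)

lemma kt_pure_bilin: "bilin K M N (ktensor K M N) (pure (ktensor K M N))"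
proof (rule bilinI[OF M N kt_module])
  show "lin K M (ktensor K M N) (\<lambda>m. pure (ktensor K M N) m n)" if "n \<in> carrier N" for n
    by (rule lin_cong_dom[of K "right_scalars M"]) (use kt.pure_lin_left[OF that] in \<open>simp_all add: ktensor_eq\<close>)
  show "lin K N (ktensor K M N) (pure (ktensor K M N) m)" if "m \<in> carrier M" for m
    using that kt.pure_closed kt.pure_add_right kt.pure_balanced kt.smult_pure
    by (intro linI[OF N kt_module]) (simp_all add: ktensor_eq)
qed

lemma kt_induct [consumes 1, case_names pure plus]:
  assumes "t \<in> carrier (ktensor K M N)"
    "\<And>m n. m \<in> carrier M \<Longrightarrow> n \<in> carrier N \<Longrightarrow> Q (pure (ktensor K M N) m n)"
    "\<And>s t. s \<in> carrier (ktensor K M N) \<Longrightarrow> t \<in> carrier (ktensor K M N) \<Longrightarrow> Q s \<Longrightarrow> Q t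
      \<Longrightarrow> Q (s \<oplus>\<^bsub>ktensor K M N\<^esub> t)"
  shows "Q t"
  using kt.tensor_induct[of t Q] assms by (simp add: ktensor_eq)

lemma kt_eqI:
  assumes "addmap (ktensor K M N) P h" "addmap (ktensor K M N) P h'"
    "\<And>m n. m \<in> carrier M \<Longrightarrow> n \<in> carrier N \<Longrightarrow> h (pure (ktensor K M N) m n) = h' (pure (ktensor K M N) m n)"
    "t \<in> carrier (ktensor K M N)"
  shows "h t = h' t"
  using kt.tensor_eqI[of P h h' t] assms by (simp add: ktensor_eq)

lemma kt_lin_eqI:
  assumes "lin K (ktensor K M N) P h" "lin K (ktensor K M N) P h'"
    "\<And>m n. m \<in> carrier M \<Longrightarrow> n \<in> carrier N \<Longrightarrow> h (pure (ktensor K M N) m n) = h' (pure (ktensor K M N) m n)"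
    "t \<in> carrier (ktensor K M N)"
  shows "h t = h' t"
  using kt_eqI[OF lin_addmap[OF assms(1)] lin_addmap[OF assms(2)] assms(3,4)] .

lemma kt_tlift_closed:
  assumes "abelian_group P" "\<And>m n. m \<in> carrier M \<Longrightarrow> n \<in> carrier N \<Longrightarrow> \<beta> m n \<in> carrier P"
    "t \<in> carrier (ktensor K M N)"
  shows "tlift P \<beta> t \<in> carrier P"
  using kt.tlift_closed[of P \<beta> t] assms by (simp add: ktensor_eq)

lemma kt_tlift_cong:
  assumes "abelian_group P" "\<And>m n. m \<in> carrier M \<Longrightarrow> n \<in> carrier N \<Longrightarrow> \<beta> m n \<in> carrier P"
    "t \<in> carrier (ktensor K M N)"
    "\<And>m n. m \<in> carrier M \<Longrightarrow> n \<in> carrier N \<Longrightarrow> \<gamma> m n = \<beta> m n"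
  shows "tlift P \<gamma> t = tlift P \<beta> t"
  using kt.tlift_cong[of P \<beta> t \<gamma>] assms by (simp add: ktensor_eq)

lemma kt_addmap_tlift:
  assumes "addmap P Q h" "\<And>m n. m \<in> carrier M \<Longrightarrow> n \<in> carrier N \<Longrightarrow> \<beta> m n \<in> carrier P"
    "t \<in> carrier (ktensor K M N)"
  shows "h (tlift P \<beta> t) = tlift Q (\<lambda>m n. h (\<beta> m n)) t"
  using kt.addmap_tlift[of P Q h \<beta> t] assms by (simp add: ktensor_eq)

lemma kt_tlift_pure: "t \<in> carrier (ktensor K M N) \<Longrightarrow> tlift (ktensor K M N) (pure (ktensor K M N)) t = t"
  using kt.tlift_pure by (simp add: ktensor_eq)

lemma kt_tlift_param:
  assumes "\<And>m n. m \<in> carrier M \<Longrightarrow> n \<in> carrier N \<Longrightarrow> lin K V P (\<lambda>v. \<beta> v m n)"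
    and "module K V" "module K P" "t \<in> carrier (ktensor K M N)"
  shows "lin K V P (\<lambda>v. tlift P (\<beta> v) t)"
proof (rule linI_addmap[OF assms(2,3)])
  interpret V: module K V by fact
  interpret P: module K P by fact
  have c: "\<beta> v m n \<in> carrier P" if "v \<in> carrier V" "m \<in> carrier M" "n \<in> carrier N" for v m n
    using lin_closed[OF assms(1)] that by blast
  show "addmap V P (\<lambda>v. tlift P (\<beta> v) t)"
    using kt.tlift_param_addmap[of V P \<beta> t] assms(4) lin_addmap[OF assms(1)]
      V.abelian_group_axioms P.abelian_group_axioms by (simp add: ktensor_eq)
  show "tlift P (\<beta> (a \<odot>\<^bsub>V\<^esub> v)) t = a \<odot>\<^bsub>P\<^esub> tlift P (\<beta> v) t" if "a \<in> carrier K" "v \<in> carrier V" for a v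
  proof -
    have "addmap P P (\<lambda>x. a \<odot>\<^bsub>P\<^esub> x)"
      using that by (intro addmapI P.abelian_group_axioms) (simp_all add: P.smult_r_distr)
    then have "a \<odot>\<^bsub>P\<^esub> tlift P (\<beta> v) t = tlift P (\<lambda>m n. a \<odot>\<^bsub>P\<^esub> \<beta> v m n) t"
      using kt_addmap_tlift[of P P "\<lambda>x. a \<odot>\<^bsub>P\<^esub> x" "\<beta> v"] c that assms(4) by blast
    also have "\<dots> = tlift P (\<beta> (a \<odot>\<^bsub>V\<^esub> v)) t"
      by (rule kt_tlift_cong[OF P.abelian_group_axioms]) (use c that assms(4) lin_smult[OF assms(1)] in auto)
    finally show ?thesis by simp
  qed
qed

lemma kt_lift:
  assumes "bilin K M N P \<beta>"
  shows "lin K (ktensor K M N) P (tlift P \<beta>)"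
proof -
  have "biadd (right_scalars M) N P \<beta>"
    using bilin_biadd[OF assms]
    by (auto simp: biadd_def intro: addmap_cong_dom)
  then show ?thesis
    using kt.tlift_lin[of P \<beta>] bilin_modules[OF assms] lin_smult[OF bilin_left[OF assms]]
      lin_smult[OF bilin_right[OF assms]] by (simp add: ktensor_eq)
qed

lemma kt_lift_pure:
  assumes "bilin K M N P \<beta>" "m \<in> carrier M" "n \<in> carrier N"
  shows "tlift P \<beta> (pure (ktensor K M N) m n) = \<beta> m n"
proof -
  have "biadd (right_scalars M) N P \<beta>"
    using bilin_biadd[OF assms(1)]
    by (auto simp: biadd_def intro: addmap_cong_dom)
  then show ?thesis
    using kt.tlift_elem[of P \<beta> m n] assms lin_smult[OF bilin_left[OF assms(1)]]
      lin_smult[OF bilin_right[OF assms(1)]] by (simp add: ktensor_eq)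
qed

end

lemmas kt_pure_closed = bilin_closed[OF kt_pure_bilin]
lemmas kt_pure_left = bilin_left[OF kt_pure_bilin]
lemmas kt_pure_right = bilin_right[OF kt_pure_bilin]

definition tmap ::
  "('k, 'q) ring_scheme \<Rightarrow> ('k, 'm, 's) module_scheme \<Rightarrow> ('k, 'n, 't) module_scheme
   \<Rightarrow> ('a \<Rightarrow> 'm) \<Rightarrow> ('b \<Rightarrow> 'n) \<Rightarrow> ('a, 'b) tensor \<Rightarrow> ('m, 'n) tensor" where
  "tmap K M N f g = tlift (ktensor K M N) (\<lambda>a b. pure (ktensor K M N) (f a) (g b))"

context
  fixes K :: "('k, 'q) ring_scheme" and A :: "('k, 'a, 's) module_scheme" and B :: "('k, 'b, 't) module_scheme"
    and M :: "('k, 'm, 'u) module_scheme" and N :: "('k, 'n, 'v) module_scheme" and f g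
  assumes f: "lin K A M f" and g: "lin K B N g"
begin

lemma tmap_bilin: "bilin K A B (ktensor K M N) (\<lambda>a b. pure (ktensor K M N) (f a) (g b))"
  by (rule bilin_comp[OF kt_pure_bilin[OF lin_cod[OF f] lin_cod[OF g]] f g
        lin_id[OF kt_module[OF lin_cod[OF f] lin_cod[OF g]]]])

lemma tmap_lin: "lin K (ktensor K A B) (ktensor K M N) (tmap K M N f g)"
  unfolding tmap_def by (rule kt_lift[OF lin_dom[OF f] lin_dom[OF g] tmap_bilin])

lemma tmap_pure:
  "a \<in> carrier A \<Longrightarrow> b \<in> carrier B \<Longrightarrow>
   tmap K M N f g (pure (ktensor K A B) a b) = pure (ktensor K M N) (f a) (g b)"
  unfolding tmap_def by (rule kt_lift_pure[OF lin_dom[OF f] lin_dom[OF g] tmap_bilin])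

end

lemma tmap_comp:
  assumes "lin K A M f" "lin K B N g" "lin K M U f'" "lin K N V g'" "t \<in> carrier (ktensor K A B)"
  shows "tmap K U V f' g' (tmap K M N f g t) = tmap K U V (\<lambda>a. f' (f a)) (\<lambda>b. g' (g b)) t"
  by (rule kt_lin_eqI[OF lin_dom[OF assms(1)] lin_dom[OF assms(2)]
        lin_comp[OF tmap_lin[OF assms(3,4)] tmap_lin[OF assms(1,2)]]
        tmap_lin[OF lin_comp[OF assms(3,1)] lin_comp[OF assms(4,2)]] _ assms(5)])
    (simp add: tmap_pure[OF assms(1,2)] tmap_pure[OF assms(3,4)]
      tmap_pure[OF lin_comp[OF assms(3,1)] lin_comp[OF assms(4,2)]] lin_closed[OF assms(1)] lin_closed[OF assms(2)])

lemma tmap_cong: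
  assumes "lin K A M f" "lin K B N g" "t \<in> carrier (ktensor K A B)"
    "\<And>a. a \<in> carrier A \<Longrightarrow> f' a = f a" "\<And>b. b \<in> carrier B \<Longrightarrow> g' b = g b"
  shows "tmap K M N f' g' t = tmap K M N f g t"
  unfolding tmap_def
  by (rule kt_tlift_cong[OF lin_dom[OF assms(1)] lin_dom[OF assms(2)]])
    (use assms kt_module[OF lin_cod[OF assms(1)] lin_cod[OF assms(2)]]
      bilin_closed[OF tmap_bilin[OF assms(1,2)]] in \<open>auto intro: module_abelian\<close>)

lemma tmap_id:
  assumes "module K A" "module K B" "t \<in> carrier (ktensor K A B)"
  shows "tmap K A B (\<lambda>a. a) (\<lambda>b. b) t = t"
  unfolding tmap_def by (rule kt_tlift_pure[OF assms])

text \<open>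
  In a twisted product the factors \<open>f\<close> and \<open>g\<close> of \<open>f \<otimes> g\<close> are multiplications by a variable element;
  bilinearity of the product is linearity in that element.
\<close>

lemma tmap_param_left:
  assumes "\<And>a. a \<in> carrier A \<Longrightarrow> lin K V M (\<lambda>v. f v a)" "lin K B N g" "module K A"
    "module K V" "module K M" "t \<in> carrier (ktensor K A B)"
  shows "lin K V (ktensor K M N) (\<lambda>v. tmap K M N (f v) g t)"
  unfolding tmap_def
proof (rule kt_tlift_param[OF assms(3) lin_dom[OF assms(2)] _ assms(4) _ assms(6)])
  show "module K (ktensor K M N)" by (rule kt_module[OF assms(5) lin_cod[OF assms(2)]])
  show "lin K V (ktensor K M N) (\<lambda>v. pure (ktensor K M N) (f v a) (g b))"
    if "a \<in> carrier A" "b \<in> carrier B" for a b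
    by (rule bilin_L[OF kt_pure_bilin[OF assms(5) lin_cod[OF assms(2)]] lin_closed[OF assms(2) that(2)] assms(1)[OF that(1)]])
qed

lemma tmap_param_right:
  assumes "lin K A M f" "\<And>b. b \<in> carrier B \<Longrightarrow> lin K V N (\<lambda>v. g v b)" "module K B"
    "module K V" "module K N" "t \<in> carrier (ktensor K A B)"
  shows "lin K V (ktensor K M N) (\<lambda>v. tmap K M N f (g v) t)"
  unfolding tmap_def
proof (rule kt_tlift_param[OF lin_dom[OF assms(1)] assms(3) _ assms(4) _ assms(6)])
  show "module K (ktensor K M N)" by (rule kt_module[OF lin_cod[OF assms(1)] assms(5)])
  show "lin K V (ktensor K M N) (\<lambda>v. pure (ktensor K M N) (f a) (g v b))"
    if "a \<in> carrier A" "b \<in> carrier B" for a b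
    by (rule bilin_R[OF kt_pure_bilin[OF lin_cod[OF assms(1)] assms(5)] lin_closed[OF assms(1) that(1)] assms(2)[OF that(2)]])
qed

section \<open>Differential calculi\<close>

definition sg :: "('p, 'r) ring_scheme \<Rightarrow> nat \<Rightarrow> 'p \<Rightarrow> 'p" where
  "sg P n x = (if even n then x else \<ominus>\<^bsub>P\<^esub> x)"

lemma sg_0 [simp]: "sg P 0 x = x"
  by (simp add: sg_def)

lemma addmap_sg: "addmap V W h \<Longrightarrow> x \<in> carrier V \<Longrightarrow> h (sg V n x) = sg W n (h x)"
  by (simp add: sg_def addmap_minus)

lemma sg_addmap: "addmap V W h \<Longrightarrow> addmap V W (\<lambda>x. sg W n (h x))"
  by (cases "even n") (simp_all add: sg_def addmap_uminus)

context abelian_group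
begin

lemma sg_closed [simp]: "x \<in> carrier G \<Longrightarrow> sg G n x \<in> carrier G"
  by (simp add: sg_def)

lemma sg_add: "x \<in> carrier G \<Longrightarrow> y \<in> carrier G \<Longrightarrow> sg G n (x \<oplus> y) = sg G n x \<oplus> sg G n y"
  by (simp add: sg_def minus_add)

lemma sg_sg: "x \<in> carrier G \<Longrightarrow> sg G m (sg G n x) = sg G (m + n) x"
  by (auto simp: sg_def)

lemma sg_minus: "x \<in> carrier G \<Longrightarrow> sg G n (\<ominus> x) = \<ominus> sg G n x"
  by (simp add: sg_def)

end

text \<open>
  The record \<open>calculus\<close> carries no laws; these are the ones on which the theory of connections rests.
  Both the universal calculus and the twisted tensor product will be shown to satisfy them.
\<close>

locale dg_calculus =
  fixes K :: "('k, 'q) ring_scheme" and D :: "('k, 'd, 'r) module_scheme"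
    and \<Gamma> :: "('k, 'w, 'd, 's) calculus_scheme"
  assumes D_algebra: "assoc_algebra K D" and G_algebra: "assoc_algebra K \<Gamma>"
    and emb_lin: "lin K D \<Gamma> (emb \<Gamma>)"
    and emb_mult: "x \<in> carrier D \<Longrightarrow> y \<in> carrier D \<Longrightarrow> emb \<Gamma> (x \<otimes>\<^bsub>D\<^esub> y) = emb \<Gamma> x \<otimes>\<^bsub>\<Gamma>\<^esub> emb \<Gamma> y"
    and emb_one: "emb \<Gamma> \<one>\<^bsub>D\<^esub> = \<one>\<^bsub>\<Gamma>\<^esub>"
    and deg_sub: "deg \<Gamma> n \<subseteq> carrier \<Gamma>" and deg_zero: "\<zero>\<^bsub>\<Gamma>\<^esub> \<in> deg \<Gamma> n"
    and deg_add: "s \<in> deg \<Gamma> n \<Longrightarrow> t \<in> deg \<Gamma> n \<Longrightarrow> s \<oplus>\<^bsub>\<Gamma>\<^esub> t \<in> deg \<Gamma> n"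
    and deg_minus: "s \<in> deg \<Gamma> n \<Longrightarrow> \<ominus>\<^bsub>\<Gamma>\<^esub> s \<in> deg \<Gamma> n"
    and deg_emb: "x \<in> carrier D \<Longrightarrow> emb \<Gamma> x \<in> deg \<Gamma> 0"
    and deg_mult: "s \<in> deg \<Gamma> m \<Longrightarrow> t \<in> deg \<Gamma> n \<Longrightarrow> s \<otimes>\<^bsub>\<Gamma>\<^esub> t \<in> deg \<Gamma> (m + n)"
    and diff_lin: "lin K \<Gamma> \<Gamma> (diff \<Gamma>)"
    and diff_deg: "s \<in> deg \<Gamma> n \<Longrightarrow> diff \<Gamma> s \<in> deg \<Gamma> (Suc n)"
    and diff_diff: "s \<in> carrier \<Gamma> \<Longrightarrow> diff \<Gamma> (diff \<Gamma> s) = \<zero>\<^bsub>\<Gamma>\<^esub>"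
    and diff_mult: "s \<in> deg \<Gamma> n \<Longrightarrow> t \<in> carrier \<Gamma> \<Longrightarrow>
      diff \<Gamma> (s \<otimes>\<^bsub>\<Gamma>\<^esub> t) = diff \<Gamma> s \<otimes>\<^bsub>\<Gamma>\<^esub> t \<oplus>\<^bsub>\<Gamma>\<^esub> sg \<Gamma> n (s \<otimes>\<^bsub>\<Gamma>\<^esub> diff \<Gamma> t)"

lemma assoc_algebraD:
  assumes "assoc_algebra K A"
  shows "ring A" "module K A"
    "\<And>c x y. c \<in> carrier K \<Longrightarrow> x \<in> carrier A \<Longrightarrow> y \<in> carrier A \<Longrightarrow> (c \<odot>\<^bsub>A\<^esub> x) \<otimes>\<^bsub>A\<^esub> y = c \<odot>\<^bsub>A\<^esub> (x \<otimes>\<^bsub>A\<^esub> y)"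
    "\<And>c x y. c \<in> carrier K \<Longrightarrow> x \<in> carrier A \<Longrightarrow> y \<in> carrier A \<Longrightarrow> x \<otimes>\<^bsub>A\<^esub> (c \<odot>\<^bsub>A\<^esub> y) = c \<odot>\<^bsub>A\<^esub> (x \<otimes>\<^bsub>A\<^esub> y)"
  using assms by (simp_all add: assoc_algebra_def)

lemma assoc_algebra_bilin:
  assumes "assoc_algebra K A" shows "bilin K A A A (monoid.mult A)"
proof -
  interpret A: ring A using assoc_algebraD(1)[OF assms] .
  note m = assoc_algebraD(2)[OF assms]
  show ?thesis
    using assoc_algebraD(3,4)[OF assms]
    by (intro bilinI[OF m m m] linI[OF m m]) (simp_all add: A.l_distr A.r_distr)
qed

section \<open>The universal differential graded algebra\<close>

text \<open>
  The structures built in stages from one group differ only in the fields added later, which an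
  additive extension does not see.
\<close>

lemma gen_extend_target_cong:
  assumes "carrier Q = carrier P" "add Q = add P" "\<zero>\<^bsub>Q\<^esub> = \<zero>\<^bsub>P\<^esub>"
  shows "gen_extend Q = gen_extend P"
  by (simp add: gen_extend_def fun_eq_iff finsum_def finprod_def add_pow_def int_pow_def nat_pow_def
      m_inv_def Let_def assms cong: if_cong)

locale univ =
  fixes K :: "('k, 'r) ring_scheme" and A :: "('k, 'a, 's) module_scheme"
  assumes A_algebra: "assoc_algebra K A"
begin

sublocale A: ring A by (rule assoc_algebraD(1)[OF A_algebra])
sublocale AM: module K A by (rule assoc_algebraD(2)[OF A_algebra])

abbreviation "U \<equiv> univ_dga K A"
abbreviation "WU \<equiv> univ_alg K A"
abbreviation "cl \<equiv> gen_class U"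

lemma words_simps [simp]:
  "[] \<in> words A" "El a # w \<in> words A \<longleftrightarrow> a \<in> carrier A \<and> w \<in> words A"
  "Di a # w \<in> words A \<longleftrightarrow> a \<in> carrier A \<and> w \<in> words A" "u @ v \<in> words A \<longleftrightarrow> u \<in> words A \<and> v \<in> words A"
  by (auto simp: words_def)

lemma words_induct [consumes 1, case_names Nil El Di]:
  assumes "w \<in> words A" "Q []" "\<And>a w. a \<in> carrier A \<Longrightarrow> w \<in> words A \<Longrightarrow> Q w \<Longrightarrow> Q (El a # w)"
    "\<And>a w. a \<in> carrier A \<Longrightarrow> w \<in> words A \<Longrightarrow> Q w \<Longrightarrow> Q (Di a # w)"
  shows "Q w"
  using assms(1)
proof (induction w)
  case (Cons l w) then show ?case using assms(3,4) by (cases l) auto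
qed (use assms in simp)

lemma word_deg_append [simp]: "word_deg (u @ v) = word_deg u + word_deg v"
  by (induction u rule: word_deg.induct) auto

text \<open>
  The sign in the graded Leibniz rule depends on the degree of a word.  That each relator consists of
  words of a single degree is what makes the differential and the parity map well defined.
\<close>

lemma dga_relators_cases:
  assumes "r \<in> dga_relators K A"
  obtains (three) x y z where "r = frag_of x - frag_of y - frag_of z" "x \<in> words A" "y \<in> words A" "z \<in> words A"
      "word_deg y = word_deg x" "word_deg z = word_deg x"
  | (two) x y where "r = frag_of x - frag_of y" "x \<in> words A" "y \<in> words A" "word_deg y = word_deg x"
  using assms unfolding dga_relators_def
proof (elim UnE CollectE exE conjE)
  fix x y
  assume "x \<in> carrier A" "y \<in> carrier A" "r = frag_of [El (x \<oplus>\<^bsub>A\<^esub> y)] - frag_of [El x] - frag_of [El y]"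
  then show thesis by (intro three[of "[El (x \<oplus>\<^bsub>A\<^esub> y)]" "[El x]" "[El y]"]) simp_all
next
  fix x y
  assume "x \<in> carrier A" "y \<in> carrier A" "r = frag_of [El (x \<otimes>\<^bsub>A\<^esub> y)] - frag_of [El x, El y]"
  then show thesis by (intro two[of "[El (x \<otimes>\<^bsub>A\<^esub> y)]" "[El x, El y]"]) simp_all
next
  assume "r \<in> {frag_of [El \<one>\<^bsub>A\<^esub>] - frag_of []}"
  then show thesis by (intro two[of "[El \<one>\<^bsub>A\<^esub>]" "[]"]) simp_all
next
  fix x y
  assume "x \<in> carrier A" "y \<in> carrier A" "r = frag_of [Di (x \<oplus>\<^bsub>A\<^esub> y)] - frag_of [Di x] - frag_of [Di y]"
  then show thesis by (intro three[of "[Di (x \<oplus>\<^bsub>A\<^esub> y)]" "[Di x]" "[Di y]"]) simp_all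
next
  fix c x
  assume "c \<in> carrier K" "x \<in> carrier A" "r = frag_of [Di (c \<odot>\<^bsub>A\<^esub> x)] - frag_of [El (c \<odot>\<^bsub>A\<^esub> \<one>\<^bsub>A\<^esub>), Di x]"
  then show thesis by (intro two[of "[Di (c \<odot>\<^bsub>A\<^esub> x)]" "[El (c \<odot>\<^bsub>A\<^esub> \<one>\<^bsub>A\<^esub>), Di x]"]) simp_all
next
  fix x y
  assume "x \<in> carrier A" "y \<in> carrier A"
    "r = frag_of [Di (x \<otimes>\<^bsub>A\<^esub> y)] - frag_of [Di x, El y] - frag_of [El x, Di y]"
  then show thesis by (intro three[of "[Di (x \<otimes>\<^bsub>A\<^esub> y)]" "[Di x, El y]" "[El x, Di y]"]) simp_all
qed

lemma relator_keys: "r \<in> dga_relators K A \<Longrightarrow> Poly_Mapping.keys r \<subseteq> words A"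
  by (erule dga_relators_cases) (use keys_two keys_three in \<open>fastforce+\<close>)

lemma ideal_gen_keys: "r \<in> dga_ideal_gens K A \<Longrightarrow> Poly_Mapping.keys r \<subseteq> words A"
  unfolding dga_ideal_gens_def
  by (auto dest!: subsetD[OF keys_frag_extend] subsetD[OF relator_keys] simp: keys_frag_of)

lemma WU_presented: "presented_group (words A) (dga_ideal_gens K A) WU"
  by unfold_locales (simp_all add: ideal_gen_keys univ_alg_def presented_space_def Let_def)

lemma U_simps:
  "carrier U = carrier WU" "add U = add WU" "\<zero>\<^bsub>U\<^esub> = \<zero>\<^bsub>WU\<^esub>" "monoid.mult U = monoid.mult WU"
  "\<one>\<^bsub>U\<^esub> = \<one>\<^bsub>WU\<^esub>" "smult U = smult WU" "emb U a = gen_class WU [El a]"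
  "deg U n = {t \<in> carrier WU. \<exists>p \<in> t. \<forall>w \<in> Poly_Mapping.keys p. word_deg w = n}"
  "diff U = gen_extend WU (word_diff WU)"
  by (simp_all add: univ_dga_def Let_def module.defs calculus.defs)

sublocale U: presented_group "words A" "dga_ideal_gens K A" U
  using WU_presented by (simp add: presented_group_def U_simps)

lemma gen_class_WU: "gen_class WU = cl"
  by (simp add: gen_class_def fun_eq_iff U_simps)

lemma gen_extend_WU: "gen_extend WU = gen_extend U"
  by (rule gen_extend_target_cong) (simp_all add: U_simps)

lemma word_diff_WU: "word_diff WU w = word_diff U w"
  by (induction w rule: word_deg.induct)
    (simp_all add: gen_class_WU U_simps a_inv_def m_inv_def)

lemma mult_U: "s \<otimes>\<^bsub>U\<^esub> t = gen_extend U (\<lambda>u. gen_extend U (\<lambda>v. cl (u @ v)) t) s"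
  and one_U: "\<one>\<^bsub>U\<^esub> = cl []"
  and smult_U: "c \<odot>\<^bsub>U\<^esub> t = cl [El (c \<odot>\<^bsub>A\<^esub> \<one>\<^bsub>A\<^esub>)] \<otimes>\<^bsub>U\<^esub> t"
proof -
  define W where "W = (presented_space (words A) (dga_ideal_gens K A) :: ('k, 'a form) module)"
  have c: "carrier W = carrier U" "add W = add U" "\<zero>\<^bsub>W\<^esub> = \<zero>\<^bsub>U\<^esub>"
    by (simp_all add: U_simps univ_alg_def W_def Let_def)
  have gc: "gen_class W = cl"
    by (simp add: gen_class_def fun_eq_iff c)
  have ge: "gen_extend W = gen_extend U"
    by (rule gen_extend_target_cong) (simp_all add: c)
  have m: "s \<otimes>\<^bsub>U\<^esub> t = gen_extend W (\<lambda>u. gen_extend W (\<lambda>v. gen_class W (u @ v)) t) s" for s t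
    by (simp add: U_simps univ_alg_def W_def Let_def)
  then show "s \<otimes>\<^bsub>U\<^esub> t = gen_extend U (\<lambda>u. gen_extend U (\<lambda>v. cl (u @ v)) t) s" by (simp add: gc ge)
  have "\<one>\<^bsub>U\<^esub> = gen_class W []"
    by (simp add: U_simps univ_alg_def W_def Let_def)
  then show "\<one>\<^bsub>U\<^esub> = cl []" by (simp add: gc)
  have "c \<odot>\<^bsub>U\<^esub> t = gen_class W [El (c \<odot>\<^bsub>A\<^esub> \<one>\<^bsub>A\<^esub>)] \<otimes>\<^bsub>U\<^esub> t"
    by (simp add: U_simps univ_alg_def W_def Let_def)
  then show "c \<odot>\<^bsub>U\<^esub> t = cl [El (c \<odot>\<^bsub>A\<^esub> \<one>\<^bsub>A\<^esub>)] \<otimes>\<^bsub>U\<^esub> t" by (simp add: gc)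
qed

lemma emb_U: "emb U a = cl [El a]"
  by (simp add: U_simps gen_class_WU)

lemma diff_U: "diff U = gen_extend U (word_diff U)"
  by (simp add: U_simps gen_extend_WU word_diff_WU[abs_def])

lemma parity_U: "parity K A = gen_extend U (\<lambda>w. sg U (word_deg w) (cl w))"
proof -
  have "\<ominus>\<^bsub>WU\<^esub> x = \<ominus>\<^bsub>U\<^esub> x" for x by (simp add: a_inv_def m_inv_def U_simps)
  then show ?thesis
    unfolding parity_def gen_extend_WU gen_class_WU sg_def by (simp cong: if_cong)
qed

lemma frag_eval_ideal_gen:
  assumes "abelian_group P" "\<And>w. w \<in> words A \<Longrightarrow> \<phi> w \<in> carrier P" "u \<in> words A" "v \<in> words A"
    "Poly_Mapping.keys r \<subseteq> words A"
  shows "frag_eval P \<phi> (frag_extend (\<lambda>w. frag_of (u @ w @ v)) r) = frag_eval P (\<lambda>w. \<phi> (u @ w @ v)) r"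
proof -
  interpret P: abelian_group P by fact
  have k: "Poly_Mapping.keys (frag_extend (\<lambda>w. frag_of (u @ w @ v)) p) \<subseteq> words A"
    if "Poly_Mapping.keys p \<subseteq> words A" for p
    using that assms(3,4) keys_frag_extend[of "\<lambda>w. frag_of (u @ w @ v)" p] by (fastforce simp: keys_frag_of)
  show ?thesis
  proof (rule free_Abelian_group_induct[OF assms(5)])
    fix p q
    assume pq: "Poly_Mapping.keys p \<subseteq> words A" "Poly_Mapping.keys q \<subseteq> words A"
      "frag_eval P \<phi> (frag_extend (\<lambda>w. frag_of (u @ w @ v)) p) = frag_eval P (\<lambda>w. \<phi> (u @ w @ v)) p"
      "frag_eval P \<phi> (frag_extend (\<lambda>w. frag_of (u @ w @ v)) q) = frag_eval P (\<lambda>w. \<phi> (u @ w @ v)) q"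
    then show "frag_eval P \<phi> (frag_extend (\<lambda>w. frag_of (u @ w @ v)) (p - q)) = frag_eval P (\<lambda>w. \<phi> (u @ w @ v)) (p - q)"
      using P.frag_eval_diff[of "words A" \<phi> "frag_extend (\<lambda>w. frag_of (u @ w @ v)) p" "frag_extend (\<lambda>w. frag_of (u @ w @ v)) q"]
        P.frag_eval_diff[of "words A" "\<lambda>w. \<phi> (u @ w @ v)" p q] k assms
      by (simp add: frag_extend_diff)
  qed (use assms in simp_all)
qed

text \<open>
  An assignment on words that satisfies this criterion extends to \<open>U\<close>; the product, the differential
  and the parity map are all obtained in this way.
\<close>

lemma word_extend_compat:
  assumes P: "abelian_group P" and \<phi>: "\<And>w. w \<in> words A \<Longrightarrow> \<phi> w \<in> carrier P"
    and van: "\<And>u r v. u \<in> words A \<Longrightarrow> r \<in> dga_relators K A \<Longrightarrow> v \<in> words A \<Longrightarrow>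
      frag_eval P (\<lambda>w. \<phi> (u @ w @ v)) r = \<zero>\<^bsub>P\<^esub>"
    and "r \<in> dga_ideal_gens K A"
  shows "frag_eval P \<phi> r = \<zero>\<^bsub>P\<^esub>"
  using assms(4) unfolding dga_ideal_gens_def
  by (auto simp: frag_eval_ideal_gen[OF P \<phi>] relator_keys van)

lemma relator_vanishes:
  assumes "u \<in> words A" "r \<in> dga_relators K A" "v \<in> words A"
  shows "frag_eval U (\<lambda>w. cl (u @ w @ v)) r = \<zero>\<^bsub>U\<^esub>"
proof -
  have g: "frag_extend (\<lambda>w. frag_of (u @ w @ v)) r \<in> dga_ideal_gens K A"
    using assms by (auto simp: dga_ideal_gens_def)
  have "frag_eval U cl (frag_extend (\<lambda>w. frag_of (u @ w @ v)) r) = \<zero>\<^bsub>U\<^esub>"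
    using U.cls_eq_eval[OF ideal_gen_keys[OF g]] U.cls_relator[OF g] by simp
  then show ?thesis
    using frag_eval_ideal_gen[OF U.abelian_T U.gen_class_closed assms(1,3) relator_keys[OF assms(2)]] by simp
qed

text \<open>
  The product is defined by two nested extensions.  This is the inner one, which has to be additive
  before the outer one can be seen to respect the relators.
\<close>

definition lmul :: "'a letter list \<Rightarrow> 'a form \<Rightarrow> 'a form" where
  "lmul u t = gen_extend U (\<lambda>v. cl (u @ v)) t"

lemma
  assumes "u \<in> words A"
  shows lmul_addmap: "addmap U U (lmul u)" and lmul_class: "v \<in> words A \<Longrightarrow> lmul u (cl v) = cl (u @ v)"
proof -
  have c: "\<And>w. w \<in> words A \<Longrightarrow> cl (u @ w) \<in> carrier U" using assms U.gen_class_closed by simp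
  have v: "frag_eval U (\<lambda>v. cl (u @ v)) r = \<zero>\<^bsub>U\<^esub>" if "r \<in> dga_ideal_gens K A" for r
    by (rule word_extend_compat[OF U.abelian_T c _ that])
      (use relator_vanishes[of "u @ _"] assms in auto)
  show "addmap U U (lmul u)"
    unfolding lmul_def[abs_def] by (rule U.addmap_extend[OF U.abelian_T c v])
  show "v \<in> words A \<Longrightarrow> lmul u (cl v) = cl (u @ v)"
    unfolding lmul_def by (rule U.gen_extend_class[OF U.abelian_T c v])
qed

lemma lmul_vanishes:
  assumes "u \<in> words A" "r \<in> dga_relators K A" "v \<in> words A" "t \<in> carrier U"
  shows "frag_eval U (\<lambda>w. lmul (u @ w @ v) t) r = \<zero>\<^bsub>U\<^esub>"
proof (rule U.addmap_eqI[of U "\<lambda>t. frag_eval U (\<lambda>w. lmul (u @ w @ v) t) r" "\<lambda>t. \<zero>\<^bsub>U\<^esub>"])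
  show "addmap U U (\<lambda>t. frag_eval U (\<lambda>w. lmul (u @ w @ v) t) r)"
    by (rule addmap_frag_eval_param[OF _ U.abelian_T U.abelian_T relator_keys[OF assms(2)]])
      (use assms lmul_addmap in simp)
  show "addmap U U (\<lambda>t. \<zero>\<^bsub>U\<^esub>)"
    by (rule addmapI[OF U.abelian_T U.abelian_T]) simp_all
  show "frag_eval U (\<lambda>w. lmul (u @ w @ v) (cl x)) r = \<zero>\<^bsub>U\<^esub>" if x: "x \<in> words A" for x
  proof -
    have "frag_eval U (\<lambda>w. lmul (u @ w @ v) (cl x)) r = frag_eval U (\<lambda>w. cl (u @ w @ (v @ x))) r"
      by (rule frag_eval_cong[OF U.abelian_T])
        (use x assms relator_keys[OF assms(2)] in \<open>auto simp: lmul_class intro!: U.gen_class_closed\<close>)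
    then show ?thesis using relator_vanishes[OF assms(1,2)] assms(3) x by simp
  qed
qed (rule assms(4))

lemma mult_biadd: "biadd U U U (monoid.mult U)"
  and mult_word: "u \<in> words A \<Longrightarrow> t \<in> carrier U \<Longrightarrow> cl u \<otimes>\<^bsub>U\<^esub> t = lmul u t"
proof -
  have m: "s \<otimes>\<^bsub>U\<^esub> t = gen_extend U (\<lambda>u. lmul u t) s" for s t
    by (simp add: mult_U lmul_def)
  have c: "\<And>w. w \<in> words A \<Longrightarrow> lmul w t \<in> carrier U" if "t \<in> carrier U" for t
    using addmap_closed[OF lmul_addmap] that by blast
  have v: "frag_eval U (\<lambda>u. lmul u t) r = \<zero>\<^bsub>U\<^esub>" if "t \<in> carrier U" "r \<in> dga_ideal_gens K A" for t r
    by (rule word_extend_compat[OF U.abelian_T c[OF that(1)] _ that(2)]) (use lmul_vanishes that in auto)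
  show "biadd U U U (monoid.mult U)"
  proof (rule biaddI)
    show "addmap U U (\<lambda>s. s \<otimes>\<^bsub>U\<^esub> t)" if "t \<in> carrier U" for t
      unfolding m by (rule U.addmap_extend[OF U.abelian_T c[OF that] v[OF that]])
    show "addmap U U (monoid.mult U s)" if "s \<in> carrier U" for s
    proof -
      have "addmap U U (\<lambda>t. s \<otimes>\<^bsub>U\<^esub> t)"
        unfolding m U.gen_extend_eval
        by (rule addmap_frag_eval_param[OF lmul_addmap U.abelian_T U.abelian_T U.representative(1)[OF that]])
      then show ?thesis .
    qed
  qed
  show "u \<in> words A \<Longrightarrow> t \<in> carrier U \<Longrightarrow> cl u \<otimes>\<^bsub>U\<^esub> t = lmul u t"
    unfolding m by (rule U.gen_extend_class[OF U.abelian_T c v])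
qed

lemma cl_mult: "u \<in> words A \<Longrightarrow> v \<in> words A \<Longrightarrow> cl u \<otimes>\<^bsub>U\<^esub> cl v = cl (u @ v)"
  by (simp add: mult_word lmul_class U.gen_class_closed)

lemmas mult_left = biadd_left[OF mult_biadd] and mult_right = biadd_right[OF mult_biadd]

lemma mult_closed: "s \<in> carrier U \<Longrightarrow> t \<in> carrier U \<Longrightarrow> s \<otimes>\<^bsub>U\<^esub> t \<in> carrier U"
  using addmap_closed[OF mult_left] .

lemma mult_assoc:
  assumes "s \<in> carrier U" "t \<in> carrier U" "u \<in> carrier U"
  shows "(s \<otimes>\<^bsub>U\<^esub> t) \<otimes>\<^bsub>U\<^esub> u = s \<otimes>\<^bsub>U\<^esub> (t \<otimes>\<^bsub>U\<^esub> u)"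
proof (rule U.addmap_eqI[OF addmap_comp[OF mult_left[OF assms(2)] mult_left[OF assms(3)]]
      mult_left[OF mult_closed[OF assms(2,3)]] _ assms(1)])
  fix x assume x: "x \<in> words A"
  note cx = U.gen_class_closed[OF x]
  show "(cl x \<otimes>\<^bsub>U\<^esub> t) \<otimes>\<^bsub>U\<^esub> u = cl x \<otimes>\<^bsub>U\<^esub> (t \<otimes>\<^bsub>U\<^esub> u)"
  proof (rule U.addmap_eqI[OF addmap_comp[OF mult_right[OF cx] mult_left[OF assms(3)]]
        addmap_comp[OF mult_left[OF assms(3)] mult_right[OF cx]] _ assms(2)])
    fix y assume y: "y \<in> words A"
    note cy = U.gen_class_closed[OF y]
    show "(cl x \<otimes>\<^bsub>U\<^esub> cl y) \<otimes>\<^bsub>U\<^esub> u = cl x \<otimes>\<^bsub>U\<^esub> (cl y \<otimes>\<^bsub>U\<^esub> u)"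
      by (rule U.addmap_eqI[OF mult_right[OF mult_closed[OF cx cy]]
            addmap_comp[OF mult_right[OF cy] mult_right[OF cx]] _ assms(3)])
        (use x y in \<open>simp add: cl_mult\<close>)
  qed
qed

lemma ring_U: "ring U"
proof (rule ringI[OF U.abelian_T monoidI])
  show "\<one>\<^bsub>U\<^esub> \<in> carrier U" by (simp add: one_U U.gen_class_closed)
  show "\<one>\<^bsub>U\<^esub> \<otimes>\<^bsub>U\<^esub> x = x" if "x \<in> carrier U" for x
    unfolding one_U by (rule U.addmap_eqI[OF mult_right addmap_id[OF U.abelian_T] _ that])
      (simp_all add: cl_mult U.gen_class_closed)
  show "x \<otimes>\<^bsub>U\<^esub> \<one>\<^bsub>U\<^esub> = x" if "x \<in> carrier U" for x
    unfolding one_U by (rule U.addmap_eqI[OF mult_left addmap_id[OF U.abelian_T] _ that])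
      (simp_all add: cl_mult U.gen_class_closed)
qed (use addmap_add[OF mult_left] addmap_add[OF mult_right] mult_assoc mult_closed in auto)

sublocale U: ring U by (rule ring_U)

lemma el_add: "x \<in> carrier A \<Longrightarrow> y \<in> carrier A \<Longrightarrow> cl [El (x \<oplus>\<^bsub>A\<^esub> y)] = cl [El x] \<oplus>\<^bsub>U\<^esub> cl [El y]"
  and el_mult: "x \<in> carrier A \<Longrightarrow> y \<in> carrier A \<Longrightarrow> cl [El (x \<otimes>\<^bsub>A\<^esub> y)] = cl [El x] \<otimes>\<^bsub>U\<^esub> cl [El y]"
  and el_one: "cl [El \<one>\<^bsub>A\<^esub>] = \<one>\<^bsub>U\<^esub>"
  and di_add: "x \<in> carrier A \<Longrightarrow> y \<in> carrier A \<Longrightarrow> cl [Di (x \<oplus>\<^bsub>A\<^esub> y)] = cl [Di x] \<oplus>\<^bsub>U\<^esub> cl [Di y]"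
  and di_smult: "c \<in> carrier K \<Longrightarrow> x \<in> carrier A \<Longrightarrow>
    cl [Di (c \<odot>\<^bsub>A\<^esub> x)] = cl [El (c \<odot>\<^bsub>A\<^esub> \<one>\<^bsub>A\<^esub>)] \<otimes>\<^bsub>U\<^esub> cl [Di x]"
  and di_mult: "x \<in> carrier A \<Longrightarrow> y \<in> carrier A \<Longrightarrow>
    cl [Di (x \<otimes>\<^bsub>A\<^esub> y)] = cl [Di x] \<otimes>\<^bsub>U\<^esub> cl [El y] \<oplus>\<^bsub>U\<^esub> cl [El x] \<otimes>\<^bsub>U\<^esub> cl [Di y]"
proof -
  have g: "r \<in> dga_ideal_gens K A" if "r \<in> dga_relators K A" for r
  proof -
    have "r = frag_extend (\<lambda>w. frag_of ([] @ w @ [])) r"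
      using frag_expansion[of r] by simp
    then show ?thesis using that unfolding dga_ideal_gens_def by (intro CollectI exI[of _ "[]"] exI[of _ r]) simp
  qed
  show "cl [El (x \<oplus>\<^bsub>A\<^esub> y)] = cl [El x] \<oplus>\<^bsub>U\<^esub> cl [El y]" if "x \<in> carrier A" "y \<in> carrier A"
    by (rule U.relator_three[OF g]) (use that in \<open>unfold dga_relators_def, blast, simp_all\<close>)
  show "cl [El (x \<otimes>\<^bsub>A\<^esub> y)] = cl [El x] \<otimes>\<^bsub>U\<^esub> cl [El y]" if "x \<in> carrier A" "y \<in> carrier A"
  proof -
    have "cl [El (x \<otimes>\<^bsub>A\<^esub> y)] = cl [El x, El y]"
      by (rule U.relator_two[OF g]) (use that in \<open>unfold dga_relators_def, blast, simp_all\<close>)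
    then show ?thesis using that by (simp add: cl_mult)
  qed
  show "cl [El \<one>\<^bsub>A\<^esub>] = \<one>\<^bsub>U\<^esub>"
    unfolding one_U by (rule U.relator_two[OF g]) (unfold dga_relators_def, blast, simp_all)
  show "cl [Di (x \<oplus>\<^bsub>A\<^esub> y)] = cl [Di x] \<oplus>\<^bsub>U\<^esub> cl [Di y]" if "x \<in> carrier A" "y \<in> carrier A"
    by (rule U.relator_three[OF g]) (use that in \<open>unfold dga_relators_def, blast, simp_all\<close>)
  show "cl [Di (c \<odot>\<^bsub>A\<^esub> x)] = cl [El (c \<odot>\<^bsub>A\<^esub> \<one>\<^bsub>A\<^esub>)] \<otimes>\<^bsub>U\<^esub> cl [Di x]"
    if "c \<in> carrier K" "x \<in> carrier A"
  proof -
    have "cl [Di (c \<odot>\<^bsub>A\<^esub> x)] = cl [El (c \<odot>\<^bsub>A\<^esub> \<one>\<^bsub>A\<^esub>), Di x]"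
      by (rule U.relator_two[OF g]) (use that in \<open>unfold dga_relators_def, blast, simp_all\<close>)
    then show ?thesis using that by (simp add: cl_mult)
  qed
  show "cl [Di (x \<otimes>\<^bsub>A\<^esub> y)] = cl [Di x] \<otimes>\<^bsub>U\<^esub> cl [El y] \<oplus>\<^bsub>U\<^esub> cl [El x] \<otimes>\<^bsub>U\<^esub> cl [Di y]"
    if "x \<in> carrier A" "y \<in> carrier A"
  proof -
    have "cl [Di (x \<otimes>\<^bsub>A\<^esub> y)] = cl [Di x, El y] \<oplus>\<^bsub>U\<^esub> cl [El x, Di y]"
      by (rule U.relator_three[OF g]) (use that in \<open>unfold dga_relators_def, blast, simp_all\<close>)
    then show ?thesis using that by (simp add: cl_mult)
  qed
qed

lemma cl_closed [simp]: "w \<in> words A \<Longrightarrow> cl w \<in> carrier U"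
  by (rule U.gen_class_closed)

text \<open>From \<open>d 1 = d (1 \<cdot> 1) = d 1 + d 1\<close>.\<close>

lemma di_one: "cl [Di \<one>\<^bsub>A\<^esub>] = \<zero>\<^bsub>U\<^esub>"
proof -
  have "cl [Di \<one>\<^bsub>A\<^esub>] = cl [Di \<one>\<^bsub>A\<^esub>] \<oplus>\<^bsub>U\<^esub> cl [Di \<one>\<^bsub>A\<^esub>]"
    using di_mult[of "\<one>\<^bsub>A\<^esub>" "\<one>\<^bsub>A\<^esub>"] by (simp add: el_one)
  then show ?thesis by (metis A.one_closed U.T.add.l_cancel_one cl_closed words_simps(1,3))
qed

lemma di_scalar: "c \<in> carrier K \<Longrightarrow> cl [Di (c \<odot>\<^bsub>A\<^esub> \<one>\<^bsub>A\<^esub>)] = \<zero>\<^bsub>U\<^esub>"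
  by (simp add: di_smult di_one)

text \<open>
  Comparing \<open>d (x c) = d x \<cdot> c\<close>, by the Leibniz rule and \<open>d c = 0\<close>, with \<open>d (c x) = c \<cdot> d x\<close>, by linearity, shows
  that the scalar \<open>c\<close> commutes with the letters \<open>Di x\<close>.
\<close>

lemma scalar_central:
  assumes c: "c \<in> carrier K" and t: "t \<in> carrier U"
  shows "t \<otimes>\<^bsub>U\<^esub> cl [El (c \<odot>\<^bsub>A\<^esub> \<one>\<^bsub>A\<^esub>)] = cl [El (c \<odot>\<^bsub>A\<^esub> \<one>\<^bsub>A\<^esub>)] \<otimes>\<^bsub>U\<^esub> t"
proof -
  let ?c = "c \<odot>\<^bsub>A\<^esub> \<one>\<^bsub>A\<^esub>"
  have cc: "?c \<in> carrier A" using c by simp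
  have comm: "x \<otimes>\<^bsub>A\<^esub> ?c = ?c \<otimes>\<^bsub>A\<^esub> x" "?c \<otimes>\<^bsub>A\<^esub> x = c \<odot>\<^bsub>A\<^esub> x" if "x \<in> carrier A" for x
    using that c assoc_algebraD(3,4)[OF A_algebra] by auto
  have el: "cl [El x] \<otimes>\<^bsub>U\<^esub> cl [El ?c] = cl [El ?c] \<otimes>\<^bsub>U\<^esub> cl [El x]" if "x \<in> carrier A" for x
    using comm(1)[OF that] that cc by (simp flip: el_mult)
  have di: "cl [Di x] \<otimes>\<^bsub>U\<^esub> cl [El ?c] = cl [El ?c] \<otimes>\<^bsub>U\<^esub> cl [Di x]" if "x \<in> carrier A" for x
    using di_mult[OF that cc] comm[OF that] that cc by (simp add: c di_smult di_one)
  show ?thesis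
  proof (rule U.addmap_eqI[OF mult_left mult_right _ t])
    show "cl [El ?c] \<in> carrier U" "cl [El ?c] \<in> carrier U" using cc by simp_all
    fix w assume "w \<in> words A"
    then show "cl w \<otimes>\<^bsub>U\<^esub> cl [El ?c] = cl [El ?c] \<otimes>\<^bsub>U\<^esub> cl w"
    proof (induction w rule: words_induct)
      case Nil then show ?case using cc by (simp flip: one_U)
    next
      case (El a w)
      have "cl (El a # w) = cl [El a] \<otimes>\<^bsub>U\<^esub> cl w" using El by (simp add: cl_mult)
      then show ?case using El cc el[of a]
        by (simp add: mult_assoc) (simp flip: mult_assoc)
    next
      case (Di a w)
      have "cl (Di a # w) = cl [Di a] \<otimes>\<^bsub>U\<^esub> cl w" using Di by (simp add: cl_mult)
      then show ?case using Di cc di[of a]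
        by (simp add: mult_assoc) (simp flip: mult_assoc)
    qed
  qed
qed

lemma U_algebra: "assoc_algebra K U"
proof -
  have cc: "c \<odot>\<^bsub>A\<^esub> \<one>\<^bsub>A\<^esub> \<in> carrier A" if "c \<in> carrier K" for c using that by simp
  have "module K U"
  proof (rule moduleI[OF AM.is_cring U.abelian_T])
    fix a b x assume "a \<in> carrier K" "b \<in> carrier K" "x \<in> carrier U"
    moreover have "a \<odot>\<^bsub>A\<^esub> \<one>\<^bsub>A\<^esub> \<otimes>\<^bsub>A\<^esub> (b \<odot>\<^bsub>A\<^esub> \<one>\<^bsub>A\<^esub>) = (a \<otimes>\<^bsub>K\<^esub> b) \<odot>\<^bsub>A\<^esub> \<one>\<^bsub>A\<^esub>"
      using calculation assoc_algebraD(3)[OF A_algebra] by (simp add: AM.smult_assoc1)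
    ultimately show "(a \<otimes>\<^bsub>K\<^esub> b) \<odot>\<^bsub>U\<^esub> x = a \<odot>\<^bsub>U\<^esub> (b \<odot>\<^bsub>U\<^esub> x)"
      using cc by (simp add: smult_U el_mult flip: mult_assoc) (simp flip: el_mult)
  qed (use cc in \<open>simp_all add: smult_U AM.smult_l_distr el_add U.l_distr U.r_distr el_one\<close>)
  moreover have "(c \<odot>\<^bsub>U\<^esub> x) \<otimes>\<^bsub>U\<^esub> y = c \<odot>\<^bsub>U\<^esub> (x \<otimes>\<^bsub>U\<^esub> y)"
    "x \<otimes>\<^bsub>U\<^esub> (c \<odot>\<^bsub>U\<^esub> y) = c \<odot>\<^bsub>U\<^esub> (x \<otimes>\<^bsub>U\<^esub> y)"
    if "c \<in> carrier K" "x \<in> carrier U" "y \<in> carrier U" for c x y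
  proof -
    show "(c \<odot>\<^bsub>U\<^esub> x) \<otimes>\<^bsub>U\<^esub> y = c \<odot>\<^bsub>U\<^esub> (x \<otimes>\<^bsub>U\<^esub> y)"
      using that cc by (simp add: smult_U mult_assoc)
    show "x \<otimes>\<^bsub>U\<^esub> (c \<odot>\<^bsub>U\<^esub> y) = c \<odot>\<^bsub>U\<^esub> (x \<otimes>\<^bsub>U\<^esub> y)"
      using that cc scalar_central[OF that(1,2)] by (simp add: smult_U flip: mult_assoc)
  qed
  ultimately show ?thesis using ring_U by (simp add: assoc_algebra_def)
qed

sublocale UM: module K U by (rule assoc_algebraD(2)[OF U_algebra])

lemma emb_U_lin: "lin K A U (emb U)"
proof (rule linI[OF AM.module_axioms UM.module_axioms])
  show "emb U (c \<odot>\<^bsub>A\<^esub> x) = c \<odot>\<^bsub>U\<^esub> emb U x" if "c \<in> carrier K" "x \<in> carrier A" for c x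
  proof -
    have "c \<odot>\<^bsub>A\<^esub> x = (c \<odot>\<^bsub>A\<^esub> \<one>\<^bsub>A\<^esub>) \<otimes>\<^bsub>A\<^esub> x" using that assoc_algebraD(3)[OF A_algebra] by simp
    then show ?thesis using that by (simp add: emb_U smult_U el_mult)
  qed
qed (simp_all add: emb_U el_add)

lemma deg_iff: "t \<in> deg U n \<longleftrightarrow> (\<exists>p. Poly_Mapping.keys p \<subseteq> {w \<in> words A. word_deg w = n} \<and> t = U.cls p)"
proof
  assume "t \<in> deg U n"
  then obtain p where p: "t \<in> carrier U" "p \<in> t" "\<forall>w \<in> Poly_Mapping.keys p. word_deg w = n"
    by (auto simp: U_simps)
  then show "\<exists>p. Poly_Mapping.keys p \<subseteq> {w \<in> words A. word_deg w = n} \<and> t = U.cls p"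
    using U.mem_cls[OF p(1,2)] by auto
next
  assume "\<exists>p. Poly_Mapping.keys p \<subseteq> {w \<in> words A. word_deg w = n} \<and> t = U.cls p"
  then obtain p where p: "Poly_Mapping.keys p \<subseteq> {w \<in> words A. word_deg w = n}" "t = U.cls p" by blast
  then have "Poly_Mapping.keys p \<subseteq> words A" by auto
  then have "t \<in> carrier U" "p \<in> t" using p(2) U.cls_closed U.cls_self by simp_all
  moreover have "\<forall>w \<in> Poly_Mapping.keys p. word_deg w = n" using p(1) by blast
  ultimately show "t \<in> deg U n" unfolding U_simps(1,8) by (intro CollectI conjI bexI[of _ p])
qed

lemma deg_induct [consumes 1, case_names zero word diff]:
  assumes "t \<in> deg U n" "Q \<zero>\<^bsub>U\<^esub>" "\<And>w. w \<in> words A \<Longrightarrow> word_deg w = n \<Longrightarrow> Q (cl w)"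
    and "\<And>s t. s \<in> carrier U \<Longrightarrow> t \<in> carrier U \<Longrightarrow> Q s \<Longrightarrow> Q t \<Longrightarrow> Q (s \<ominus>\<^bsub>U\<^esub> t)"
  shows "Q t"
proof -
  let ?S = "{w \<in> words A. word_deg w = n}"
  obtain p where p: "Poly_Mapping.keys p \<subseteq> ?S" "t = U.cls p" using assms(1)[unfolded deg_iff] by (elim exE conjE)
  have "Q (U.cls p)"
    using p(1)
  proof (rule free_Abelian_group_induct)
    show "Q (U.cls 0)" using assms(2) by (simp add: U.cls_0)
    show "Q (U.cls (frag_of w))" if "w \<in> ?S" for w
      using assms(3)[of w] that by (simp add: U.gen_class_eq)
    fix p q assume "Poly_Mapping.keys p \<subseteq> ?S" "Poly_Mapping.keys q \<subseteq> ?S" "Q (U.cls p)" "Q (U.cls q)"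
    moreover from this have "Poly_Mapping.keys p \<subseteq> words A" "Poly_Mapping.keys q \<subseteq> words A" by auto
    ultimately show "Q (U.cls (p - q))"
      by (simp add: U.cls_diff assms(4) U.cls_closed)
  qed
  with p show ?thesis by simp
qed

lemma deg_U_sub: "deg U n \<subseteq> carrier U"
  by (auto simp: U_simps)

lemma deg_U_word: "w \<in> words A \<Longrightarrow> cl w \<in> deg U (word_deg w)"
  unfolding deg_iff by (intro exI[of _ "frag_of w"]) (simp add: keys_frag_of U.gen_class_eq)

lemma deg_U_zero: "\<zero>\<^bsub>U\<^esub> \<in> deg U n"
  unfolding deg_iff by (intro exI[of _ 0]) (simp add: U.cls_0)

lemma deg_U_diff:
  assumes "s \<in> deg U n" "t \<in> deg U n" shows "s \<ominus>\<^bsub>U\<^esub> t \<in> deg U n"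
proof -
  let ?S = "{w \<in> words A. word_deg w = n}"
  obtain p q where pq: "Poly_Mapping.keys p \<subseteq> ?S" "s = U.cls p" "Poly_Mapping.keys q \<subseteq> ?S" "t = U.cls q"
    using assms[unfolded deg_iff] by (elim exE conjE)
  then have "Poly_Mapping.keys p \<subseteq> words A" "Poly_Mapping.keys q \<subseteq> words A" by auto
  then have "s \<ominus>\<^bsub>U\<^esub> t = U.cls (p - q)" using pq by (simp add: U.cls_diff)
  moreover have "Poly_Mapping.keys (p - q) \<subseteq> ?S" using keys_diff[of p q] pq by blast
  ultimately show ?thesis unfolding deg_iff by (intro exI conjI)
qed

lemma deg_U_minus: "s \<in> deg U n \<Longrightarrow> \<ominus>\<^bsub>U\<^esub> s \<in> deg U n"
  using deg_U_diff[OF deg_U_zero, of s n] deg_U_sub[of n] by (auto simp: a_minus_def)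

lemma deg_U_add: "s \<in> deg U n \<Longrightarrow> t \<in> deg U n \<Longrightarrow> s \<oplus>\<^bsub>U\<^esub> t \<in> deg U n"
  using deg_U_diff[OF _ deg_U_minus, of s n t] deg_U_sub[of n] by (auto simp: a_minus_def)

lemma deg_U_mult:
  assumes "s \<in> deg U m" "t \<in> deg U n" shows "s \<otimes>\<^bsub>U\<^esub> t \<in> deg U (m + n)"
proof -
  have t: "t \<in> carrier U" using assms(2) deg_U_sub by blast
  have w: "cl u \<otimes>\<^bsub>U\<^esub> t \<in> deg U (m + n)" if u: "u \<in> words A" "word_deg u = m" for u
    using assms(2)
  proof (induction t rule: deg_induct)
    case zero then show ?case using u by (simp add: deg_U_zero)
  next
    case (word v) then show ?case using u deg_U_word[of "u @ v"] by (simp add: cl_mult)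
  next
    case (diff s t)
    then have "cl u \<otimes>\<^bsub>U\<^esub> (s \<ominus>\<^bsub>U\<^esub> t) = cl u \<otimes>\<^bsub>U\<^esub> s \<ominus>\<^bsub>U\<^esub> cl u \<otimes>\<^bsub>U\<^esub> t"
      using u by (simp add: a_minus_def U.r_distr U.r_minus)
    then show ?case using diff deg_U_diff by simp
  qed
  show ?thesis
    using assms(1)
  proof (induction s rule: deg_induct)
    case zero then show ?case using t by (simp add: deg_U_zero)
  next
    case (word v) then show ?case using w by simp
  next
    case (diff s s')
    then have "(s \<ominus>\<^bsub>U\<^esub> s') \<otimes>\<^bsub>U\<^esub> t = s \<otimes>\<^bsub>U\<^esub> t \<ominus>\<^bsub>U\<^esub> s' \<otimes>\<^bsub>U\<^esub> t"
      using t by (simp add: a_minus_def U.l_distr U.l_minus)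
    then show ?case using diff deg_U_diff by simp
  qed
qed

lemma word_diff_closed [simp]: "w \<in> words A \<Longrightarrow> word_diff U w \<in> carrier U"
  by (induction w rule: words_induct) simp_all

lemma cl_Cons:
  assumes "l # w \<in> words A" shows "cl (l # w) = cl [l] \<otimes>\<^bsub>U\<^esub> cl w"
proof -
  have "[l] \<in> words A" "w \<in> words A" using assms by (auto simp: words_def)
  then show ?thesis by (simp add: cl_mult)
qed

lemma word_diff_append:
  assumes "u \<in> words A" "v \<in> words A"
  shows "word_diff U (u @ v) = word_diff U u \<otimes>\<^bsub>U\<^esub> cl v \<oplus>\<^bsub>U\<^esub> sg U (word_deg u) (cl u \<otimes>\<^bsub>U\<^esub> word_diff U v)"
  using assms(1)
proof (induction u rule: words_induct)
  case Nil then show ?case using assms by (simp flip: one_U)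
next
  case (El a u)
  have "cl [El a] \<otimes>\<^bsub>U\<^esub> sg U (word_deg u) (cl u \<otimes>\<^bsub>U\<^esub> word_diff U v)
      = sg U (word_deg u) (cl [El a] \<otimes>\<^bsub>U\<^esub> (cl u \<otimes>\<^bsub>U\<^esub> word_diff U v))"
    by (rule addmap_sg[OF mult_right]) (use El assms in simp_all)
  then show ?case using El assms
    by (simp add: cl_Cons[of _ "_ @ _"] cl_Cons[of _ u] U.l_distr U.r_distr mult_assoc U.T.a_assoc flip: cl_mult)
next
  case (Di a u)
  have "cl [Di a] \<otimes>\<^bsub>U\<^esub> sg U (word_deg u) (cl u \<otimes>\<^bsub>U\<^esub> word_diff U v)
      = sg U (word_deg u) (cl [Di a] \<otimes>\<^bsub>U\<^esub> (cl u \<otimes>\<^bsub>U\<^esub> word_diff U v))"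
    by (rule addmap_sg[OF mult_right]) (use Di assms in simp_all)
  moreover have "\<ominus>\<^bsub>U\<^esub> sg U (word_deg u) x = sg U (Suc (word_deg u)) x" if "x \<in> carrier U" for x
    using that by (simp add: sg_def)
  ultimately show ?case using Di assms
    by (simp add: cl_Cons[of _ u] U.l_distr U.r_distr U.l_minus U.T.minus_add mult_assoc)
qed

lemma word_diff_middle:
  assumes "u \<in> words A" "w \<in> words A" "v \<in> words A"
  shows "word_diff U (u @ w @ v) = word_diff U u \<otimes>\<^bsub>U\<^esub> (cl w \<otimes>\<^bsub>U\<^esub> cl v) \<oplus>\<^bsub>U\<^esub>
    sg U (word_deg u) (cl u \<otimes>\<^bsub>U\<^esub> (word_diff U w \<otimes>\<^bsub>U\<^esub> cl v \<oplus>\<^bsub>U\<^esub>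
      sg U (word_deg w) (cl w \<otimes>\<^bsub>U\<^esub> word_diff U v)))"
  using assms by (simp add: word_diff_append cl_mult)

lemma word_diff_relator:
  assumes "r \<in> dga_relators K A"
  shows "frag_eval U (word_diff U) r = \<zero>\<^bsub>U\<^esub>"
proof -
  have self: "a \<ominus>\<^bsub>U\<^esub> a = \<zero>\<^bsub>U\<^esub>" if "a \<in> carrier U" for a
    using that by (simp add: a_minus_def U.T.r_neg)
  have three: "frag_eval U (word_diff U) (frag_of x - frag_of y - frag_of z) = \<zero>\<^bsub>U\<^esub>"
    if "word_diff U x = word_diff U y \<oplus>\<^bsub>U\<^esub> word_diff U z" "x \<in> words A" "y \<in> words A" "z \<in> words A" for x y z
  proof -
    have "Poly_Mapping.keys (frag_of y + frag_of z) \<subseteq> words A"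
      using keys_add[of "frag_of y" "frag_of z"] that(3,4) by (auto simp: keys_frag_of)
    then have "frag_eval U (word_diff U) (frag_of x - (frag_of y + frag_of z)) = word_diff U x \<ominus>\<^bsub>U\<^esub> (word_diff U y \<oplus>\<^bsub>U\<^esub> word_diff U z)"
      using U.T.frag_eval_diff[of "words A" "word_diff U" "frag_of x" "frag_of y + frag_of z"]
        U.T.frag_eval_add[of "words A" "word_diff U" "frag_of y" "frag_of z"] that(2-4)
      by (simp add: keys_frag_of)
    then show ?thesis using that self by (simp add: diff_diff_eq)
  qed
  have two: "frag_eval U (word_diff U) (frag_of x - frag_of y) = \<zero>\<^bsub>U\<^esub>"
    if "word_diff U x = word_diff U y" "x \<in> words A" "y \<in> words A" for x y
    using U.T.frag_eval_diff[of "words A" "word_diff U" "frag_of x" "frag_of y"] that self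
    by (simp add: keys_frag_of)
  show ?thesis
    using assms unfolding dga_relators_def
  proof (elim UnE CollectE exE conjE)
    fix x y assume "x \<in> carrier A" "y \<in> carrier A" "r = frag_of [El (x \<oplus>\<^bsub>A\<^esub> y)] - frag_of [El x] - frag_of [El y]"
    then show ?thesis using three[of "[El (x \<oplus>\<^bsub>A\<^esub> y)]" "[El x]" "[El y]"] by (simp add: di_add)
  next
    fix x y assume "x \<in> carrier A" "y \<in> carrier A" "r = frag_of [El (x \<otimes>\<^bsub>A\<^esub> y)] - frag_of [El x, El y]"
    then show ?thesis using two[of "[El (x \<otimes>\<^bsub>A\<^esub> y)]" "[El x, El y]"] by (simp add: di_mult cl_Cons[of _ "[_]"])
  next
    assume "r \<in> {frag_of [El \<one>\<^bsub>A\<^esub>] - frag_of []}"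
    then show ?thesis using two[of "[El \<one>\<^bsub>A\<^esub>]" "[]"] by (simp add: di_one)
  next
    fix x y assume "x \<in> carrier A" "y \<in> carrier A" "r = frag_of [Di (x \<oplus>\<^bsub>A\<^esub> y)] - frag_of [Di x] - frag_of [Di y]"
    then show ?thesis using three[of "[Di (x \<oplus>\<^bsub>A\<^esub> y)]" "[Di x]" "[Di y]"] by simp
  next
    fix c x assume "c \<in> carrier K" "x \<in> carrier A" "r = frag_of [Di (c \<odot>\<^bsub>A\<^esub> x)] - frag_of [El (c \<odot>\<^bsub>A\<^esub> \<one>\<^bsub>A\<^esub>), Di x]"
    then show ?thesis using two[of "[Di (c \<odot>\<^bsub>A\<^esub> x)]" "[El (c \<odot>\<^bsub>A\<^esub> \<one>\<^bsub>A\<^esub>), Di x]"]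
      by (simp add: di_scalar cl_Cons[of _ "[_]"])
  next
    fix x y assume xy: "x \<in> carrier A" "y \<in> carrier A"
      "r = frag_of [Di (x \<otimes>\<^bsub>A\<^esub> y)] - frag_of [Di x, El y] - frag_of [El x, Di y]"
    have "word_diff U [Di (x \<otimes>\<^bsub>A\<^esub> y)] = word_diff U [Di x, El y] \<oplus>\<^bsub>U\<^esub> word_diff U [El x, Di y]"
      using xy by (simp add: cl_Cons[of _ "[_]"] U.T.l_neg)
    from three[OF this] show ?thesis unfolding xy(3) using xy(1,2) by simp
  qed
qed

lemma relator_homogeneous:
  assumes "r \<in> dga_relators K A" shows "\<exists>n. \<forall>w \<in> Poly_Mapping.keys r. word_deg w = n"
  using assms
proof (cases rule: dga_relators_cases)
  case (three x y z)
  then show ?thesis using keys_three[of x y z] by (intro exI[of _ "word_deg x"]) auto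
next
  case (two x y)
  then show ?thesis using keys_two[of x y] by (intro exI[of _ "word_deg x"]) auto
qed

text \<open>
  On words \<open>w\<close> of a fixed degree, \<open>word_diff (u w v)\<close> is an additive function of the pair
  \<open>(w, word_diff w)\<close>.  A relator is homogeneous, and both components of the pair vanish on it.
\<close>

lemma word_diff_vanishes:
  assumes u: "u \<in> words A" and r: "r \<in> dga_relators K A" and v: "v \<in> words A"
  shows "frag_eval U (\<lambda>w. word_diff U (u @ w @ v)) r = \<zero>\<^bsub>U\<^esub>"
proof -
  obtain n where n: "\<And>w. w \<in> Poly_Mapping.keys r \<Longrightarrow> word_deg w = n"
    using relator_homogeneous[OF r] by blast
  define G where "G a b = word_diff U u \<otimes>\<^bsub>U\<^esub> (a \<otimes>\<^bsub>U\<^esub> cl v) \<oplus>\<^bsub>U\<^esub>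
      sg U (word_deg u) (cl u \<otimes>\<^bsub>U\<^esub> (b \<otimes>\<^bsub>U\<^esub> cl v \<oplus>\<^bsub>U\<^esub> sg U n (a \<otimes>\<^bsub>U\<^esub> word_diff U v)))" for a b
  have k: "Poly_Mapping.keys r \<subseteq> words A" using relator_keys[OF r] .
  have "frag_eval U (\<lambda>w. word_diff U (u @ w @ v)) r = frag_eval U (\<lambda>w. G (cl w) (word_diff U w)) r"
    by (rule frag_eval_cong[OF U.abelian_T]) (use u v k n in \<open>auto simp: word_diff_middle G_def subset_iff\<close>)
  also have "\<dots> = G (frag_eval U cl r) (frag_eval U (word_diff U) r)"
    using k
  proof (rule free_Abelian_group_induct)
    show "frag_eval U (\<lambda>w. G (cl w) (word_diff U w)) 0 = G (frag_eval U cl 0) (frag_eval U (word_diff U) 0)"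
      using u v by (simp add: G_def sg_def)
  next
    fix w assume "w \<in> words A"
    then show "frag_eval U (\<lambda>w. G (cl w) (word_diff U w)) (frag_of w) = G (frag_eval U cl (frag_of w)) (frag_eval U (word_diff U) (frag_of w))"
      using u v by (simp add: G_def)
  next
    fix p q
    assume pq: "Poly_Mapping.keys p \<subseteq> words A" "Poly_Mapping.keys q \<subseteq> words A"
      "frag_eval U (\<lambda>w. G (cl w) (word_diff U w)) p = G (frag_eval U cl p) (frag_eval U (word_diff U) p)"
      "frag_eval U (\<lambda>w. G (cl w) (word_diff U w)) q = G (frag_eval U cl q) (frag_eval U (word_diff U) q)"
    have Gc: "G a b \<in> carrier U" if "a \<in> carrier U" "b \<in> carrier U" for a b
      using that u v by (simp add: G_def)
    have Gd: "G (a \<ominus>\<^bsub>U\<^esub> a') (b \<ominus>\<^bsub>U\<^esub> b') = G a b \<ominus>\<^bsub>U\<^esub> G a' b'"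
      if "a \<in> carrier U" "b \<in> carrier U" "a' \<in> carrier U" "b' \<in> carrier U" for a b a' b'
      using that u v
      by (simp add: G_def a_minus_def U.l_distr U.r_distr U.l_minus U.r_minus U.T.sg_add U.T.sg_minus U.T.minus_add U.T.a_ac)
    have "frag_eval U cl p \<in> carrier U" "frag_eval U cl q \<in> carrier U"
      "frag_eval U (word_diff U) p \<in> carrier U" "frag_eval U (word_diff U) q \<in> carrier U"
      using pq(1,2) by (auto intro!: U.T.frag_eval_closed simp: subset_iff)
    then show "frag_eval U (\<lambda>w. G (cl w) (word_diff U w)) (p - q) = G (frag_eval U cl (p - q)) (frag_eval U (word_diff U) (p - q))"
      using pq Gd U.T.frag_eval_diff[of "words A" cl p q] U.T.frag_eval_diff[of "words A" "word_diff U" p q]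
        U.T.frag_eval_diff[of "words A" "\<lambda>w. G (cl w) (word_diff U w)" p q] Gc by simp
  qed
  also have "\<dots> = G \<zero>\<^bsub>U\<^esub> \<zero>\<^bsub>U\<^esub>"
    using relator_vanishes[of "[]" r "[]"] word_diff_relator[OF r] r by simp
  also have "\<dots> = \<zero>\<^bsub>U\<^esub>"
    using u v by (simp add: G_def sg_def)
  finally show ?thesis .
qed

lemma diff_addmap: "addmap U U (diff U)"
  and diff_word: "w \<in> words A \<Longrightarrow> diff U (cl w) = word_diff U w"
proof -
  have v: "frag_eval U (word_diff U) r = \<zero>\<^bsub>U\<^esub>" if "r \<in> dga_ideal_gens K A" for r
    by (rule word_extend_compat[OF U.abelian_T word_diff_closed word_diff_vanishes that])
  show "addmap U U (diff U)"
    unfolding diff_U by (rule U.addmap_extend[OF U.abelian_T word_diff_closed v])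
  show "w \<in> words A \<Longrightarrow> diff U (cl w) = word_diff U w"
    unfolding diff_U by (rule U.gen_extend_class[OF U.abelian_T word_diff_closed v])
qed

lemma diff_closed [simp]: "s \<in> carrier U \<Longrightarrow> diff U s \<in> carrier U"
  using addmap_closed[OF diff_addmap] .

lemma diff_U_mult:
  assumes "s \<in> deg U n" "t \<in> carrier U"
  shows "diff U (s \<otimes>\<^bsub>U\<^esub> t) = diff U s \<otimes>\<^bsub>U\<^esub> t \<oplus>\<^bsub>U\<^esub> sg U n (s \<otimes>\<^bsub>U\<^esub> diff U t)"
proof -
  have w: "diff U (cl u \<otimes>\<^bsub>U\<^esub> t) = diff U (cl u) \<otimes>\<^bsub>U\<^esub> t \<oplus>\<^bsub>U\<^esub> sg U n (cl u \<otimes>\<^bsub>U\<^esub> diff U t)"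
    if u: "u \<in> words A" "word_deg u = n" for u
  proof (rule U.addmap_eqI[OF addmap_comp[OF mult_right diff_addmap]
        addmap_plus[OF mult_right sg_addmap[OF addmap_comp[OF diff_addmap mult_right]]] _ assms(2)])
    show "cl u \<in> carrier U" "diff U (cl u) \<in> carrier U" "cl u \<in> carrier U" using u by simp_all
    show "diff U (cl u \<otimes>\<^bsub>U\<^esub> cl v) = diff U (cl u) \<otimes>\<^bsub>U\<^esub> cl v \<oplus>\<^bsub>U\<^esub> sg U n (cl u \<otimes>\<^bsub>U\<^esub> diff U (cl v))"
      if "v \<in> words A" for v
      using u that by (simp add: cl_mult diff_word word_diff_append)
  qed
  show ?thesis
    using assms(1)
  proof (induction s rule: deg_induct)
    case zero
    show ?case using assms(2) addmap_zero[OF diff_addmap] by (simp add: sg_def)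
  next
    case (word v) then show ?case using w by simp
  next
    case (diff s s')
    then show ?case using assms(2)
      by (simp add: a_minus_def addmap_add[OF diff_addmap] addmap_minus[OF diff_addmap] U.l_distr U.l_minus
          U.T.sg_add U.T.sg_minus U.T.minus_add U.T.a_ac)
  qed
qed

lemma diff_di: "a \<in> carrier A \<Longrightarrow> diff U (cl [El a]) = cl [Di a]"
  by (simp add: diff_word)

lemma word_diff_deg: "w \<in> words A \<Longrightarrow> word_diff U w \<in> deg U (Suc (word_deg w))"
proof (induction w rule: words_induct)
  case Nil then show ?case by (simp add: deg_U_zero)
next
  case (El a w)
  then show ?case
    using deg_U_word[of "Di a # w"] deg_U_mult[OF deg_U_word[of "[El a]"] El.IH] by (simp add: deg_U_add)
next
  case (Di a w)
  then show ?case
    using deg_U_mult[OF deg_U_word[of "[Di a]"] Di.IH] by (simp add: deg_U_minus)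
qed

lemma diff_U_deg: "s \<in> deg U n \<Longrightarrow> diff U s \<in> deg U (Suc n)"
proof (induction s rule: deg_induct)
  case zero then show ?case using addmap_zero[OF diff_addmap] by (simp add: deg_U_zero)
next
  case (word w) then show ?case using word_diff_deg by (auto simp: diff_word)
next
  case (diff s t)
  then show ?case using deg_U_diff[of "diff U s" "Suc n" "diff U t"]
    by (simp add: a_minus_def addmap_add[OF diff_addmap] addmap_minus[OF diff_addmap])
qed

lemma diff_U_diff: "s \<in> carrier U \<Longrightarrow> diff U (diff U s) = \<zero>\<^bsub>U\<^esub>"
proof (rule U.addmap_eqI[OF addmap_comp[OF diff_addmap diff_addmap], of "\<lambda>_. \<zero>\<^bsub>U\<^esub>"])
  show "addmap U U (\<lambda>t. \<zero>\<^bsub>U\<^esub>)"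
    by (rule addmapI[OF U.abelian_T U.abelian_T]) simp_all
  fix w assume "w \<in> words A"
  then have "diff U (word_diff U w) = \<zero>\<^bsub>U\<^esub>"
  proof (induction w rule: words_induct)
    case Nil then show ?case using addmap_zero[OF diff_addmap] by simp
  next
    case (El a w)
    have "cl [El a] \<in> deg U 0" using deg_U_word[of "[El a]"] El by simp
    then show ?case using El
      by (simp add: addmap_add[OF diff_addmap] diff_U_mult diff_word U.T.l_neg)
  next
    case (Di a w)
    have "cl [Di a] \<in> deg U 1" using deg_U_word[of "[Di a]"] Di by simp
    then show ?case using Di
      by (simp add: addmap_minus[OF diff_addmap] diff_U_mult diff_word) (simp add: sg_def)
  qed
  then show "diff U (diff U (cl w)) = \<zero>\<^bsub>U\<^esub>" using \<open>w \<in> words A\<close> by (simp add: diff_word)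
qed

lemma diff_U_lin: "lin K U U (diff U)"
proof (rule linI_addmap[OF UM.module_axioms UM.module_axioms diff_addmap])
  fix c s assume c: "c \<in> carrier K" and s: "s \<in> carrier U"
  have "cl [El (c \<odot>\<^bsub>A\<^esub> \<one>\<^bsub>A\<^esub>)] \<in> deg U 0" using deg_U_word[of "[El (c \<odot>\<^bsub>A\<^esub> \<one>\<^bsub>A\<^esub>)]"] c by simp
  then show "diff U (c \<odot>\<^bsub>U\<^esub> s) = c \<odot>\<^bsub>U\<^esub> diff U s"
    using c s by (simp add: smult_U diff_U_mult diff_di di_scalar)
qed

theorem univ_dga_calculus: "dg_calculus K A U"
  by (rule dg_calculus.intro)
    (simp_all add: A_algebra U_algebra emb_U_lin deg_U_sub deg_U_zero deg_U_add deg_U_minus deg_U_mult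
      diff_U_lin diff_U_deg diff_U_diff diff_U_mult, simp_all add: emb_U el_mult el_one deg_U_word[of "[El _]", simplified])

sublocale dg_calculus K A U by (rule univ_dga_calculus)

lemma parity_addmap: "addmap U U (parity K A)"
  and parity_word: "w \<in> words A \<Longrightarrow> parity K A (cl w) = sg U (word_deg w) (cl w)"
proof -
  have c: "\<And>w. w \<in> words A \<Longrightarrow> sg U (word_deg w) (cl w) \<in> carrier U" by simp
  have v: "frag_eval U (\<lambda>w. sg U (word_deg (u @ w @ v)) (cl (u @ w @ v))) r = \<zero>\<^bsub>U\<^esub>"
    if uv: "u \<in> words A" "v \<in> words A" and r: "r \<in> dga_relators K A" for u r v
  proof -
    obtain n where n: "\<And>w. w \<in> Poly_Mapping.keys r \<Longrightarrow> word_deg w = n"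
      using relator_homogeneous[OF r] by blast
    let ?s = "sg U (word_deg u + (n + word_deg v))"
    have k: "Poly_Mapping.keys r \<subseteq> words A" using relator_keys[OF r] .
    have s: "addmap U U ?s" using sg_addmap[OF addmap_id[OF U.abelian_T]] .
    have "frag_eval U (\<lambda>w. sg U (word_deg (u @ w @ v)) (cl (u @ w @ v))) r = frag_eval U (\<lambda>w. ?s (cl (u @ w @ v))) r"
      by (rule frag_eval_cong[OF U.abelian_T]) (use uv k n in \<open>auto simp: subset_iff\<close>)
    also have "\<dots> = ?s (frag_eval U (\<lambda>w. cl (u @ w @ v)) r)"
      by (rule addmap_frag_eval[OF s _ k, symmetric]) (use uv in simp)
    also have "\<dots> = \<zero>\<^bsub>U\<^esub>" using relator_vanishes[OF uv(1) r uv(2)] by (simp add: sg_def)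
    finally show ?thesis .
  qed
  have z: "frag_eval U (\<lambda>w. sg U (word_deg w) (cl w)) r = \<zero>\<^bsub>U\<^esub>" if "r \<in> dga_ideal_gens K A" for r
    by (rule word_extend_compat[OF U.abelian_T c v that]) simp_all
  show "addmap U U (parity K A)"
    unfolding parity_U by (rule U.addmap_extend[OF U.abelian_T c z])
  show "w \<in> words A \<Longrightarrow> parity K A (cl w) = sg U (word_deg w) (cl w)"
    unfolding parity_U by (rule U.gen_extend_class[OF U.abelian_T c z])
qed

lemma parity_deg: "s \<in> deg U n \<Longrightarrow> parity K A s = sg U n s"
proof (induction s rule: deg_induct)
  case zero then show ?case using addmap_zero[OF parity_addmap] by (simp add: sg_def)
next
  case (diff s t)
  then show ?case
    by (simp add: a_minus_def addmap_add[OF parity_addmap] addmap_minus[OF parity_addmap] U.T.sg_add U.T.sg_minus)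
qed (simp add: parity_word)

lemma parity_lin: "lin K U U (parity K A)"
proof (rule linI_addmap[OF UM.module_axioms UM.module_axioms parity_addmap])
  fix c s assume c: "c \<in> carrier K" and s: "s \<in> carrier U"
  have cc: "cl [El (c \<odot>\<^bsub>A\<^esub> \<one>\<^bsub>A\<^esub>)] \<in> carrier U" using c by simp
  show "parity K A (c \<odot>\<^bsub>U\<^esub> s) = c \<odot>\<^bsub>U\<^esub> parity K A s"
    unfolding smult_U
  proof (rule U.addmap_eqI[OF addmap_comp[OF mult_right[OF cc] parity_addmap]
        addmap_comp[OF parity_addmap mult_right[OF cc]] _ s])
    fix w assume w: "w \<in> words A"
    show "parity K A (cl [El (c \<odot>\<^bsub>A\<^esub> \<one>\<^bsub>A\<^esub>)] \<otimes>\<^bsub>U\<^esub> cl w) = cl [El (c \<odot>\<^bsub>A\<^esub> \<one>\<^bsub>A\<^esub>)] \<otimes>\<^bsub>U\<^esub> parity K A (cl w)"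
      using w c addmap_sg[OF mult_right[OF cc], of "cl w"] by (simp add: cl_mult parity_word)
  qed
qed

end

section \<open>Twisted actions\<close>

text \<open>
  Right actions are treated as functions and not as fields of a record, since an algebra acts on itself
  by its multiplication.
\<close>

definition raction ::
  "('k, 'r) ring_scheme \<Rightarrow> ('k, 'd, 's) module_scheme \<Rightarrow> ('k, 'm, 't) module_scheme \<Rightarrow> ('m \<Rightarrow> 'd \<Rightarrow> 'm) \<Rightarrow> bool" where
  "raction K D M r \<longleftrightarrow> bilin K M D M r \<and>
     (\<forall>m \<in> carrier M. \<forall>x \<in> carrier D. \<forall>y \<in> carrier D. r m (x \<otimes>\<^bsub>D\<^esub> y) = r (r m x) y) \<and>
     (\<forall>m \<in> carrier M. r m \<one>\<^bsub>D\<^esub> = m)"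

lemma
  assumes "raction K D M r"
  shows raction_bilin: "bilin K M D M r"
    and raction_assoc: "m \<in> carrier M \<Longrightarrow> x \<in> carrier D \<Longrightarrow> y \<in> carrier D \<Longrightarrow> r m (x \<otimes>\<^bsub>D\<^esub> y) = r (r m x) y"
    and raction_one: "m \<in> carrier M \<Longrightarrow> r m \<one>\<^bsub>D\<^esub> = m"
  using assms by (simp_all add: raction_def)

lemma raction_algebra:
  assumes "assoc_algebra K A" shows "raction K A A (monoid.mult A)"
proof -
  interpret ring A using assoc_algebraD(1)[OF assms] .
  show ?thesis by (simp add: raction_def assoc_algebra_bilin[OF assms] m_assoc)
qed

lemma raction_right_module:
  assumes "module K D" "right_module K D M" shows "raction K D M (ract M)"
  using assms unfolding raction_def right_module_def
  by (intro conjI bilinI linI) auto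

text \<open>
  The product \<open>(e \<otimes> f) \<cdot> (\<alpha> \<otimes> \<beta>) = e \<alpha>\<^sub>\<tau> \<otimes> f\<^sub>\<tau> \<beta>\<close>.  For \<open>E = A\<close> and \<open>F = B\<close> it is the multiplication of the twisted
  tensor product; for \<open>F = B\<close> alone it is the action on \<open>E \<otimes> B\<close>, and for \<open>E = A\<close> alone the one on
  \<open>A \<otimes> F\<close>.  Hence one proof of associativity serves all three, and also the algebra of forms.
\<close>

definition tact ::
  "('k, 'r) ring_scheme \<Rightarrow> ('k, 'a, 's) module_scheme \<Rightarrow> ('k, 'e, 'v) module_scheme \<Rightarrow> ('k, 'f, 'u) module_scheme
   \<Rightarrow> ('e \<Rightarrow> 'a \<Rightarrow> 'e) \<Rightarrow> ('f \<Rightarrow> 'b \<Rightarrow> 'f) \<Rightarrow> (('f, 'a) tensor \<Rightarrow> ('a, 'f) tensor)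
   \<Rightarrow> ('e, 'f) tensor \<Rightarrow> ('a, 'b) tensor \<Rightarrow> ('e, 'f) tensor" where
  "tact K A E F re rf \<tau> s z =
     tlift (ktensor K E F) (\<lambda>e f. tlift (ktensor K E F) (\<lambda>\<alpha> \<beta>.
       tmap K E F (re e) (\<lambda>g. rf g \<beta>) (\<tau> (pure (ktensor K F A) f \<alpha>))) z) s"

text \<open>
  The axioms of a module twisting map, normalized by \<open>\<tau> (f \<otimes> 1) = 1 \<otimes> f\<close>.  For \<open>F = B\<close> and \<open>\<tau> = R\<close> they are
  axioms of the twisting map \<open>R\<close> itself.
\<close>

locale module_twist =
  fixes K :: "('k, 'q) ring_scheme" and A :: "('k, 'a, 's) module_scheme" and B :: "('k, 'b, 't) module_scheme"
    and R :: "('b, 'a) tensor \<Rightarrow> ('a, 'b) tensor" and F :: "('k, 'f, 'u) module_scheme"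
    and rf :: "'f \<Rightarrow> 'b \<Rightarrow> 'f" and \<tau> :: "('f, 'a) tensor \<Rightarrow> ('a, 'f) tensor"
  assumes A_algebra: "assoc_algebra K A" and B_algebra: "assoc_algebra K B" and F_action: "raction K B F rf"
    and tau_lin: "lin K (ktensor K F A) (ktensor K A F) \<tau>"
    and tau_one: "f \<in> carrier F \<Longrightarrow> \<tau> (pure (ktensor K F A) f \<one>\<^bsub>A\<^esub>) = pure (ktensor K A F) \<one>\<^bsub>A\<^esub> f"
    and tau_mult: "f \<in> carrier F \<Longrightarrow> a \<in> carrier A \<Longrightarrow> a' \<in> carrier A \<Longrightarrow>
      \<tau> (pure (ktensor K F A) f (a \<otimes>\<^bsub>A\<^esub> a')) =
        tlift (ktensor K A F) (\<lambda>x g. tmap K A F (monoid.mult A x) (\<lambda>g. g) (\<tau> (pure (ktensor K F A) g a')))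
          (\<tau> (pure (ktensor K F A) f a))"
    and tau_act: "f \<in> carrier F \<Longrightarrow> b \<in> carrier B \<Longrightarrow> a \<in> carrier A \<Longrightarrow>
      \<tau> (pure (ktensor K F A) (rf f b) a) =
        tlift (ktensor K A F) (\<lambda>x y. tmap K A F (\<lambda>x. x) (\<lambda>g. rf g y) (\<tau> (pure (ktensor K F A) f x)))
          (R (pure (ktensor K B A) b a))"
begin

abbreviation "AF \<equiv> ktensor K A F"
abbreviation "AB \<equiv> ktensor K A B"
abbreviation tw where "tw f a \<equiv> \<tau> (pure (ktensor K F A) f a)"

lemma A_module: "module K A" and B_module: "module K B" and F_module: "module K F"
  using assoc_algebraD(2)[OF A_algebra] assoc_algebraD(2)[OF B_algebra] bilin_modules(1)[OF raction_bilin[OF F_action]] .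

sublocale A: ring A by (rule assoc_algebraD(1)[OF A_algebra])
sublocale B: ring B by (rule assoc_algebraD(1)[OF B_algebra])

lemma AF_module: "module K AF" by (rule kt_module[OF A_module F_module])
lemma AB_module: "module K AB" by (rule kt_module[OF A_module B_module])

lemmas rf_bilin = raction_bilin[OF F_action]
lemmas A_bilin = assoc_algebra_bilin[OF A_algebra]

lemma tw_bilin: "bilin K F A AF tw"
  by (rule bilin_comp[OF kt_pure_bilin[OF F_module A_module] lin_id[OF F_module] lin_id[OF A_module] tau_lin])

lemma tw_closed: "f \<in> carrier F \<Longrightarrow> a \<in> carrier A \<Longrightarrow> tw f a \<in> carrier AF"
  by (rule bilin_closed[OF tw_bilin])

text \<open>
  The building blocks of the product: \<open>rop b\<close> is right multiplication by \<open>1 \<otimes> b\<close>, \<open>kap p\<close> is right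
  multiplication by \<open>p \<otimes> 1\<close>, and \<open>rho f\<close> is \<open>z \<mapsto> (1 \<otimes> f) \<cdot> z\<close>.  In these terms the two axioms on \<open>\<tau>\<close> read
  \<open>tau_mult'\<close> and \<open>tau_act'\<close>.
\<close>

definition rop :: "'b \<Rightarrow> ('a, 'f) tensor \<Rightarrow> ('a, 'f) tensor" where
  "rop b = tmap K A F (\<lambda>x. x) (\<lambda>g. rf g b)"

definition rho :: "'f \<Rightarrow> ('a, 'b) tensor \<Rightarrow> ('a, 'f) tensor" where
  "rho f = tlift AF (\<lambda>\<alpha> \<beta>. rop \<beta> (tw f \<alpha>))"

definition kap :: "'a \<Rightarrow> ('a, 'f) tensor \<Rightarrow> ('a, 'f) tensor" where
  "kap p = tlift AF (\<lambda>x g. tmap K A F (monoid.mult A x) (\<lambda>g. g) (tw g p))"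

lemma rop_lin: "b \<in> carrier B \<Longrightarrow> lin K AF AF (rop b)"
  unfolding rop_def by (rule tmap_lin[OF lin_id[OF A_module] bilin_left[OF rf_bilin]])

lemma rop_lin_param: "v \<in> carrier AF \<Longrightarrow> lin K B AF (\<lambda>b. rop b v)"
  unfolding rop_def
  by (rule tmap_param_right[OF lin_id[OF A_module] bilin_right[OF rf_bilin] F_module B_module F_module])

lemma rop_pure: "a \<in> carrier A \<Longrightarrow> f \<in> carrier F \<Longrightarrow> b \<in> carrier B \<Longrightarrow> rop b (pure AF a f) = pure AF a (rf f b)"
  unfolding rop_def by (rule tmap_pure[OF lin_id[OF A_module] bilin_left[OF rf_bilin]])

lemma rop_mult:
  assumes b: "b \<in> carrier B" and b': "b' \<in> carrier B" and v: "v \<in> carrier AF"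
  shows "rop (b \<otimes>\<^bsub>B\<^esub> b') v = rop b' (rop b v)"
proof -
  note rb = bilin_left[OF rf_bilin b] and rb' = bilin_left[OF rf_bilin b']
  have "rop b' (rop b v) = tmap K A F (\<lambda>x. x) (\<lambda>g. rf (rf g b) b') v"
    unfolding rop_def by (rule tmap_comp[OF lin_id[OF A_module] rb lin_id[OF A_module] rb' v])
  also have "\<dots> = rop (b \<otimes>\<^bsub>B\<^esub> b') v"
    unfolding rop_def
    by (rule tmap_cong[OF lin_id[OF A_module] lin_cong[OF lin_comp[OF rb' rb]] v, symmetric])
      (simp_all add: raction_assoc[OF F_action] b b')
  finally show ?thesis by simp
qed

lemma rho_bilin: "f \<in> carrier F \<Longrightarrow> bilin K A B AF (\<lambda>\<alpha> \<beta>. rop \<beta> (tw f \<alpha>))"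
  by (intro bilinI A_module B_module AF_module)
    (auto intro: lin_comp[OF rop_lin bilin_right[OF tw_bilin]] rop_lin_param tw_closed)

lemma rho_lin: "f \<in> carrier F \<Longrightarrow> lin K AB AF (rho f)"
  unfolding rho_def by (rule kt_lift[OF A_module B_module rho_bilin])

lemma rho_pure: "f \<in> carrier F \<Longrightarrow> a \<in> carrier A \<Longrightarrow> b \<in> carrier B \<Longrightarrow> rho f (pure AB a b) = rop b (tw f a)"
  unfolding rho_def by (rule kt_lift_pure[OF A_module B_module rho_bilin])

lemma rho_lin_param:
  assumes "z \<in> carrier AB" shows "lin K F AF (\<lambda>f. rho f z)"
  unfolding rho_def
  by (rule kt_tlift_param[OF A_module B_module _ F_module AF_module assms])
    (auto intro: lin_comp[OF rop_lin bilin_left[OF tw_bilin]])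

lemma tau_act': "f \<in> carrier F \<Longrightarrow> b \<in> carrier B \<Longrightarrow> a \<in> carrier A \<Longrightarrow>
    tw (rf f b) a = rho f (R (pure (ktensor K B A) b a))"
  by (simp add: tau_act rho_def rop_def)

context
  fixes E :: "('k, 'e, 'v) module_scheme" and re :: "'e \<Rightarrow> 'a \<Rightarrow> 'e"
  assumes E_action: "raction K A E re"
begin

abbreviation "EF \<equiv> ktensor K E F"

lemma E_module: "module K E"
  by (rule bilin_modules(1)[OF raction_bilin[OF E_action]])

lemma EF_module: "module K EF" by (rule kt_module[OF E_module F_module])

lemma lop_lin: "e \<in> carrier E \<Longrightarrow> lin K AF EF (tmap K E F (re e) (\<lambda>g. g))"
  by (rule tmap_lin[OF bilin_right[OF raction_bilin[OF E_action]] lin_id[OF F_module]])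

lemma lop_lin_param: "v \<in> carrier AF \<Longrightarrow> lin K E EF (\<lambda>e. tmap K E F (re e) (\<lambda>g. g) v)"
  by (rule tmap_param_left[OF bilin_left[OF raction_bilin[OF E_action]] lin_id[OF F_module] A_module E_module E_module])

lemma lop_pure: "e \<in> carrier E \<Longrightarrow> a \<in> carrier A \<Longrightarrow> f \<in> carrier F \<Longrightarrow>
    tmap K E F (re e) (\<lambda>g. g) (pure AF a f) = pure EF (re e a) f"
  by (rule tmap_pure[OF bilin_right[OF raction_bilin[OF E_action]] lin_id[OF F_module]])

lemma lop_rop:
  assumes "e \<in> carrier E" "b \<in> carrier B" "v \<in> carrier AF"
  shows "tmap K E F (re e) (\<lambda>g. g) (rop b v) = tmap K E F (re e) (\<lambda>g. rf g b) v"
  unfolding rop_def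
  by (rule tmap_comp[OF lin_id[OF A_module] bilin_left[OF rf_bilin assms(2)]
        bilin_right[OF raction_bilin[OF E_action] assms(1)] lin_id[OF F_module] assms(3)])

lemma tact_inner:
  assumes e: "e \<in> carrier E" and f: "f \<in> carrier F" and z: "z \<in> carrier AB"
  shows "tlift EF (\<lambda>\<alpha> \<beta>. tmap K E F (re e) (\<lambda>g. rf g \<beta>) (tw f \<alpha>)) z = tmap K E F (re e) (\<lambda>g. g) (rho f z)"
proof -
  have "tmap K E F (re e) (\<lambda>g. g) (rho f z) = tlift EF (\<lambda>\<alpha> \<beta>. tmap K E F (re e) (\<lambda>g. g) (rop \<beta> (tw f \<alpha>))) z"
    unfolding rho_def
    by (rule kt_addmap_tlift[OF A_module B_module lin_addmap[OF lop_lin[OF e]] _ z])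
      (auto intro: bilin_closed[OF rho_bilin[OF f]])
  also have "\<dots> = tlift EF (\<lambda>\<alpha> \<beta>. tmap K E F (re e) (\<lambda>g. rf g \<beta>) (tw f \<alpha>)) z"
    by (rule kt_tlift_cong[OF A_module B_module module_abelian[OF EF_module] _ z])
      (simp_all add: lop_rop[OF e] tw_closed f flip: lop_rop[OF e], auto intro!: lin_closed[OF lop_lin[OF e]] lin_closed[OF rop_lin] tw_closed f)
  finally show ?thesis by simp
qed

lemma tact_bilin_inner:
  assumes z: "z \<in> carrier AB"
  shows "bilin K E F EF (\<lambda>e f. tmap K E F (re e) (\<lambda>g. g) (rho f z))"
  by (intro bilinI E_module F_module EF_module)
    (auto intro!: lop_lin_param lin_closed[OF rho_lin] z lin_comp[OF lop_lin rho_lin_param])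

abbreviation "act \<equiv> tact K A E F re rf \<tau>"

lemma tact_eq:
  assumes z: "z \<in> carrier AB" and s: "s \<in> carrier EF"
  shows "act s z = tlift EF (\<lambda>e f. tmap K E F (re e) (\<lambda>g. g) (rho f z)) s"
  unfolding tact_def
  by (rule kt_tlift_cong[OF E_module F_module module_abelian[OF EF_module] _ s])
    (auto simp: tact_inner z intro: bilin_closed[OF tact_bilin_inner[OF z]])

lemma tact_pure:
  assumes "e \<in> carrier E" "f \<in> carrier F" "z \<in> carrier AB"
  shows "act (pure EF e f) z = tmap K E F (re e) (\<lambda>g. g) (rho f z)"
  using assms kt_lift_pure[OF E_module F_module tact_bilin_inner[OF assms(3)] assms(1,2)]
  by (simp add: tact_eq kt_pure_closed[OF E_module F_module])

lemma tact_bilin: "bilin K EF AB EF act"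
proof (intro bilinI EF_module AB_module)
  show "lin K EF EF (\<lambda>s. act s z)" if "z \<in> carrier AB" for z
    by (rule lin_cong[OF kt_lift[OF E_module F_module tact_bilin_inner[OF that]]]) (simp add: tact_eq that)
  show "lin K AB EF (act s)" if s: "s \<in> carrier EF" for s
  proof (rule lin_cong[OF kt_tlift_param[OF E_module F_module _ AB_module EF_module s]])
    show "lin K AB EF (\<lambda>z. tmap K E F (re e) (\<lambda>g. g) (rho f z))" if "e \<in> carrier E" "f \<in> carrier F" for e f
      by (rule lin_comp[OF lop_lin[OF that(1)] rho_lin[OF that(2)]])
    show "act s z = tlift EF (\<lambda>e f. tmap K E F (re e) (\<lambda>g. g) (rho f z)) s" if "z \<in> carrier AB" for z
      by (rule tact_eq[OF that s])
  qed
qed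

lemmas tact_closed = bilin_closed[OF tact_bilin]

end

lemmas A_action = raction_algebra[OF A_algebra]

abbreviation "actA \<equiv> tact K A A F (monoid.mult A) rf \<tau>"

lemma tact_lop:
  assumes E: "raction K A E re" and e: "e \<in> carrier E" and v: "v \<in> carrier AF" and z: "z \<in> carrier AB"
  shows "tact K A E F re rf \<tau> (tmap K E F (re e) (\<lambda>g. g) v) z = tmap K E F (re e) (\<lambda>g. g) (actA v z)"
proof (rule kt_lin_eqI[OF A_module F_module
      lin_comp[OF bilin_left[OF tact_bilin[OF E] z] lop_lin[OF E e]]
      lin_comp[OF lop_lin[OF E e] bilin_left[OF tact_bilin[OF A_action] z]] _ v])
  fix a f assume a: "a \<in> carrier A" and f: "f \<in> carrier F"
  have ea: "re e a \<in> carrier E" using bilin_closed[OF raction_bilin[OF E] e a] .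
  have "tmap K E F (re e) (\<lambda>g. g) (tmap K A F (monoid.mult A a) (\<lambda>g. g) w) = tmap K E F (re (re e a)) (\<lambda>g. g) w"
    if w: "w \<in> carrier AF" for w
  proof -
    have "tmap K E F (re (re e a)) (\<lambda>g. g) w = tmap K E F (\<lambda>x. re e (a \<otimes>\<^bsub>A\<^esub> x)) (\<lambda>g. g) w"
      by (rule tmap_cong[OF bilin_R[OF raction_bilin[OF E] e bilin_right[OF A_bilin a]] lin_id[OF F_module] w])
        (simp_all add: raction_assoc[OF E e a])
    then show ?thesis
      by (simp add: tmap_comp[OF bilin_right[OF A_bilin a] lin_id[OF F_module] bilin_right[OF raction_bilin[OF E] e] lin_id[OF F_module] w])
  qed
  then show "tact K A E F re rf \<tau> (tmap K E F (re e) (\<lambda>g. g) (pure AF a f)) z = tmap K E F (re e) (\<lambda>g. g) (actA (pure AF a f) z)"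
    by (simp add: lop_pure[OF E] e a f tact_pure[OF E] tact_pure[OF A_action] ea z lin_closed[OF rho_lin])
qed

lemma kap_bilin: "p \<in> carrier A \<Longrightarrow> bilin K A F AF (\<lambda>x g. tmap K A F (monoid.mult A x) (\<lambda>g. g) (tw g p))"
  by (intro bilinI A_module F_module AF_module)
    (auto intro!: lop_lin_param[OF A_action] tw_closed lin_comp[OF lop_lin[OF A_action] bilin_left[OF tw_bilin]])

lemma kap_lin: "p \<in> carrier A \<Longrightarrow> lin K AF AF (kap p)"
  unfolding kap_def by (rule kt_lift[OF A_module F_module kap_bilin])

lemma tau_mult': "f \<in> carrier F \<Longrightarrow> a \<in> carrier A \<Longrightarrow> a' \<in> carrier A \<Longrightarrow> tw f (a \<otimes>\<^bsub>A\<^esub> a') = kap a' (tw f a)"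
  by (simp add: tau_mult kap_def)

lemma tact_elem:
  assumes "w \<in> carrier AF" "p \<in> carrier A" "q \<in> carrier B"
  shows "actA w (pure AB p q) = rop q (kap p w)"
proof (rule kt_lin_eqI[OF A_module F_module bilin_left[OF tact_bilin[OF A_action]] lin_comp[OF rop_lin kap_lin] _ assms(1)])
  show pq: "pure AB p q \<in> carrier AB" using kt_pure_closed[OF A_module B_module] assms by blast
  fix x g assume x: "x \<in> carrier A" and g: "g \<in> carrier F"
  have "rop q (tmap K A F (monoid.mult A x) (\<lambda>g. g) u) = tmap K A F (monoid.mult A x) (\<lambda>g. g) (rop q u)" if "u \<in> carrier AF" for u
    using that assms(3) x unfolding rop_def
    by (simp add: tmap_comp[OF lin_id[OF A_module] bilin_left[OF rf_bilin] bilin_right[OF A_bilin] lin_id[OF F_module]]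
        tmap_comp[OF bilin_right[OF A_bilin] lin_id[OF F_module] lin_id[OF A_module] bilin_left[OF rf_bilin]])
  then show "actA (pure AF x g) (pure AB p q) = rop q (kap p (pure AF x g))"
    using assms x g
    by (simp add: tact_pure[OF A_action] pq rho_pure kap_def kt_lift_pure[OF A_module F_module kap_bilin] tw_closed)
qed (use assms in simp_all)

end

text \<open>
  In \<open>(v \<cdot> y) \<cdot> x = v \<cdot> (y x)\<close> the product \<open>y x\<close> is again a twisted action, of \<open>A \<otimes> B\<close> on itself.  The prefix \<open>B\<close>
  marks the notions that belong to it.
\<close>

locale module_twist_assoc =
  B: module_twist K A B R B "monoid.mult B" R + module_twist K A B R F rf \<tau>
  for K :: "('k, 'q) ring_scheme" and A :: "('k, 'a, 's) module_scheme" and B :: "('k, 'b, 't) module_scheme"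
    and R :: "('b, 'a) tensor \<Rightarrow> ('a, 'b) tensor" and F :: "('k, 'f, 'u) module_scheme"
    and rf :: "'f \<Rightarrow> 'b \<Rightarrow> 'f" and \<tau> :: "('f, 'a) tensor \<Rightarrow> ('a, 'f) tensor"
begin

abbreviation "tmul \<equiv> tact K A A B (monoid.mult A) (monoid.mult B) R"

lemma rho_rop:
  assumes f: "f \<in> carrier F" and z: "z \<in> carrier B" and v: "v \<in> carrier AB"
  shows "rho f (B.rop z v) = rop z (rho f v)"
proof (rule kt_lin_eqI[OF A_module B_module lin_comp[OF rho_lin[OF f] B.rop_lin[OF z]] lin_comp[OF rop_lin[OF z] rho_lin[OF f]] _ v])
  fix a b assume "a \<in> carrier A" "b \<in> carrier B"
  then show "rho f (B.rop z (pure AB a b)) = rop z (rho f (pure AB a b))"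
    using f z by (simp add: B.rop_pure rho_pure rop_mult tw_closed)
qed

lemma rho_act:
  assumes f: "f \<in> carrier F" and b: "b \<in> carrier B" and x: "x \<in> carrier AB"
  shows "rho (rf f b) x = rho f (B.rho b x)"
proof (rule kt_lin_eqI[OF A_module B_module rho_lin[OF bilin_closed[OF rf_bilin f b]] lin_comp[OF rho_lin[OF f] B.rho_lin[OF b]] _ x])
  fix a z assume "a \<in> carrier A" "z \<in> carrier B"
  then show "rho (rf f b) (pure AB a z) = rho f (B.rho b (pure AB a z))"
    using f b by (simp add: rho_pure B.rho_pure rho_rop B.tw_closed tau_act' bilin_closed[OF rf_bilin])
qed

lemma tact_rop:
  assumes b: "b \<in> carrier B" and v: "v \<in> carrier AF" and x: "x \<in> carrier AB"
  shows "actA (rop b v) x = actA v (B.rho b x)"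
proof (rule kt_lin_eqI[OF A_module F_module lin_comp[OF bilin_left[OF tact_bilin[OF A_action] x] rop_lin[OF b]]
      bilin_left[OF tact_bilin[OF A_action] lin_closed[OF B.rho_lin[OF b] x]] _ v])
  fix p g assume "p \<in> carrier A" "g \<in> carrier F"
  then show "actA (rop b (pure AF p g)) x = actA (pure AF p g) (B.rho b x)"
    using b x by (simp add: rop_pure tact_pure[OF A_action] bilin_closed[OF rf_bilin] rho_act lin_closed[OF B.rho_lin])
qed

lemma tact_tw:
  assumes f: "f \<in> carrier F" and a: "a \<in> carrier A" and v: "v \<in> carrier AB"
  shows "actA (tw f a) v = rho f (tmap K A B (monoid.mult A a) (\<lambda>b. b) v)"
proof (rule kt_lin_eqI[OF A_module B_module bilin_right[OF tact_bilin[OF A_action] tw_closed[OF f a]]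
      lin_comp[OF rho_lin[OF f] B.lop_lin[OF A_action a]] _ v])
  fix p q assume "p \<in> carrier A" "q \<in> carrier B"
  then show "actA (tw f a) (pure AB p q) = rho f (tmap K A B (monoid.mult A a) (\<lambda>b. b) (pure AB p q))"
    using f a by (simp add: tact_elem tw_closed B.lop_pure[OF A_action] rho_pure tau_mult')
qed

text \<open>
  This is associativity for \<open>v = 1 \<otimes> f\<close>.  For \<open>y = (a \<otimes> 1) (1 \<otimes> b)\<close> the factors \<open>b\<close> and \<open>a\<close> are moved
  from \<open>y\<close> into \<open>x\<close> one after the other: \<open>b\<close> by the axiom on \<open>\<tau>\<close> and the action of \<open>B\<close>, which is behind
  \<open>tact_rop\<close>, and \<open>a\<close> by the one on \<open>\<tau>\<close> and products in \<open>A\<close>, which is behind \<open>tact_tw\<close>.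
\<close>

lemma tact_rho:
  assumes f: "f \<in> carrier F" and y: "y \<in> carrier AB" and x: "x \<in> carrier AB"
  shows "actA (rho f y) x = rho f (tmul y x)"
proof (rule kt_lin_eqI[OF A_module B_module lin_comp[OF bilin_left[OF tact_bilin[OF A_action] x] rho_lin[OF f]]
      lin_comp[OF rho_lin[OF f] bilin_left[OF B.tact_bilin[OF A_action] x]] _ y])
  fix a b assume "a \<in> carrier A" "b \<in> carrier B"
  then show "actA (rho f (pure AB a b)) x = rho f (tmul (pure AB a b) x)"
    using f x by (simp add: rho_pure tact_rop tw_closed tact_tw lin_closed[OF B.rho_lin] B.tact_pure[OF A_action])
qed

theorem tact_assoc:
  assumes E: "raction K A E re" and s: "s \<in> carrier (ktensor K E F)" and y: "y \<in> carrier AB" and x: "x \<in> carrier AB"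
  shows "tact K A E F re rf \<tau> (tact K A E F re rf \<tau> s y) x = tact K A E F re rf \<tau> s (tmul y x)"
proof -
  have yx: "tmul y x \<in> carrier AB" by (rule B.tact_closed[OF A_action y x])
  show ?thesis
  proof (rule kt_lin_eqI[OF E_module[OF E] F_module lin_comp[OF bilin_left[OF tact_bilin[OF E] x] bilin_left[OF tact_bilin[OF E] y]]
      bilin_left[OF tact_bilin[OF E] yx] _ s])
    fix e f assume "e \<in> carrier E" "f \<in> carrier F"
    then show "tact K A E F re rf \<tau> (tact K A E F re rf \<tau> (pure (ktensor K E F) e f) y) x
        = tact K A E F re rf \<tau> (pure (ktensor K E F) e f) (tmul y x)"
      using x y yx by (simp add: tact_pure[OF E] tact_lop[OF E] lin_closed[OF rho_lin] tact_rho)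
  qed
qed

lemma tact_one:
  assumes E: "raction K A E re" and s: "s \<in> carrier (ktensor K E F)"
  shows "tact K A E F re rf \<tau> s (pure AB \<one>\<^bsub>A\<^esub> \<one>\<^bsub>B\<^esub>) = s"
proof -
  have o: "pure AB \<one>\<^bsub>A\<^esub> \<one>\<^bsub>B\<^esub> \<in> carrier AB" using kt_pure_closed[OF A_module B_module] by simp
  show ?thesis
  proof (rule kt_lin_eqI[OF E_module[OF E] F_module bilin_left[OF tact_bilin[OF E] o] lin_id[OF EF_module[OF E]] _ s])
    fix e f assume "e \<in> carrier E" "f \<in> carrier F"
    then show "tact K A E F re rf \<tau> (pure (ktensor K E F) e f) (pure AB \<one>\<^bsub>A\<^esub> \<one>\<^bsub>B\<^esub>) = pure (ktensor K E F) e f"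
      using o by (simp add: tact_pure[OF E] rho_pure tau_one rop_pure raction_one[OF F_action] lop_pure[OF E] raction_one[OF E])
  qed
qed

end

section \<open>The twisted tensor product algebra\<close>

locale twisted_pair =
  fixes K :: "('k, 'q) ring_scheme" and A :: "('k, 'a, 's) module_scheme" and B :: "('k, 'b, 't) module_scheme"
    and R :: "('b, 'a) tensor \<Rightarrow> ('a, 'b) tensor"
  assumes algA: "assoc_algebra K A" and algB: "assoc_algebra K B" and twist: "twisting_map K A B R"
begin

lemma modA: "module K A" and modB: "module K B"
  using assoc_algebraD(2)[OF algA] assoc_algebraD(2)[OF algB] .

lemma twist_module: "module_twist K A B R B (monoid.mult B) R"
proof (rule module_twist.intro[OF algA algB raction_algebra[OF algB]])
  show "lin K (ktensor K B A) (ktensor K A B) R"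
    using twist kt_module[OF modA modB] kt_module[OF modB modA] by (simp add: lin_def twisting_map_def)
qed (use twist in \<open>simp_all add: twisting_map_def tmap_def\<close>)

sublocale tw: module_twist_assoc K A B R B "monoid.mult B" R
  by (intro module_twist_assoc.intro twist_module)

abbreviation "TP \<equiv> twisted_product K A B R"
abbreviation "AB \<equiv> ktensor K A B"

lemma TP_simps:
  "carrier TP = carrier AB" "add TP = add AB" "\<zero>\<^bsub>TP\<^esub> = \<zero>\<^bsub>AB\<^esub>" "smult TP = smult AB"
  "s \<otimes>\<^bsub>TP\<^esub> t = tact K A A B (monoid.mult A) (monoid.mult B) R s t" "\<one>\<^bsub>TP\<^esub> = pure AB \<one>\<^bsub>A\<^esub> \<one>\<^bsub>B\<^esub>"
  by (simp_all add: twisted_product_def Let_def tact_def tmap_def)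

lemma TP_class: "gen_class TP = gen_class AB"
  by (simp add: gen_class_def fun_eq_iff TP_simps)

lemma TP_extend: "gen_extend TP = gen_extend AB"
  by (rule gen_extend_target_cong) (simp_all add: TP_simps)

lemma AB_module: "module K AB" by (rule kt_module[OF modA modB])

lemma TP_module: "module K TP"
  by (rule module_cong[OF AB_module]) (simp_all add: TP_simps)

lemma lin_TP_cod: "lin K V TP h \<longleftrightarrow> lin K V AB h"
  using TP_module AB_module by (simp add: lin_def linear_map_def hom_def TP_simps)

lemma lin_TP_dom: "lin K TP V h \<longleftrightarrow> lin K AB V h"
  using TP_module AB_module by (simp add: lin_def linear_map_def hom_def TP_simps)

lemma one_AB: "pure AB \<one>\<^bsub>A\<^esub> \<one>\<^bsub>B\<^esub> \<in> carrier AB"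
proof -
  interpret A: ring A by (rule assoc_algebraD(1)[OF algA])
  interpret B: ring B by (rule assoc_algebraD(1)[OF algB])
  show ?thesis by (rule kt_pure_closed[OF modA modB]) simp_all
qed

lemma TP_mult_bilin: "bilin K TP TP TP (monoid.mult TP)"
proof -
  have "bilin K AB AB AB (tact K A A B (monoid.mult A) (monoid.mult B) R)"
    by (rule tw.B.tact_bilin[OF raction_algebra[OF algA]])
  then have "bilin K AB AB AB (monoid.mult TP)"
    by (simp add: TP_simps[abs_def])
  then show ?thesis
    using TP_module by (simp add: bilin_def lin_TP_cod lin_TP_dom TP_simps(1))
qed

lemma twist_unit_left:
  assumes "a \<in> carrier A" shows "R (pure (ktensor K B A) \<one>\<^bsub>B\<^esub> a) = pure AB a \<one>\<^bsub>B\<^esub>"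
  using twist assms by (simp add: twisting_map_def)

lemma TP_one_left:
  assumes z: "z \<in> carrier AB" shows "\<one>\<^bsub>TP\<^esub> \<otimes>\<^bsub>TP\<^esub> z = z"
proof -
  interpret A: ring A by (rule assoc_algebraD(1)[OF algA])
  interpret B: ring B by (rule assoc_algebraD(1)[OF algB])
  note actA = raction_algebra[OF algA]
  show ?thesis
    unfolding TP_simps
  proof (rule kt_lin_eqI[OF modA modB bilin_right[OF tw.B.tact_bilin[OF actA] one_AB] lin_id[OF AB_module] _ z])
    fix a b assume ab: "a \<in> carrier A" "b \<in> carrier B"
    have "pure AB a b \<in> carrier AB" "pure AB a \<one>\<^bsub>B\<^esub> \<in> carrier AB"
      using ab by (simp_all add: kt_pure_closed[OF modA modB])
    then show "tact K A A B (monoid.mult A) (monoid.mult B) R (pure AB \<one>\<^bsub>A\<^esub> \<one>\<^bsub>B\<^esub>) (pure AB a b) = pure AB a b"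
      using ab by (simp add: tw.B.tact_pure[OF actA] tw.B.rho_pure twist_unit_left tw.B.rop_pure tw.B.lop_pure[OF actA])
  qed
qed

theorem TP_algebra: "assoc_algebra K TP"
proof -
  interpret TPM: module K TP by (rule TP_module)
  note b = TP_mult_bilin
  have r: "ring TP"
  proof (rule ringI[OF TPM.M.abelian_group_axioms monoidI])
    show "x \<otimes>\<^bsub>TP\<^esub> y \<in> carrier TP" if "x \<in> carrier TP" "y \<in> carrier TP" for x y
      using bilin_closed[OF b that] .
    show "\<one>\<^bsub>TP\<^esub> \<in> carrier TP" using one_AB by (simp add: TP_simps)
    show "x \<otimes>\<^bsub>TP\<^esub> y \<otimes>\<^bsub>TP\<^esub> z = x \<otimes>\<^bsub>TP\<^esub> (y \<otimes>\<^bsub>TP\<^esub> z)"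
      if "x \<in> carrier TP" "y \<in> carrier TP" "z \<in> carrier TP" for x y z
      using that tw.tact_assoc[OF raction_algebra[OF algA]] by (simp add: TP_simps)
    show "\<one>\<^bsub>TP\<^esub> \<otimes>\<^bsub>TP\<^esub> x = x" if "x \<in> carrier TP" for x
      using that TP_one_left by (simp add: TP_simps(1))
    show "x \<otimes>\<^bsub>TP\<^esub> \<one>\<^bsub>TP\<^esub> = x" if "x \<in> carrier TP" for x
      using that tw.tact_one[OF raction_algebra[OF algA]] by (simp add: TP_simps)
    show "(x \<oplus>\<^bsub>TP\<^esub> y) \<otimes>\<^bsub>TP\<^esub> z = x \<otimes>\<^bsub>TP\<^esub> z \<oplus>\<^bsub>TP\<^esub> y \<otimes>\<^bsub>TP\<^esub> z"
      if "x \<in> carrier TP" "y \<in> carrier TP" "z \<in> carrier TP" for x y z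
      using lin_add[OF bilin_left[OF b]] that by blast
    show "z \<otimes>\<^bsub>TP\<^esub> (x \<oplus>\<^bsub>TP\<^esub> y) = z \<otimes>\<^bsub>TP\<^esub> x \<oplus>\<^bsub>TP\<^esub> z \<otimes>\<^bsub>TP\<^esub> y"
      if "x \<in> carrier TP" "y \<in> carrier TP" "z \<in> carrier TP" for x y z
      using lin_add[OF bilin_right[OF b]] that by blast
  qed
  show ?thesis
    unfolding assoc_algebra_def
    by (intro conjI ballI r TP_module lin_smult[OF bilin_left[OF b]] lin_smult[OF bilin_right[OF b]])
qed

lemma TP_mult_pure:
  assumes "a \<in> carrier A" "b \<in> carrier B" "a' \<in> carrier A" "b' \<in> carrier B"
  shows "pure AB a b \<otimes>\<^bsub>TP\<^esub> pure AB a' b' =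
    tmap K A B (\<lambda>x. a \<otimes>\<^bsub>A\<^esub> x) (\<lambda>y. y \<otimes>\<^bsub>B\<^esub> b') (R (pure (ktensor K B A) b a'))"
  using assms kt_pure_closed[OF modA modB assms(3,4)]
  by (simp add: TP_simps tw.B.tact_pure[OF raction_algebra[OF algA]] tw.B.rho_pure
      tw.B.lop_rop[OF raction_algebra[OF algA]] tw.B.tw_closed)

end

section \<open>The twisted tensor product of the universal calculi\<close>

text \<open>
  Sums of one or more elements of \<open>X\<close>.  All the sets \<open>X\<close> to which this is applied are closed under
  negation, so these sums form the additive span.
\<close>

inductive_set add_span :: "('p, 'r) ring_scheme \<Rightarrow> 'p set \<Rightarrow> 'p set" for P X where
  base: "x \<in> X \<Longrightarrow> x \<in> add_span P X"
| plus: "s \<in> add_span P X \<Longrightarrow> t \<in> add_span P X \<Longrightarrow> s \<oplus>\<^bsub>P\<^esub> t \<in> add_span P X"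

lemma add_span_closed:
  assumes "abelian_group P" "X \<subseteq> carrier P" "t \<in> add_span P X" shows "t \<in> carrier P"
proof -
  interpret abelian_group P by fact
  show ?thesis using assms(3) by induction (use assms(2) in auto)
qed

lemma addmap_span:
  assumes h: "addmap P Q h" and X: "X \<subseteq> carrier P" and hX: "\<And>x. x \<in> X \<Longrightarrow> h x \<in> add_span Q Y" and t: "t \<in> add_span P X"
  shows "h t \<in> add_span Q Y"
  using t
proof induction
  case (plus s t)
  then show ?case using add_span_closed[OF addmap_dom[OF h] X] by (simp add: addmap_add[OF h] add_span.plus)
qed (rule hX)

lemma addmap_span_eq:
  assumes h: "addmap P Q h" and h': "addmap P Q h'" and X: "X \<subseteq> carrier P"
    and eq: "\<And>x. x \<in> X \<Longrightarrow> h x = h' x" and t: "t \<in> add_span P X"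
  shows "h t = h' t"
  using t
proof induction
  case (plus s t)
  then show ?case using add_span_closed[OF addmap_dom[OF h] X] by (simp add: addmap_add[OF h] addmap_add[OF h'])
qed (rule eq)

locale twisted_forms = twisted_pair K A B R
  for K :: "('k, 'q) ring_scheme" and A :: "('k, 'a, 's) module_scheme" and B :: "('k, 'b, 't) module_scheme"
    and R :: "('b, 'a) tensor \<Rightarrow> ('a, 'b) tensor" and Rt :: "('b form, 'a form) tensor \<Rightarrow> ('a form, 'b form) tensor" +
  assumes extension: "twisting_extension K A B R Rt"
begin

abbreviation "OA \<equiv> univ_dga K A"
abbreviation "OB \<equiv> univ_dga K B"
abbreviation "T \<equiv> ktensor K OA OB"
abbreviation "S \<equiv> ktensor K OB OA"
abbreviation "G \<equiv> twisted_calculus K A B Rt"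
abbreviation tm where "tm f g \<equiv> tmap K OA OB f g"

sublocale UA: univ K A by (rule univ.intro[OF algA])
sublocale UB: univ K B by (rule univ.intro[OF algB])

lemma twist_t: "twisting_map K OA OB Rt"
  using extension by (simp add: twisting_extension_def Let_def)

sublocale W: twisted_pair K OA OB Rt
  by (rule twisted_pair.intro[OF UA.U_algebra UB.U_algebra twist_t])

lemma Rt_emb: "b \<in> carrier B \<Longrightarrow> a \<in> carrier A \<Longrightarrow>
    Rt (pure S (emb OB b) (emb OA a)) = tm (emb OA) (emb OB) (R (pure (ktensor K B A) b a))"
  and Rt_diff_left: "\<omega> \<in> carrier OB \<Longrightarrow> \<phi> \<in> carrier OA \<Longrightarrow>
    Rt (pure S (diff OB \<omega>) \<phi>) = tm (parity K A) (diff OB) (Rt (pure S \<omega> \<phi>))"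
  and Rt_diff_right: "\<omega> \<in> carrier OB \<Longrightarrow> \<phi> \<in> carrier OA \<Longrightarrow>
    Rt (pure S \<omega> (diff OA \<phi>)) = tm (diff OA) (parity K B) (Rt (pure S \<omega> \<phi>))"
  using extension by (simp_all add: twisting_extension_def Let_def tmap_def)

lemma G_simps:
  "carrier G = carrier T" "add G = add T" "\<zero>\<^bsub>G\<^esub> = \<zero>\<^bsub>T\<^esub>" "smult G = smult T"
  "monoid.mult G = monoid.mult W.TP" "\<one>\<^bsub>G\<^esub> = pure T \<one>\<^bsub>OA\<^esub> \<one>\<^bsub>OB\<^esub>"
  "emb G = tm (emb OA) (emb OB)"
  "deg G n = generate (add_monoid W.TP) {pure T \<phi> \<omega> | \<phi> \<omega>. \<exists>p q. p + q = n \<and> \<phi> \<in> deg OA p \<and> \<omega> \<in> deg OB q}"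
  by (simp_all add: twisted_calculus_def Let_def module.defs calculus.defs W.TP_simps W.TP_class W.TP_extend tmap_def)

lemma G_diff_raw: "diff G = tlift T (\<lambda>\<phi> \<omega>. pure T (diff OA \<phi>) \<omega> \<oplus>\<^bsub>T\<^esub> pure T (parity K A \<phi>) (diff OB \<omega>))"
  by (simp add: twisted_calculus_def Let_def module.defs calculus.defs W.TP_simps W.TP_class W.TP_extend)

lemma G_class: "gen_class G = gen_class T"
  by (simp add: gen_class_def fun_eq_iff G_simps)

lemma T_module: "module K T" by (rule W.AB_module)

sublocale T: module K T by (rule T_module)

lemma G_algebra: "assoc_algebra K G"
proof -
  have W: "ring W.TP" "module K W.TP" using W.TP_algebra by (simp_all add: assoc_algebra_def)
  interpret R: ring W.TP by fact
  have c: "carrier G = carrier W.TP" "add G = add W.TP" "\<zero>\<^bsub>G\<^esub> = \<zero>\<^bsub>W.TP\<^esub>" "smult G = smult W.TP" "\<one>\<^bsub>G\<^esub> = \<one>\<^bsub>W.TP\<^esub>"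
    "monoid.mult G = monoid.mult W.TP"
    by (simp_all add: G_simps W.TP_simps)
  have "abelian_group G" by (rule abelian_group_cong[OF R.abelian_group_axioms]) (simp_all add: c)
  then have "ring G"
    by (rule ringI[OF _ monoidI]) (simp_all add: c R.m_assoc R.l_distr R.r_distr)
  moreover have "module K G" by (rule module_cong[OF W(2)]) (simp_all add: c)
  ultimately show ?thesis using W.TP_algebra by (simp add: assoc_algebra_def c)
qed

lemma T_pure_closed: "\<phi> \<in> carrier OA \<Longrightarrow> \<omega> \<in> carrier OB \<Longrightarrow> pure T \<phi> \<omega> \<in> carrier T"
  by (rule kt_pure_closed[OF W.modA W.modB])

lemma pure_add: "\<phi> \<in> carrier OA \<Longrightarrow> \<phi>' \<in> carrier OA \<Longrightarrow> \<omega> \<in> carrier OB \<Longrightarrow>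
    pure T (\<phi> \<oplus>\<^bsub>OA\<^esub> \<phi>') \<omega> = pure T \<phi> \<omega> \<oplus>\<^bsub>T\<^esub> pure T \<phi>' \<omega>"
  "\<phi> \<in> carrier OA \<Longrightarrow> \<omega> \<in> carrier OB \<Longrightarrow> \<omega>' \<in> carrier OB \<Longrightarrow>
    pure T \<phi> (\<omega> \<oplus>\<^bsub>OB\<^esub> \<omega>') = pure T \<phi> \<omega> \<oplus>\<^bsub>T\<^esub> pure T \<phi> \<omega>'"
  using lin_add[OF kt_pure_left[OF W.modA W.modB]] lin_add[OF kt_pure_right[OF W.modA W.modB]] by blast+

lemma pure_sg: "\<phi> \<in> carrier OA \<Longrightarrow> \<omega> \<in> carrier OB \<Longrightarrow> pure T (sg OA n \<phi>) \<omega> = sg T n (pure T \<phi> \<omega>)"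
  "\<phi> \<in> carrier OA \<Longrightarrow> \<omega> \<in> carrier OB \<Longrightarrow> pure T \<phi> (sg OB n \<omega>) = sg T n (pure T \<phi> \<omega>)"
  using addmap_sg[OF lin_addmap[OF kt_pure_left[OF W.modA W.modB]]]
    addmap_sg[OF lin_addmap[OF kt_pure_right[OF W.modA W.modB]]] by blast+

lemma pure_zero: "\<omega> \<in> carrier OB \<Longrightarrow> pure T \<zero>\<^bsub>OA\<^esub> \<omega> = \<zero>\<^bsub>T\<^esub>"
  "\<phi> \<in> carrier OA \<Longrightarrow> pure T \<phi> \<zero>\<^bsub>OB\<^esub> = \<zero>\<^bsub>T\<^esub>"
  using lin_zero[OF kt_pure_left[OF W.modA W.modB]] lin_zero[OF kt_pure_right[OF W.modA W.modB]] by blast+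

lemma pure_minus: "\<phi> \<in> carrier OA \<Longrightarrow> \<omega> \<in> carrier OB \<Longrightarrow> pure T (\<ominus>\<^bsub>OA\<^esub> \<phi>) \<omega> = \<ominus>\<^bsub>T\<^esub> pure T \<phi> \<omega>"
  using lin_minus[OF kt_pure_left[OF W.modA W.modB]] by blast

lemmas tm_lin = tmap_lin[of K OA OA _ OB OB]
lemmas tm_pure = tmap_pure[of K OA OA _ OB OB]
lemmas idA = lin_id[OF W.modA] and idB = lin_id[OF W.modB]
lemmas lmA = bilin_right[OF assoc_algebra_bilin[OF UA.U_algebra]]
lemmas rmB = bilin_left[OF assoc_algebra_bilin[OF UB.U_algebra]]

text \<open>
  The subspaces \<open>\<Omega>\<^sup>pA \<otimes> \<Omega>\<^sup>qB\<close> and \<open>A \<otimes> \<Omega>\<^sup>qB\<close> of \<open>\<Omega>A \<otimes> \<Omega>B\<close>, as sets of sums of elementary tensors.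
\<close>

definition gr :: "nat \<Rightarrow> nat \<Rightarrow> ('a form, 'b form) tensor set" where
  "gr p q = add_span T {pure T \<phi> \<omega> | \<phi> \<omega>. \<phi> \<in> deg OA p \<and> \<omega> \<in> deg OB q}"

definition gr0 :: "nat \<Rightarrow> ('a form, 'b form) tensor set" where
  "gr0 q = add_span T {pure T (emb OA a) \<omega> | a \<omega>. a \<in> carrier A \<and> \<omega> \<in> deg OB q}"

lemma gr_gens: "{pure T \<phi> \<omega> | \<phi> \<omega>. \<phi> \<in> deg OA p \<and> \<omega> \<in> deg OB q} \<subseteq> carrier T"
  using UA.deg_U_sub UB.deg_U_sub T_pure_closed by blast

lemma gr0_gens: "{pure T (emb OA a) \<omega> | a \<omega>. a \<in> carrier A \<and> \<omega> \<in> deg OB q} \<subseteq> carrier T"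
  using lin_closed[OF UA.emb_lin] UB.deg_U_sub T_pure_closed by blast

lemma gr_closed: "t \<in> gr p q \<Longrightarrow> t \<in> carrier T"
  unfolding gr_def by (rule add_span_closed[OF T.abelian_group_axioms gr_gens])

lemma gr_pure: "\<phi> \<in> deg OA p \<Longrightarrow> \<omega> \<in> deg OB q \<Longrightarrow> pure T \<phi> \<omega> \<in> gr p q"
  unfolding gr_def by (rule add_span.base) blast

lemma gr0_pure: "a \<in> carrier A \<Longrightarrow> \<omega> \<in> deg OB q \<Longrightarrow> pure T (emb OA a) \<omega> \<in> gr0 q"
  unfolding gr0_def by (rule add_span.base) blast

lemma gr_map:
  assumes "addmap T T h" "\<And>\<phi> \<omega>. \<phi> \<in> deg OA p \<Longrightarrow> \<omega> \<in> deg OB q \<Longrightarrow> h (pure T \<phi> \<omega>) \<in> gr p' q'" "t \<in> gr p q"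
  shows "h t \<in> gr p' q'"
  using assms(3) unfolding gr_def
  by (rule addmap_span[OF assms(1) gr_gens, rotated]) (use assms(2) in \<open>auto simp: gr_def\<close>)

lemma gr0_map:
  assumes "addmap T T h" "\<And>a \<omega>. a \<in> carrier A \<Longrightarrow> \<omega> \<in> deg OB q \<Longrightarrow> h (pure T (emb OA a) \<omega>) \<in> gr0 q'" "t \<in> gr0 q"
  shows "h t \<in> gr0 q'"
  using assms(3) unfolding gr0_def
  by (rule addmap_span[OF assms(1) gr0_gens, rotated]) (use assms(2) in \<open>auto simp: gr0_def\<close>)

lemma gr_eq:
  assumes "addmap T P h" "addmap T P h'"
    "\<And>\<phi> \<omega>. \<phi> \<in> deg OA p \<Longrightarrow> \<omega> \<in> deg OB q \<Longrightarrow> h (pure T \<phi> \<omega>) = h' (pure T \<phi> \<omega>)" "t \<in> gr p q"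
  shows "h t = h' t"
  by (rule addmap_span_eq[OF assms(1,2) gr_gens _ assms(4)[unfolded gr_def]]) (use assms(3) in auto)

lemma gr0_gr: "t \<in> gr0 q \<Longrightarrow> t \<in> gr 0 q"
  unfolding gr0_def gr_def
  by (rule addmap_span[OF addmap_id[OF T.abelian_group_axioms] gr0_gens])
    (auto intro!: add_span.base UA.deg_emb)

lemma gr0_add: "s \<in> gr0 q \<Longrightarrow> t \<in> gr0 q \<Longrightarrow> s \<oplus>\<^bsub>T\<^esub> t \<in> gr0 q"
  unfolding gr0_def by (rule add_span.plus)

lemma gr0_zero: "\<zero>\<^bsub>T\<^esub> \<in> gr0 q"
  using gr0_pure[OF abelian_monoid.zero_closed[OF abelian_group.axioms(1)[OF module_abelian[OF modA]]] UB.deg_U_zero, of q] lin_zero[OF UA.emb_lin] by (simp add: pure_zero)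

lemma gr0_minus: "t \<in> gr0 q \<Longrightarrow> \<ominus>\<^bsub>T\<^esub> t \<in> gr0 q"
proof (rule gr0_map[OF addmap_uminus[OF addmap_id[OF T.abelian_group_axioms]]])
  fix a \<omega> assume "a \<in> carrier A" "\<omega> \<in> deg OB q"
  moreover from this have "\<ominus>\<^bsub>T\<^esub> pure T (emb OA a) \<omega> = pure T (emb OA (\<ominus>\<^bsub>A\<^esub> a)) \<omega>"
    using UB.deg_U_sub[of q] lin_minus[OF UA.emb_lin] by (simp add: pure_minus[symmetric] lin_closed[OF UA.emb_lin] subset_iff)
  ultimately show "\<ominus>\<^bsub>T\<^esub> pure T (emb OA a) \<omega> \<in> gr0 q" by (simp add: gr0_pure)
qed

lemma gr_add: "s \<in> gr p q \<Longrightarrow> t \<in> gr p q \<Longrightarrow> s \<oplus>\<^bsub>T\<^esub> t \<in> gr p q"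
  unfolding gr_def by (rule add_span.plus)

lemma gr_zero: "\<zero>\<^bsub>T\<^esub> \<in> gr p q"
  using gr_pure[OF UA.deg_U_zero UB.deg_U_zero, of p q] by (simp add: pure_zero)

lemma gr_minus: "t \<in> gr p q \<Longrightarrow> \<ominus>\<^bsub>T\<^esub> t \<in> gr p q"
proof (rule gr_map[OF addmap_uminus[OF addmap_id[OF T.abelian_group_axioms]]])
  fix \<phi> \<omega> assume "\<phi> \<in> deg OA p" "\<omega> \<in> deg OB q"
  moreover from this have "\<ominus>\<^bsub>T\<^esub> pure T \<phi> \<omega> = pure T (\<ominus>\<^bsub>OA\<^esub> \<phi>) \<omega>"
    using UB.deg_U_sub[of q] UA.deg_U_sub[of p] by (simp add: pure_minus subset_iff)
  ultimately show "\<ominus>\<^bsub>T\<^esub> pure T \<phi> \<omega> \<in> gr p q" by (simp add: gr_pure UA.deg_U_minus)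
qed

lemma Rt_bilin: "bilin K OB OA T (\<lambda>\<omega> \<phi>. Rt (pure S \<omega> \<phi>))"
  by (rule W.tw.B.tw_bilin)

lemma emb_closedA: "a \<in> carrier A \<Longrightarrow> emb OA a \<in> carrier OA" and emb_closedB: "b \<in> carrier B \<Longrightarrow> emb OB b \<in> carrier OB"
  using lin_closed[OF UA.emb_lin] lin_closed[OF UB.emb_lin] by blast+

lemma cl_El_A: "UA.cl [El a] = emb OA a" and cl_El_B: "UB.cl [El b] = emb OB b"
  by (simp_all add: UA.emb_U UB.emb_U)

lemma cl_Di_A: "a \<in> carrier A \<Longrightarrow> UA.cl [Di a] = diff OA (emb OA a)"
  and cl_Di_B: "b \<in> carrier B \<Longrightarrow> UB.cl [Di b] = diff OB (emb OB b)"
  by (simp_all add: UA.emb_U UB.emb_U UA.diff_di UB.diff_di)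

text \<open>
  On letters the map \<open>Rt\<close> is determined by \<open>R\<close> and the differentials, hence preserves degrees; words
  are then treated letter by letter, using multiplicativity of \<open>Rt\<close> first in \<open>\<Omega>B\<close> and afterwards in \<open>\<Omega>A\<close>.
  The first step is carried out with \<open>gr0\<close> in place of \<open>gr 0\<close>, since the compatibility condition for
  \<open>\<nabla>\<^sup>F\<close> requires \<open>Rt (\<eta> \<otimes> a)\<close> to come from \<open>A \<otimes> \<Omega>\<^sup>1B\<close>.
\<close>

lemma Rt_letter:
  assumes b: "b \<in> carrier B" and a: "a \<in> carrier A"
  shows "Rt (pure S (emb OB b) (emb OA a)) \<in> gr0 0" "Rt (pure S (diff OB (emb OB b)) (emb OA a)) \<in> gr0 1"
proof -
  have ba: "R (pure (ktensor K B A) b a) \<in> carrier AB"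
    by (rule tw.B.tw_closed[OF b a])
  have "tm (emb OA) (emb OB) v \<in> gr0 0" if "v \<in> carrier AB" for v
    using that
  proof (induction v rule: kt_induct[OF modA modB, consumes 1, case_names pure plus])
    case (pure x y)
    then show ?case by (simp add: tmap_pure[OF UA.emb_lin UB.emb_lin] gr0_pure UB.deg_emb)
  next
    case (plus s t)
    then show ?case by (simp add: lin_add[OF tmap_lin[OF UA.emb_lin UB.emb_lin]] gr0_add)
  qed
  then show *: "Rt (pure S (emb OB b) (emb OA a)) \<in> gr0 0"
    by (simp add: Rt_emb[OF b a] ba)
  show "Rt (pure S (diff OB (emb OB b)) (emb OA a)) \<in> gr0 1"
    unfolding Rt_diff_left[OF emb_closedB[OF b] emb_closedA[OF a]]
  proof (rule gr0_map[OF lin_addmap[OF tm_lin[OF UA.parity_lin UB.diff_lin]] _ *])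
    fix x \<omega> assume "x \<in> carrier A" "\<omega> \<in> deg OB 0"
    then show "tm (parity K A) (diff OB) (pure T (emb OA x) \<omega>) \<in> gr0 1"
      using UB.deg_U_sub[of 0] UB.diff_U_deg[of \<omega> 0]
      by (simp add: tm_pure[OF UA.parity_lin UB.diff_lin] emb_closedA subset_iff UA.parity_deg[OF UA.deg_emb] gr0_pure)
  qed
qed

lemma rho_gr0:
  assumes "\<omega> \<in> deg OB p" and ga: "\<And>a. a \<in> carrier A \<Longrightarrow> Rt (pure S \<omega> (emb OA a)) \<in> gr0 p" and t: "t \<in> gr0 q"
  shows "W.tw.B.rho \<omega> t \<in> gr0 (p + q)"
proof (rule gr0_map[OF lin_addmap[OF W.tw.B.rho_lin] _ t])
  show o: "\<omega> \<in> carrier OB" using assms(1) UB.deg_U_sub by blast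
  fix a \<eta> assume a: "a \<in> carrier A" and \<eta>: "\<eta> \<in> deg OB q"
  have e: "\<eta> \<in> carrier OB" using \<eta> UB.deg_U_sub by blast
  have "W.tw.B.rop \<eta> (Rt (pure S \<omega> (emb OA a))) \<in> gr0 (p + q)"
  proof (rule gr0_map[OF lin_addmap[OF W.tw.B.rop_lin[OF e]] _ ga[OF a]])
    fix x \<zeta> assume "x \<in> carrier A" "\<zeta> \<in> deg OB p"
    then show "W.tw.B.rop \<eta> (pure T (emb OA x) \<zeta>) \<in> gr0 (p + q)"
      using UB.deg_U_sub[of p] e \<eta> by (simp add: W.tw.B.rop_pure emb_closedA subset_iff gr0_pure UB.deg_U_mult)
  qed
  then show "W.tw.B.rho \<omega> (pure T (emb OA a) \<eta>) \<in> gr0 (p + q)"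
    using a e o by (simp add: W.tw.B.rho_pure emb_closedA)
qed

lemma Rt_gr0:
  assumes "\<omega> \<in> deg OB q" and a: "a \<in> carrier A"
  shows "Rt (pure S \<omega> (emb OA a)) \<in> gr0 q"
proof -
  have on_word: "\<forall>a \<in> carrier A. Rt (pure S (UB.cl w) (emb OA a)) \<in> gr0 (word_deg w)" if "w \<in> words B" for w
    using that
  proof (induction w rule: UB.words_induct)
    case Nil
    then show ?case
      using UB.deg_U_word[of "[]"] by (simp add: UB.one_U[symmetric] W.twist_unit_left emb_closedA gr0_pure)
  next
    case (El b w)
    show ?case
    proof
      fix a assume a: "a \<in> carrier A"
      have "Rt (pure S (UB.cl (El b # w)) (emb OA a)) = W.tw.B.rho (emb OB b) (Rt (pure S (UB.cl w) (emb OA a)))"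
        using El a W.tw.B.tau_act'[of "emb OB b" "UB.cl w" "emb OA a"]
        by (simp add: UB.cl_Cons[of _ w] cl_El_B emb_closedA emb_closedB)
      moreover have "\<dots> \<in> gr0 (0 + word_deg w)"
        by (rule rho_gr0[OF UB.deg_emb]) (use El a Rt_letter in auto)
      ultimately show "Rt (pure S (UB.cl (El b # w)) (emb OA a)) \<in> gr0 (word_deg (El b # w))" by simp
    qed
  next
    case (Di b w)
    show ?case
    proof
      fix a assume a: "a \<in> carrier A"
      have db: "diff OB (emb OB b) \<in> deg OB 1"
        using UB.diff_deg[OF UB.deg_emb[OF Di(1)]] by simp
      have "Rt (pure S (UB.cl (Di b # w)) (emb OA a)) = W.tw.B.rho (diff OB (emb OB b)) (Rt (pure S (UB.cl w) (emb OA a)))"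
        using Di a W.tw.B.tau_act'[of "diff OB (emb OB b)" "UB.cl w" "emb OA a"]
        by (simp add: UB.cl_Cons[of _ w] cl_Di_B emb_closedA emb_closedB)
      moreover have "\<dots> \<in> gr0 (1 + word_deg w)"
        by (rule rho_gr0[OF db]) (use Di a Rt_letter in auto)
      ultimately show "Rt (pure S (UB.cl (Di b # w)) (emb OA a)) \<in> gr0 (word_deg (Di b # w))" by simp
    qed
  qed
  note l = bilin_left[OF Rt_bilin emb_closedA[OF a]]
  show ?thesis
    using assms(1)
  proof (induction \<omega> rule: UB.deg_induct)
    case zero then show ?case by (simp add: lin_zero[OF l] gr0_zero)
  next
    case (word w) then show ?case using on_word a by blast
  next
    case (diff s t)
    then show ?case using gr0_add gr0_minus by (simp add: a_minus_def lin_add[OF l] lin_minus[OF l])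
  qed
qed

lemma kap_gr:
  assumes \<phi>: "\<phi> \<in> deg OA p" and IH: "\<And>\<omega>. \<omega> \<in> deg OB q \<Longrightarrow> Rt (pure S \<omega> \<phi>) \<in> gr p q" and t: "t \<in> gr p' q"
  shows "W.tw.B.kap \<phi> t \<in> gr (p' + p) q"
proof (rule gr_map[OF lin_addmap[OF W.tw.B.kap_lin] _ t])
  show f: "\<phi> \<in> carrier OA" using \<phi> UA.deg_U_sub by blast
  fix \<psi> \<omega> assume \<psi>: "\<psi> \<in> deg OA p'" and \<omega>: "\<omega> \<in> deg OB q"
  have c: "\<psi> \<in> carrier OA" "\<omega> \<in> carrier OB" using \<psi> \<omega> UA.deg_U_sub UB.deg_U_sub by blast+
  have "tm (monoid.mult OA \<psi>) (\<lambda>g. g) (Rt (pure S \<omega> \<phi>)) \<in> gr (p' + p) q"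
  proof (rule gr_map[OF lin_addmap[OF tm_lin[OF lmA[OF c(1)] idB]] _ IH[OF \<omega>]])
    fix \<alpha> \<beta> assume "\<alpha> \<in> deg OA p" "\<beta> \<in> deg OB q"
    then show "tm (monoid.mult OA \<psi>) (\<lambda>g. g) (pure T \<alpha> \<beta>) \<in> gr (p' + p) q"
      using UA.deg_U_sub[of p] UB.deg_U_sub[of q] \<psi>
      by (simp add: tm_pure[OF lmA[OF c(1)] idB] subset_iff gr_pure UA.deg_U_mult)
  qed
  then show "W.tw.B.kap \<phi> (pure T \<psi> \<omega>) \<in> gr (p' + p) q"
    using c by (simp add: W.tw.B.kap_def kt_lift_pure[OF W.modA W.modB W.tw.B.kap_bilin[OF f]])
qed

lemma Rt_gr:
  assumes \<omega>: "\<omega> \<in> deg OB q" and "\<phi> \<in> deg OA p"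
  shows "Rt (pure S \<omega> \<phi>) \<in> gr p q"
proof -
  have letter: "Rt (pure S \<omega> (diff OA (emb OA a))) \<in> gr 1 q" if \<omega>: "\<omega> \<in> deg OB q" and a: "a \<in> carrier A" for a \<omega>
  proof -
    have o: "\<omega> \<in> carrier OB" using \<omega> UB.deg_U_sub by blast
    show ?thesis
      unfolding Rt_diff_right[OF o emb_closedA[OF a]]
    proof (rule gr_map[OF lin_addmap[OF tm_lin[OF UA.diff_lin UB.parity_lin]] _ gr0_gr[OF Rt_gr0[OF \<omega> a]]])
      fix \<alpha> \<beta> assume "\<alpha> \<in> deg OA 0" "\<beta> \<in> deg OB q"
      then show "tm (diff OA) (parity K B) (pure T \<alpha> \<beta>) \<in> gr 1 q"
        using UA.deg_U_sub[of 0] UB.deg_U_sub[of q] UA.diff_U_deg[of \<alpha> 0] UB.deg_U_minus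
        by (auto simp add: tm_pure[OF UA.diff_lin UB.parity_lin] subset_iff UB.parity_deg sg_def intro!: gr_pure)
    qed
  qed
  have on_word: "\<forall>\<omega> \<in> deg OB q. Rt (pure S \<omega> (UA.cl w)) \<in> gr (word_deg w) q" if "w \<in> words A" for w
    using that
  proof (induction w rule: UA.words_induct)
    case Nil
    show ?case
    proof
      fix \<omega> assume \<omega>: "\<omega> \<in> deg OB q"
      then have "\<omega> \<in> carrier OB" using UB.deg_U_sub by blast
      then show "Rt (pure S \<omega> (UA.cl [])) \<in> gr (word_deg []) q"
        using \<omega> UA.deg_U_word[of "[]"] W.tw.B.tau_one by (simp add: UA.one_U gr_pure)
    qed
  next
    case (El a w)
    show ?case
    proof
      fix \<omega> assume \<omega>: "\<omega> \<in> deg OB q"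
      then have o: "\<omega> \<in> carrier OB" using UB.deg_U_sub by blast
      have "Rt (pure S \<omega> (UA.cl (El a # w))) = W.tw.B.kap (UA.cl w) (Rt (pure S \<omega> (emb OA a)))"
        using El o by (simp add: UA.cl_Cons[of _ w] cl_El_A W.tw.B.tau_mult' emb_closedA)
      moreover have "\<dots> \<in> gr (0 + word_deg w) q"
        by (rule kap_gr[OF UA.deg_U_word _ gr0_gr[OF Rt_gr0[OF \<omega>]]]) (use El in auto)
      ultimately show "Rt (pure S \<omega> (UA.cl (El a # w))) \<in> gr (word_deg (El a # w)) q" by simp
    qed
  next
    case (Di a w)
    show ?case
    proof
      fix \<omega> assume \<omega>: "\<omega> \<in> deg OB q"
      then have o: "\<omega> \<in> carrier OB" using UB.deg_U_sub by blast
      have "Rt (pure S \<omega> (UA.cl (Di a # w))) = W.tw.B.kap (UA.cl w) (Rt (pure S \<omega> (diff OA (emb OA a))))"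
        using Di o by (simp add: UA.cl_Cons[of _ w] cl_Di_A W.tw.B.tau_mult' emb_closedA)
      moreover have "\<dots> \<in> gr (1 + word_deg w) q"
        by (rule kap_gr[OF UA.deg_U_word _ letter[OF \<omega>]]) (use Di in auto)
      ultimately show "Rt (pure S \<omega> (UA.cl (Di a # w))) \<in> gr (word_deg (Di a # w)) q" by simp
    qed
  qed
  have o: "\<omega> \<in> carrier OB" using \<omega> UB.deg_U_sub by blast
  note r = bilin_right[OF Rt_bilin o]
  show ?thesis
    using assms(2)
  proof (induction \<phi> rule: UA.deg_induct)
    case zero then show ?case by (simp add: lin_zero[OF r] gr_zero)
  next
    case (word w) then show ?case using on_word \<omega> by blast
  next
    case (diff s t)
    then show ?case using gr_add gr_minus by (simp add: a_minus_def lin_add[OF r] lin_minus[OF r])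
  qed
qed

lemma T_eqI:
  assumes h: "addmap T P h" and h': "addmap T P h'"
    and eq: "\<And>p \<phi> \<omega>. \<phi> \<in> deg OA p \<Longrightarrow> \<omega> \<in> carrier OB \<Longrightarrow> h (pure T \<phi> \<omega>) = h' (pure T \<phi> \<omega>)" and t: "t \<in> carrier T"
  shows "h t = h' t"
proof (rule kt_eqI[OF W.modA W.modB h h' _ t])
  fix \<phi> \<omega> assume \<phi>: "\<phi> \<in> carrier OA" and \<omega>: "\<omega> \<in> carrier OB"
  note l = lin_addmap[OF kt_pure_left[OF W.modA W.modB \<omega>]]
  show "h (pure T \<phi> \<omega>) = h' (pure T \<phi> \<omega>)"
    by (rule UA.U.addmap_eqI[OF addmap_comp[OF l h] addmap_comp[OF l h'] eq[OF UA.deg_U_word \<omega>] \<phi>])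
qed

lemma G_diff_bilin: "bilin K OA OB T (\<lambda>\<phi> \<omega>. pure T (diff OA \<phi>) \<omega> \<oplus>\<^bsub>T\<^esub> pure T (parity K A \<phi>) (diff OB \<omega>))"
proof (rule bilinI[OF W.modA W.modB T_module])
  show "lin K OA T (\<lambda>\<phi>. pure T (diff OA \<phi>) \<omega> \<oplus>\<^bsub>T\<^esub> pure T (parity K A \<phi>) (diff OB \<omega>))" if "\<omega> \<in> carrier OB" for \<omega>
    by (rule lin_plus[OF bilin_L[OF kt_pure_bilin[OF W.modA W.modB] that UA.diff_lin]
        bilin_L[OF kt_pure_bilin[OF W.modA W.modB] lin_closed[OF UB.diff_lin that] UA.parity_lin]])
  show "lin K OB T (\<lambda>\<omega>. pure T (diff OA \<phi>) \<omega> \<oplus>\<^bsub>T\<^esub> pure T (parity K A \<phi>) (diff OB \<omega>))" if "\<phi> \<in> carrier OA" for \<phi>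
    by (rule lin_plus[OF kt_pure_right[OF W.modA W.modB lin_closed[OF UA.diff_lin that]]
        bilin_R[OF kt_pure_bilin[OF W.modA W.modB] lin_closed[OF UA.parity_lin that] UB.diff_lin]])
qed

lemma G_diff_lin: "lin K T T (diff G)"
  unfolding G_diff_raw by (rule kt_lift[OF W.modA W.modB G_diff_bilin])

lemma G_diff_pure:
  assumes "\<phi> \<in> deg OA p" "\<omega> \<in> carrier OB"
  shows "diff G (pure T \<phi> \<omega>) = pure T (diff OA \<phi>) \<omega> \<oplus>\<^bsub>T\<^esub> sg T p (pure T \<phi> (diff OB \<omega>))"
proof -
  have c: "\<phi> \<in> carrier OA" using assms(1) UA.deg_U_sub by blast
  show ?thesis
    unfolding G_diff_raw using kt_lift_pure[OF W.modA W.modB G_diff_bilin c assms(2)] assms c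
    by (simp add: UA.parity_deg pure_sg lin_closed[OF UB.diff_lin])
qed

lemma a_inv_TP: "\<ominus>\<^bsub>W.TP\<^esub> x = \<ominus>\<^bsub>T\<^esub> x"
  by (simp add: a_inv_def m_inv_def W.TP_simps)

lemma deg_G_gen: "\<phi> \<in> deg OA p \<Longrightarrow> \<omega> \<in> deg OB q \<Longrightarrow> pure T \<phi> \<omega> \<in> deg G (p + q)"
  unfolding G_simps by (rule generate.incl) blast

lemma deg_G_add: "s \<in> deg G n \<Longrightarrow> t \<in> deg G n \<Longrightarrow> s \<oplus>\<^bsub>T\<^esub> t \<in> deg G n"
  unfolding G_simps using generate.eng[of s "add_monoid W.TP" _ t] by (simp add: W.TP_simps)

lemma deg_G_zero: "\<zero>\<^bsub>T\<^esub> \<in> deg G n"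
  unfolding G_simps using generate.one[of "add_monoid W.TP"] by (simp add: W.TP_simps)

lemma deg_G_induct [consumes 1, case_names pure plus]:
  assumes "t \<in> deg G n"
    and pure: "\<And>p q \<phi> \<omega>. p + q = n \<Longrightarrow> \<phi> \<in> deg OA p \<Longrightarrow> \<omega> \<in> deg OB q \<Longrightarrow> Q (pure T \<phi> \<omega>)"
    and plus: "\<And>s t. s \<in> carrier T \<Longrightarrow> t \<in> carrier T \<Longrightarrow> Q s \<Longrightarrow> Q t \<Longrightarrow> Q (s \<oplus>\<^bsub>T\<^esub> t)"
  shows "Q t"
proof -
  have "t \<in> carrier T \<and> Q t"
    using assms(1) unfolding G_simps
  proof (induction t rule: generate.induct)
    case one
    have "pure T \<zero>\<^bsub>OA\<^esub> \<zero>\<^bsub>OB\<^esub> = \<zero>\<^bsub>T\<^esub>" by (rule pure_zero) simp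
    then show ?case using pure[OF _ UA.deg_U_zero[of 0] UB.deg_U_zero[of n]] by (simp add: W.TP_simps)
  next
    case (incl h)
    then show ?case using pure UA.deg_U_sub UB.deg_U_sub T_pure_closed by blast
  next
    case (inv h)
    then obtain p q \<phi> \<omega> where h: "h = pure T \<phi> \<omega>" "p + q = n" "\<phi> \<in> deg OA p" "\<omega> \<in> deg OB q" by blast
    then have c: "\<phi> \<in> carrier OA" "\<omega> \<in> carrier OB" using UA.deg_U_sub UB.deg_U_sub by blast+
    have "inv\<^bsub>add_monoid W.TP\<^esub> h = pure T (\<ominus>\<^bsub>OA\<^esub> \<phi>) \<omega>"
      using a_inv_TP[of h] by (simp add: a_inv_def h(1) pure_minus[OF c, unfolded a_inv_def])
    moreover have "\<ominus>\<^bsub>OA\<^esub> \<phi> \<in> carrier OA" using c by simp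
    ultimately show ?case using pure[OF h(2) UA.deg_U_minus[OF h(3)] h(4)] T_pure_closed c by simp
  next
    case (eng s t)
    then show ?case using plus by (simp add: W.TP_simps)
  qed
  then show ?thesis ..
qed

lemma deg_G_sub: "deg G n \<subseteq> carrier T"
proof
  show "t \<in> carrier T" if "t \<in> deg G n" for t
    using that
  proof (induction t rule: deg_G_induct)
    case (pure p q \<phi> \<omega>)
    then show ?case using UA.deg_U_sub UB.deg_U_sub T_pure_closed by blast
  qed simp
qed

lemma deg_G_map:
  assumes h: "addmap T T h" and "\<And>p q \<phi> \<omega>. p + q = n \<Longrightarrow> \<phi> \<in> deg OA p \<Longrightarrow> \<omega> \<in> deg OB q \<Longrightarrow> h (pure T \<phi> \<omega>) \<in> deg G m"
    and t: "t \<in> deg G n"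
  shows "h t \<in> deg G m"
  using t
proof (induction t rule: deg_G_induct)
  case (plus s t) then show ?case by (simp add: addmap_add[OF h] deg_G_add)
qed (rule assms(2))

lemma gr_deg: "t \<in> gr p q \<Longrightarrow> t \<in> deg G (p + q)"
  unfolding gr_def by (induction rule: add_span.induct) (auto intro: deg_G_gen deg_G_add)

lemma deg_G_minus: "t \<in> deg G n \<Longrightarrow> \<ominus>\<^bsub>T\<^esub> t \<in> deg G n"
proof (rule deg_G_map[OF addmap_uminus[OF addmap_id[OF T.abelian_group_axioms]]])
  fix p q \<phi> \<omega> assume "p + q = n" "\<phi> \<in> deg OA p" "\<omega> \<in> deg OB q"
  then show "\<ominus>\<^bsub>T\<^esub> pure T \<phi> \<omega> \<in> deg G n" using gr_deg[OF gr_minus[OF gr_pure]] by blast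
qed

lemma sg_deg_G: "t \<in> deg G n \<Longrightarrow> sg T m t \<in> deg G n"
  by (simp add: sg_def deg_G_minus)

lemma G_mult_lin: "s \<in> carrier T \<Longrightarrow> lin K T T (monoid.mult G s)" "s \<in> carrier T \<Longrightarrow> lin K T T (\<lambda>t. t \<otimes>\<^bsub>G\<^esub> s)"
proof -
  have "module K G" using assoc_algebraD(2)[OF G_algebra] .
  then have dom: "lin K G G h \<Longrightarrow> lin K T T h" for h
    using T_module by (simp add: lin_def linear_map_def hom_def G_simps)
  note b = assoc_algebra_bilin[OF G_algebra]
  show "s \<in> carrier T \<Longrightarrow> lin K T T (monoid.mult G s)" "s \<in> carrier T \<Longrightarrow> lin K T T (\<lambda>t. t \<otimes>\<^bsub>G\<^esub> s)"
    using dom[OF bilin_right[OF b]] dom[OF bilin_left[OF b]] by (simp_all add: G_simps(1))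
qed

lemma G_mult_pure:
  assumes "\<phi> \<in> carrier OA" "\<omega> \<in> carrier OB" "\<phi>' \<in> carrier OA" "\<omega>' \<in> carrier OB"
  shows "pure T \<phi> \<omega> \<otimes>\<^bsub>G\<^esub> pure T \<phi>' \<omega>' = tm (\<lambda>x. \<phi> \<otimes>\<^bsub>OA\<^esub> x) (\<lambda>y. y \<otimes>\<^bsub>OB\<^esub> \<omega>') (Rt (pure S \<omega> \<phi>'))"
  unfolding G_simps by (rule W.TP_mult_pure[OF assms])

lemma deg_G_mult:
  assumes s: "s \<in> deg G m" and t: "t \<in> deg G n"
  shows "s \<otimes>\<^bsub>G\<^esub> t \<in> deg G (m + n)"
proof -
  have tc: "t \<in> carrier T" using t deg_G_sub by blast
  show ?thesis
  proof (rule deg_G_map[OF lin_addmap[OF G_mult_lin(2)[OF tc]] _ s])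
    fix p q \<phi> \<omega> assume 1: "p + q = m" "\<phi> \<in> deg OA p" "\<omega> \<in> deg OB q"
    then have c1: "\<phi> \<in> carrier OA" "\<omega> \<in> carrier OB" using UA.deg_U_sub UB.deg_U_sub by blast+
    show "pure T \<phi> \<omega> \<otimes>\<^bsub>G\<^esub> t \<in> deg G (m + n)"
    proof (rule deg_G_map[OF lin_addmap[OF G_mult_lin(1)[OF T_pure_closed[OF c1]]] _ t])
      fix p' q' \<phi>' \<omega>' assume 2: "p' + q' = n" "\<phi>' \<in> deg OA p'" "\<omega>' \<in> deg OB q'"
      then have c2: "\<phi>' \<in> carrier OA" "\<omega>' \<in> carrier OB" using UA.deg_U_sub UB.deg_U_sub by blast+
      have "tm (\<lambda>x. \<phi> \<otimes>\<^bsub>OA\<^esub> x) (\<lambda>y. y \<otimes>\<^bsub>OB\<^esub> \<omega>') (Rt (pure S \<omega> \<phi>')) \<in> gr (p + p') (q + q')"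
      proof (rule gr_map[OF lin_addmap[OF tm_lin[OF lmA[OF c1(1)] rmB[OF c2(2)]]] _ Rt_gr[OF 1(3) 2(2)]])
        fix \<alpha> \<beta> assume "\<alpha> \<in> deg OA p'" "\<beta> \<in> deg OB q"
        then show "tm (\<lambda>x. \<phi> \<otimes>\<^bsub>OA\<^esub> x) (\<lambda>y. y \<otimes>\<^bsub>OB\<^esub> \<omega>') (pure T \<alpha> \<beta>) \<in> gr (p + p') (q + q')"
          using UA.deg_U_sub[of p'] UB.deg_U_sub[of q] 1 2
          by (simp add: tm_pure[OF lmA[OF c1(1)] rmB[OF c2(2)]] subset_iff gr_pure UA.deg_U_mult UB.deg_U_mult)
      qed
      from gr_deg[OF this] show "pure T \<phi> \<omega> \<otimes>\<^bsub>G\<^esub> pure T \<phi>' \<omega>' \<in> deg G (m + n)"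
        using 1(1) 2(1) by (simp add: G_mult_pure[OF c1 c2] algebra_simps)
    qed
  qed
qed

lemma diff_G_deg:
  assumes "s \<in> deg G n" shows "diff G s \<in> deg G (Suc n)"
proof (rule deg_G_map[OF lin_addmap[OF G_diff_lin] _ assms])
  fix p q \<phi> \<omega> assume 1: "p + q = n" "\<phi> \<in> deg OA p" "\<omega> \<in> deg OB q"
  then have c: "\<phi> \<in> carrier OA" "\<omega> \<in> carrier OB" using UA.deg_U_sub UB.deg_U_sub by blast+
  show "diff G (pure T \<phi> \<omega>) \<in> deg G (Suc n)"
    using deg_G_gen[OF UA.diff_U_deg[OF 1(2)] 1(3)] deg_G_gen[OF 1(2) UB.diff_U_deg[OF 1(3)]] 1(1)
    by (simp add: G_diff_pure[OF 1(2) c(2)] deg_G_add sg_deg_G)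
qed

lemma diff_G_diff:
  assumes "s \<in> carrier T" shows "diff G (diff G s) = \<zero>\<^bsub>T\<^esub>"
proof (rule T_eqI[OF lin_addmap[OF lin_comp[OF G_diff_lin G_diff_lin]] _ _ assms, of "\<lambda>_. \<zero>\<^bsub>T\<^esub>"])
  show "addmap T T (\<lambda>_. \<zero>\<^bsub>T\<^esub>)" using lin_addmap[OF lin_zero_map[OF T_module T_module]] .
  fix p \<phi> \<omega> assume 1: "\<phi> \<in> deg OA p" and \<omega>: "\<omega> \<in> carrier OB"
  have c: "\<phi> \<in> carrier OA" using 1 UA.deg_U_sub by blast
  have "sg T (Suc p) x \<oplus>\<^bsub>T\<^esub> sg T p x = \<zero>\<^bsub>T\<^esub>" if "x \<in> carrier T" for x
    using that by (simp add: sg_def T.l_neg T.r_neg)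
  then show "diff G (diff G (pure T \<phi> \<omega>)) = \<zero>\<^bsub>T\<^esub>"
    using c \<omega>
    by (simp add: G_diff_pure[OF 1] G_diff_pure[OF UA.diff_U_deg[OF 1]] lin_add[OF G_diff_lin] T_pure_closed
        addmap_sg[OF lin_addmap[OF G_diff_lin], symmetric] UA.diff_U_diff UB.diff_U_diff pure_zero)
      (simp add: G_diff_pure[OF 1] addmap_sg[OF lin_addmap[OF G_diff_lin]] UB.diff_U_diff pure_zero T_pure_closed T.sg_add
        T.a_assoc[symmetric], simp add: sg_def)
qed

text \<open>
  Both sides are expressed through \<open>V = Rt (\<omega> \<otimes> \<phi>')\<close>, which has bidegree \<open>(p', q)\<close>.  On the left the
  differential meets \<open>\<phi> V \<omega>'\<close>, to which the Leibniz rules of \<open>\<Omega>A\<close> and \<open>\<Omega>B\<close> apply.  On the right, \<open>d \<omega>\<close> and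
  \<open>d \<phi>'\<close> sit inside \<open>Rt\<close>; passing \<open>d\<close> to the outside costs the signs \<open>(-1)\<^sup>p'\<close> and \<open>(-1)\<^sup>q\<close>.
\<close>

lemma diff_G_mult_pure:
  assumes 1: "\<phi> \<in> deg OA p" "\<omega> \<in> deg OB q" and 2: "\<phi>' \<in> deg OA p'" and \<omega>': "\<omega>' \<in> carrier OB"
  shows "diff G (pure T \<phi> \<omega> \<otimes>\<^bsub>G\<^esub> pure T \<phi>' \<omega>') =
    diff G (pure T \<phi> \<omega>) \<otimes>\<^bsub>G\<^esub> pure T \<phi>' \<omega>' \<oplus>\<^bsub>T\<^esub> sg T (p + q) (pure T \<phi> \<omega> \<otimes>\<^bsub>G\<^esub> diff G (pure T \<phi>' \<omega>'))"
proof -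
  have c1: "\<phi> \<in> carrier OA" "\<omega> \<in> carrier OB" and c2: "\<phi>' \<in> carrier OA"
    using 1 2 UA.deg_U_sub UB.deg_U_sub by blast+
  have d: "diff OA \<phi> \<in> carrier OA" "diff OB \<omega> \<in> carrier OB" "diff OA \<phi>' \<in> carrier OA" "diff OB \<omega>' \<in> carrier OB"
    using c1 c2 \<omega>' by simp_all
  define V where "V = Rt (pure S \<omega> \<phi>')"
  have V: "V \<in> gr p' q" unfolding V_def by (rule Rt_gr[OF 1(2) 2])
  have Vc: "V \<in> carrier T" using gr_closed[OF V] .
  let ?m = "tm (monoid.mult OA \<phi>) (\<lambda>y. y \<otimes>\<^bsub>OB\<^esub> \<omega>')"
  let ?a = "tm (monoid.mult OA (diff OA \<phi>)) (\<lambda>y. y \<otimes>\<^bsub>OB\<^esub> \<omega>')"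
  let ?b = "tm (monoid.mult OA \<phi>) (\<lambda>y. y \<otimes>\<^bsub>OB\<^esub> diff OB \<omega>')"
  let ?dl = "tm (diff OA) (\<lambda>y. y)" and ?dr = "tm (\<lambda>x. x) (diff OB)"
  have lm: "lin K T T ?m" by (rule tm_lin[OF lmA[OF c1(1)] rmB[OF \<omega>']])
  have la: "lin K T T ?a" by (rule tm_lin[OF lmA[OF d(1)] rmB[OF \<omega>']])
  have lb: "lin K T T ?b" by (rule tm_lin[OF lmA[OF c1(1)] rmB[OF d(4)]])
  have ldl: "lin K T T ?dl" by (rule tm_lin[OF UA.diff_lin idB])
  have ldr: "lin K T T ?dr" by (rule tm_lin[OF idA UB.diff_lin])
  have cl: "?m v \<in> carrier T" "?a v \<in> carrier T" "?b v \<in> carrier T" "?dl v \<in> carrier T" "?dr v \<in> carrier T" if "v \<in> carrier T" for v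
    using that by (simp_all add: lin_closed[OF lm] lin_closed[OF la] lin_closed[OF lb] lin_closed[OF ldl] lin_closed[OF ldr])
  \<comment> \<open>The Leibniz rules of \<open>\<Omega>A\<close> and \<open>\<Omega>B\<close>, with \<open>\<phi> \<alpha>\<close> of degree \<open>p + p'\<close>.\<close>
  have lhs: "diff G (?m V) = ?a V \<oplus>\<^bsub>T\<^esub> sg T p (?m (?dl V)) \<oplus>\<^bsub>T\<^esub> (sg T (p + p') (?m (?dr V)) \<oplus>\<^bsub>T\<^esub> sg T (p + p' + q) (?b V))"
  proof (rule gr_eq[OF lin_addmap[OF lin_comp[OF G_diff_lin lm]]
        addmap_plus[OF addmap_plus[OF lin_addmap[OF la] sg_addmap[OF lin_addmap[OF lin_comp[OF lm ldl]]]]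
          addmap_plus[OF sg_addmap[OF lin_addmap[OF lin_comp[OF lm ldr]]] sg_addmap[OF lin_addmap[OF lb]]]] _ V])
    fix \<alpha> \<beta> assume \<alpha>: "\<alpha> \<in> deg OA p'" and \<beta>: "\<beta> \<in> deg OB q"
    have c: "\<alpha> \<in> carrier OA" "\<beta> \<in> carrier OB" using \<alpha> \<beta> UA.deg_U_sub UB.deg_U_sub by blast+
    have "diff G (?m (pure T \<alpha> \<beta>)) = diff G (pure T (\<phi> \<otimes>\<^bsub>OA\<^esub> \<alpha>) (\<beta> \<otimes>\<^bsub>OB\<^esub> \<omega>'))"
      by (simp add: tm_pure[OF lmA[OF c1(1)] rmB[OF \<omega>']] c)
    also have "\<dots> = pure T (diff OA (\<phi> \<otimes>\<^bsub>OA\<^esub> \<alpha>)) (\<beta> \<otimes>\<^bsub>OB\<^esub> \<omega>') \<oplus>\<^bsub>T\<^esub> sg T (p + p') (pure T (\<phi> \<otimes>\<^bsub>OA\<^esub> \<alpha>) (diff OB (\<beta> \<otimes>\<^bsub>OB\<^esub> \<omega>')))"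
      by (rule G_diff_pure[OF UA.deg_U_mult[OF 1(1) \<alpha>]]) (simp add: c \<omega>')
    also have "diff OA (\<phi> \<otimes>\<^bsub>OA\<^esub> \<alpha>) = diff OA \<phi> \<otimes>\<^bsub>OA\<^esub> \<alpha> \<oplus>\<^bsub>OA\<^esub> sg OA p (\<phi> \<otimes>\<^bsub>OA\<^esub> diff OA \<alpha>)"
      by (rule UA.diff_U_mult[OF 1(1) c(1)])
    also have "diff OB (\<beta> \<otimes>\<^bsub>OB\<^esub> \<omega>') = diff OB \<beta> \<otimes>\<^bsub>OB\<^esub> \<omega>' \<oplus>\<^bsub>OB\<^esub> sg OB q (\<beta> \<otimes>\<^bsub>OB\<^esub> diff OB \<omega>')"
      by (rule UB.diff_U_mult[OF \<beta> \<omega>'])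
    finally show "diff G (?m (pure T \<alpha> \<beta>)) = ?a (pure T \<alpha> \<beta>) \<oplus>\<^bsub>T\<^esub> sg T p (?m (?dl (pure T \<alpha> \<beta>))) \<oplus>\<^bsub>T\<^esub>
        (sg T (p + p') (?m (?dr (pure T \<alpha> \<beta>))) \<oplus>\<^bsub>T\<^esub> sg T (p + p' + q) (?b (pure T \<alpha> \<beta>)))"
      using c c1 \<omega>' d
      by (simp add: tm_pure[OF lmA[OF c1(1)] rmB[OF \<omega>']] tm_pure[OF lmA[OF d(1)] rmB[OF \<omega>']]
          tm_pure[OF lmA[OF c1(1)] rmB[OF d(4)]] tm_pure[OF UA.diff_lin idB] tm_pure[OF idA UB.diff_lin]
          pure_add pure_sg T.sg_add T.sg_sg T_pure_closed)
  qed
  have s0: "pure T \<phi> \<omega> \<otimes>\<^bsub>G\<^esub> pure T \<phi>' \<omega>' = ?m V"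
    unfolding V_def by (rule G_mult_pure[OF c1 c2 \<omega>'])
  have s1: "pure T (diff OA \<phi>) \<omega> \<otimes>\<^bsub>G\<^esub> pure T \<phi>' \<omega>' = ?a V"
    unfolding V_def by (rule G_mult_pure[OF d(1) c1(2) c2 \<omega>'])
  have s2: "pure T \<phi> (diff OB \<omega>) \<otimes>\<^bsub>G\<^esub> pure T \<phi>' \<omega>' = sg T p' (?m (?dr V))"
  proof -
    have "tm (parity K A) (diff OB) V = sg T p' (?dr V)"
    proof (rule gr_eq[OF lin_addmap[OF tm_lin[OF UA.parity_lin UB.diff_lin]] sg_addmap[OF lin_addmap[OF ldr]] _ V])
      fix \<alpha> \<beta> assume \<alpha>: "\<alpha> \<in> deg OA p'" and \<beta>: "\<beta> \<in> deg OB q"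
      have c: "\<alpha> \<in> carrier OA" "\<beta> \<in> carrier OB" using \<alpha> \<beta> UA.deg_U_sub UB.deg_U_sub by blast+
      show "tm (parity K A) (diff OB) (pure T \<alpha> \<beta>) = sg T p' (?dr (pure T \<alpha> \<beta>))"
        using c by (simp add: tm_pure[OF UA.parity_lin UB.diff_lin] tm_pure[OF idA UB.diff_lin] UA.parity_deg[OF \<alpha>] pure_sg)
    qed
    then show ?thesis
      using G_mult_pure[OF c1(1) d(2) c2 \<omega>'] Rt_diff_left[OF c1(2) c2] addmap_sg[OF lin_addmap[OF lm], of "?dr V" p'] cl Vc
      by (simp add: V_def)
  qed
  have s3: "pure T \<phi> \<omega> \<otimes>\<^bsub>G\<^esub> pure T (diff OA \<phi>') \<omega>' = sg T q (?m (?dl V))"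
  proof -
    have "tm (diff OA) (parity K B) V = sg T q (?dl V)"
    proof (rule gr_eq[OF lin_addmap[OF tm_lin[OF UA.diff_lin UB.parity_lin]] sg_addmap[OF lin_addmap[OF ldl]] _ V])
      fix \<alpha> \<beta> assume \<alpha>: "\<alpha> \<in> deg OA p'" and \<beta>: "\<beta> \<in> deg OB q"
      have c: "\<alpha> \<in> carrier OA" "\<beta> \<in> carrier OB" using \<alpha> \<beta> UA.deg_U_sub UB.deg_U_sub by blast+
      show "tm (diff OA) (parity K B) (pure T \<alpha> \<beta>) = sg T q (?dl (pure T \<alpha> \<beta>))"
        using c by (simp add: tm_pure[OF UA.diff_lin UB.parity_lin] tm_pure[OF UA.diff_lin idB] UB.parity_deg[OF \<beta>] pure_sg)
    qed
    then show ?thesis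
      using G_mult_pure[OF c1 d(3) \<omega>'] Rt_diff_right[OF c1(2) c2] addmap_sg[OF lin_addmap[OF lm], of "?dl V" q] cl Vc
      by (simp add: V_def)
  qed
  have s4: "pure T \<phi> \<omega> \<otimes>\<^bsub>G\<^esub> pure T \<phi>' (diff OB \<omega>') = ?b V"
    unfolding V_def by (rule G_mult_pure[OF c1 c2 d(4)])
  have t1: "diff G (pure T \<phi> \<omega>) \<otimes>\<^bsub>G\<^esub> pure T \<phi>' \<omega>' = ?a V \<oplus>\<^bsub>T\<^esub> sg T (p + p') (?m (?dr V))"
  proof -
    note l = G_mult_lin(2)[OF T_pure_closed[OF c2 \<omega>']]
    have "diff G (pure T \<phi> \<omega>) \<otimes>\<^bsub>G\<^esub> pure T \<phi>' \<omega>' = pure T (diff OA \<phi>) \<omega> \<otimes>\<^bsub>G\<^esub> pure T \<phi>' \<omega>' \<oplus>\<^bsub>T\<^esub>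
        sg T p (pure T \<phi> (diff OB \<omega>) \<otimes>\<^bsub>G\<^esub> pure T \<phi>' \<omega>')"
      using c1 d by (simp add: G_diff_pure[OF 1(1) c1(2)] lin_add[OF l] addmap_sg[OF lin_addmap[OF l]] T_pure_closed)
    then show ?thesis using cl Vc by (simp add: s1 s2 T.sg_sg)
  qed
  have t2: "sg T (p + q) (pure T \<phi> \<omega> \<otimes>\<^bsub>G\<^esub> diff G (pure T \<phi>' \<omega>')) = sg T p (?m (?dl V)) \<oplus>\<^bsub>T\<^esub> sg T (p + p' + q) (?b V)"
  proof -
    note l = G_mult_lin(1)[OF T_pure_closed[OF c1]]
    have e: "sg T (p + q + q) x = sg T p x" "sg T (p + q + p') x = sg T (p + p' + q) x" for x
      by (simp add: sg_def, simp add: add.assoc add.commute[of q])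
    have "pure T \<phi> \<omega> \<otimes>\<^bsub>G\<^esub> diff G (pure T \<phi>' \<omega>') = pure T \<phi> \<omega> \<otimes>\<^bsub>G\<^esub> pure T (diff OA \<phi>') \<omega>' \<oplus>\<^bsub>T\<^esub>
        sg T p' (pure T \<phi> \<omega> \<otimes>\<^bsub>G\<^esub> pure T \<phi>' (diff OB \<omega>'))"
      using c2 d \<omega>' by (simp add: G_diff_pure[OF 2 \<omega>'] lin_add[OF l] addmap_sg[OF lin_addmap[OF l]] T_pure_closed)
    then show ?thesis using cl Vc by (simp add: s3 s4 T.sg_sg T.sg_add e)
  qed
  show ?thesis
    unfolding s0 lhs t1 t2 using cl Vc T.a_assoc T.a_lcomm by simp
qed

lemma emb_G_lin: "lin K TP G (emb G)"
  by (rule lin_cong_cod[of K TP T], unfold G_simps lin_TP_dom, rule tmap_lin[OF UA.emb_lin UB.emb_lin])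
    (simp_all add: G_simps)

lemma emb_G_mult:
  assumes x: "x \<in> carrier AB" and y: "y \<in> carrier AB"
  shows "emb G (x \<otimes>\<^bsub>TP\<^esub> y) = emb G x \<otimes>\<^bsub>G\<^esub> emb G y"
proof -
  note le = tmap_lin[OF UA.emb_lin UB.emb_lin]
  have bi: "bilin K AB AB AB (monoid.mult TP)"
    using TP_mult_bilin AB_module by (simp add: bilin_def lin_TP_dom lin_TP_cod TP_simps(1))
  note l = bilin_left[OF bi] and r = bilin_right[OF bi]
  have p: "pure AB a b \<in> carrier AB" if "a \<in> carrier A" "b \<in> carrier B" for a b
    by (rule kt_pure_closed[OF modA modB that])
  note ec = lin_closed[OF le]
  have "tm (emb OA) (emb OB) (x \<otimes>\<^bsub>TP\<^esub> y) = tm (emb OA) (emb OB) x \<otimes>\<^bsub>G\<^esub> tm (emb OA) (emb OB) y"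
  proof (rule kt_lin_eqI[OF modA modB lin_comp[OF le l[OF y]] lin_comp[OF G_mult_lin(2)[OF ec[OF y]] le] _ x])
    fix a b assume ab: "a \<in> carrier A" "b \<in> carrier B"
    note eab = ec[OF p[OF ab]]
    show "tm (emb OA) (emb OB) (pure AB a b \<otimes>\<^bsub>TP\<^esub> y) = tm (emb OA) (emb OB) (pure AB a b) \<otimes>\<^bsub>G\<^esub> tm (emb OA) (emb OB) y"
    proof (rule kt_lin_eqI[OF modA modB lin_comp[OF le r[OF p[OF ab]]] lin_comp[OF G_mult_lin(1)[OF eab] le] _ y])
      fix a' b' assume ab': "a' \<in> carrier A" "b' \<in> carrier B"
      note v = tw.B.tw_closed[OF ab(2) ab'(1)]
      note la = bilin_right[OF assoc_algebra_bilin[OF algA] ab(1)]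
      note rb = bilin_left[OF assoc_algebra_bilin[OF algB] ab'(2)]
      note la' = lmA[OF emb_closedA[OF ab(1)]] and rb' = rmB[OF emb_closedB[OF ab'(2)]]
      let ?V = "R (pure (ktensor K B A) b a')"
      have "tm (emb OA) (emb OB) (pure AB a b \<otimes>\<^bsub>TP\<^esub> pure AB a' b')
          = tm (\<lambda>x. emb OA (a \<otimes>\<^bsub>A\<^esub> x)) (\<lambda>y. emb OB (y \<otimes>\<^bsub>B\<^esub> b')) ?V"
        by (simp add: TP_mult_pure[OF ab ab'] tmap_comp[OF la rb UA.emb_lin UB.emb_lin v])
      also have "\<dots> = tm (\<lambda>x. emb OA a \<otimes>\<^bsub>OA\<^esub> emb OA x) (\<lambda>y. emb OB y \<otimes>\<^bsub>OB\<^esub> emb OB b') ?V"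
        by (rule tmap_cong[OF lin_comp[OF la' UA.emb_lin] lin_comp[OF rb' UB.emb_lin] v])
          (simp_all add: UA.emb_mult UB.emb_mult ab ab')
      also have "\<dots> = tm (\<lambda>x. emb OA a \<otimes>\<^bsub>OA\<^esub> x) (\<lambda>y. y \<otimes>\<^bsub>OB\<^esub> emb OB b') (tm (emb OA) (emb OB) ?V)"
        by (simp add: tmap_comp[OF UA.emb_lin UB.emb_lin la' rb' v])
      also have "\<dots> = pure T (emb OA a) (emb OB b) \<otimes>\<^bsub>G\<^esub> pure T (emb OA a') (emb OB b')"
        using ab ab' by (simp add: G_mult_pure emb_closedA emb_closedB Rt_emb)
      finally show "tm (emb OA) (emb OB) (pure AB a b \<otimes>\<^bsub>TP\<^esub> pure AB a' b') =
          tm (emb OA) (emb OB) (pure AB a b) \<otimes>\<^bsub>G\<^esub> tm (emb OA) (emb OB) (pure AB a' b')"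
        using ab ab' by (simp add: tmap_pure[OF UA.emb_lin UB.emb_lin])
    qed
  qed
  then show ?thesis by (simp add: G_simps(7))
qed

lemma emb_G_pure: "a \<in> carrier A \<Longrightarrow> b \<in> carrier B \<Longrightarrow> emb G (pure AB a b) = pure T (emb OA a) (emb OB b)"
  by (simp add: G_simps(7) tmap_pure[OF UA.emb_lin UB.emb_lin])

lemma emb_G_deg:
  assumes "x \<in> carrier AB" shows "emb G x \<in> deg G 0"
  using assms
proof (induction x rule: kt_induct[OF modA modB, consumes 1, case_names pure plus])
  case (pure a b)
  then show ?case using deg_G_gen[OF UA.deg_emb UB.deg_emb] by (simp add: emb_G_pure)
next
  case (plus s t)
  then show ?case using lin_add[OF emb_G_lin] deg_G_add by (simp add: TP_simps G_simps(2))
qed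

theorem G_calculus: "dg_calculus K TP G"
proof -
  have neg: "\<ominus>\<^bsub>G\<^esub> x = \<ominus>\<^bsub>T\<^esub> x" for x
    by (simp add: a_inv_def m_inv_def G_simps)
  have sgG: "sg G n x = sg T n x" for n x
    by (simp add: sg_def neg)
  have one: "emb G \<one>\<^bsub>TP\<^esub> = \<one>\<^bsub>G\<^esub>"
  proof -
    have "\<one>\<^bsub>A\<^esub> \<in> carrier A" "\<one>\<^bsub>B\<^esub> \<in> carrier B"
      using monoid.one_closed[OF ring.is_monoid[OF assoc_algebraD(1)[OF algA]]]
        monoid.one_closed[OF ring.is_monoid[OF assoc_algebraD(1)[OF algB]]] .
    then show ?thesis by (simp add: TP_simps(6) G_simps(6) emb_G_pure UA.emb_one UB.emb_one)
  qed
  have dl: "lin K G G (diff G)"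
    by (rule lin_cong_cod[OF lin_cong_dom[OF G_diff_lin]]) (simp_all add: G_simps)
  have dm: "diff G (s \<otimes>\<^bsub>G\<^esub> t) = diff G s \<otimes>\<^bsub>G\<^esub> t \<oplus>\<^bsub>T\<^esub> sg T n (s \<otimes>\<^bsub>G\<^esub> diff G t)"
    if s: "s \<in> deg G n" and t: "t \<in> carrier T" for s t n
    using s
  proof (induction s rule: deg_G_induct)
    case (pure p q \<phi> \<omega>)
    have c: "\<phi> \<in> carrier OA" "\<omega> \<in> carrier OB" using pure UA.deg_U_sub UB.deg_U_sub by blast+
    note ls = G_mult_lin(1)[OF T_pure_closed[OF c]]
      and lds = G_mult_lin(1)[OF lin_closed[OF G_diff_lin T_pure_closed[OF c]]]
    show ?case
    proof (rule T_eqI[OF lin_addmap[OF lin_comp[OF G_diff_lin ls]]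
          addmap_plus[OF lin_addmap[OF lds] sg_addmap[OF lin_addmap[OF lin_comp[OF ls G_diff_lin]]]] _ t])
      fix p' \<phi>' \<omega>' assume "\<phi>' \<in> deg OA p'" "\<omega>' \<in> carrier OB"
      from diff_G_mult_pure[OF pure(2,3) this]
      show "diff G (pure T \<phi> \<omega> \<otimes>\<^bsub>G\<^esub> pure T \<phi>' \<omega>') = diff G (pure T \<phi> \<omega>) \<otimes>\<^bsub>G\<^esub> pure T \<phi>' \<omega>' \<oplus>\<^bsub>T\<^esub>
          sg T n (pure T \<phi> \<omega> \<otimes>\<^bsub>G\<^esub> diff G (pure T \<phi>' \<omega>'))"
        unfolding pure(1) .
    qed
  next
    case (plus s s')
    note l = G_mult_lin(2)[OF t] and l' = G_mult_lin(2)[OF lin_closed[OF G_diff_lin t]]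
    have cl: "diff G s \<otimes>\<^bsub>G\<^esub> t \<in> carrier T" "diff G s' \<otimes>\<^bsub>G\<^esub> t \<in> carrier T"
      "s \<otimes>\<^bsub>G\<^esub> diff G t \<in> carrier T" "s' \<otimes>\<^bsub>G\<^esub> diff G t \<in> carrier T"
      "s \<otimes>\<^bsub>G\<^esub> t \<in> carrier T" "s' \<otimes>\<^bsub>G\<^esub> t \<in> carrier T" "diff G s \<in> carrier T" "diff G s' \<in> carrier T"
      using plus by (simp_all add: lin_closed[OF l] lin_closed[OF l'] lin_closed[OF G_diff_lin])
    show ?case
      using plus cl by (simp add: lin_add[OF l] lin_add[OF l'] lin_add[OF G_diff_lin] T.sg_add T.a_ac)
  qed
  show ?thesis
  proof (rule dg_calculus.intro[OF TP_algebra G_algebra emb_G_lin _ one])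
    show "emb G (x \<otimes>\<^bsub>TP\<^esub> y) = emb G x \<otimes>\<^bsub>G\<^esub> emb G y" if "x \<in> carrier TP" "y \<in> carrier TP" for x y
      using that emb_G_mult by (simp add: TP_simps(1))
    show "s \<otimes>\<^bsub>G\<^esub> t \<in> deg G (m + n)" if "s \<in> deg G m" "t \<in> deg G n" for s t m n
      by (rule deg_G_mult[OF that])
    show "lin K G G (diff G)" by (rule dl)
  qed (use deg_G_sub deg_G_zero deg_G_add deg_G_minus emb_G_deg diff_G_deg diff_G_diff dm in
      \<open>simp_all add: G_simps(1-3) neg sgG TP_simps(1)\<close>)
qed

end

section \<open>Connections and curvature\<close>

(* The degree 1 occurs as an index of spaces of forms, where it is to be kept as it is written. *)
declare One_nat_def [simp del]

locale calculus_module = dg_calculus K D \<Gamma>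
  for K :: "('k, 'q) ring_scheme" and D :: "('k, 'd, 'r) module_scheme" and \<Gamma> :: "('k, 'w, 'd, 's) calculus_scheme" +
  fixes M :: "('k, 'm, 'd, 't) rmodule_scheme"
  assumes M_action: "raction K D M (ract M)"
begin

sublocale G: ring \<Gamma> by (rule assoc_algebraD(1)[OF G_algebra])
sublocale DR: ring D by (rule assoc_algebraD(1)[OF D_algebra])

lemma M_mod: "module K M"
  by (rule bilin_modules(1)[OF raction_bilin[OF M_action]])

sublocale M: module K M by (rule M_mod)

abbreviation "F n \<equiv> forms \<Gamma> n"
abbreviation "P n \<equiv> mforms D M \<Gamma> n"
abbreviation "mm \<equiv> mforms_mult D M \<Gamma>"

lemma forms_simps [simp]:
  "carrier (F n) = deg \<Gamma> n" "add (F n) = add \<Gamma>" "\<zero>\<^bsub>F n\<^esub> = \<zero>\<^bsub>\<Gamma>\<^esub>" "x \<odot>\<^bsub>F n\<^esub> \<omega> = emb \<Gamma> x \<otimes>\<^bsub>\<Gamma>\<^esub> \<omega>"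
  by (simp_all add: forms_def)

lemma deg_carrier: "\<omega> \<in> deg \<Gamma> n \<Longrightarrow> \<omega> \<in> carrier \<Gamma>"
  using deg_sub by blast

lemma diff_deg': "s \<in> deg \<Gamma> n \<Longrightarrow> k = 1 + n \<Longrightarrow> diff \<Gamma> s \<in> deg \<Gamma> k"
  using diff_deg[of s n] by (simp add: plus_1_eq_Suc)

lemma emb_closed [simp]: "x \<in> carrier D \<Longrightarrow> emb \<Gamma> x \<in> carrier \<Gamma>"
  by (rule lin_closed[OF emb_lin])

lemma emb_mult_deg: "x \<in> carrier D \<Longrightarrow> \<omega> \<in> deg \<Gamma> n \<Longrightarrow> emb \<Gamma> x \<otimes>\<^bsub>\<Gamma>\<^esub> \<omega> \<in> deg \<Gamma> n"
  using deg_mult[OF deg_emb, of x \<omega> n] by simp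

lemma forms_abelian: "abelian_group (F n)"
proof (rule abelian_groupI)
  show "\<exists>y \<in> carrier (F n). y \<oplus>\<^bsub>F n\<^esub> x = \<zero>\<^bsub>F n\<^esub>" if "x \<in> carrier (F n)" for x
    using that deg_minus[of x n] deg_carrier[of x n] by (auto intro!: bexI[of _ "\<ominus>\<^bsub>\<Gamma>\<^esub> x"] simp: G.l_neg)
  show "x \<oplus>\<^bsub>F n\<^esub> y = y \<oplus>\<^bsub>F n\<^esub> x" if "x \<in> carrier (F n)" "y \<in> carrier (F n)" for x y
    using that deg_carrier G.a_comm by simp
qed (simp_all add: deg_add deg_zero deg_carrier G.a_assoc)

lemma mforms_space: "tensor_space K D M (F n)"
proof (intro tensor_space.intro tensor_pair.intro tensor_space_axioms.intro)
  show "abelian_group M" by (rule M.abelian_group_axioms)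
  show "abelian_group (F n)" by (rule forms_abelian)
  show "module K M" by (rule M_mod)
  show "ract M m x \<in> carrier M" if "m \<in> carrier M" "x \<in> carrier D" for m x
    by (rule bilin_closed[OF raction_bilin[OF M_action] that])
  show "x \<odot>\<^bsub>F n\<^esub> \<omega> \<in> carrier (F n)" if "\<omega> \<in> carrier (F n)" "x \<in> carrier D" for x \<omega>
    using that emb_mult_deg by simp
  show "ract M (c \<odot>\<^bsub>M\<^esub> m) x = c \<odot>\<^bsub>M\<^esub> ract M m x" if "c \<in> carrier K" "m \<in> carrier M" "x \<in> carrier D" for c m x
    by (rule lin_smult[OF bilin_left[OF raction_bilin[OF M_action] that(3)] that(1,2)])
qed

lemma P_eq: "P n = tensor D M (F n)"
  by (simp add: mforms_def)

lemmas ract_closed = bilin_closed[OF raction_bilin[OF M_action]]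

context
  fixes n :: nat
begin

interpretation ts: tensor_space K D M "F n" by (rule mforms_space)

lemma P_module: "module K (P n)" unfolding P_eq by (rule ts.module_T)

lemma pP_closed: "m \<in> carrier M \<Longrightarrow> \<omega> \<in> deg \<Gamma> n \<Longrightarrow> pure (P n) m \<omega> \<in> carrier (P n)"
  unfolding P_eq using ts.pure_closed by simp

lemma pP_balanced: "m \<in> carrier M \<Longrightarrow> x \<in> carrier D \<Longrightarrow> \<omega> \<in> deg \<Gamma> n \<Longrightarrow>
    pure (P n) (ract M m x) \<omega> = pure (P n) m (emb \<Gamma> x \<otimes>\<^bsub>\<Gamma>\<^esub> \<omega>)"
  unfolding P_eq using ts.pure_balanced by simp

lemma pP_biadd: "biadd M (F n) (P n) (pure (P n))"
  unfolding P_eq by (rule ts.biadd_pure)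

lemma pP_lin: "\<omega> \<in> deg \<Gamma> n \<Longrightarrow> lin K M (P n) (\<lambda>m. pure (P n) m \<omega>)"
  unfolding P_eq using ts.pure_lin_left by simp

lemma P_eqI:
  assumes "addmap (P n) Q h" "addmap (P n) Q h'"
    "\<And>m \<omega>. m \<in> carrier M \<Longrightarrow> \<omega> \<in> deg \<Gamma> n \<Longrightarrow> h (pure (P n) m \<omega>) = h' (pure (P n) m \<omega>)" "t \<in> carrier (P n)"
  shows "h t = h' t"
  using ts.tensor_eqI[of Q h h' t] assms unfolding P_eq by simp

lemma
  assumes "biadd M (F n) Q \<beta>"
    and "\<And>m x \<omega>. m \<in> carrier M \<Longrightarrow> x \<in> carrier D \<Longrightarrow> \<omega> \<in> deg \<Gamma> n \<Longrightarrow> \<beta> (ract M m x) \<omega> = \<beta> m (emb \<Gamma> x \<otimes>\<^bsub>\<Gamma>\<^esub> \<omega>)"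
  shows P_lift_addmap: "addmap (P n) Q (tlift Q \<beta>)"
    and P_lift_pure: "m \<in> carrier M \<Longrightarrow> \<omega> \<in> deg \<Gamma> n \<Longrightarrow> tlift Q \<beta> (pure (P n) m \<omega>) = \<beta> m \<omega>"
  unfolding P_eq using ts.tlift_addmap[OF assms(1)] ts.tlift_elem[OF assms(1)] assms(2) by simp_all

lemma P_lift_lin:
  assumes "biadd M (F n) Q \<beta>" "module K Q"
    and "\<And>m x \<omega>. m \<in> carrier M \<Longrightarrow> x \<in> carrier D \<Longrightarrow> \<omega> \<in> deg \<Gamma> n \<Longrightarrow> \<beta> (ract M m x) \<omega> = \<beta> m (emb \<Gamma> x \<otimes>\<^bsub>\<Gamma>\<^esub> \<omega>)"
    and "\<And>c m \<omega>. c \<in> carrier K \<Longrightarrow> m \<in> carrier M \<Longrightarrow> \<omega> \<in> deg \<Gamma> n \<Longrightarrow> \<beta> (c \<odot>\<^bsub>M\<^esub> m) \<omega> = c \<odot>\<^bsub>Q\<^esub> \<beta> m \<omega>"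
  shows "lin K (P n) Q (tlift Q \<beta>)"
  unfolding P_eq using ts.tlift_lin[OF assms(1,2)] assms(3,4) by simp

lemma P_addmap_tlift:
  assumes "addmap Q Q' h" "\<And>m \<omega>. m \<in> carrier M \<Longrightarrow> \<omega> \<in> deg \<Gamma> n \<Longrightarrow> \<beta> m \<omega> \<in> carrier Q" "t \<in> carrier (P n)"
  shows "h (tlift Q \<beta> t) = tlift Q' (\<lambda>m \<omega>. h (\<beta> m \<omega>)) t"
  using ts.addmap_tlift[OF assms(1)] assms(2,3) unfolding P_eq by simp

lemma P_tlift_cong:
  assumes "abelian_group Q" "\<And>m \<omega>. m \<in> carrier M \<Longrightarrow> \<omega> \<in> deg \<Gamma> n \<Longrightarrow> \<beta> m \<omega> \<in> carrier Q" "t \<in> carrier (P n)"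
    "\<And>m \<omega>. m \<in> carrier M \<Longrightarrow> \<omega> \<in> deg \<Gamma> n \<Longrightarrow> \<gamma> m \<omega> = \<beta> m \<omega>"
  shows "tlift Q \<gamma> t = tlift Q \<beta> t"
  using ts.tlift_cong[OF assms(1)] assms(2-4) unfolding P_eq by simp

lemma P_tlift_param:
  assumes "\<And>m \<omega>. m \<in> carrier M \<Longrightarrow> \<omega> \<in> deg \<Gamma> n \<Longrightarrow> addmap V Q (\<lambda>v. \<beta> v m \<omega>)"
    and "abelian_group V" "abelian_group Q" "t \<in> carrier (P n)"
  shows "addmap V Q (\<lambda>v. tlift Q (\<beta> v) t)"
  using ts.tlift_param_addmap[OF _ assms(2,3)] assms(1,4) unfolding P_eq by simp

end

lemma P_abelian: "abelian_group (P n)"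
  by (rule module_abelian[OF P_module])

lemma pP_left: "\<omega> \<in> deg \<Gamma> n \<Longrightarrow> addmap M (P n) (\<lambda>m. pure (P n) m \<omega>)"
  using biadd_left[OF pP_biadd] by simp

lemma pP_right: "m \<in> carrier M \<Longrightarrow> addmap (F n) (P n) (pure (P n) m)"
  using biadd_right[OF pP_biadd] .

lemma pP_add_right: "m \<in> carrier M \<Longrightarrow> \<omega> \<in> deg \<Gamma> n \<Longrightarrow> \<omega>' \<in> deg \<Gamma> n \<Longrightarrow>
    pure (P n) m (\<omega> \<oplus>\<^bsub>\<Gamma>\<^esub> \<omega>') = pure (P n) m \<omega> \<oplus>\<^bsub>P n\<^esub> pure (P n) m \<omega>'"
  using addmap_add[OF pP_right, of m \<omega> n \<omega>'] by simp

lemma forms_minus: "\<omega> \<in> deg \<Gamma> n \<Longrightarrow> \<ominus>\<^bsub>F n\<^esub> \<omega> = \<ominus>\<^bsub>\<Gamma>\<^esub> \<omega>"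
  using abelian_group.minus_equality[OF forms_abelian[of n], of "\<ominus>\<^bsub>\<Gamma>\<^esub> \<omega>" \<omega>] deg_carrier[of \<omega> n]
  by (simp add: deg_minus G.l_neg)

lemma pP_minus_right: "m \<in> carrier M \<Longrightarrow> \<omega> \<in> deg \<Gamma> n \<Longrightarrow>
    pure (P n) m (\<ominus>\<^bsub>\<Gamma>\<^esub> \<omega>) = \<ominus>\<^bsub>P n\<^esub> pure (P n) m \<omega>"
  using addmap_minus[OF pP_right, of m \<omega> n] by (simp add: forms_minus)

lemma pP_zero_right: "m \<in> carrier M \<Longrightarrow> pure (P n) m \<zero>\<^bsub>\<Gamma>\<^esub> = \<zero>\<^bsub>P n\<^esub>"
  using addmap_zero[OF pP_right, of m n] by simp

lemma addmap_forms_mult: "\<omega> \<in> deg \<Gamma> p \<Longrightarrow> k = n + p \<Longrightarrow> addmap (F n) (F k) (\<lambda>\<eta>. \<eta> \<otimes>\<^bsub>\<Gamma>\<^esub> \<omega>)"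
  by (rule addmapI[OF forms_abelian forms_abelian]) (simp_all add: deg_mult deg_carrier G.l_distr)

lemma addmap_forms_mult': "\<eta> \<in> deg \<Gamma> n \<Longrightarrow> k = n + p \<Longrightarrow> addmap (F p) (F k) (\<lambda>\<omega>. \<eta> \<otimes>\<^bsub>\<Gamma>\<^esub> \<omega>)"
  by (rule addmapI[OF forms_abelian forms_abelian]) (simp_all add: deg_mult deg_carrier G.r_distr)

lemma addmap_forms_diff: "k = Suc n \<Longrightarrow> addmap (F n) (F k) (diff \<Gamma>)"
  by (rule addmapI[OF forms_abelian forms_abelian]) (simp_all add: diff_deg deg_carrier lin_add[OF diff_lin])

lemma mm_biadd: "\<omega> \<in> deg \<Gamma> p \<Longrightarrow> k = n + p \<Longrightarrow> biadd M (F n) (P k) (\<lambda>m \<eta>. pure (P k) m (\<eta> \<otimes>\<^bsub>\<Gamma>\<^esub> \<omega>))"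
  by (rule biaddI[OF addmap_comp[OF addmap_forms_mult pP_right] pP_left]) (simp_all add: deg_mult)

lemma mm_balanced:
  "\<omega> \<in> deg \<Gamma> p \<Longrightarrow> k = n + p \<Longrightarrow> m \<in> carrier M \<Longrightarrow> x \<in> carrier D \<Longrightarrow> \<eta> \<in> deg \<Gamma> n \<Longrightarrow>
   pure (P k) (ract M m x) (\<eta> \<otimes>\<^bsub>\<Gamma>\<^esub> \<omega>) = pure (P k) m (emb \<Gamma> x \<otimes>\<^bsub>\<Gamma>\<^esub> \<eta> \<otimes>\<^bsub>\<Gamma>\<^esub> \<omega>)"
  by (simp add: pP_balanced deg_mult G.m_assoc deg_carrier)

text \<open>
  A degree is an index of a space of forms and must match literally.  The total degree is therefore a
  variable \<open>k\<close> with \<open>k = n + p\<close>, so that the rules apply to \<open>2\<close>, \<open>1 + n\<close> or \<open>n + 0\<close> alike.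
\<close>

lemma mm_eq: "k = n + p \<Longrightarrow> mm n p t \<omega> = tlift (P k) (\<lambda>m \<eta>. pure (P k) m (\<eta> \<otimes>\<^bsub>\<Gamma>\<^esub> \<omega>)) t"
  by (simp add: mforms_mult_def)

lemma mm_lin:
  assumes "\<omega> \<in> deg \<Gamma> p" "k = n + p" shows "lin K (P n) (P k) (\<lambda>t. mm n p t \<omega>)"
  unfolding mm_eq[OF assms(2)]
  by (rule P_lift_lin[OF mm_biadd[OF assms] P_module mm_balanced[OF assms]])
    (use assms lin_smult[OF pP_lin] in \<open>simp_all add: deg_mult\<close>)

lemmas mm_left = lin_addmap[OF mm_lin]

lemma mm_pure: "\<omega> \<in> deg \<Gamma> p \<Longrightarrow> k = n + p \<Longrightarrow> m \<in> carrier M \<Longrightarrow> \<eta> \<in> deg \<Gamma> n \<Longrightarrow>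
    mm n p (pure (P n) m \<eta>) \<omega> = pure (P k) m (\<eta> \<otimes>\<^bsub>\<Gamma>\<^esub> \<omega>)"
  unfolding mm_eq by (rule P_lift_pure[OF mm_biadd mm_balanced])

lemma mm_right: "t \<in> carrier (P n) \<Longrightarrow> k = n + p \<Longrightarrow> addmap (F p) (P k) (\<lambda>\<omega>. mm n p t \<omega>)"
  unfolding mm_eq
  by (rule P_tlift_param[OF addmap_comp[OF addmap_forms_mult' pP_right] forms_abelian P_abelian]) simp_all

lemma mm_closed: "t \<in> carrier (P n) \<Longrightarrow> \<omega> \<in> deg \<Gamma> p \<Longrightarrow> k = n + p \<Longrightarrow> mm n p t \<omega> \<in> carrier (P k)"
  using addmap_closed[OF mm_left] by blast

lemma mm_assoc:
  assumes t: "t \<in> carrier (P n)" and "\<omega> \<in> deg \<Gamma> p" "\<omega>' \<in> deg \<Gamma> q" "k = n + p" "l = p + q"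
  shows "mm k q (mm n p t \<omega>) \<omega>' = mm n l t (\<omega> \<otimes>\<^bsub>\<Gamma>\<^esub> \<omega>')"
proof (rule P_eqI[OF addmap_comp[OF mm_left[OF assms(2,4)] mm_left[OF assms(3) refl]] mm_left _ t])
  show "\<omega> \<otimes>\<^bsub>\<Gamma>\<^esub> \<omega>' \<in> deg \<Gamma> l" using assms by (simp add: deg_mult)
  show kq: "k + q = n + l" using assms by simp
  fix m \<eta> assume m: "m \<in> carrier M" and \<eta>: "\<eta> \<in> deg \<Gamma> n"
  have d: "\<eta> \<otimes>\<^bsub>\<Gamma>\<^esub> \<omega> \<in> deg \<Gamma> k" "\<omega> \<otimes>\<^bsub>\<Gamma>\<^esub> \<omega>' \<in> deg \<Gamma> l" using assms \<eta> by (simp_all add: deg_mult)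
  have "mm k q (mm n p (pure (P n) m \<eta>) \<omega>) \<omega>' = pure (P (k + q)) m (\<eta> \<otimes>\<^bsub>\<Gamma>\<^esub> \<omega> \<otimes>\<^bsub>\<Gamma>\<^esub> \<omega>')"
    by (simp only: mm_pure[OF assms(2,4) m \<eta>] mm_pure[OF assms(3) refl m d(1)])
  also have "\<dots> = mm n l (pure (P n) m \<eta>) (\<omega> \<otimes>\<^bsub>\<Gamma>\<^esub> \<omega>')"
    using mm_pure[OF d(2) kq m \<eta>] assms(2,3) \<eta> by (simp add: G.m_assoc deg_carrier)
  finally show "mm k q (mm n p (pure (P n) m \<eta>) \<omega>) \<omega>' = mm n l (pure (P n) m \<eta>) (\<omega> \<otimes>\<^bsub>\<Gamma>\<^esub> \<omega>')" .
qed

lemma one_deg: "\<one>\<^bsub>\<Gamma>\<^esub> \<in> deg \<Gamma> 0"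
  using deg_emb[of "\<one>\<^bsub>D\<^esub>"] by (simp add: emb_one)

lemma diff_one: "diff \<Gamma> \<one>\<^bsub>\<Gamma>\<^esub> = \<zero>\<^bsub>\<Gamma>\<^esub>"
proof -
  have c: "diff \<Gamma> \<one>\<^bsub>\<Gamma>\<^esub> \<in> carrier \<Gamma>" by (rule lin_closed[OF diff_lin]) simp
  have "diff \<Gamma> \<one>\<^bsub>\<Gamma>\<^esub> \<oplus>\<^bsub>\<Gamma>\<^esub> diff \<Gamma> \<one>\<^bsub>\<Gamma>\<^esub> = diff \<Gamma> \<one>\<^bsub>\<Gamma>\<^esub>"
    using diff_mult[OF one_deg, of "\<one>\<^bsub>\<Gamma>\<^esub>"] c by simp
  then show ?thesis using c by (metis G.add.l_cancel_one)
qed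

lemma mm_one: "t \<in> carrier (P n) \<Longrightarrow> mm n 0 t \<one>\<^bsub>\<Gamma>\<^esub> = t"
  by (rule P_eqI[OF mm_left[OF one_deg] addmap_id[OF P_abelian]]) (simp_all add: mm_pure[OF one_deg] deg_carrier)

lemma connectionD:
  assumes "right_connection K D M \<Gamma> nab"
  shows "lin K M (P 1) nab"
    and "m \<in> carrier M \<Longrightarrow> x \<in> carrier D \<Longrightarrow>
      nab (ract M m x) = mm 1 0 (nab m) (emb \<Gamma> x) \<oplus>\<^bsub>P 1\<^esub> pure (P 1) m (diff \<Gamma> (emb \<Gamma> x))"
  using assms M_mod P_module by (simp_all add: right_connection_def lin_def)

context
  fixes nab
  assumes nab: "right_connection K D M \<Gamma> nab"
begin

lemma nab_lin: "lin K M (P 1) nab" by (rule connectionD(1)[OF nab])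

lemmas nab_addmap = lin_addmap[OF nab_lin]
lemmas nab_closed = lin_closed[OF nab_lin]

lemma diff_emb_deg: "x \<in> carrier D \<Longrightarrow> diff \<Gamma> (emb \<Gamma> x) \<in> deg \<Gamma> 1"
  using diff_deg'[OF deg_emb] by simp

lemma conn_ext_biadd:
  assumes "k = 1 + n"
  shows "biadd M (F n) (P k) (\<lambda>m \<omega>. mm 1 n (nab m) \<omega> \<oplus>\<^bsub>P k\<^esub> pure (P k) m (diff \<Gamma> \<omega>))"
proof (rule biaddI)
  show "addmap (F n) (P k) (\<lambda>\<omega>. mm 1 n (nab m) \<omega> \<oplus>\<^bsub>P k\<^esub> pure (P k) m (diff \<Gamma> \<omega>))" if "m \<in> carrier M" for m
    by (rule addmap_plus[OF mm_right[OF nab_closed[OF that] assms] addmap_comp[OF addmap_forms_diff pP_right[OF that]]])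
      (simp add: assms)
  show "addmap M (P k) (\<lambda>m. mm 1 n (nab m) \<omega> \<oplus>\<^bsub>P k\<^esub> pure (P k) m (diff \<Gamma> \<omega>))" if "\<omega> \<in> carrier (F n)" for \<omega>
    by (rule addmap_plus[OF addmap_comp[OF nab_addmap mm_left] pP_left]) (use that assms diff_deg'[of \<omega> n k] in simp_all)
qed

text \<open>
  The term \<open>m \<otimes> d x \<cdot> \<omega>\<close> arises on the left from \<open>\<nabla> (m x)\<close> and on the right from \<open>d (x \<omega>)\<close>.
\<close>

lemma conn_ext_balanced:
  assumes k: "k = 1 + n" and m: "m \<in> carrier M" and x: "x \<in> carrier D" and \<omega>: "\<omega> \<in> deg \<Gamma> n"
  shows "mm 1 n (nab (ract M m x)) \<omega> \<oplus>\<^bsub>P k\<^esub> pure (P k) (ract M m x) (diff \<Gamma> \<omega>) =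
    mm 1 n (nab m) (emb \<Gamma> x \<otimes>\<^bsub>\<Gamma>\<^esub> \<omega>) \<oplus>\<^bsub>P k\<^esub> pure (P k) m (diff \<Gamma> (emb \<Gamma> x \<otimes>\<^bsub>\<Gamma>\<^esub> \<omega>))"
proof -
  interpret Pk: module K "P k" by (rule P_module)
  note l = mm_left[OF \<omega> k]
  have d: "diff \<Gamma> \<omega> \<in> deg \<Gamma> k" using diff_deg'[OF \<omega> k] .
  have dx: "diff \<Gamma> (emb \<Gamma> x) \<in> deg \<Gamma> 1" by (rule diff_emb_deg[OF x])
  have c1: "mm 1 0 (nab m) (emb \<Gamma> x) \<in> carrier (P 1)" by (rule mm_closed[OF nab_closed[OF m] deg_emb[OF x]]) simp
  have c2: "pure (P 1) m (diff \<Gamma> (emb \<Gamma> x)) \<in> carrier (P 1)" by (rule pP_closed[OF m dx])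
  have e: "diff \<Gamma> (emb \<Gamma> x) \<otimes>\<^bsub>\<Gamma>\<^esub> \<omega> \<in> deg \<Gamma> k" "emb \<Gamma> x \<otimes>\<^bsub>\<Gamma>\<^esub> diff \<Gamma> \<omega> \<in> deg \<Gamma> k"
    using deg_mult[OF dx \<omega>] emb_mult_deg[OF x d] k by simp_all
  have "mm 1 n (nab (ract M m x)) \<omega> = mm 1 n (nab m) (emb \<Gamma> x \<otimes>\<^bsub>\<Gamma>\<^esub> \<omega>) \<oplus>\<^bsub>P k\<^esub> pure (P k) m (diff \<Gamma> (emb \<Gamma> x) \<otimes>\<^bsub>\<Gamma>\<^esub> \<omega>)"
    using mm_assoc[OF nab_closed[OF m] deg_emb[OF x] \<omega>, of 1 n]
    by (simp add: connectionD(2)[OF nab m x] addmap_add[OF l c1 c2] mm_pure[OF \<omega> k m dx])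
  moreover have "diff \<Gamma> (emb \<Gamma> x \<otimes>\<^bsub>\<Gamma>\<^esub> \<omega>) = diff \<Gamma> (emb \<Gamma> x) \<otimes>\<^bsub>\<Gamma>\<^esub> \<omega> \<oplus>\<^bsub>\<Gamma>\<^esub> emb \<Gamma> x \<otimes>\<^bsub>\<Gamma>\<^esub> diff \<Gamma> \<omega>"
    using diff_mult[OF deg_emb[OF x] deg_carrier[OF \<omega>]] by simp
  moreover have "mm 1 n (nab m) (emb \<Gamma> x \<otimes>\<^bsub>\<Gamma>\<^esub> \<omega>) \<in> carrier (P k)"
    by (rule mm_closed[OF nab_closed[OF m] emb_mult_deg[OF x \<omega>] k])
  ultimately show ?thesis
    using e by (simp add: pP_add_right[OF m] pP_balanced[OF m x d] pP_closed[OF m] Pk.a_assoc)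
qed

lemma conn_ext_eq: "k = 1 + n \<Longrightarrow> conn_ext D M \<Gamma> nab n = tlift (P k) (\<lambda>m \<omega>. mm 1 n (nab m) \<omega> \<oplus>\<^bsub>P k\<^esub> pure (P k) m (diff \<Gamma> \<omega>))"
  by (simp add: conn_ext_def)

lemma conn_ext_addmap: "k = 1 + n \<Longrightarrow> addmap (P n) (P k) (conn_ext D M \<Gamma> nab n)"
  unfolding conn_ext_eq by (rule P_lift_addmap[OF conn_ext_biadd conn_ext_balanced])

lemma conn_ext_pure: "k = 1 + n \<Longrightarrow> m \<in> carrier M \<Longrightarrow> \<omega> \<in> deg \<Gamma> n \<Longrightarrow>
    conn_ext D M \<Gamma> nab n (pure (P n) m \<omega>) = mm 1 n (nab m) \<omega> \<oplus>\<^bsub>P k\<^esub> pure (P k) m (diff \<Gamma> \<omega>)"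
  unfolding conn_ext_eq by (rule P_lift_pure[OF conn_ext_biadd conn_ext_balanced])

lemma curvature_eq:
  assumes "m \<in> carrier M" shows "curvature D M \<Gamma> nab m = conn_ext D M \<Gamma> nab 1 (nab m)"
proof -
  interpret P1: module K "P 1" by (rule P_module)
  have "conn_ext D M \<Gamma> nab 0 (pure (P 0) m \<one>\<^bsub>\<Gamma>\<^esub>) = nab m"
    using conn_ext_pure[of 1 0, OF _ assms one_deg] nab_closed[OF assms] assms
    by (simp add: diff_one pP_zero_right mm_one)
  then show ?thesis by (simp add: curvature_def)
qed

lemma curvature_addmap: "addmap M (P 2) (curvature D M \<Gamma> nab)"
  by (rule addmap_cong[OF addmap_comp[OF nab_addmap conn_ext_addmap]]) (simp_all add: curvature_eq)

text \<open>
  The extended operator obeys a graded Leibniz rule.  In the curvature of \<open>m x\<close> its error term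
  \<open>- \<nabla> m \<cdot> d x\<close> cancels against \<open>\<nabla> (m \<otimes> d x) = \<nabla> m \<cdot> d x\<close>.
\<close>

lemma conn_ext_act:
  assumes t: "t \<in> carrier (P 1)" and x: "x \<in> carrier D"
  shows "conn_ext D M \<Gamma> nab 1 (mm 1 0 t (emb \<Gamma> x)) =
    mm 2 0 (conn_ext D M \<Gamma> nab 1 t) (emb \<Gamma> x) \<oplus>\<^bsub>P 2\<^esub> \<ominus>\<^bsub>P 2\<^esub> mm 1 1 t (diff \<Gamma> (emb \<Gamma> x))"
proof -
  interpret P2: module K "P 2" by (rule P_module)
  have ex: "emb \<Gamma> x \<in> deg \<Gamma> 0" and dx: "diff \<Gamma> (emb \<Gamma> x) \<in> deg \<Gamma> 1"
    using deg_emb[OF x] diff_emb_deg[OF x] by auto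
  have D: "addmap (P 1) (P 2) (conn_ext D M \<Gamma> nab 1)" by (rule conn_ext_addmap) simp
  have l10: "addmap (P 1) (P 1) (\<lambda>t. mm 1 0 t (emb \<Gamma> x))" and l20: "addmap (P 2) (P 2) (\<lambda>t. mm 2 0 t (emb \<Gamma> x))"
    and l11: "addmap (P 1) (P 2) (\<lambda>t. mm 1 1 t (diff \<Gamma> (emb \<Gamma> x)))"
    by (rule mm_left[OF ex] mm_left[OF dx]; simp)+
  show ?thesis
  proof (rule P_eqI[OF addmap_comp[OF l10 D] addmap_plus[OF addmap_comp[OF D l20] addmap_uminus[OF l11]] _ t])
    fix m \<eta> assume m: "m \<in> carrier M" and \<eta>: "\<eta> \<in> deg \<Gamma> 1"
    have c: "\<eta> \<otimes>\<^bsub>\<Gamma>\<^esub> emb \<Gamma> x \<in> deg \<Gamma> 1" "diff \<Gamma> \<eta> \<in> deg \<Gamma> 2" "diff \<Gamma> \<eta> \<otimes>\<^bsub>\<Gamma>\<^esub> emb \<Gamma> x \<in> deg \<Gamma> 2" "\<eta> \<otimes>\<^bsub>\<Gamma>\<^esub> diff \<Gamma> (emb \<Gamma> x) \<in> deg \<Gamma> 2"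
      using deg_mult[OF \<eta> ex] diff_deg[OF \<eta>] deg_mult[OF diff_deg[OF \<eta>] ex] deg_mult[OF \<eta> dx]
      by simp_all
    have "diff \<Gamma> (\<eta> \<otimes>\<^bsub>\<Gamma>\<^esub> emb \<Gamma> x) = diff \<Gamma> \<eta> \<otimes>\<^bsub>\<Gamma>\<^esub> emb \<Gamma> x \<oplus>\<^bsub>\<Gamma>\<^esub> \<ominus>\<^bsub>\<Gamma>\<^esub> (\<eta> \<otimes>\<^bsub>\<Gamma>\<^esub> diff \<Gamma> (emb \<Gamma> x))"
      using diff_mult[OF \<eta> deg_carrier[OF ex]] by (simp add: sg_def)
    then have d: "pure (P 2) m (diff \<Gamma> (\<eta> \<otimes>\<^bsub>\<Gamma>\<^esub> emb \<Gamma> x)) =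
        pure (P 2) m (diff \<Gamma> \<eta> \<otimes>\<^bsub>\<Gamma>\<^esub> emb \<Gamma> x) \<oplus>\<^bsub>P 2\<^esub> \<ominus>\<^bsub>P 2\<^esub> pure (P 2) m (\<eta> \<otimes>\<^bsub>\<Gamma>\<^esub> diff \<Gamma> (emb \<Gamma> x))"
      using c m by (simp add: pP_add_right pP_minus_right deg_minus)
    have n1: "mm 1 1 (nab m) \<eta> \<in> carrier (P 2)" "mm 1 1 (nab m) (\<eta> \<otimes>\<^bsub>\<Gamma>\<^esub> emb \<Gamma> x) \<in> carrier (P 2)"
      by (rule mm_closed[OF nab_closed[OF m]], use \<eta> c in simp_all)+
    have "mm 2 0 (conn_ext D M \<Gamma> nab 1 (pure (P 1) m \<eta>)) (emb \<Gamma> x) =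
        mm 1 1 (nab m) (\<eta> \<otimes>\<^bsub>\<Gamma>\<^esub> emb \<Gamma> x) \<oplus>\<^bsub>P 2\<^esub> pure (P 2) m (diff \<Gamma> \<eta> \<otimes>\<^bsub>\<Gamma>\<^esub> emb \<Gamma> x)"
      using conn_ext_pure[of 2 1, OF _ m \<eta>] addmap_add[OF l20 n1(1) pP_closed[OF m c(2)]]
        mm_assoc[OF nab_closed[OF m] \<eta> ex, of 2 1] mm_pure[OF ex _ m c(2), of 2] by simp
    moreover have "conn_ext D M \<Gamma> nab 1 (mm 1 0 (pure (P 1) m \<eta>) (emb \<Gamma> x)) =
        mm 1 1 (nab m) (\<eta> \<otimes>\<^bsub>\<Gamma>\<^esub> emb \<Gamma> x) \<oplus>\<^bsub>P 2\<^esub> pure (P 2) m (diff \<Gamma> (\<eta> \<otimes>\<^bsub>\<Gamma>\<^esub> emb \<Gamma> x))"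
      using mm_pure[OF ex _ m \<eta>, of 1] conn_ext_pure[of 2 1, OF _ m c(1)] by simp
    moreover have "mm 1 1 (pure (P 1) m \<eta>) (diff \<Gamma> (emb \<Gamma> x)) = pure (P 2) m (\<eta> \<otimes>\<^bsub>\<Gamma>\<^esub> diff \<Gamma> (emb \<Gamma> x))"
      by (rule mm_pure[OF dx _ m \<eta>]) simp
    ultimately show "conn_ext D M \<Gamma> nab 1 (mm 1 0 (pure (P 1) m \<eta>) (emb \<Gamma> x)) =
        mm 2 0 (conn_ext D M \<Gamma> nab 1 (pure (P 1) m \<eta>)) (emb \<Gamma> x) \<oplus>\<^bsub>P 2\<^esub> \<ominus>\<^bsub>P 2\<^esub> mm 1 1 (pure (P 1) m \<eta>) (diff \<Gamma> (emb \<Gamma> x))"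
      using n1 c m by (simp add: d pP_closed P2.a_assoc)
  qed
qed

theorem curvature_act:
  assumes m: "m \<in> carrier M" and x: "x \<in> carrier D"
  shows "curvature D M \<Gamma> nab (ract M m x) = mm 2 0 (curvature D M \<Gamma> nab m) (emb \<Gamma> x)"
proof -
  interpret P2: module K "P 2" by (rule P_module)
  have dx: "diff \<Gamma> (emb \<Gamma> x) \<in> deg \<Gamma> 1" using diff_emb_deg[OF x] .
  have D: "addmap (P 1) (P 2) (conn_ext D M \<Gamma> nab 1)" by (rule conn_ext_addmap) simp
  have c: "mm 1 0 (nab m) (emb \<Gamma> x) \<in> carrier (P 1)" "pure (P 1) m (diff \<Gamma> (emb \<Gamma> x)) \<in> carrier (P 1)"
    "mm 1 1 (nab m) (diff \<Gamma> (emb \<Gamma> x)) \<in> carrier (P 2)"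
    using mm_closed[OF nab_closed[OF m] deg_emb[OF x], of 1] pP_closed[OF m dx] mm_closed[OF nab_closed[OF m] dx, of 2] by simp_all
  have cu: "mm 2 0 (conn_ext D M \<Gamma> nab 1 (nab m)) (emb \<Gamma> x) \<in> carrier (P 2)"
    by (rule mm_closed[OF addmap_closed[OF D nab_closed[OF m]] deg_emb[OF x]]) simp
  have "conn_ext D M \<Gamma> nab 1 (pure (P 1) m (diff \<Gamma> (emb \<Gamma> x))) = mm 1 1 (nab m) (diff \<Gamma> (emb \<Gamma> x))"
    using conn_ext_pure[of 2 1, OF _ m dx] diff_diff[OF emb_closed[OF x]] c(3) by (simp add: pP_zero_right m)
  then show ?thesis
    using m x c cu
    by (simp add: curvature_eq ract_closed connectionD(2)[OF nab] addmap_add[OF D] conn_ext_act nab_closed P2.a_assoc P2.l_neg)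
qed

end

text \<open>
  If \<open>m = s y\<close> with a generator \<open>s\<close>, then both \<open>\<nabla> m\<close> and \<open>\<nabla> (m x) = \<nabla> (s (y x))\<close> are given by the rule at \<open>s\<close>,
  and the Leibniz rule at \<open>m\<close> is that of \<open>d\<close> for \<open>y x\<close>.
\<close>

lemma connection_on_generators:
  assumes nab: "lin K M (P 1) nab" and Gs: "Gs \<subseteq> carrier M"
    and gen: "\<And>m. m \<in> carrier M \<Longrightarrow> m \<in> add_span M {ract M s y | s y. s \<in> Gs \<and> y \<in> carrier D}"
    and leib: "\<And>s y. s \<in> Gs \<Longrightarrow> y \<in> carrier D \<Longrightarrow>
      nab (ract M s y) = mm 1 0 (nab s) (emb \<Gamma> y) \<oplus>\<^bsub>P 1\<^esub> pure (P 1) s (diff \<Gamma> (emb \<Gamma> y))"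
  shows "right_connection K D M \<Gamma> nab"
  unfolding right_connection_def
proof (intro conjI ballI)
  show "linear_map K M (P 1) nab" using nab by (simp add: lin_def)
  fix m x assume m: "m \<in> carrier M" and x: "x \<in> carrier D"
  interpret P1: module K "P 1" by (rule P_module)
  have N: "nab s \<in> carrier (P 1)" if "s \<in> Gs" for s
    using lin_closed[OF nab] Gs that by blast
  have ex: "emb \<Gamma> x \<in> deg \<Gamma> 0" and dx: "diff \<Gamma> (emb \<Gamma> x) \<in> deg \<Gamma> 1"
    using deg_emb[OF x] diff_deg'[OF deg_emb[OF x], of 1] by simp_all
  have l: "addmap (P 1) (P 1) (\<lambda>t. mm 1 0 t (emb \<Gamma> x))" by (rule mm_left[OF ex]) simp
  note rx = lin_addmap[OF bilin_left[OF raction_bilin[OF M_action] x]]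
  show "nab (ract M m x) = mm 1 0 (nab m) (emb \<Gamma> x) \<oplus>\<^bsub>P 1\<^esub> pure (P 1) m (diff \<Gamma> (emb \<Gamma> x))"
  proof (rule addmap_span_eq[OF addmap_comp[OF rx lin_addmap[OF nab]]
        addmap_plus[OF addmap_comp[OF lin_addmap[OF nab] l] pP_left[OF dx]] _ _ gen[OF m]])
    show "{ract M s y | s y. s \<in> Gs \<and> y \<in> carrier D} \<subseteq> carrier M"
      using Gs ract_closed by blast
    fix m assume "m \<in> {ract M s y | s y. s \<in> Gs \<and> y \<in> carrier D}"
    then obtain s y where s: "s \<in> Gs" and y: "y \<in> carrier D" and m: "m = ract M s y" by blast
    have sM: "s \<in> carrier M" using s Gs by blast
    have ey: "emb \<Gamma> y \<in> deg \<Gamma> 0" and dy: "diff \<Gamma> (emb \<Gamma> y) \<in> deg \<Gamma> 1"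
      using deg_emb[OF y] diff_deg'[OF deg_emb[OF y], of 1] by simp_all
    have c: "mm 1 0 (nab s) (emb \<Gamma> y) \<in> carrier (P 1)" "pure (P 1) s (diff \<Gamma> (emb \<Gamma> y)) \<in> carrier (P 1)"
      "mm 1 0 (nab s) (emb \<Gamma> y \<otimes>\<^bsub>\<Gamma>\<^esub> emb \<Gamma> x) \<in> carrier (P 1)"
      using mm_closed[OF N[OF s] ey, of 1] pP_closed[OF sM dy] mm_closed[OF N[OF s] deg_mult[OF ey ex, simplified], of 1] by simp_all
    have e: "diff \<Gamma> (emb \<Gamma> y) \<otimes>\<^bsub>\<Gamma>\<^esub> emb \<Gamma> x \<in> deg \<Gamma> 1" "emb \<Gamma> y \<otimes>\<^bsub>\<Gamma>\<^esub> diff \<Gamma> (emb \<Gamma> x) \<in> deg \<Gamma> 1"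
      using deg_mult[OF dy ex] emb_mult_deg[OF y dx] by simp_all
    have "nab (ract M m x) = nab (ract M s (y \<otimes>\<^bsub>D\<^esub> x))"
      using raction_assoc[OF M_action sM y x] by (simp add: m)
    also have "\<dots> = mm 1 0 (nab s) (emb \<Gamma> y \<otimes>\<^bsub>\<Gamma>\<^esub> emb \<Gamma> x) \<oplus>\<^bsub>P 1\<^esub>
        (pure (P 1) s (diff \<Gamma> (emb \<Gamma> y) \<otimes>\<^bsub>\<Gamma>\<^esub> emb \<Gamma> x) \<oplus>\<^bsub>P 1\<^esub> pure (P 1) s (emb \<Gamma> y \<otimes>\<^bsub>\<Gamma>\<^esub> diff \<Gamma> (emb \<Gamma> x)))"
      using x y s diff_mult[OF ey deg_carrier[OF ex]] e by (simp add: leib emb_mult pP_add_right sM)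
    also have "\<dots> = mm 1 0 (nab m) (emb \<Gamma> x) \<oplus>\<^bsub>P 1\<^esub> pure (P 1) m (diff \<Gamma> (emb \<Gamma> x))"
      using mm_assoc[OF N[OF s] ey ex, of 1 0] mm_pure[OF ex _ sM dy, of 1] pP_balanced[OF sM y dx] c e
      by (simp add: m leib s y addmap_add[OF l] P1.a_assoc pP_closed sM)
    finally show "nab (ract M m x) = mm 1 0 (nab m) (emb \<Gamma> x) \<oplus>\<^bsub>P 1\<^esub> pure (P 1) m (diff \<Gamma> (emb \<Gamma> x))" .
  qed
qed

lemma flat_on_generators:
  assumes nab: "right_connection K D M \<Gamma> nab" and Gs: "Gs \<subseteq> carrier M"
    and gen: "\<And>m. m \<in> carrier M \<Longrightarrow> m \<in> add_span M {ract M s y | s y. s \<in> Gs \<and> y \<in> carrier D}"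
    and flat: "\<And>s. s \<in> Gs \<Longrightarrow> curvature D M \<Gamma> nab s = \<zero>\<^bsub>P 2\<^esub>"
  shows "flat_connection K D M \<Gamma> nab"
  unfolding flat_connection_def
proof (intro conjI ballI nab)
  fix m assume m: "m \<in> carrier M"
  show "curvature D M \<Gamma> nab m = \<zero>\<^bsub>P 2\<^esub>"
  proof (rule addmap_span_eq[OF curvature_addmap[OF nab] _ _ _ gen[OF m], of "\<lambda>_. \<zero>\<^bsub>P 2\<^esub>"])
    show "addmap M (P 2) (\<lambda>_. \<zero>\<^bsub>P 2\<^esub>)" by (rule lin_addmap[OF lin_zero_map[OF M_mod P_module]])
    show "{ract M s y | s y. s \<in> Gs \<and> y \<in> carrier D} \<subseteq> carrier M"
      using Gs ract_closed by blast
    fix m assume "m \<in> {ract M s y | s y. s \<in> Gs \<and> y \<in> carrier D}"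
    then obtain s y where s: "s \<in> Gs" and y: "y \<in> carrier D" and m: "m = ract M s y" by blast
    have l: "addmap (P 2) (P 2) (\<lambda>t. mm 2 0 t (emb \<Gamma> y))" by (rule mm_left[OF deg_emb[OF y]]) simp
    have "s \<in> carrier M" using s Gs by blast
    then show "curvature D M \<Gamma> nab m = \<zero>\<^bsub>P 2\<^esub>"
      by (simp only: m curvature_act[OF nab _ y] flat[OF s] addmap_zero[OF l])
  qed
qed

lemma pP_smult_right:
  assumes c: "c \<in> carrier K" and m: "m \<in> carrier M" and \<omega>: "\<omega> \<in> deg \<Gamma> n"
  shows "pure (P n) m (c \<odot>\<^bsub>\<Gamma>\<^esub> \<omega>) = c \<odot>\<^bsub>P n\<^esub> pure (P n) m \<omega>"
proof -
  interpret GM: module K \<Gamma> by (rule assoc_algebraD(2)[OF G_algebra])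
  interpret DM: module K D by (rule assoc_algebraD(2)[OF D_algebra])
  have c1: "c \<odot>\<^bsub>D\<^esub> \<one>\<^bsub>D\<^esub> \<in> carrier D" using c by simp
  have "c \<odot>\<^bsub>\<Gamma>\<^esub> \<omega> = emb \<Gamma> (c \<odot>\<^bsub>D\<^esub> \<one>\<^bsub>D\<^esub>) \<otimes>\<^bsub>\<Gamma>\<^esub> \<omega>"
    using c deg_carrier[OF \<omega>] assoc_algebraD(3)[OF G_algebra]
    by (simp add: lin_smult[OF emb_lin] emb_one)
  then have "pure (P n) m (c \<odot>\<^bsub>\<Gamma>\<^esub> \<omega>) = pure (P n) (ract M m (c \<odot>\<^bsub>D\<^esub> \<one>\<^bsub>D\<^esub>)) \<omega>"
    by (simp add: pP_balanced[OF m c1 \<omega>])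
  also have "ract M m (c \<odot>\<^bsub>D\<^esub> \<one>\<^bsub>D\<^esub>) = c \<odot>\<^bsub>M\<^esub> m"
    using lin_smult[OF bilin_right[OF raction_bilin[OF M_action] m] c] raction_one[OF M_action m] by simp
  finally show ?thesis using lin_smult[OF pP_lin[OF \<omega>] c m] by simp
qed

lemma pP_right_lin:
  assumes h: "lin K V \<Gamma> h" and d: "\<And>v. v \<in> carrier V \<Longrightarrow> h v \<in> deg \<Gamma> n" and m: "m \<in> carrier M"
  shows "lin K V (P n) (\<lambda>v. pure (P n) m (h v))"
  by (rule linI[OF lin_dom[OF h] P_module])
    (simp_all add: pP_closed m d lin_add[OF h] pP_add_right lin_smult[OF h] pP_smult_right)

lemma P_tlift_param_lin:
  assumes \<beta>: "\<And>m \<omega>. m \<in> carrier M \<Longrightarrow> \<omega> \<in> deg \<Gamma> n \<Longrightarrow> lin K V Q (\<lambda>v. \<beta> v m \<omega>)"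
    and V: "module K V" and Q: "module K Q" and t: "t \<in> carrier (P n)"
  shows "lin K V Q (\<lambda>v. tlift Q (\<beta> v) t)"
proof (rule linI_addmap[OF V Q])
  interpret V: module K V by fact
  interpret Q: module K Q by fact
  have c: "\<beta> v m \<omega> \<in> carrier Q" if "v \<in> carrier V" "m \<in> carrier M" "\<omega> \<in> deg \<Gamma> n" for v m \<omega>
    using lin_closed[OF \<beta>] that by blast
  show "addmap V Q (\<lambda>v. tlift Q (\<beta> v) t)"
    by (rule P_tlift_param[OF lin_addmap[OF \<beta>] V.abelian_group_axioms Q.abelian_group_axioms t])
  show "tlift Q (\<beta> (a \<odot>\<^bsub>V\<^esub> v)) t = a \<odot>\<^bsub>Q\<^esub> tlift Q (\<beta> v) t" if a: "a \<in> carrier K" and v: "v \<in> carrier V" for a v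
  proof -
    have "addmap Q Q (\<lambda>x. a \<odot>\<^bsub>Q\<^esub> x)"
      using a by (intro addmapI Q.abelian_group_axioms) (simp_all add: Q.smult_r_distr)
    then have "a \<odot>\<^bsub>Q\<^esub> tlift Q (\<beta> v) t = tlift Q (\<lambda>m \<omega>. a \<odot>\<^bsub>Q\<^esub> \<beta> v m \<omega>) t"
      by (rule P_addmap_tlift[OF _ c[OF v] t])
    also have "\<dots> = tlift Q (\<beta> (a \<odot>\<^bsub>V\<^esub> v)) t"
      by (rule P_tlift_cong[OF Q.abelian_group_axioms _ t]) (use c a v lin_smult[OF \<beta>] in simp_all)
    finally show ?thesis by simp
  qed
qed

lemma emb_forms: "addmap D (F 0) (emb \<Gamma>)"
  by (rule addmapI[OF module_abelian[OF lin_dom[OF emb_lin]] forms_abelian])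
    (simp_all add: deg_emb lin_add[OF emb_lin])

end

text \<open>
  A module map \<open>\<psi>\<close> over a homomorphism \<open>J\<close> of calculi, as for the inclusion of a module into the one
  induced from it.  The map \<open>push n\<close> is \<open>\<psi> \<otimes> J\<close> on forms of degree \<open>n\<close>.
\<close>

locale induced_connection =
  S: calculus_module K D' \<Gamma>' M' + calculus_module K D \<Gamma> M
  for K :: "('k, 'q) ring_scheme" and D' :: "('k, 'e, 'r1) module_scheme" and \<Gamma>' :: "('k, 'v, 'e, 's1) calculus_scheme"
    and M' :: "('k, 'n, 'e, 't1) rmodule_scheme" and D :: "('k, 'd, 'r) module_scheme"
    and \<Gamma> :: "('k, 'w, 'd, 's) calculus_scheme" and M :: "('k, 'm, 'd, 't) rmodule_scheme" +
  fixes \<psi> :: "'n \<Rightarrow> 'm" and j :: "'e \<Rightarrow> 'd" and J :: "'v \<Rightarrow> 'w"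
  assumes psi_lin: "lin K M' M \<psi>" and J_addmap: "addmap \<Gamma>' \<Gamma> J"
    and j_closed: "x \<in> carrier D' \<Longrightarrow> j x \<in> carrier D"
    and psi_act: "m \<in> carrier M' \<Longrightarrow> x \<in> carrier D' \<Longrightarrow> \<psi> (ract M' m x) = ract M (\<psi> m) (j x)"
    and J_emb: "x \<in> carrier D' \<Longrightarrow> J (emb \<Gamma>' x) = emb \<Gamma> (j x)"
    and J_deg: "\<omega> \<in> deg \<Gamma>' n \<Longrightarrow> J \<omega> \<in> deg \<Gamma> n"
    and J_mult: "\<omega> \<in> carrier \<Gamma>' \<Longrightarrow> \<eta> \<in> carrier \<Gamma>' \<Longrightarrow> J (\<omega> \<otimes>\<^bsub>\<Gamma>'\<^esub> \<eta>) = J \<omega> \<otimes>\<^bsub>\<Gamma>\<^esub> J \<eta>"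
    and J_diff: "\<omega> \<in> carrier \<Gamma>' \<Longrightarrow> J (diff \<Gamma>' \<omega>) = diff \<Gamma> (J \<omega>)"
begin

abbreviation push :: "nat \<Rightarrow> ('n, 'v) tensor \<Rightarrow> ('m, 'w) tensor" where
  "push n \<equiv> tlift (P n) (\<lambda>m \<omega>. pure (P n) (\<psi> m) (J \<omega>))"

lemma J_forms: "addmap (S.F n) (F n) J"
  by (rule addmapI[OF S.forms_abelian forms_abelian])
    (simp_all add: J_deg addmap_add[OF J_addmap] S.deg_carrier)

lemma push_biadd: "biadd M' (S.F n) (P n) (\<lambda>m \<omega>. pure (P n) (\<psi> m) (J \<omega>))"
  by (rule biaddI[OF addmap_comp[OF J_forms pP_right] addmap_comp[OF lin_addmap[OF psi_lin] pP_left]])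
    (simp_all add: lin_closed[OF psi_lin] J_deg)

lemma push_balanced: "m \<in> carrier M' \<Longrightarrow> x \<in> carrier D' \<Longrightarrow> \<omega> \<in> deg \<Gamma>' n \<Longrightarrow>
    pure (P n) (\<psi> (ract M' m x)) (J \<omega>) = pure (P n) (\<psi> m) (J (emb \<Gamma>' x \<otimes>\<^bsub>\<Gamma>'\<^esub> \<omega>))"
  by (simp add: psi_act pP_balanced lin_closed[OF psi_lin] j_closed J_deg J_mult S.deg_carrier J_emb)

lemma push_lin: "lin K (S.P n) (P n) (push n)"
  by (rule S.P_lift_lin[OF push_biadd P_module push_balanced])
    (simp_all add: lin_smult[OF psi_lin] lin_smult[OF pP_lin] J_deg lin_closed[OF psi_lin])

lemmas push_addmap = lin_addmap[OF push_lin]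

lemma push_pure: "m \<in> carrier M' \<Longrightarrow> \<omega> \<in> deg \<Gamma>' n \<Longrightarrow> push n (pure (S.P n) m \<omega>) = pure (P n) (\<psi> m) (J \<omega>)"
  by (rule S.P_lift_pure[OF push_biadd push_balanced])

lemma push_mm:
  assumes t: "t \<in> carrier (S.P n)" and \<omega>: "\<omega> \<in> deg \<Gamma>' p" and k: "k = n + p"
  shows "push k (S.mm n p t \<omega>) = mm n p (push n t) (J \<omega>)"
  by (rule S.P_eqI[OF addmap_comp[OF S.mm_left[OF \<omega> k] push_addmap] addmap_comp[OF push_addmap mm_left[OF J_deg[OF \<omega>] k]] _ t])
    (simp add: S.mm_pure[OF \<omega> k] push_pure mm_pure[OF J_deg[OF \<omega>] k] J_deg S.deg_mult[OF _ \<omega>] k J_mult S.deg_carrier[OF \<omega>] S.deg_carrier lin_closed[OF psi_lin])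

text \<open>
  As \<open>J\<close> respects products and differentials, \<open>\<psi> \<otimes> J\<close> intertwines the extensions of the two connections
  in degree 1 as soon as it does so in degree 0.
\<close>

theorem curvature_push:
  assumes nab': "right_connection K D' M' \<Gamma>' nab'" and nab: "right_connection K D M \<Gamma> nab"
    and eq: "\<And>m. m \<in> carrier M' \<Longrightarrow> nab (\<psi> m) = push 1 (nab' m)" and m: "m \<in> carrier M'"
  shows "curvature D M \<Gamma> nab (\<psi> m) = push 2 (curvature D' M' \<Gamma>' nab' m)"
proof -
  have D': "addmap (S.P 1) (S.P 2) (conn_ext D' M' \<Gamma>' nab' 1)" by (rule S.conn_ext_addmap[OF nab']) simp
  have D: "addmap (P 1) (P 2) (conn_ext D M \<Gamma> nab 1)" by (rule conn_ext_addmap[OF nab]) simp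
  have "conn_ext D M \<Gamma> nab 1 (push 1 t) = push 2 (conn_ext D' M' \<Gamma>' nab' 1 t)" if t: "t \<in> carrier (S.P 1)" for t
  proof (rule S.P_eqI[OF addmap_comp[OF push_addmap D] addmap_comp[OF D' push_addmap] _ t])
    fix m \<omega> assume m: "m \<in> carrier M'" and \<omega>: "\<omega> \<in> deg \<Gamma>' 1"
    have d: "diff \<Gamma>' \<omega> \<in> deg \<Gamma>' 2" using S.diff_deg[OF \<omega>] by simp
    note n' = S.nab_closed[OF nab' m]
    have c: "S.mm 1 1 (nab' m) \<omega> \<in> carrier (S.P 2)" by (rule S.mm_closed[OF n' \<omega>]) simp
    have "conn_ext D M \<Gamma> nab 1 (push 1 (pure (S.P 1) m \<omega>)) = mm 1 1 (push 1 (nab' m)) (J \<omega>) \<oplus>\<^bsub>P 2\<^esub> pure (P 2) (\<psi> m) (J (diff \<Gamma>' \<omega>))"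
      using conn_ext_pure[OF nab, of 2 1 "\<psi> m" "J \<omega>"]
      by (simp add: push_pure m \<omega> lin_closed[OF psi_lin] J_deg eq J_diff S.deg_carrier[OF \<omega>])
    also have "\<dots> = push 2 (S.mm 1 1 (nab' m) \<omega>) \<oplus>\<^bsub>P 2\<^esub> push 2 (pure (S.P 2) m (diff \<Gamma>' \<omega>))"
      using push_mm[OF n' \<omega>, of 2] push_pure[OF m d] by simp
    also have "\<dots> = push 2 (conn_ext D' M' \<Gamma>' nab' 1 (pure (S.P 1) m \<omega>))"
      using S.conn_ext_pure[OF nab', of 2 1 m \<omega>] addmap_add[OF push_addmap c S.pP_closed[OF m d]] m \<omega> by simp
    finally show "conn_ext D M \<Gamma> nab 1 (push 1 (pure (S.P 1) m \<omega>)) = push 2 (conn_ext D' M' \<Gamma>' nab' 1 (pure (S.P 1) m \<omega>))" .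
  qed
  from this[OF S.nab_closed[OF nab' m]] show ?thesis
    by (simp add: curvature_eq[OF nab] S.curvature_eq[OF nab'] m lin_closed[OF psi_lin] eq)
qed

text \<open>
  Since \<open>\<psi> s \<cdot> (j x y) = \<psi> (s x) \<cdot> y\<close>, the rule at \<open>j x y\<close> follows from the one at \<open>y\<close> for \<open>s x\<close> in place of
  \<open>s\<close> and the Leibniz rule of the source connection.
\<close>

lemma leibniz_extend:
  assumes nab': "right_connection K D' M' \<Gamma>' nab'" and nab: "lin K M (P 1) nab" and Y: "Y \<subseteq> carrier D"
    and base: "\<And>s y. s \<in> carrier M' \<Longrightarrow> y \<in> Y \<Longrightarrow>
      nab (ract M (\<psi> s) y) = mm 1 0 (push 1 (nab' s)) (emb \<Gamma> y) \<oplus>\<^bsub>P 1\<^esub> pure (P 1) (\<psi> s) (diff \<Gamma> (emb \<Gamma> y))"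
    and span: "\<And>y. y \<in> carrier D \<Longrightarrow> y \<in> add_span D {j x \<otimes>\<^bsub>D\<^esub> y | x y. x \<in> carrier D' \<and> y \<in> Y}"
    and s: "s \<in> carrier M'" and y: "y \<in> carrier D"
  shows "nab (ract M (\<psi> s) y) = mm 1 0 (push 1 (nab' s)) (emb \<Gamma> y) \<oplus>\<^bsub>P 1\<^esub> pure (P 1) (\<psi> s) (diff \<Gamma> (emb \<Gamma> y))"
proof -
  interpret P1: module K "P 1" by (rule P_module)
  note ps = lin_closed[OF psi_lin s]
  note n' = S.nab_closed[OF nab' s]
  note pn = lin_closed[OF push_lin n']
  have d1: "addmap D (P 1) (\<lambda>y. pure (P 1) (\<psi> s) (diff \<Gamma> (emb \<Gamma> y)))"
    by (rule addmap_comp[OF emb_forms addmap_comp[OF addmap_forms_diff pP_right[OF ps]]]) (simp add: One_nat_def)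
  show ?thesis
  proof (rule addmap_span_eq[OF addmap_comp[OF lin_addmap[OF bilin_right[OF raction_bilin[OF M_action] ps]] lin_addmap[OF nab]]
        addmap_plus[OF addmap_comp[OF emb_forms mm_right[OF pn]] d1] _ _ span[OF y]])
    show "{j x \<otimes>\<^bsub>D\<^esub> y | x y. x \<in> carrier D' \<and> y \<in> Y} \<subseteq> carrier D"
      using Y j_closed DR.m_closed by blast
    fix z assume "z \<in> {j x \<otimes>\<^bsub>D\<^esub> y | x y. x \<in> carrier D' \<and> y \<in> Y}"
    then obtain x y where x: "x \<in> carrier D'" and yY: "y \<in> Y" and z: "z = j x \<otimes>\<^bsub>D\<^esub> y" by blast
    have y: "y \<in> carrier D" using yY Y by blast
    note jx = j_closed[OF x]
    note ey = deg_emb[OF y] and ex = deg_emb[OF jx] and ex' = S.deg_emb[OF x]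
    have dy: "diff \<Gamma> (emb \<Gamma> y) \<in> deg \<Gamma> 1" and dx: "diff \<Gamma> (emb \<Gamma> (j x)) \<in> deg \<Gamma> 1" and dx': "diff \<Gamma>' (emb \<Gamma>' x) \<in> deg \<Gamma>' 1"
      using diff_deg'[OF ey, of 1] diff_deg'[OF ex, of 1] S.diff_deg'[OF ex', of 1] by simp_all
    have e: "diff \<Gamma> (emb \<Gamma> (j x)) \<otimes>\<^bsub>\<Gamma>\<^esub> emb \<Gamma> y \<in> deg \<Gamma> 1" "emb \<Gamma> (j x) \<otimes>\<^bsub>\<Gamma>\<^esub> diff \<Gamma> (emb \<Gamma> y) \<in> deg \<Gamma> 1"
      using deg_mult[OF dx ey] emb_mult_deg[OF jx dy] by simp_all
    have l: "addmap (P 1) (P 1) (\<lambda>t. mm 1 0 t (emb \<Gamma> y))" by (rule mm_left[OF ey]) simp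
    have c: "mm 1 0 (push 1 (nab' s)) (emb \<Gamma> (j x)) \<in> carrier (P 1)" "pure (P 1) (\<psi> s) (diff \<Gamma> (emb \<Gamma> (j x))) \<in> carrier (P 1)"
      "mm 1 0 (push 1 (nab' s)) (emb \<Gamma> (j x) \<otimes>\<^bsub>\<Gamma>\<^esub> emb \<Gamma> y) \<in> carrier (P 1)"
      using mm_closed[OF pn ex, of 1] pP_closed[OF ps dx] mm_closed[OF pn deg_mult[OF ex ey, simplified], of 1] by simp_all
    have c': "S.mm 1 0 (nab' s) (emb \<Gamma>' x) \<in> carrier (S.P 1)" "pure (S.P 1) s (diff \<Gamma>' (emb \<Gamma>' x)) \<in> carrier (S.P 1)"
      using S.mm_closed[OF n' ex', of 1] S.pP_closed[OF s dx'] by simp_all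
    have "push 1 (nab' (ract M' s x)) = mm 1 0 (push 1 (nab' s)) (emb \<Gamma> (j x)) \<oplus>\<^bsub>P 1\<^esub> pure (P 1) (\<psi> s) (diff \<Gamma> (emb \<Gamma> (j x)))"
      using push_mm[OF n' ex', of 1]
      by (simp add: S.connectionD(2)[OF nab' s x] addmap_add[OF push_addmap c'] push_pure[OF s dx'] J_emb[OF x] J_diff S.deg_carrier[OF ex'])
    moreover have "nab (ract M (\<psi> s) z) = mm 1 0 (push 1 (nab' (ract M' s x))) (emb \<Gamma> y) \<oplus>\<^bsub>P 1\<^esub> pure (P 1) (\<psi> (ract M' s x)) (diff \<Gamma> (emb \<Gamma> y))"
      using base[OF S.ract_closed[OF s x] yY] raction_assoc[OF M_action ps jx y] psi_act[OF s x] by (simp add: z)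
    moreover have "diff \<Gamma> (emb \<Gamma> z) = diff \<Gamma> (emb \<Gamma> (j x)) \<otimes>\<^bsub>\<Gamma>\<^esub> emb \<Gamma> y \<oplus>\<^bsub>\<Gamma>\<^esub> emb \<Gamma> (j x) \<otimes>\<^bsub>\<Gamma>\<^esub> diff \<Gamma> (emb \<Gamma> y)"
      using diff_mult[OF ex deg_carrier[OF ey]] by (simp add: z emb_mult jx y)
    ultimately show "nab (ract M (\<psi> s) z) = mm 1 0 (push 1 (nab' s)) (emb \<Gamma> z) \<oplus>\<^bsub>P 1\<^esub> pure (P 1) (\<psi> s) (diff \<Gamma> (emb \<Gamma> z))"
      using mm_assoc[OF pn ex ey, of 1 0] mm_pure[OF ey _ ps dx, of 1] pP_balanced[OF ps jx dy] psi_act[OF s x] c e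
      by (simp add: addmap_add[OF l] z emb_mult jx y pP_add_right ps P1.a_assoc pP_closed)
  qed simp
qed

lemma leibniz_at_one:
  assumes nab': "right_connection K D' M' \<Gamma>' nab'" and s: "s \<in> carrier M'"
    and leib: "nab (ract M (\<psi> s) \<one>\<^bsub>D\<^esub>) = mm 1 0 (push 1 (nab' s)) (emb \<Gamma> \<one>\<^bsub>D\<^esub>) \<oplus>\<^bsub>P 1\<^esub> pure (P 1) (\<psi> s) (diff \<Gamma> (emb \<Gamma> \<one>\<^bsub>D\<^esub>))"
  shows "nab (\<psi> s) = push 1 (nab' s)"
proof -
  interpret P1: module K "P 1" by (rule P_module)
  show ?thesis
    using leib lin_closed[OF push_lin S.nab_closed[OF nab' s]] lin_closed[OF psi_lin s]
    by (simp add: raction_one[OF M_action] emb_one diff_one pP_zero_right mm_one)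
qed

end

section \<open>The product module\<close>

text \<open>
  The endomorphism \<open>x \<otimes> g \<mapsto> x \<cdot> \<tau> (g \<otimes> 1)\<close> fixes every \<open>\<tau> (f \<otimes> a)\<close>, by
  multiplicativity of \<open>\<tau>\<close>.  As these span \<open>A \<otimes> F\<close>, it also fixes \<open>1 \<otimes> f\<close>.
\<close>

lemma module_twisting_unit:
  assumes A: "assoc_algebra K A" and F: "module K F"
    and lin: "lin K (ktensor K F A) (ktensor K A F) \<tau>"
    and surj: "\<tau> ` carrier (ktensor K F A) = carrier (ktensor K A F)"
    and mult: "\<And>f a a'. f \<in> carrier F \<Longrightarrow> a \<in> carrier A \<Longrightarrow> a' \<in> carrier A \<Longrightarrow>
      \<tau> (pure (ktensor K F A) f (a \<otimes>\<^bsub>A\<^esub> a')) =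
        tlift (ktensor K A F) (\<lambda>x g. tmap K A F (monoid.mult A x) (\<lambda>g. g) (\<tau> (pure (ktensor K F A) g a')))
          (\<tau> (pure (ktensor K F A) f a))"
    and f: "f \<in> carrier F"
  shows "\<tau> (pure (ktensor K F A) f \<one>\<^bsub>A\<^esub>) = pure (ktensor K A F) \<one>\<^bsub>A\<^esub> f"
proof -
  interpret A: ring A by (rule assoc_algebraD(1)[OF A])
  note mA = assoc_algebraD(2)[OF A]
  note bA = assoc_algebra_bilin[OF A]
  let ?AF = "ktensor K A F" and ?FA = "ktensor K F A"
  have AF: "module K ?AF" and FA: "module K ?FA" using kt_module[OF mA F] kt_module[OF F mA] .
  have tl: "lin K F ?AF (\<lambda>g. \<tau> (pure ?FA g \<one>\<^bsub>A\<^esub>))"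
    by (rule lin_comp[OF lin kt_pure_left[OF F mA]]) simp
  define h where "h = tlift ?AF (\<lambda>x g. tmap K A F (monoid.mult A x) (\<lambda>g. g) (\<tau> (pure ?FA g \<one>\<^bsub>A\<^esub>)))"
  have b: "bilin K A F ?AF (\<lambda>x g. tmap K A F (monoid.mult A x) (\<lambda>g. g) (\<tau> (pure ?FA g \<one>\<^bsub>A\<^esub>)))"
  proof (rule bilinI[OF mA F AF])
    show "lin K A ?AF (\<lambda>x. tmap K A F (monoid.mult A x) (\<lambda>g. g) (\<tau> (pure ?FA g \<one>\<^bsub>A\<^esub>)))" if "g \<in> carrier F" for g
      by (rule tmap_param_left[OF bilin_left[OF bA] lin_id[OF F] mA mA mA lin_closed[OF tl that]])
    show "lin K F ?AF (\<lambda>g. tmap K A F (monoid.mult A x) (\<lambda>g. g) (\<tau> (pure ?FA g \<one>\<^bsub>A\<^esub>)))" if "x \<in> carrier A" for x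
      by (rule lin_comp[OF tmap_lin[OF bilin_right[OF bA that] lin_id[OF F]] tl])
  qed
  have hl: "lin K ?AF ?AF h" unfolding h_def by (rule kt_lift[OF mA F b])
  have stable: "h (\<tau> u) = \<tau> u" if "u \<in> carrier ?FA" for u
    by (rule kt_lin_eqI[OF F mA lin_comp[OF hl lin] lin _ that])
      (use mult[of _ _ "\<one>\<^bsub>A\<^esub>"] in \<open>simp add: h_def\<close>)
  have p: "pure ?AF \<one>\<^bsub>A\<^esub> f \<in> carrier ?AF" using kt_pure_closed[OF mA F] f by simp
  then obtain u where u: "u \<in> carrier ?FA" "pure ?AF \<one>\<^bsub>A\<^esub> f = \<tau> u" using surj by blast
  have "pure ?AF \<one>\<^bsub>A\<^esub> f = h (pure ?AF \<one>\<^bsub>A\<^esub> f)" using stable[OF u(1)] u(2) by simp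
  also have "\<dots> = tmap K A F (monoid.mult A \<one>\<^bsub>A\<^esub>) (\<lambda>g. g) (\<tau> (pure ?FA f \<one>\<^bsub>A\<^esub>))"
    unfolding h_def by (rule kt_lift_pure[OF mA F b]) (simp_all add: f)
  also have "\<dots> = tmap K A F (\<lambda>x. x) (\<lambda>g. g) (\<tau> (pure ?FA f \<one>\<^bsub>A\<^esub>))"
    by (rule tmap_cong[OF lin_id[OF mA] lin_id[OF F] lin_closed[OF tl f]]) simp_all
  also have "\<dots> = \<tau> (pure ?FA f \<one>\<^bsub>A\<^esub>)" by (rule tmap_id[OF mA F lin_closed[OF tl f]])
  finally show ?thesis by simp
qed

lemma direct_sum_module:
  assumes "module K V" "module K W" shows "module K (direct_sum V W)"
proof -
  interpret V: module K V by fact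
  interpret W: module K W by fact
  show ?thesis
  proof (rule moduleI[OF V.R.is_cring abelian_groupI])
    show "\<exists>y \<in> carrier (direct_sum V W). y \<oplus>\<^bsub>direct_sum V W\<^esub> x = \<zero>\<^bsub>direct_sum V W\<^esub>" if "x \<in> carrier (direct_sum V W)" for x
      using that by (intro bexI[of _ "(\<ominus>\<^bsub>V\<^esub> fst x, \<ominus>\<^bsub>W\<^esub> snd x)"]) (auto simp: direct_sum_def V.l_neg W.l_neg)
    show "x \<oplus>\<^bsub>direct_sum V W\<^esub> y = y \<oplus>\<^bsub>direct_sum V W\<^esub> x" if "x \<in> carrier (direct_sum V W)" "y \<in> carrier (direct_sum V W)" for x y
      using that by (auto simp: direct_sum_def V.a_comm W.a_comm)
  qed (auto simp: direct_sum_def V.a_assoc W.a_assoc V.smult_l_distr W.smult_l_distr V.smult_r_distr W.smult_r_distr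
      V.smult_assoc1 W.smult_assoc1)
qed

lemma lin_pair:
  assumes "lin K U V f" "lin K U W g" shows "lin K U (direct_sum V W) (\<lambda>x. (f x, g x))"
  by (rule linI[OF lin_dom[OF assms(1)] direct_sum_module[OF lin_cod[OF assms(1)] lin_cod[OF assms(2)]]])
    (simp_all add: direct_sum_def lin_closed[OF assms(1)] lin_closed[OF assms(2)] lin_add[OF assms(1)] lin_add[OF assms(2)]
      lin_smult[OF assms(1)] lin_smult[OF assms(2)])

lemma lin_fst: "module K V \<Longrightarrow> module K W \<Longrightarrow> lin K (direct_sum V W) V fst"
  and lin_snd: "module K V \<Longrightarrow> module K W \<Longrightarrow> lin K (direct_sum V W) W snd"
  by (rule linI[OF direct_sum_module]; auto simp: direct_sum_def)+

section \<open>The product connection\<close>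

locale product_data = twisted_forms K A B R Rt
  for K :: "'k ring" and A :: "('k, 'a) module" and B :: "('k, 'b) module"
    and R :: "('b, 'a) tensor \<Rightarrow> ('a, 'b) tensor" and Rt :: "('b form, 'a form) tensor \<Rightarrow> ('a form, 'b form) tensor" +
  fixes E :: "('k, 'e, 'a) rmodule" and F :: "('k, 'f, 'b) rmodule" and \<tau> :: "('f, 'a) tensor \<Rightarrow> ('a, 'f) tensor"
    and nabE :: "'e \<Rightarrow> ('e, 'a form) tensor" and nabF :: "'f \<Rightarrow> ('f, 'b form) tensor"
  assumes R_surj: "R ` carrier (ktensor K B A) = carrier (ktensor K A B)"
    and E_mod: "right_module K A E" and nabE: "right_connection K A E (univ_dga K A) nabE"
    and F_mod: "right_module K B F" and nabF: "right_connection K B F (univ_dga K B) nabF"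
    and tau: "module_twisting_map K A B R F \<tau>"
    and tau_bij: "bij_betw \<tau> (carrier (ktensor K F A)) (carrier (ktensor K A F))"
    and compatible: "connection_compatible K A B Rt F \<tau> nabF"
begin

lemma E_action: "raction K A E (ract E)" by (rule raction_right_module[OF modA E_mod])
lemma F_action: "raction K B F (ract F)" by (rule raction_right_module[OF modB F_mod])
lemma modE: "module K E" and modF: "module K F"
  using E_mod F_mod by (simp_all add: right_module_def)

abbreviation "EB \<equiv> ktensor K E B"
abbreviation "AF \<equiv> ktensor K A F"
abbreviation "FA \<equiv> ktensor K F A"
abbreviation "M \<equiv> product_module K A B R E F \<tau>"

lemma modEB: "module K EB" and modAF: "module K AF" and modFA: "module K FA"
  by (rule kt_module[OF modE modB], rule kt_module[OF modA modF], rule kt_module[OF modF modA])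

lemma tau_lin: "lin K FA AF \<tau>"
  using tau modAF modFA by (simp add: module_twisting_map_def lin_def)

lemma tau_surj: "\<tau> ` carrier FA = carrier AF"
  using tau_bij by (rule bij_betw_imp_surj_on)

lemma tau_twist: "module_twist K A B R F (ract F) \<tau>"
proof (rule module_twist.intro[OF algA algB F_action tau_lin])
  show m: "\<tau> (pure FA f (a \<otimes>\<^bsub>A\<^esub> a')) = tlift AF (\<lambda>x g. tmap K A F (monoid.mult A x) (\<lambda>g. g) (\<tau> (pure FA g a'))) (\<tau> (pure FA f a))"
    if "f \<in> carrier F" "a \<in> carrier A" "a' \<in> carrier A" for f a a'
    using tau that by (simp add: module_twisting_map_def tmap_def)
  show "\<tau> (pure FA f \<one>\<^bsub>A\<^esub>) = pure AF \<one>\<^bsub>A\<^esub> f" if "f \<in> carrier F" for f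
    by (rule module_twisting_unit[OF algA modF tau_lin tau_surj m that])
  show "\<tau> (pure FA (ract F f b) a) = tlift AF (\<lambda>x y. tmap K A F (\<lambda>x. x) (\<lambda>g. ract F g y) (\<tau> (pure FA f x))) (R (pure (ktensor K B A) b a))"
    if "f \<in> carrier F" "b \<in> carrier B" "a \<in> carrier A" for f b a
    using tau that by (simp add: module_twisting_map_def tmap_def)
qed

sublocale fw: module_twist_assoc K A B R F "ract F" \<tau>
  by (intro module_twist_assoc.intro twist_module tau_twist)

abbreviation "actE \<equiv> tact K A E B (ract E) (monoid.mult B) R"
abbreviation "actF \<equiv> tact K A A F (monoid.mult A) (ract F) \<tau>"

lemma M_simps:
  "carrier M = carrier EB \<times> carrier AF" "(s, t) \<oplus>\<^bsub>M\<^esub> (s', t') = (s \<oplus>\<^bsub>EB\<^esub> s', t \<oplus>\<^bsub>AF\<^esub> t')" "\<zero>\<^bsub>M\<^esub> = (\<zero>\<^bsub>EB\<^esub>, \<zero>\<^bsub>AF\<^esub>)"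
  "c \<odot>\<^bsub>M\<^esub> (s, t) = (c \<odot>\<^bsub>EB\<^esub> s, c \<odot>\<^bsub>AF\<^esub> t)" "ract M (s, t) z = (actE s z, actF t z)"
  "add M = add (direct_sum EB AF)" "smult M = smult (direct_sum EB AF)"
  by (simp_all add: product_module_def Let_def module.defs rmodule.defs direct_sum_def tact_def tmap_def)

lemma modM: "module K M"
  by (rule module_cong[OF direct_sum_module[OF modEB modAF]])
    (simp_all only: M_simps(1,3,6,7), simp_all add: direct_sum_def)

lemma lin_M_cod: "lin K V (direct_sum EB AF) h \<Longrightarrow> lin K V M h"
  by (erule lin_cong_cod) (simp_all only: M_simps(1,3,6,7), simp_all add: direct_sum_def)

lemma lin_M_dom: "lin K (direct_sum EB AF) V h \<Longrightarrow> lin K M V h"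
  by (erule lin_cong_dom) (simp_all only: M_simps(1,3,6,7), simp_all add: direct_sum_def)

lemmas actE_bilin = tw.B.tact_bilin[OF E_action]
lemmas A_action = raction_algebra[OF algA]
lemmas actF_bilin = fw.tact_bilin[OF A_action]

lemma M_action: "raction K TP M (ract M)"
  unfolding raction_def
proof (intro conjI ballI)
  show "bilin K M TP M (ract M)"
  proof (rule bilinI[OF modM TP_module modM])
    show "lin K M M (\<lambda>m. ract M m z)" if "z \<in> carrier TP" for z
    proof -
      have z: "z \<in> carrier AB" using that by (simp add: TP_simps)
      have "lin K M M (\<lambda>m. (actE (fst m) z, actF (snd m) z))"
        by (rule lin_M_dom[OF lin_M_cod[OF lin_pair[OF lin_comp[OF bilin_left[OF actE_bilin z] lin_fst[OF modEB modAF]]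
                lin_comp[OF bilin_left[OF actF_bilin z] lin_snd[OF modEB modAF]]]]])
      then show ?thesis by (rule lin_cong) (auto simp: M_simps)
    qed
    show "lin K TP M (ract M m)" if m: "m \<in> carrier M" for m
    proof -
      have "fst m \<in> carrier EB" "snd m \<in> carrier AF" using m by (auto simp: M_simps)
      then have "lin K TP M (\<lambda>z. (actE (fst m) z, actF (snd m) z))"
        unfolding lin_TP_dom by (intro lin_M_cod lin_pair bilin_right[OF actE_bilin] bilin_right[OF actF_bilin])
      then show ?thesis by (rule lin_cong) (metis M_simps(5) prod.collapse)
    qed
  qed
  show "ract M m (x \<otimes>\<^bsub>TP\<^esub> y) = ract M (ract M m x) y" if "m \<in> carrier M" "x \<in> carrier TP" "y \<in> carrier TP" for m x y
    using that tw.tact_assoc[OF E_action] fw.tact_assoc[OF A_action] by (auto simp: M_simps TP_simps)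
  show "ract M m \<one>\<^bsub>TP\<^esub> = m" if "m \<in> carrier M" for m
    using that tw.tact_one[OF E_action] fw.tact_one[OF A_action] by (auto simp: M_simps TP_simps)
qed

sublocale C: calculus_module K TP G M
  by (intro calculus_module.intro G_calculus calculus_module_axioms.intro M_action)

sublocale CE: calculus_module K A OA E
  by (intro calculus_module.intro UA.univ_dga_calculus calculus_module_axioms.intro E_action)

sublocale CF: calculus_module K B OB F
  by (intro calculus_module.intro UB.univ_dga_calculus calculus_module_axioms.intro F_action)

lemma oneA: "\<one>\<^bsub>A\<^esub> \<in> carrier A" and oneB: "\<one>\<^bsub>B\<^esub> \<in> carrier B"
  using monoid.one_closed[OF ring.is_monoid[OF assoc_algebraD(1)[OF algA]]]
    monoid.one_closed[OF ring.is_monoid[OF assoc_algebraD(1)[OF algB]]] .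

lemma oneOA: "\<one>\<^bsub>OA\<^esub> \<in> deg OA 0" "\<one>\<^bsub>OA\<^esub> \<in> carrier OA" and oneOB: "\<one>\<^bsub>OB\<^esub> \<in> deg OB 0" "\<one>\<^bsub>OB\<^esub> \<in> carrier OB"
  using CE.one_deg CF.one_deg by simp_all

text \<open>
  The generators of the product module, and the maps of algebras and of calculi over which they depend
  linearly on \<open>E\<close> and \<open>F\<close>.  In \<open>psiF\<close> the factor \<open>a\<close> is kept variable, because the product connection on
  \<open>A \<otimes> F\<close> is linear in it.
\<close>

definition psiE :: "'e \<Rightarrow> ('e, 'b) tensor \<times> ('a, 'f) tensor" where
  "psiE e = (pure EB e \<one>\<^bsub>B\<^esub>, \<zero>\<^bsub>AF\<^esub>)"
definition psiF :: "'a \<Rightarrow> 'f \<Rightarrow> ('e, 'b) tensor \<times> ('a, 'f) tensor" where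
  "psiF a f = (\<zero>\<^bsub>EB\<^esub>, pure AF a f)"
definition jA :: "'a \<Rightarrow> ('a, 'b) tensor" where "jA a = pure AB a \<one>\<^bsub>B\<^esub>"
definition jB :: "'b \<Rightarrow> ('a, 'b) tensor" where "jB b = pure AB \<one>\<^bsub>A\<^esub> b"
definition JA :: "'a form \<Rightarrow> ('a form, 'b form) tensor" where "JA \<phi> = pure T \<phi> \<one>\<^bsub>OB\<^esub>"
definition JB :: "'b form \<Rightarrow> ('a form, 'b form) tensor" where "JB \<omega> = pure T \<one>\<^bsub>OA\<^esub> \<omega>"

lemma jA_closed: "a \<in> carrier A \<Longrightarrow> jA a \<in> carrier AB" and jB_closed: "b \<in> carrier B \<Longrightarrow> jB b \<in> carrier AB"
  by (simp_all add: jA_def jB_def kt_pure_closed[OF modA modB] oneA oneB)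

lemma inE_lin: "lin K EB M (\<lambda>s. (s, \<zero>\<^bsub>AF\<^esub>))" and inF_lin: "lin K AF M (\<lambda>t. (\<zero>\<^bsub>EB\<^esub>, t))"
  by (rule lin_M_cod[OF lin_pair[OF lin_id[OF modEB] lin_zero_map[OF modEB modAF]]],
      rule lin_M_cod[OF lin_pair[OF lin_zero_map[OF modAF modEB] lin_id[OF modAF]]])

lemma psiE_lin: "lin K E M psiE"
  unfolding psiE_def[abs_def] by (rule lin_comp[OF inE_lin kt_pure_left[OF modE modB oneB]])

lemma psiF_bilin: "bilin K A F M psiF"
  unfolding psiF_def[abs_def]
  using bilin_comp[OF kt_pure_bilin[OF modA modF] lin_id[OF modA] lin_id[OF modF] inF_lin] .

text \<open>
  Both \<open>JA\<close> and \<open>JB\<close> are homomorphisms of differential graded algebras.  Products in the order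
  \<open>JA \<cdot> JB\<close> are elementary tensors; in the other order they are given by \<open>Rt\<close>.
\<close>

lemma JA_lin: "lin K OA T JA" and JB_lin: "lin K OB T JB"
  unfolding JA_def[abs_def] JB_def[abs_def]
  by (rule kt_pure_left[OF W.modA W.modB oneOB(2)], rule kt_pure_right[OF W.modA W.modB oneOA(2)])

lemma JA_deg: "\<phi> \<in> deg OA n \<Longrightarrow> JA \<phi> \<in> deg G n" and JB_deg: "\<omega> \<in> deg OB n \<Longrightarrow> JB \<omega> \<in> deg G n"
  unfolding JA_def JB_def using deg_G_gen[OF _ oneOB(1), of \<phi> n] deg_G_gen[OF oneOA(1), of \<omega> n] by simp_all

lemma J_emb: "a \<in> carrier A \<Longrightarrow> JA (emb OA a) = emb G (jA a)" "b \<in> carrier B \<Longrightarrow> JB (emb OB b) = emb G (jB b)"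
  by (simp_all add: JA_def JB_def jA_def jB_def emb_G_pure oneA oneB UA.emb_one UB.emb_one)

lemma JA_JB: "\<phi> \<in> carrier OA \<Longrightarrow> \<omega> \<in> carrier OB \<Longrightarrow> JA \<phi> \<otimes>\<^bsub>G\<^esub> JB \<omega> = pure T \<phi> \<omega>"
  unfolding JA_def JB_def
  by (simp add: G_mult_pure oneOA oneOB W.twist_unit_left tm_pure[OF lmA rmB])

lemma JA_mult: "\<phi> \<in> carrier OA \<Longrightarrow> \<phi>' \<in> carrier OA \<Longrightarrow> JA (\<phi> \<otimes>\<^bsub>OA\<^esub> \<phi>') = JA \<phi> \<otimes>\<^bsub>G\<^esub> JA \<phi>'"
  unfolding JA_def
  by (simp add: G_mult_pure oneOA oneOB W.twist_unit_left tm_pure[OF lmA rmB])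

lemma JB_mult: "\<omega> \<in> carrier OB \<Longrightarrow> \<omega>' \<in> carrier OB \<Longrightarrow> JB (\<omega> \<otimes>\<^bsub>OB\<^esub> \<omega>') = JB \<omega> \<otimes>\<^bsub>G\<^esub> JB \<omega>'"
  unfolding JB_def
  by (simp add: G_mult_pure oneOA oneOB W.tw.B.tau_one tm_pure[OF lmA rmB])

lemma JB_JA:
  assumes "\<omega> \<in> carrier OB" "\<phi> \<in> carrier OA" shows "JB \<omega> \<otimes>\<^bsub>G\<^esub> JA \<phi> = Rt (pure S \<omega> \<phi>)"
proof -
  have V: "Rt (pure S \<omega> \<phi>) \<in> carrier T" by (rule bilin_closed[OF Rt_bilin assms])
  have "JB \<omega> \<otimes>\<^bsub>G\<^esub> JA \<phi> = tm (\<lambda>x. \<one>\<^bsub>OA\<^esub> \<otimes>\<^bsub>OA\<^esub> x) (\<lambda>y. y \<otimes>\<^bsub>OB\<^esub> \<one>\<^bsub>OB\<^esub>) (Rt (pure S \<omega> \<phi>))"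
    unfolding JA_def JB_def by (rule G_mult_pure) (simp_all add: assms oneOA oneOB)
  also have "\<dots> = tm (\<lambda>x. x) (\<lambda>y. y) (Rt (pure S \<omega> \<phi>))"
    by (rule tmap_cong[OF idA idB V]) simp_all
  also have "\<dots> = Rt (pure S \<omega> \<phi>)" by (rule tmap_id[OF W.modA W.modB V])
  finally show ?thesis .
qed

lemma JA_diff: "\<phi> \<in> carrier OA \<Longrightarrow> JA (diff OA \<phi>) = diff G (JA \<phi>)"
  using kt_lift_pure[OF W.modA W.modB G_diff_bilin, of \<phi> "\<one>\<^bsub>OB\<^esub>"] lin_closed[OF UA.parity_lin, of \<phi>]
  by (simp add: JA_def G_diff_raw oneOB CF.diff_one pure_zero T_pure_closed)

lemma JB_diff: "\<omega> \<in> carrier OB \<Longrightarrow> JB (diff OB \<omega>) = diff G (JB \<omega>)"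
  using G_diff_pure[OF oneOA(1), of \<omega>]
  by (simp add: JB_def CE.diff_one pure_zero T_pure_closed oneOA)

lemma jA_jB: "a \<in> carrier A \<Longrightarrow> b \<in> carrier B \<Longrightarrow> jA a \<otimes>\<^bsub>TP\<^esub> jB b = pure AB a b"
  unfolding jA_def jB_def
  by (simp add: TP_mult_pure oneA oneB twist_unit_left
      tmap_pure[OF bilin_right[OF assoc_algebra_bilin[OF algA]] bilin_left[OF assoc_algebra_bilin[OF algB]]])

lemma jB_jA:
  assumes "b \<in> carrier B" "a \<in> carrier A" shows "jB b \<otimes>\<^bsub>TP\<^esub> jA a = R (pure (ktensor K B A) b a)"
proof -
  have V: "R (pure (ktensor K B A) b a) \<in> carrier AB" by (rule tw.B.tw_closed[OF assms])
  have "jB b \<otimes>\<^bsub>TP\<^esub> jA a = tmap K A B (\<lambda>x. \<one>\<^bsub>A\<^esub> \<otimes>\<^bsub>A\<^esub> x) (\<lambda>y. y \<otimes>\<^bsub>B\<^esub> \<one>\<^bsub>B\<^esub>) (R (pure (ktensor K B A) b a))"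
    unfolding jA_def jB_def by (rule TP_mult_pure) (simp_all add: assms oneA oneB)
  also have "\<dots> = tmap K A B (\<lambda>x. x) (\<lambda>y. y) (R (pure (ktensor K B A) b a))"
    by (rule tmap_cong[OF lin_id[OF modA] lin_id[OF modB] V]) simp_all
  also have "\<dots> = R (pure (ktensor K B A) b a)" by (rule tmap_id[OF modA modB V])
  finally show ?thesis .
qed

lemma act_zero: "z \<in> carrier AB \<Longrightarrow> actE \<zero>\<^bsub>EB\<^esub> z = \<zero>\<^bsub>EB\<^esub>" "z \<in> carrier AB \<Longrightarrow> actF \<zero>\<^bsub>AF\<^esub> z = \<zero>\<^bsub>AF\<^esub>"
  using lin_zero[OF bilin_left[OF actE_bilin]] lin_zero[OF bilin_left[OF actF_bilin]] by blast+

lemma psiE_jB: "e \<in> carrier E \<Longrightarrow> b \<in> carrier B \<Longrightarrow> ract M (psiE e) (jB b) = (pure EB e b, \<zero>\<^bsub>AF\<^esub>)"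
  by (simp add: psiE_def M_simps act_zero jB_closed)
    (simp add: jB_def oneA oneB tw.B.tact_pure[OF E_action] kt_pure_closed[OF modA modB] tw.B.rho_pure tw.B.tau_one
      tw.B.rop_pure tw.B.lop_pure[OF E_action] raction_one[OF E_action])

lemma psiE_jA: "e \<in> carrier E \<Longrightarrow> a \<in> carrier A \<Longrightarrow> psiE (ract E e a) = ract M (psiE e) (jA a)"
  by (simp add: psiE_def M_simps act_zero jA_closed)
    (simp add: jA_def oneA oneB tw.B.tact_pure[OF E_action] kt_pure_closed[OF modA modB] tw.B.rho_pure twist_unit_left
      tw.B.rop_pure tw.B.lop_pure[OF E_action])

lemma psiF_jB: "a \<in> carrier A \<Longrightarrow> f \<in> carrier F \<Longrightarrow> b \<in> carrier B \<Longrightarrow> psiF a (ract F f b) = ract M (psiF a f) (jB b)"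
  by (simp add: psiF_def M_simps act_zero jB_closed)
    (simp add: jB_def oneA oneB fw.tact_pure[OF A_action] kt_pure_closed[OF modA modB] fw.rho_pure fw.tau_one
      fw.rop_pure fw.lop_pure[OF A_action] CF.ract_closed)

lemma psiF_jA:
  assumes f: "f \<in> carrier F" and a: "a \<in> carrier A"
  shows "ract M (psiF \<one>\<^bsub>A\<^esub> f) (jA a) = (\<zero>\<^bsub>EB\<^esub>, \<tau> (pure FA f a))"
proof -
  have V: "\<tau> (pure FA f a) \<in> carrier AF" by (rule fw.tw_closed[OF f a])
  have "actF (pure AF \<one>\<^bsub>A\<^esub> f) (jA a) = tmap K A F (\<lambda>x. \<one>\<^bsub>A\<^esub> \<otimes>\<^bsub>A\<^esub> x) (\<lambda>g. ract F g \<one>\<^bsub>B\<^esub>) (\<tau> (pure FA f a))"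
    using f a V by (simp add: jA_def fw.tact_pure[OF A_action] oneA oneB kt_pure_closed[OF modA modB] fw.rho_pure fw.lop_rop[OF A_action])
  also have "\<dots> = tmap K A F (\<lambda>x. x) (\<lambda>g. g) (\<tau> (pure FA f a))"
    by (rule tmap_cong[OF lin_id[OF modA] lin_id[OF modF] V]) (simp_all add: raction_one[OF F_action])
  also have "\<dots> = \<tau> (pure FA f a)" by (rule tmap_id[OF modA modF V])
  finally show ?thesis by (simp add: psiF_def M_simps act_zero jA_closed a)
qed

lemma addmap_G: "addmap V T h \<Longrightarrow> addmap V G h"
  using abelian_group_cong[OF T.abelian_group_axioms, of G] by (simp add: addmap_def G_simps)

sublocale IE: induced_connection K A OA E TP G M psiE jA JA
proof (intro induced_connection.intro induced_connection_axioms.intro)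
  show "calculus_module K A OA E" "calculus_module K TP G M" by (rule CE.calculus_module_axioms, rule C.calculus_module_axioms)
qed (simp_all add: psiE_lin addmap_G[OF lin_addmap[OF JA_lin]] jA_closed TP_simps(1) psiE_jA J_emb JA_deg JA_mult JA_diff)

lemma induced_F:
  assumes a: "a \<in> carrier A"
  shows "induced_connection K B OB F TP G M (psiF a) jB JB"
proof (intro induced_connection.intro induced_connection_axioms.intro)
  show "calculus_module K B OB F" "calculus_module K TP G M" by (rule CF.calculus_module_axioms, rule C.calculus_module_axioms)
  show "lin K F M (psiF a)" by (rule bilin_right[OF psiF_bilin a])
qed (simp_all add: addmap_G[OF lin_addmap[OF JB_lin]] jB_closed TP_simps(1) psiF_jB[OF a] J_emb JB_deg JB_mult JB_diff)

sublocale IF: induced_connection K B OB F TP G M "psiF \<one>\<^bsub>A\<^esub>" jB JB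
  by (rule induced_F[OF oneA])

abbreviation "P1 \<equiv> C.P 1"
abbreviation "F1 \<equiv> CF.P 1"
abbreviation "nab \<equiv> product_connection K A B R Rt E F \<tau> nabE nabF"

text \<open>
  The constituents of the product connection: \<open>nabE_part\<close> is its value on \<open>E \<otimes> B\<close>, and on
  \<open>A \<otimes> F\<close> it is composed of the maps \<open>left_push a\<close>, applied to \<open>\<nabla>\<^sup>F\<close>, and \<open>dA_part\<close>, applied to \<open>\<sigma> = \<tau>\<inverse>\<close>.
\<close>

definition sigma :: "('a, 'f) tensor \<Rightarrow> ('f, 'a) tensor" where
  "sigma = inv_into (carrier FA) \<tau>"

definition nabE_part :: "'e \<Rightarrow> 'b \<Rightarrow> (('e, 'b) tensor \<times> ('a, 'f) tensor, ('a form, 'b form) tensor) tensor" where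
  "nabE_part e b = tlift P1 (\<lambda>e' \<eta>. pure P1 (psiE e') (pure T \<eta> (emb OB b))) (nabE e)
     \<oplus>\<^bsub>P1\<^esub> pure P1 (psiE e) (JB (diff OB (emb OB b)))"

definition left_push :: "'a \<Rightarrow> ('f, 'b form) tensor \<Rightarrow> (('e, 'b) tensor \<times> ('a, 'f) tensor, ('a form, 'b form) tensor) tensor" where
  "left_push a = tlift P1 (\<lambda>f' \<eta>. pure P1 (psiF a f') (JB \<eta>))"

definition dA_part :: "('f, 'a) tensor \<Rightarrow> (('e, 'b) tensor \<times> ('a, 'f) tensor, ('a form, 'b form) tensor) tensor" where
  "dA_part = tlift P1 (\<lambda>g x. pure P1 (psiF \<one>\<^bsub>A\<^esub> g) (JA (diff OA (emb OA x))))"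

lemma nab_eq: "nab (s, t) = tlift P1 nabE_part s \<oplus>\<^bsub>P1\<^esub> tlift P1 (\<lambda>a f. left_push a (nabF f) \<oplus>\<^bsub>P1\<^esub> dA_part (sigma (pure AF a f))) t"
  by (simp add: product_connection_def Let_def nabE_part_def[abs_def] left_push_def dA_part_def sigma_def psiE_def psiF_def
      JA_def JB_def G_class)

lemma modP: "module K P1" by (rule C.P_module)

sublocale P1: module K P1 by (rule modP)

lemma lin_G: "lin K V T h \<Longrightarrow> lin K V G h"
  by (erule lin_cong_cod) (simp_all add: G_simps)

lemma dembA: "a \<in> carrier A \<Longrightarrow> diff OA (emb OA a) \<in> deg OA 1" and dembB: "b \<in> carrier B \<Longrightarrow> diff OB (emb OB b) \<in> deg OB 1"
  by (rule CE.diff_deg'[OF UA.deg_emb], assumption, simp, rule CF.diff_deg'[OF UB.deg_emb], assumption, simp)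

lemma embG_jA: "a \<in> carrier A \<Longrightarrow> emb G (jA a) \<in> deg G 0" and embG_jB: "b \<in> carrier B \<Longrightarrow> emb G (jB b) \<in> deg G 0"
  by (simp_all add: emb_G_deg jA_closed jB_closed)

lemma mm_lin_0: "x \<in> deg G 0 \<Longrightarrow> lin K P1 P1 (\<lambda>u. C.mm 1 0 u x)"
  by (rule C.mm_lin) simp_all

text \<open>
  By \<open>\<eta> \<otimes> b = (\<eta> \<otimes> 1) (1 \<otimes> b)\<close> the first part of the connection on \<open>E \<otimes> B\<close> is the product of the image
  of \<open>\<nabla>\<^sup>E e\<close> and \<open>1 \<otimes> b\<close>.
\<close>

lemma nabE_part_push:
  assumes t: "t \<in> carrier (CE.P 1)" and b: "b \<in> carrier B"
  shows "tlift P1 (\<lambda>e' \<eta>. pure P1 (psiE e') (pure T \<eta> (emb OB b))) t = C.mm 1 0 (IE.push 1 t) (emb G (jB b))"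
proof -
  note x = embG_jB[OF b]
  have pc: "pure P1 (psiE m) (JA \<omega>) \<in> carrier P1" if "m \<in> carrier E" "\<omega> \<in> deg OA 1" for m \<omega>
    by (rule C.pP_closed[OF lin_closed[OF psiE_lin that(1)] JA_deg[OF that(2)]])
  have "C.mm 1 0 (IE.push 1 t) (emb G (jB b)) = tlift P1 (\<lambda>m \<omega>. C.mm 1 0 (pure P1 (psiE m) (JA \<omega>)) (emb G (jB b))) t"
    by (rule CE.P_addmap_tlift[OF lin_addmap[OF mm_lin_0[OF x]] pc t])
  also have "\<dots> = tlift P1 (\<lambda>e' \<eta>. pure P1 (psiE e') (pure T \<eta> (emb OB b))) t"
  proof (rule CE.P_tlift_cong[OF P1.abelian_group_axioms _ t, symmetric])
    fix m \<omega> assume m: "m \<in> carrier E" and \<omega>: "\<omega> \<in> deg OA 1"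
    show "C.mm 1 0 (pure P1 (psiE m) (JA \<omega>)) (emb G (jB b)) \<in> carrier P1"
      by (rule lin_closed[OF mm_lin_0[OF x] pc[OF m \<omega>]])
    have "C.mm 1 0 (pure P1 (psiE m) (JA \<omega>)) (emb G (jB b)) = pure P1 (psiE m) (JA \<omega> \<otimes>\<^bsub>G\<^esub> JB (emb OB b))"
      unfolding J_emb(2)[OF b] by (rule C.mm_pure[OF x _ lin_closed[OF psiE_lin m] JA_deg[OF \<omega>]]) simp
    then show "pure P1 (psiE m) (pure T \<omega> (emb OB b)) = C.mm 1 0 (pure P1 (psiE m) (JA \<omega>)) (emb G (jB b))"
      by (simp add: JA_JB CE.deg_carrier[OF \<omega>] b)
  qed
  finally show ?thesis by simp
qed

lemma nabE_lin: "lin K E (CE.P 1) nabE" by (rule CE.nab_lin[OF nabE])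
lemma nabF_lin: "lin K F F1 nabF" by (rule CF.nab_lin[OF nabF])

lemma JB_demb_lin: "lin K B G (\<lambda>b. JB (diff OB (emb OB b)))"
  by (rule lin_G[OF lin_comp[OF JB_lin lin_comp[OF UB.diff_lin UB.emb_lin]]])

lemma JA_demb_lin: "lin K A G (\<lambda>a. JA (diff OA (emb OA a)))"
  by (rule lin_G[OF lin_comp[OF JA_lin lin_comp[OF UA.diff_lin UA.emb_lin]]])

lemma nabE_part_bilin: "bilin K E B P1 nabE_part"
proof (rule bilinI[OF modE modB modP])
  show "lin K E P1 (\<lambda>e. nabE_part e b)" if b: "b \<in> carrier B" for b
  proof (rule lin_cong)
    show "lin K E P1 (\<lambda>e. C.mm 1 0 (IE.push 1 (nabE e)) (emb G (jB b)) \<oplus>\<^bsub>P1\<^esub> pure P1 (psiE e) (JB (diff OB (emb OB b))))"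
      by (rule lin_plus[OF lin_comp[OF mm_lin_0[OF embG_jB[OF b]] lin_comp[OF IE.push_lin nabE_lin]]
            lin_comp[OF C.pP_lin[OF JB_deg[OF dembB[OF b]]] psiE_lin]])
  qed (simp add: nabE_part_def nabE_part_push[OF lin_closed[OF nabE_lin] b])
  show "lin K B P1 (nabE_part e)" if e: "e \<in> carrier E" for e
    unfolding nabE_part_def[abs_def]
  proof (rule lin_plus[OF CE.P_tlift_param_lin[OF _ modB modP lin_closed[OF nabE_lin e]]
        C.pP_right_lin[OF JB_demb_lin JB_deg[OF dembB] lin_closed[OF psiE_lin e]]])
    fix m \<omega> assume m: "m \<in> carrier E" and \<omega>: "\<omega> \<in> deg OA 1"
    show "lin K B P1 (\<lambda>b. pure P1 (psiE m) (pure T \<omega> (emb OB b)))"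
    proof (rule C.pP_right_lin[OF lin_G[OF lin_comp[OF kt_pure_right[OF W.modA W.modB CE.deg_carrier[OF \<omega>]] UB.emb_lin]] _ lin_closed[OF psiE_lin m]])
      show "pure T \<omega> (emb OB b) \<in> deg G 1" if "b \<in> carrier B" for b
        using deg_G_gen[OF \<omega> UB.deg_emb[OF that]] by simp
    qed
  qed
qed

lemma left_push_bilin: "bilin K A F1 P1 left_push"
proof (rule bilinI[OF modA CF.P_module modP])
  show "lin K F1 P1 (left_push a)" if "a \<in> carrier A" for a
    unfolding left_push_def by (rule induced_connection.push_lin[OF induced_F[OF that]])
  show "lin K A P1 (\<lambda>a. left_push a t)" if "t \<in> carrier F1" for t
    unfolding left_push_def
    by (rule CF.P_tlift_param_lin[OF lin_comp[OF C.pP_lin[OF JB_deg] bilin_left[OF psiF_bilin]] modA modP that])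
qed

lemma left_push_pure: "a \<in> carrier A \<Longrightarrow> f \<in> carrier F \<Longrightarrow> \<eta> \<in> deg OB 1 \<Longrightarrow>
    left_push a (pure F1 f \<eta>) = pure P1 (psiF a f) (JB \<eta>)"
  unfolding left_push_def by (rule induced_connection.push_pure[OF induced_F])

lemma left_push_one: "left_push \<one>\<^bsub>A\<^esub> = IF.push 1"
  by (simp add: left_push_def)

lemma dA_bilin: "bilin K F A P1 (\<lambda>g x. pure P1 (psiF \<one>\<^bsub>A\<^esub> g) (JA (diff OA (emb OA x))))"
proof (rule bilinI[OF modF modA modP])
  show "lin K F P1 (\<lambda>g. pure P1 (psiF \<one>\<^bsub>A\<^esub> g) (JA (diff OA (emb OA x))))" if "x \<in> carrier A" for x
    by (rule lin_comp[OF C.pP_lin[OF JA_deg[OF dembA[OF that]]] bilin_right[OF psiF_bilin oneA]])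
  show "lin K A P1 (\<lambda>x. pure P1 (psiF \<one>\<^bsub>A\<^esub> g) (JA (diff OA (emb OA x))))" if "g \<in> carrier F" for g
    by (rule C.pP_right_lin[OF JA_demb_lin JA_deg[OF dembA] bilin_closed[OF psiF_bilin oneA that]])
qed

lemma dA_part_lin: "lin K FA P1 dA_part"
  unfolding dA_part_def by (rule kt_lift[OF modF modA dA_bilin])

lemma dA_part_pure: "g \<in> carrier F \<Longrightarrow> x \<in> carrier A \<Longrightarrow> dA_part (pure FA g x) = pure P1 (psiF \<one>\<^bsub>A\<^esub> g) (JA (diff OA (emb OA x)))"
  unfolding dA_part_def by (rule kt_lift_pure[OF modF modA dA_bilin])

lemma sigma_tau: "u \<in> carrier FA \<Longrightarrow> sigma (\<tau> u) = u"
  using tau_bij by (simp add: sigma_def bij_betw_def inv_into_f_f)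

lemma sigma_closed: "v \<in> carrier AF \<Longrightarrow> sigma v \<in> carrier FA"
  unfolding sigma_def using tau_surj by (simp add: inv_into_into)

lemma tau_sigma: "v \<in> carrier AF \<Longrightarrow> \<tau> (sigma v) = v"
  unfolding sigma_def using tau_surj by (simp add: f_inv_into_f)

lemma sigma_lin: "lin K AF FA sigma"
proof (rule linI[OF modAF modFA sigma_closed])
  interpret FAm: module K FA by (rule modFA)
  show "sigma (x \<oplus>\<^bsub>AF\<^esub> y) = sigma x \<oplus>\<^bsub>FA\<^esub> sigma y" if "x \<in> carrier AF" "y \<in> carrier AF" for x y
    using sigma_tau[of "sigma x \<oplus>\<^bsub>FA\<^esub> sigma y"] that by (simp add: sigma_closed lin_add[OF tau_lin] tau_sigma)
  show "sigma (c \<odot>\<^bsub>AF\<^esub> x) = c \<odot>\<^bsub>FA\<^esub> sigma x" if "c \<in> carrier K" "x \<in> carrier AF" for c x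
    using sigma_tau[of "c \<odot>\<^bsub>FA\<^esub> sigma x"] that by (simp add: sigma_closed lin_smult[OF tau_lin] tau_sigma)
qed

lemma left_nab_bilin: "bilin K A F P1 (\<lambda>a f. left_push a (nabF f))"
  using bilin_comp[OF left_push_bilin lin_id[OF modA] nabF_lin lin_id[OF modP]] .

lemma nabF_part_bilin: "bilin K A F P1 (\<lambda>a f. left_push a (nabF f) \<oplus>\<^bsub>P1\<^esub> dA_part (sigma (pure AF a f)))"
proof (rule bilinI[OF modA modF modP])
  show "lin K A P1 (\<lambda>a. left_push a (nabF f) \<oplus>\<^bsub>P1\<^esub> dA_part (sigma (pure AF a f)))" if "f \<in> carrier F" for f
    by (rule lin_plus[OF bilin_left[OF left_nab_bilin that] lin_comp[OF dA_part_lin lin_comp[OF sigma_lin kt_pure_left[OF modA modF that]]]])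
  show "lin K F P1 (\<lambda>f. left_push a (nabF f) \<oplus>\<^bsub>P1\<^esub> dA_part (sigma (pure AF a f)))" if "a \<in> carrier A" for a
    by (rule lin_plus[OF bilin_right[OF left_nab_bilin that] lin_comp[OF dA_part_lin lin_comp[OF sigma_lin kt_pure_right[OF modA modF that]]]])
qed

lemma nab_linear: "lin K M P1 nab"
proof (rule lin_cong[OF lin_M_dom[OF lin_plus[OF lin_comp[OF kt_lift[OF modE modB nabE_part_bilin] lin_fst[OF modEB modAF]]
          lin_comp[OF kt_lift[OF modA modF nabF_part_bilin] lin_snd[OF modEB modAF]]]]])
  fix m assume "m \<in> carrier M"
  obtain s t where m: "m = (s, t)" by (cases m)
  show "nab m = tlift P1 nabE_part (fst m) \<oplus>\<^bsub>P1\<^esub>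
      tlift P1 (\<lambda>a f. left_push a (nabF f) \<oplus>\<^bsub>P1\<^esub> dA_part (sigma (pure AF a f))) (snd m)"
    by (simp add: m nab_eq)
qed

lemma nab_inE:
  assumes "e \<in> carrier E" "b \<in> carrier B"
  shows "nab (pure EB e b, \<zero>\<^bsub>AF\<^esub>) = C.mm 1 0 (IE.push 1 (nabE e)) (emb G (jB b)) \<oplus>\<^bsub>P1\<^esub> pure P1 (psiE e) (JB (diff OB (emb OB b)))"
proof -
  have "nab (pure EB e b, \<zero>\<^bsub>AF\<^esub>) = nabE_part e b"
    using bilin_closed[OF nabE_part_bilin assms]
    by (simp add: nab_eq kt_lift_pure[OF modE modB nabE_part_bilin assms] lin_zero[OF kt_lift[OF modA modF nabF_part_bilin]])
  then show ?thesis by (simp add: nabE_part_def nabE_part_push[OF lin_closed[OF nabE_lin assms(1)] assms(2)])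
qed

lemma nab_inF:
  assumes v: "v \<in> carrier AF"
  shows "nab (\<zero>\<^bsub>EB\<^esub>, v) = tlift P1 (\<lambda>a f. left_push a (nabF f)) v \<oplus>\<^bsub>P1\<^esub> dA_part (sigma v)"
proof -
  have "tlift P1 (\<lambda>a f. left_push a (nabF f) \<oplus>\<^bsub>P1\<^esub> dA_part (sigma (pure AF a f))) v = tlift P1 (\<lambda>a f. left_push a (nabF f)) v \<oplus>\<^bsub>P1\<^esub> dA_part (sigma v)"
    by (rule kt_lin_eqI[OF modA modF kt_lift[OF modA modF nabF_part_bilin]
          lin_plus[OF kt_lift[OF modA modF left_nab_bilin] lin_comp[OF dA_part_lin sigma_lin]] _ v])
      (simp add: kt_lift_pure[OF modA modF nabF_part_bilin] kt_lift_pure[OF modA modF left_nab_bilin])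
  moreover have "tlift P1 (\<lambda>a f. left_push a (nabF f)) v \<oplus>\<^bsub>P1\<^esub> dA_part (sigma v) \<in> carrier P1"
    using v by (simp add: lin_closed[OF kt_lift[OF modA modF left_nab_bilin]] lin_closed[OF dA_part_lin] sigma_closed)
  ultimately show ?thesis
    by (simp add: nab_eq lin_zero[OF kt_lift[OF modE modB nabE_part_bilin]])
qed

subsection \<open>The compatibility condition\<close>

text \<open>
  The condition evaluates \<open>Rt (\<eta> \<otimes> a)\<close> on a chosen preimage under \<open>iota\<close>, the map from
  \<open>A \<otimes> \<Omega>\<^sup>1B\<close> to \<open>\<Omega>A \<otimes> \<Omega>B\<close>.
\<close>

abbreviation "O1 \<equiv> OB\<lparr>carrier := deg OB 1\<rparr>"
abbreviation "AO \<equiv> ktensor K A O1"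
abbreviation "AF1 \<equiv> ktensor K A F1"
abbreviation "iota \<equiv> tlift T (\<lambda>x \<eta>. pure T (emb OA x) \<eta>)"

lemma modO1: "module K O1"
proof (rule submodule.submodule_is_module[OF UB.UM.submoduleI UB.UM.module_axioms])
  show "deg OB 1 \<subseteq> carrier OB" by (rule UB.deg_U_sub)
  show "\<zero>\<^bsub>OB\<^esub> \<in> deg OB 1" by (rule UB.deg_U_zero)
  show "\<ominus>\<^bsub>OB\<^esub> a \<in> deg OB 1" if "a \<in> deg OB 1" for a using that by (rule UB.deg_U_minus)
  show "a \<oplus>\<^bsub>OB\<^esub> b \<in> deg OB 1" if "a \<in> deg OB 1" "b \<in> deg OB 1" for a b using that by (rule UB.deg_U_add)
  show "c \<odot>\<^bsub>OB\<^esub> x \<in> deg OB 1" if "c \<in> carrier K" "x \<in> deg OB 1" for c x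
    using that UB.deg_U_mult[OF UB.deg_U_word[of "[El (c \<odot>\<^bsub>B\<^esub> \<one>\<^bsub>B\<^esub>)]"], of x 1] by (simp add: UB.smult_U)
qed

lemma O1_lin:
  assumes "lin K OB V h" shows "lin K O1 V h"
  by (rule linI[OF modO1 lin_cod[OF assms]])
    (simp_all add: lin_closed[OF assms] lin_add[OF assms] lin_smult[OF assms] CF.deg_carrier)

lemma iota_bilin: "bilin K A O1 T (\<lambda>x \<eta>. pure T (emb OA x) \<eta>)"
proof (rule bilinI[OF modA modO1 T_module])
  show "lin K A T (\<lambda>x. pure T (emb OA x) \<eta>)" if "\<eta> \<in> carrier O1" for \<eta>
    by (rule bilin_L[OF kt_pure_bilin[OF W.modA W.modB] _ UA.emb_lin]) (use that CF.deg_carrier in simp)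
  show "lin K O1 T (pure T (emb OA x))" if "x \<in> carrier A" for x
    by (rule O1_lin[OF kt_pure_right[OF W.modA W.modB emb_closedA[OF that]]])
qed

lemma iota_lin: "lin K AO T iota" by (rule kt_lift[OF modA modO1 iota_bilin])

lemma iota_pure: "a \<in> carrier A \<Longrightarrow> \<eta> \<in> deg OB 1 \<Longrightarrow> iota (pure AO a \<eta>) = pure T (emb OA a) \<eta>"
  by (rule kt_lift_pure[OF modA modO1 iota_bilin]) simp_all

lemma gr0_iota:
  assumes "t \<in> gr0 1" shows "t \<in> iota ` carrier AO"
  using assms unfolding gr0_def
proof (induction rule: add_span.induct)
  case (base x)
  then obtain a \<omega> where x: "x = pure T (emb OA a) \<omega>" "a \<in> carrier A" "\<omega> \<in> deg OB 1" by blast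
  then have "x = iota (pure AO a \<omega>)" by (simp only: iota_pure)
  moreover have "pure AO a \<omega> \<in> carrier AO" using x by (simp add: kt_pure_closed[OF modA modO1])
  ultimately show ?case by blast
next
  case (plus s t)
  interpret AOm: module K AO by (rule kt_module[OF modA modO1])
  obtain s' t' where "s = iota s'" "t = iota t'" "s' \<in> carrier AO" "t' \<in> carrier AO" using plus by blast
  then have "s \<oplus>\<^bsub>T\<^esub> t = iota (s' \<oplus>\<^bsub>AO\<^esub> t')" "s' \<oplus>\<^bsub>AO\<^esub> t' \<in> carrier AO"
    by (simp_all only: lin_add[OF iota_lin] AOm.a_closed)
  then show ?case by blast
qed

text \<open>
  Both sides of the compatibility condition are mapped to \<open>M \<otimes> \<Gamma>\<^sup>1\<close> by
  \<open>a \<otimes> (f \<otimes> \<eta>) \<mapsto> (a \<otimes> f) \<otimes> (1 \<otimes> \<eta>)\<close>; there the right-hand side becomes the image of \<open>\<nabla>\<^sup>F f\<close> times \<open>a \<otimes> 1\<close>.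
\<close>

abbreviation "spread \<equiv> tlift P1 left_push"

lemma spread_lin: "lin K AF1 P1 spread" by (rule kt_lift[OF modA CF.P_module left_push_bilin])

lemma spread_pure: "a \<in> carrier A \<Longrightarrow> t \<in> carrier F1 \<Longrightarrow> spread (pure AF1 a t) = left_push a t"
  by (rule kt_lift_pure[OF modA CF.P_module left_push_bilin])

text \<open>
  Because of \<open>(0, \<tau> (g \<otimes> x)) = \<psi> g \<cdot> (x \<otimes> 1)\<close>, the factor \<open>x\<close> can be moved across the tensor product over \<open>D\<close>.
  What results depends on \<open>z\<close> only through \<open>iota z\<close>, so the choice of a preimage is immaterial.
\<close>

lemma pull_side:
  assumes g: "g \<in> carrier F" and z: "z \<in> carrier AO"
  shows "iota z \<in> deg G 1 \<and> tlift P1 (\<lambda>x \<eta>'. pure P1 (\<zero>\<^bsub>EB\<^esub>, \<tau> (pure FA g x)) (JB \<eta>')) z = pure P1 (psiF \<one>\<^bsub>A\<^esub> g) (iota z)"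
proof -
  note pg = bilin_closed[OF psiF_bilin oneA g]
  have b: "bilin K A O1 P1 (\<lambda>x \<eta>'. pure P1 (\<zero>\<^bsub>EB\<^esub>, \<tau> (pure FA g x)) (JB \<eta>'))"
  proof (rule bilinI[OF modA modO1 modP])
    show "lin K A P1 (\<lambda>x. pure P1 (\<zero>\<^bsub>EB\<^esub>, \<tau> (pure FA g x)) (JB \<eta>'))" if "\<eta>' \<in> carrier O1" for \<eta>'
      by (rule lin_comp[OF C.pP_lin[OF JB_deg] lin_comp[OF inF_lin lin_comp[OF tau_lin kt_pure_right[OF modF modA g]]]])
        (use that in simp)
    show "lin K O1 P1 (\<lambda>\<eta>'. pure P1 (\<zero>\<^bsub>EB\<^esub>, \<tau> (pure FA g x)) (JB \<eta>'))" if "x \<in> carrier A" for x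
      by (rule C.pP_right_lin[OF O1_lin[OF lin_G[OF JB_lin]] JB_deg lin_closed[OF inF_lin fw.tw_closed[OF g that]]]) simp
  qed
  show ?thesis
    using z
  proof (induction z rule: kt_induct[OF modA modO1, consumes 1, case_names pure plus])
    case (pure x \<eta>)
    then have x: "x \<in> carrier A" and \<eta>: "\<eta> \<in> deg OB 1" by simp_all
    have d: "pure T (emb OA x) \<eta> \<in> deg G 1" using deg_G_gen[OF UA.deg_emb[OF x] \<eta>] by simp
    have "pure P1 (ract M (psiF \<one>\<^bsub>A\<^esub> g) (jA x)) (JB \<eta>) = pure P1 (psiF \<one>\<^bsub>A\<^esub> g) (emb G (jA x) \<otimes>\<^bsub>G\<^esub> JB \<eta>)"
      by (rule C.pP_balanced[OF pg _ JB_deg[OF \<eta>]]) (simp add: TP_simps(1) jA_closed x)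
    also have "emb G (jA x) \<otimes>\<^bsub>G\<^esub> JB \<eta> = pure T (emb OA x) \<eta>"
      using JA_JB[OF emb_closedA[OF x] CF.deg_carrier[OF \<eta>]] by (simp add: J_emb x)
    finally have "pure P1 (\<zero>\<^bsub>EB\<^esub>, \<tau> (pure FA g x)) (JB \<eta>) = pure P1 (psiF \<one>\<^bsub>A\<^esub> g) (pure T (emb OA x) \<eta>)"
      by (simp only: psiF_jA[OF g x])
    then show ?case using d kt_lift_pure[OF modA modO1 b pure] by (simp only: iota_pure[OF x \<eta>])
  next
    case (plus s t)
    then show ?case
      using lin_add[OF kt_lift[OF modA modO1 b] plus(1,2)] lin_add[OF iota_lin plus(1,2)] C.pP_add_right[OF pg, of "iota s" 1 "iota t"] deg_G_add
      by (simp only: G_simps(2) simp_thms)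
  qed
qed

text \<open>
  Applying \<open>spread\<close> to the compatibility condition turns the inner sums into
  \<open>\<psi> g \<otimes> Rt (\<eta> \<otimes> a) = \<psi> g \<otimes> (1 \<otimes> \<eta>) (a \<otimes> 1)\<close>, where \<open>g \<otimes> \<eta>\<close> runs through the terms of \<open>\<nabla>\<^sup>F f\<close>.
\<close>

theorem compatible_push:
  assumes f: "f \<in> carrier F" and a: "a \<in> carrier A"
  shows "tlift P1 (\<lambda>a f. left_push a (nabF f)) (\<tau> (pure FA f a)) = C.mm 1 0 (left_push \<one>\<^bsub>A\<^esub> (nabF f)) (emb G (jA a))"
proof -
  define pull where "pull = inv_into (carrier AO) iota"
  define inner where "inner g x \<eta>' = tlift AF1 (\<lambda>x' g'. pure AF1 x' (pure F1 g' \<eta>')) (\<tau> (pure FA g x))" for g x \<eta>'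
  define Z where "Z g \<eta> = tlift AF1 (inner g) (pull (Rt (pure S \<eta> (emb OA a))))" for g \<eta>
  have cond: "tlift AF1 (\<lambda>x g. pure AF1 x (nabF g)) (\<tau> (pure FA f a)) = tlift AF1 Z (nabF f)"
    using compatible f a
    by (simp add: connection_compatible_def Let_def pull_def Z_def[abs_def] inner_def[abs_def])
  have v: "\<tau> (pure FA g x) \<in> carrier AF" if "g \<in> carrier F" "x \<in> carrier A" for g x
    by (rule fw.tw_closed[OF that])
  have abAF1: "abelian_group AF1" by (rule module_abelian[OF kt_module[OF modA CF.P_module]])
  note pAF1 = kt_pure_closed[OF modA CF.P_module]
  have "spread (tlift AF1 (\<lambda>x g. pure AF1 x (nabF g)) (\<tau> (pure FA f a))) = tlift P1 (\<lambda>x g. spread (pure AF1 x (nabF g))) (\<tau> (pure FA f a))"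
    by (rule kt_addmap_tlift[OF modA modF lin_addmap[OF spread_lin] _ v[OF f a]]) (rule pAF1, assumption, rule lin_closed[OF nabF_lin])
  also have "\<dots> = tlift P1 (\<lambda>a f. left_push a (nabF f)) (\<tau> (pure FA f a))"
    by (rule kt_tlift_cong[OF modA modF P1.abelian_group_axioms _ v[OF f a]])
      (rule bilin_closed[OF left_nab_bilin], assumption, assumption, rule spread_pure, assumption, rule lin_closed[OF nabF_lin])
  finally have lhs: "spread (tlift AF1 (\<lambda>x g. pure AF1 x (nabF g)) (\<tau> (pure FA f a))) = tlift P1 (\<lambda>a f. left_push a (nabF f)) (\<tau> (pure FA f a))" .
  have inner_closed: "inner g x \<eta>' \<in> carrier AF1" if "g \<in> carrier F" "x \<in> carrier A" "\<eta>' \<in> deg OB 1" for g x \<eta>'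
    unfolding inner_def
    by (rule kt_tlift_closed[OF modA modF abAF1 _ v[OF that(1,2)]]) (rule pAF1, assumption, rule CF.pP_closed[OF _ that(3)])
  have spread_inner: "spread (inner g x \<eta>') = pure P1 (\<zero>\<^bsub>EB\<^esub>, \<tau> (pure FA g x)) (JB \<eta>')"
    if g: "g \<in> carrier F" and x: "x \<in> carrier A" and \<eta>': "\<eta>' \<in> deg OB 1" for g x \<eta>'
  proof -
    have k: "addmap AF P1 (\<lambda>v. pure P1 (\<zero>\<^bsub>EB\<^esub>, v) (JB \<eta>'))"
      by (rule lin_addmap[OF lin_comp[OF C.pP_lin[OF JB_deg[OF \<eta>']] inF_lin]])
    have "spread (inner g x \<eta>') = tlift P1 (\<lambda>x' g'. spread (pure AF1 x' (pure F1 g' \<eta>'))) (\<tau> (pure FA g x))"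
      unfolding inner_def
      by (rule kt_addmap_tlift[OF modA modF lin_addmap[OF spread_lin] _ v[OF g x]]) (rule pAF1, assumption, rule CF.pP_closed[OF _ \<eta>'])
    also have "\<dots> = tlift P1 (\<lambda>x' g'. pure P1 (\<zero>\<^bsub>EB\<^esub>, pure AF x' g') (JB \<eta>')) (\<tau> (pure FA g x))"
    proof (rule kt_tlift_cong[OF modA modF P1.abelian_group_axioms _ v[OF g x]])
      fix x' g' assume x': "x' \<in> carrier A" and g': "g' \<in> carrier F"
      show "pure P1 (\<zero>\<^bsub>EB\<^esub>, pure AF x' g') (JB \<eta>') \<in> carrier P1"
        by (rule addmap_closed[OF k kt_pure_closed[OF modA modF x' g']])
      show "spread (pure AF1 x' (pure F1 g' \<eta>')) = pure P1 (\<zero>\<^bsub>EB\<^esub>, pure AF x' g') (JB \<eta>')"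
        using spread_pure[OF x' CF.pP_closed[OF g' \<eta>']] left_push_pure[OF x' g' \<eta>'] by (simp only: psiF_def)
    qed
    also have "\<dots> = pure P1 (\<zero>\<^bsub>EB\<^esub>, tlift AF (pure AF) (\<tau> (pure FA g x))) (JB \<eta>')"
      by (rule kt_addmap_tlift[OF modA modF k _ v[OF g x], symmetric]) (rule kt_pure_closed[OF modA modF])
    also have "\<dots> = pure P1 (\<zero>\<^bsub>EB\<^esub>, \<tau> (pure FA g x)) (JB \<eta>')"
      by (simp only: kt_tlift_pure[OF modA modF v[OF g x]])
    finally show ?thesis .
  qed
  have pull: "pull (Rt (pure S \<eta> (emb OA a))) \<in> carrier AO" "iota (pull (Rt (pure S \<eta> (emb OA a)))) = Rt (pure S \<eta> (emb OA a))"
    if \<eta>: "\<eta> \<in> deg OB 1" for \<eta>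
    using gr0_iota[OF Rt_gr0[OF \<eta> a]] by (simp_all only: pull_def inv_into_into f_inv_into_f)
  have Z_closed: "Z g \<eta> \<in> carrier AF1" if "g \<in> carrier F" "\<eta> \<in> deg OB 1" for g \<eta>
    unfolding Z_def
    by (rule kt_tlift_closed[OF modA modO1 abAF1 _ pull(1)[OF that(2)]]) (use inner_closed[OF that(1)] in simp)
  have spread_Z: "spread (Z g \<eta>) = C.mm 1 0 (pure P1 (psiF \<one>\<^bsub>A\<^esub> g) (JB \<eta>)) (emb G (jA a))"
    if g: "g \<in> carrier F" and \<eta>: "\<eta> \<in> deg OB 1" for g \<eta>
  proof -
    let ?z = "pull (Rt (pure S \<eta> (emb OA a)))"
    note pg = bilin_closed[OF psiF_bilin oneA g]
    have "spread (Z g \<eta>) = tlift P1 (\<lambda>x \<eta>'. spread (inner g x \<eta>')) ?z"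
      unfolding Z_def by (rule kt_addmap_tlift[OF modA modO1 lin_addmap[OF spread_lin] _ pull(1)[OF \<eta>]]) (use inner_closed[OF g] in simp)
    also have "\<dots> = tlift P1 (\<lambda>x \<eta>'. pure P1 (\<zero>\<^bsub>EB\<^esub>, \<tau> (pure FA g x)) (JB \<eta>')) ?z"
    proof (rule kt_tlift_cong[OF modA modO1 P1.abelian_group_axioms _ pull(1)[OF \<eta>]])
      fix x \<eta>' assume x: "x \<in> carrier A" and "\<eta>' \<in> carrier O1"
      then have e: "\<eta>' \<in> deg OB 1" by simp
      show "pure P1 (\<zero>\<^bsub>EB\<^esub>, \<tau> (pure FA g x)) (JB \<eta>') \<in> carrier P1"
        by (rule C.pP_closed[OF lin_closed[OF inF_lin v[OF g x]] JB_deg[OF e]])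
      show "spread (inner g x \<eta>') = pure P1 (\<zero>\<^bsub>EB\<^esub>, \<tau> (pure FA g x)) (JB \<eta>')"
        by (rule spread_inner[OF g x e])
    qed
    also have "\<dots> = pure P1 (psiF \<one>\<^bsub>A\<^esub> g) (JB \<eta> \<otimes>\<^bsub>G\<^esub> emb G (jA a))"
      using pull_side[OF g pull(1)[OF \<eta>]] pull(2)[OF \<eta>] JB_JA[OF CF.deg_carrier[OF \<eta>] emb_closedA[OF a]] J_emb(1)[OF a] by (simp only:)
    also have "\<dots> = C.mm 1 0 (pure P1 (psiF \<one>\<^bsub>A\<^esub> g) (JB \<eta>)) (emb G (jA a))"
      by (rule C.mm_pure[OF embG_jA[OF a] _ pg JB_deg[OF \<eta>], symmetric]) simp
    finally show ?thesis .
  qed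
  note n = lin_closed[OF nabF_lin f]
  have pc: "pure P1 (psiF \<one>\<^bsub>A\<^esub> g) (JB \<eta>) \<in> carrier P1" if "g \<in> carrier F" "\<eta> \<in> deg OB 1" for g \<eta>
    by (rule C.pP_closed[OF bilin_closed[OF psiF_bilin oneA that(1)] JB_deg[OF that(2)]])
  have "spread (tlift AF1 Z (nabF f)) = tlift P1 (\<lambda>g \<eta>. spread (Z g \<eta>)) (nabF f)"
    by (rule CF.P_addmap_tlift[OF lin_addmap[OF spread_lin] Z_closed n])
  also have "\<dots> = tlift P1 (\<lambda>g \<eta>. C.mm 1 0 (pure P1 (psiF \<one>\<^bsub>A\<^esub> g) (JB \<eta>)) (emb G (jA a))) (nabF f)"
    by (rule CF.P_tlift_cong[OF P1.abelian_group_axioms lin_closed[OF mm_lin_0[OF embG_jA[OF a]] pc] n spread_Z])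
  also have "\<dots> = C.mm 1 0 (left_push \<one>\<^bsub>A\<^esub> (nabF f)) (emb G (jA a))"
    unfolding left_push_def by (rule CF.P_addmap_tlift[OF lin_addmap[OF mm_lin_0[OF embG_jA[OF a]]] pc n, symmetric])
  finally show ?thesis using lhs cond by simp
qed

subsection \<open>Leibniz rule and flatness\<close>

text \<open>
  The case \<open>y = 1 \<otimes> b\<close> is the definition of the connection on \<open>E \<otimes> B\<close>, and the \<open>(a \<otimes> 1) (1 \<otimes> b)\<close> span
  \<open>A \<otimes> B\<close>.
\<close>

lemma leibniz_E:
  assumes "e \<in> carrier E" "y \<in> carrier TP"
  shows "nab (ract M (psiE e) y) = C.mm 1 0 (IE.push 1 (nabE e)) (emb G y) \<oplus>\<^bsub>P1\<^esub> pure P1 (psiE e) (diff G (emb G y))"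
proof (rule IE.leibniz_extend[OF nabE nab_linear _ _ _ assms])
  show "jB ` carrier B \<subseteq> carrier TP" using jB_closed by (auto simp: TP_simps(1))
  show "nab (ract M (psiE s) y) = C.mm 1 0 (IE.push 1 (nabE s)) (emb G y) \<oplus>\<^bsub>P1\<^esub> pure P1 (psiE s) (diff G (emb G y))"
    if s: "s \<in> carrier E" and y: "y \<in> jB ` carrier B" for s y
  proof -
    obtain b where b: "b \<in> carrier B" "y = jB b" using y by blast
    show ?thesis
      using nab_inE[OF s b(1)] by (simp only: b(2) psiE_jB[OF s b(1)] JB_diff[OF emb_closedB[OF b(1)]] J_emb(2)[OF b(1)])
  qed
  show "y \<in> add_span TP {jA x \<otimes>\<^bsub>TP\<^esub> y | x y. x \<in> carrier A \<and> y \<in> jB ` carrier B}" if "y \<in> carrier TP" for y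
  proof -
    have "y \<in> carrier AB" using that by (simp add: TP_simps(1))
    then show ?thesis
    proof (induction y rule: kt_induct[OF modA modB, consumes 1, case_names pure plus])
      case (pure a b)
      then show ?case using jA_jB[OF pure] by (intro add_span.base) (metis (mono_tags, lifting) CollectI imageI)
    next
      case (plus s t)
      then show ?case using add_span.plus[of s TP _ t] by (simp only: TP_simps(2))
    qed
  qed
qed

text \<open>
  The case \<open>y = a \<otimes> 1\<close>, where \<open>\<psi> f \<cdot> y = (0, \<tau> (f \<otimes> a))\<close>, is the compatibility condition together with
  \<open>\<sigma> (\<tau> (f \<otimes> a)) = f \<otimes> a\<close>.  Surjectivity of \<open>R\<close> makes the \<open>(1 \<otimes> b) (a \<otimes> 1)\<close> span \<open>A \<otimes> B\<close>.
\<close>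

lemma leibniz_F:
  assumes "f \<in> carrier F" "y \<in> carrier TP"
  shows "nab (ract M (psiF \<one>\<^bsub>A\<^esub> f) y) = C.mm 1 0 (IF.push 1 (nabF f)) (emb G y) \<oplus>\<^bsub>P1\<^esub> pure P1 (psiF \<one>\<^bsub>A\<^esub> f) (diff G (emb G y))"
proof (rule IF.leibniz_extend[OF nabF nab_linear _ _ _ assms])
  show "jA ` carrier A \<subseteq> carrier TP" using jA_closed by (auto simp: TP_simps(1))
  show "nab (ract M (psiF \<one>\<^bsub>A\<^esub> s) y) = C.mm 1 0 (IF.push 1 (nabF s)) (emb G y) \<oplus>\<^bsub>P1\<^esub> pure P1 (psiF \<one>\<^bsub>A\<^esub> s) (diff G (emb G y))"
    if s: "s \<in> carrier F" and y: "y \<in> jA ` carrier A" for s y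
  proof -
    obtain a where a: "a \<in> carrier A" "y = jA a" using y by blast
    have u: "pure FA s a \<in> carrier FA" by (rule kt_pure_closed[OF modF modA s a(1)])
    show ?thesis
      using nab_inF[OF fw.tw_closed[OF s a(1)]]
      by (simp only: a(2) psiF_jA[OF s a(1)] compatible_push[OF s a(1)] sigma_tau[OF u] dA_part_pure[OF s a(1)]
          left_push_one JA_diff[OF emb_closedA[OF a(1)]] J_emb(1)[OF a(1)])
  qed
  show "y \<in> add_span TP {jB x \<otimes>\<^bsub>TP\<^esub> y | x y. x \<in> carrier B \<and> y \<in> jA ` carrier A}" if "y \<in> carrier TP" for y
  proof -
    have "y \<in> carrier AB" using that by (simp add: TP_simps(1))
    then obtain u where u: "u \<in> carrier (ktensor K B A)" "y = R u" using R_surj by blast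
    have "R u \<in> add_span TP {jB x \<otimes>\<^bsub>TP\<^esub> y | x y. x \<in> carrier B \<and> y \<in> jA ` carrier A}"
      using u(1)
    proof (induction u rule: kt_induct[OF modB modA, consumes 1, case_names pure plus])
      case (pure b a)
      then show ?case using jB_jA[OF pure] by (intro add_span.base) (metis (mono_tags, lifting) CollectI imageI)
    next
      case (plus s t)
      then show ?case using add_span.plus[of "R s" TP _ "R t"] lin_add[OF tw.B.tau_lin plus(1,2)] by (simp only: TP_simps(2))
    qed
    then show ?thesis using u(2) by simp
  qed
qed

lemma nab_psiE:
  assumes e: "e \<in> carrier E" shows "nab (psiE e) = IE.push 1 (nabE e)"
  by (rule IE.leibniz_at_one[where nab = nab and nab' = nabE, OF nabE e leibniz_E[OF e C.DR.one_closed]])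

lemma nab_psiF:
  assumes f: "f \<in> carrier F" shows "nab (psiF \<one>\<^bsub>A\<^esub> f) = IF.push 1 (nabF f)"
  by (rule IF.leibniz_at_one[where nab = nab and nab' = nabF, OF nabF f leibniz_F[OF f C.DR.one_closed]])

definition gens :: "(('e, 'b) tensor \<times> ('a, 'f) tensor) set" where
  "gens = psiE ` carrier E \<union> psiF \<one>\<^bsub>A\<^esub> ` carrier F"

lemma gens_sub: "gens \<subseteq> carrier M"
  unfolding gens_def using lin_closed[OF psiE_lin] bilin_closed[OF psiF_bilin oneA] by blast

lemma gens_span:
  assumes "m \<in> carrier M" shows "m \<in> add_span M {ract M s y | s y. s \<in> gens \<and> y \<in> carrier TP}"
proof -
  let ?X = "{ract M s y | s y. s \<in> gens \<and> y \<in> carrier TP}"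
  obtain s t where m: "m = (s, t)" and s: "s \<in> carrier EB" and t: "t \<in> carrier AF"
    using assms by (auto simp: M_simps)
  have sE: "(s, \<zero>\<^bsub>AF\<^esub>) \<in> add_span M ?X"
    using s
  proof (induction s rule: kt_induct[OF modE modB, consumes 1, case_names pure plus])
    case (pure e b)
    have "psiE e \<in> gens" "jB b \<in> carrier TP" using pure jB_closed by (auto simp: gens_def TP_simps(1))
    then show ?case using psiE_jB[OF pure] by (intro add_span.base) (metis (mono_tags, lifting) CollectI)
  next
    case (plus s s')
    then show ?case using add_span.plus[of "(s, \<zero>\<^bsub>AF\<^esub>)" M ?X "(s', \<zero>\<^bsub>AF\<^esub>)"] lin_add[OF inE_lin plus(1,2)] by (simp only:)
  qed
  \<comment> \<open>Every element of \<open>A \<otimes> F\<close> is a sum of \<open>\<tau> (f \<otimes> a)\<close>, and \<open>(0, \<tau> (f \<otimes> a)) = psiF 1 f \<cdot> (a \<otimes> 1)\<close>.\<close>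
  obtain u where u: "u \<in> carrier FA" "t = \<tau> u" using t tau_surj by blast
  have sF: "(\<zero>\<^bsub>EB\<^esub>, \<tau> u) \<in> add_span M ?X"
    using u(1)
  proof (induction u rule: kt_induct[OF modF modA, consumes 1, case_names pure plus])
    case (pure f a)
    have "psiF \<one>\<^bsub>A\<^esub> f \<in> gens" "jA a \<in> carrier TP" using pure jA_closed by (auto simp: gens_def TP_simps(1))
    then show ?case using psiF_jA[OF pure] by (intro add_span.base) (metis (mono_tags, lifting) CollectI)
  next
    case (plus v w)
    have "(\<zero>\<^bsub>EB\<^esub>, \<tau> (v \<oplus>\<^bsub>FA\<^esub> w)) = (\<zero>\<^bsub>EB\<^esub>, \<tau> v) \<oplus>\<^bsub>M\<^esub> (\<zero>\<^bsub>EB\<^esub>, \<tau> w)"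
      using lin_add[OF lin_comp[OF inF_lin tau_lin] plus(1,2)] .
    then show ?case using add_span.plus[OF plus(3,4)] by (simp only:)
  qed
  interpret EBm: module K EB by (rule modEB)
  interpret AFm: module K AF by (rule modAF)
  have "m = (s, \<zero>\<^bsub>AF\<^esub>) \<oplus>\<^bsub>M\<^esub> (\<zero>\<^bsub>EB\<^esub>, \<tau> u)"
    using s t by (simp add: m M_simps(2) u(2))
  then show ?thesis using add_span.plus[OF sE sF] by (simp only:)
qed

lemma nab_connection: "right_connection K TP M G nab"
proof (rule C.connection_on_generators[OF nab_linear gens_sub gens_span])
  show "nab (ract M s y) = C.mm 1 0 (nab s) (emb G y) \<oplus>\<^bsub>P1\<^esub> pure P1 s (diff G (emb G y))"
    if "s \<in> gens" and y: "y \<in> carrier TP" for s y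
    using that(1) unfolding gens_def
  proof (elim UnE imageE)
    fix e assume e: "s = psiE e" "e \<in> carrier E"
    show ?thesis unfolding e(1) nab_psiE[OF e(2)] by (rule leibniz_E[OF e(2) y])
  next
    fix f assume f: "s = psiF \<one>\<^bsub>A\<^esub> f" "f \<in> carrier F"
    show ?thesis unfolding f(1) nab_psiF[OF f(2)] by (rule leibniz_F[OF f(2) y])
  qed
qed

theorem product_flat:
  assumes E_flat: "flat_connection K A E OA nabE" and F_flat: "flat_connection K B F OB nabF"
  shows "flat_connection K TP M G nab"
proof (rule C.flat_on_generators[OF nab_connection gens_sub gens_span])
  show "curvature TP M G nab s = \<zero>\<^bsub>C.P 2\<^esub>" if "s \<in> gens" for s
    using that unfolding gens_def
  proof (elim UnE imageE)
    fix e assume e: "s = psiE e" "e \<in> carrier E"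
    show ?thesis
      using IE.curvature_push[OF nabE nab_connection nab_psiE e(2)] E_flat e addmap_zero[OF IE.push_addmap]
      by (simp add: flat_connection_def)
  next
    fix f assume f: "s = psiF \<one>\<^bsub>A\<^esub> f" "f \<in> carrier F"
    show ?thesis
      using IF.curvature_push[OF nabF nab_connection nab_psiF f(2)] F_flat f addmap_zero[OF IF.push_addmap]
      by (simp add: flat_connection_def)
  qed
qed

end

theorem corollary3p2:
  fixes K :: "'k ring"
    and A :: "('k, 'a) module" and B :: "('k, 'b) module"
    and R :: "('b, 'a) tensor \<Rightarrow> ('a, 'b) tensor"
    and Rt :: "('b form, 'a form) tensor \<Rightarrow> ('a form, 'b form) tensor"
    and E :: "('k, 'e, 'a) rmodule" and F :: "('k, 'f, 'b) rmodule"
    and nabE :: "'e \<Rightarrow> ('e, 'a form) tensor" and nabF :: "'f \<Rightarrow> ('f, 'b form) tensor"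
    and \<tau> :: "('f, 'a) tensor \<Rightarrow> ('a, 'f) tensor"
  assumes "field K"
    and "assoc_algebra K A" and "assoc_algebra K B"
    and "twisting_map K A B R"
    and "bij_betw R (carrier (ktensor K B A)) (carrier (ktensor K A B))"
    and "twisting_extension K A B R Rt"
    and "right_module K A E" and "right_connection K A E (univ_dga K A) nabE"
    and "right_module K B F" and "right_connection K B F (univ_dga K B) nabF"
    and "module_twisting_map K A B R F \<tau>"
    and "bij_betw \<tau> (carrier (ktensor K F A)) (carrier (ktensor K A F))"
    and "connection_compatible K A B Rt F \<tau> nabF"
    and "flat_connection K A E (univ_dga K A) nabE"
    and "flat_connection K B F (univ_dga K B) nabF"
  shows "flat_connection K (twisted_product K A B R) (product_module K A B R E F \<tau>)
           (twisted_calculus K A B Rt) (product_connection K A B R Rt E F \<tau> nabE nabF)"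
proof -
  interpret product_data K A B R Rt E F \<tau> nabE nabF
    by (intro product_data.intro twisted_forms.intro twisted_pair.intro twisted_forms_axioms.intro product_data_axioms.intro
        bij_betw_imp_surj_on assms)
  show ?thesis by (rule product_flat[OF assms(14,15)])
qed

end
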